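(* Let $S$ be a $k$-scheme, let $G$ be a $p$-divisible group over $S$ with an action of $O_F$, and suppose given adequate filtrations for $G$. Let $1\le i\le f$ with $d_i\notin\{0,h\}$. Then $$Ha_i(G)=h_i^{[s(i)]}\cdot\bigl(h_{i-1}^{[s(i)]}\bigr)^p\cdots\bigl(h_{i+1}^{[s(i)]}\bigr)^{p^{f-1}}=\prod_{l=0}^{f-1}\bigl(h_{i-l}^{[s(i)]}\bigr)^{p^l}$$ as sections of $(\det\omega_{G,i})^{p^f-1}$ (indices modulo $f$), where $Ha_i(G)$ is the $\mu$-ordinary partial Hasse invariant attached to $i$ and the $h_k^{[j]}$ are the refined partial Hasse invariants.
   Context: Setting. $F/\mathbb{Q}_p$ is a finite unramified extension of degree $f$, with ring of integers $O_F$ and residue field $k=\mathbb{F}_{p^f}$. The embeddings of $F$ are identified with $\mathbb{Z}/f\mathbb{Z}$ via powers of the Frobenius $\sigma$; indices $i$ are read modulo $f$. $S$ is a $k$-scheme and $G$ is a $p$-divisible group over $S$ of height $fh$ with an action of $O_F$. $\mathcal{E}$ is the contravariant Dieudonné crystal of $G$ evaluated at $S$ (locally free of rank $fh$); it decomposes as $\mathcal{E}=\bigoplus_{i=1}^f\mathcal{E}_i$ with $O_F$ acting on $\mathcal{E}_i$ through $\sigma^i$, each $\mathcal{E}_i$ locally free of rank $h$. Frobenius and Verschiebung give $F_i:\mathcal{E}_{i-1}^{(p)}\to\mathcal{E}_i$ and $V_i:\mathcal{E}_i\to\mathcal{E}_{i-1}^{(p)}$, where $(p)$ denotes the Frobenius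 twist. $\mathcal{F}_i=\omega_{G,i}\subset\mathcal{E}_i$ is the Hodge filtration, assumed of constant rank $d_i$, and $\mathcal{E}_i/\mathcal{F}_i\simeq\omega_{G^D,i}^\vee$. Put $\widetilde{\mathcal{F}}_i=\ker V_i=\operatorname{Im}F_i$; also $\mathcal{F}_{i-1}^{(p)}=\operatorname{Im}V_i=\ker F_i$. Let $\delta_1<\dots<\delta_r$ be the distinct elements of $\{d_i\}\cap[1,h-1]$, $\delta_0=0$, $\delta_{r+1}=h$, and define $s(i)\in\{0,\dots,r+1\}$ by $d_i=\delta_{s(i)}$. Adequate filtrations. These consist, for each $i$, of a filtration $$0\subset\mathcal{F}_i^{[s(i)-1]}\subset\dots\subset\mathcal{F}_i^{[1]}\subset\mathcal{F}_i\subset\mathcal{F}_i^{[r]}\subset\dots\subset\mathcal{F}_i^{[s(i)+1]}\subset\mathcal{E}_i$$ (only indices $1\le j\le r$ occur) with each $\mathcal{F}_i^{[j]}$ locally a direct factor of $\mathcal{E}_i$, of rank $d_i-\delta_j$ if $1\le j\le s(i)-1$ and of rank $h+d_i-\delta_j$ if $s(i)+1\le j\le r$. Set $\mathcal{F}_i^{[s(i)]}:=0$. Define $\widetilde{\mathcal{F}}_i^{[j]}:=V_i^{-1}((\mathcal{F}_{i-1}^{[j]})^{(p)})$ for $1\le j\le s(i-1)$ and $\widetilde{\mathcal{F}}_i^{[j]}:=F_i((\mathcal{F}_{i-1}^{[j]})^{(p)})$ for $s(i-1)+1\le j\le r$. The filtrations are required to satisfy, for all $i$: $\mathcal{F}_i^{[j]}\subset\widetilde{\mathcal{F}}_i^{[j]}$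 for $1\le j\le s(i)-1$, and $\widetilde{\mathcal{F}}_i^{[j]}\subset\mathcal{F}_i^{[j]}$ for $s(i)+1\le j\le r$. Refined partial Hasse invariants. For $1\le j\le r$ put $\mathcal{L}_i^{[j]}=\det(\mathcal{F}_i/\mathcal{F}_i^{[j]})$ if $j\le s(i)$, and $\mathcal{L}_i^{[j]}=\det(\mathcal{E}_i/\mathcal{F}_i^{[j]})\otimes\det\mathcal{F}_i$ if $j>s(i)$; so $\mathcal{L}_i^{[s(i)]}=\det\mathcal{F}_i$. There is an isomorphism $\det(\mathcal{E}_i/\widetilde{\mathcal{F}}_i^{[j]})\simeq(\mathcal{L}_{i-1}^{[j]})^p$: for $j\le s(i-1)$ it is induced by $V_i:\mathcal{E}_i/\widetilde{\mathcal{F}}_i^{[j]}\simeq(\mathcal{F}_{i-1}/\mathcal{F}_{i-1}^{[j]})^{(p)}$; for $j>s(i-1)$ it is $\det(\mathcal{E}_i/\widetilde{\mathcal{F}}_i)\otimes\det(\widetilde{\mathcal{F}}_i/\widetilde{\mathcal{F}}_i^{[j]})\simeq\det(\mathcal{F}_{i-1})^p\otimes\det(\mathcal{E}_{i-1}/\mathcal{F}_{i-1}^{[j]})^p$, using $V_i$ on the first factor and the inverse of $F_i$ on the second. Let $H_i^{[j]}$ be the natural map $\mathcal{F}_i/\mathcal{F}_i^{[j]}\to\mathcal{E}_i/\widetilde{\mathcal{F}}_i^{[j]}$ if $1\le j\le s(i)$, and $\widetilde{\mathcal{F}}_i^{[j]}\to\mathcal{F}_i^{[j]}/\mathcal{F}_i$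 if $s(i)<j\le r$. Its determinant gives, via these isomorphisms and multiplicativity of determinants, the refined partial Hasse invariant $h_i^{[j]}\in H^0(S,(\mathcal{L}_{i-1}^{[j]})^p(\mathcal{L}_i^{[j]})^{-1})$. $\mu$-ordinary partial Hasse invariants. For $0\le d\le d_{i-1}$ let $f_i^d=\bigwedge^dV_i:\bigwedge^d\mathcal{E}_i\to\bigwedge^d\mathcal{E}_{i-1}^{(p)}$. For $d_{i-1}<d\le h$, let $f_i^d:\bigwedge^d\mathcal{E}_i\to\bigwedge^d\mathcal{E}_{i-1}^{(p)}$ be the (well-defined) map such that $x_1\wedge\dots\wedge x_{d_{i-1}}\wedge F_iy_1\wedge\dots\wedge F_iy_{d-d_{i-1}}\mapsto V_ix_1\wedge\dots\wedge V_ix_{d_{i-1}}\wedge y_1\wedge\dots\wedge y_{d-d_{i-1}}$. If $d_i\ne0$, $Ha_i(G)\in H^0(S,(\det\omega_{G,i})^{p^f-1})$ is the section induced by the composite $$\textstyle\bigwedge^{d_i}\mathcal{F}_i\hookrightarrow\bigwedge^{d_i}\mathcal{E}_i\xrightarrow{f_i^{d_i}}\bigwedge^{d_i}\mathcal{E}_{i-1}^{(p)}\to\dots\xrightarrow{(f_{i+2}^{d_i})^{(p^{f-2})}}\bigwedge^{d_i}\mathcal{E}_{i+1}^{(p^{f-1})}\xrightarrow{\bigwedge^{d_i}V_{i+1}^{(p^{f-1})}}\bigwedge^{d_i}\mathcal{F}_i^{(p^f)}.$$ Equalities of sections are understood under the canonical isomorphisms of invertible sheaves just described (signs from reordering determinant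 factors are suppressed). *)

theory Defs
  imports
    "HOL-Algebra.Module"
    "HOL-Algebra.Ideal_Product"
    "HOL-Algebra.QuotRing"
    "HOL-Analysis.Abstract_Topology"
    "HOL-Computational_Algebra.Primes"
begin

section \<open>Modules given by generators and relations\<close>

definition mspan :: "'r ring \<Rightarrow> ('r, 'm) module \<Rightarrow> 'm set \<Rightarrow> 'm set" where
  "mspan R M X = \<Inter> {N. submodule N R M \<and> X \<subseteq> N}"

definition lin_map :: "'r ring \<Rightarrow> ('r, 'm) module \<Rightarrow> ('r, 'n) module \<Rightarrow> ('m \<Rightarrow> 'n) set" where
  "lin_map R M N = {u \<in> carrier M \<rightarrow>\<^sub>E carrier N.
     (\<forall>x\<in>carrier M. \<forall>y\<in>carrier M. u (x \<oplus>\<^bsub>M\<^esub> y) = u x \<oplus>\<^bsub>N\<^esub> u y) \<and>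
     (\<forall>r\<in>carrier R. \<forall>x\<in>carrier M. u (r \<odot>\<^bsub>M\<^esub> x) = r \<odot>\<^bsub>N\<^esub> u x)}"

definition basis :: "'r ring \<Rightarrow> ('r, 'm) module \<Rightarrow> 'm list \<Rightarrow> bool" where
  "basis R M bs \<longleftrightarrow> set bs \<subseteq> carrier M \<and>
     (\<forall>x\<in>carrier M. \<exists>!c. c \<in> {..<length bs} \<rightarrow>\<^sub>E carrier R \<and>
        x = finsum M (\<lambda>k. c k \<odot>\<^bsub>M\<^esub> (bs ! k)) {..<length bs})"

definition free_rank :: "'r ring \<Rightarrow> ('r, 'm) module \<Rightarrow> nat \<Rightarrow> bool" where
  "free_rank R M n \<longleftrightarrow> (\<exists>bs. length bs = n \<and> basis R M bs)"

text \<open>\<open>mult\<close> and \<open>one\<close> are junk fields of the record \<open>module\<close>; they are only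
  meaningful for the algebras below.\<close>

definition quot_mod :: "('r, 'm) module \<Rightarrow> 'm set \<Rightarrow> ('r, 'm set) module" where
  "quot_mod M N = \<lparr>carrier = a_rcosets\<^bsub>M\<^esub> N, monoid.mult = undefined, one = undefined,
     zero = N, add = set_add M, smult = (\<lambda>r C. \<Union>c\<in>C. N +>\<^bsub>M\<^esub> (r \<odot>\<^bsub>M\<^esub> c))\<rparr>"

definition free_mod :: "'r ring \<Rightarrow> 'x set \<Rightarrow> ('r, 'x \<Rightarrow> 'r) module" where
  "free_mod R X = \<lparr>carrier = {v. (\<forall>x. v x \<in> carrier R) \<and> (\<forall>x. x \<notin> X \<longrightarrow> v x = \<zero>\<^bsub>R\<^esub>) \<and>
        finite {x. v x \<noteq> \<zero>\<^bsub>R\<^esub>}},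
     monoid.mult = undefined, one = undefined, zero = (\<lambda>_. \<zero>\<^bsub>R\<^esub>),
     add = (\<lambda>v w x. v x \<oplus>\<^bsub>R\<^esub> w x), smult = (\<lambda>r v x. r \<otimes>\<^bsub>R\<^esub> v x)\<rparr>"

definition delta_fun :: "'r ring \<Rightarrow> 'x \<Rightarrow> 'x \<Rightarrow> 'r" where
  "delta_fun R x = (\<lambda>y. if y = x then \<one>\<^bsub>R\<^esub> else \<zero>\<^bsub>R\<^esub>)"

definition pres :: "'r ring \<Rightarrow> 'x set \<Rightarrow> ('x \<Rightarrow> 'r) set \<Rightarrow> ('r, ('x \<Rightarrow> 'r) set) module" where
  "pres R X Rel = quot_mod (free_mod R X) (mspan R (free_mod R X) Rel)"

definition psym :: "'r ring \<Rightarrow> 'x set \<Rightarrow> ('x \<Rightarrow> 'r) set \<Rightarrow> 'x \<Rightarrow> ('x \<Rightarrow> 'r) set" where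
  "psym R X Rel x = mspan R (free_mod R X) Rel +>\<^bsub>free_mod R X\<^esub> delta_fun R x"

text \<open>The \<open>\<phi>\<close>-semilinear map out of a presented \<open>R\<close>-module that sends the generator \<open>x\<close>
  to \<open>g x\<close>, and its linear special case. They are only used when \<open>g\<close> respects the relations,
  so that the chosen representative does not matter.\<close>

definition sext :: "'r ring \<Rightarrow> ('r \<Rightarrow> 'q) \<Rightarrow> ('q, 'n) module \<Rightarrow> ('x \<Rightarrow> 'n) \<Rightarrow> ('x \<Rightarrow> 'r) set \<Rightarrow> 'n" where
  "sext R \<phi> N g C = (let v = (SOME v. v \<in> C) in
     finsum N (\<lambda>x. \<phi> (v x) \<odot>\<^bsub>N\<^esub> g x) {x. v x \<noteq> \<zero>\<^bsub>R\<^esub>})"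

definition lext :: "'r ring \<Rightarrow> ('r, 'n) module \<Rightarrow> ('x \<Rightarrow> 'n) \<Rightarrow> ('x \<Rightarrow> 'r) set \<Rightarrow> 'n" where
  "lext R N g = sext R (\<lambda>r. r) N g"

subsection \<open>Base change\<close>

text \<open>\<open>base_change R \<phi> R' M\<close> is \<open>R' \<otimes>\<^bsub>R,\<phi>\<^esub> M\<close>, generated by symbols \<open>1 \<otimes> x\<close>
  with \<open>x \<in> M\<close>.\<close>

definition bc_rel :: "'r ring \<Rightarrow> ('r \<Rightarrow> 'q) \<Rightarrow> 'q ring \<Rightarrow> ('r, 'm) module \<Rightarrow> ('m \<Rightarrow> 'q) set" where
  "bc_rel R \<phi> R' M = (let L = free_mod R' (carrier M); e = delta_fun R' in
     {e (x \<oplus>\<^bsub>M\<^esub> y) \<ominus>\<^bsub>L\<^esub> (e x \<oplus>\<^bsub>L\<^esub> e y) | x y. x \<in> carrier M \<and> y \<in> carrier M} \<union>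
     {e (r \<odot>\<^bsub>M\<^esub> x) \<ominus>\<^bsub>L\<^esub> (\<phi> r \<odot>\<^bsub>L\<^esub> e x) | r x. r \<in> carrier R \<and> x \<in> carrier M})"

definition base_change ::
    "'r ring \<Rightarrow> ('r \<Rightarrow> 'q) \<Rightarrow> 'q ring \<Rightarrow> ('r, 'm) module \<Rightarrow> ('q, ('m \<Rightarrow> 'q) set) module" where
  "base_change R \<phi> R' M = pres R' (carrier M) (bc_rel R \<phi> R' M)"

definition frob_pow :: "'r ring \<Rightarrow> nat \<Rightarrow> 'r \<Rightarrow> 'r" where
  "frob_pow R q r = r [^]\<^bsub>R\<^esub> q"

text \<open>The twist \<open>M\<^sup>(\<^sup>q\<^sup>)\<close> for a power \<open>q\<close> of the characteristic, and the map \<open>x \<mapsto> 1 \<otimes> x\<close>.\<close>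

definition twist :: "'r ring \<Rightarrow> nat \<Rightarrow> ('r, 'm) module \<Rightarrow> ('r, ('m \<Rightarrow> 'r) set) module" where
  "twist R q M = base_change R (frob_pow R q) R M"

definition tw_in :: "'r ring \<Rightarrow> nat \<Rightarrow> ('r, 'm) module \<Rightarrow> 'm \<Rightarrow> ('m \<Rightarrow> 'r) set" where
  "tw_in R q M x = psym R (carrier M) (bc_rel R (frob_pow R q) R M) x"

text \<open>The \<open>q'\<close>-semilinear map \<open>M\<^sup>(\<^sup>q\<^sup>) \<rightarrow> M\<^sup>(\<^sup>q\<^sup>q\<^sup>'\<^sup>)\<close>, \<open>r \<otimes> x \<mapsto> r\<^sup>q\<^sup>' \<otimes> x\<close>.\<close>

definition tw_tw :: "'r ring \<Rightarrow> nat \<Rightarrow> nat \<Rightarrow> ('r, 'm) module \<Rightarrow> ('m \<Rightarrow> 'r) set \<Rightarrow> ('m \<Rightarrow> 'r) set" where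
  "tw_tw R q q' M = sext R (frob_pow R q') (twist R (q * q') M) (tw_in R (q * q') M)"

definition tw_sub :: "'r ring \<Rightarrow> nat \<Rightarrow> ('r, 'm) module \<Rightarrow> 'm set \<Rightarrow> ('m \<Rightarrow> 'r) set set" where
  "tw_sub R q M N = mspan R (twist R q M) (tw_in R q M ` N)"

subsection \<open>Tensor products of exterior powers of subquotients\<close>

text \<open>
  A block \<open>(a, A, B)\<close>, with \<open>B \<subseteq> A\<close> submodules of \<open>M\<close>, stands for \<open>\<Lambda>\<^sup>a(A/B)\<close>; \<open>wedges R M Bs\<close> is the tensor product of
  these modules over the blocks in the list \<open>Bs\<close>. It is generated by lists of lists: the symbol
  \<open>[xs, ys, \<dots>]\<close> is \<open>(x\<^sub>1 \<and> \<dots> \<and> x\<^sub>a) \<otimes> (y\<^sub>1 \<and> \<dots> \<and> y\<^sub>b) \<otimes> \<dots>\<close>, where the entries are lifts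
  to \<open>A\<close> and a symbol vanishes as soon as an entry of a block lies in its \<open>B\<close>.
  With blocks \<open>(1, M, 0)\<close> this is an ordinary tensor power of \<open>M\<close>.\<close>

type_synonym 'm block = "nat \<times> 'm set \<times> 'm set"
type_synonym ('m, 'r) wedge = "('m list list \<Rightarrow> 'r) set"

definition wgen :: "'m block list \<Rightarrow> 'm list list set" where
  "wgen Bs = {xss. list_all2 (\<lambda>xs (a, A, B). length xs = a \<and> set xs \<subseteq> A) xss Bs}"

definition wrel :: "'r ring \<Rightarrow> ('r, 'm) module \<Rightarrow> 'm block list \<Rightarrow> ('m list list \<Rightarrow> 'r) set" where
  "wrel R M Bs = (let L = free_mod R (wgen Bs); e = delta_fun R;
       put = (\<lambda>pre us vs post z. pre @ (us @ z # vs) # post) in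
     {e (put pre us vs post (x \<oplus>\<^bsub>M\<^esub> y)) \<ominus>\<^bsub>L\<^esub> (e (put pre us vs post x) \<oplus>\<^bsub>L\<^esub> e (put pre us vs post y))
        | pre us vs post x y. put pre us vs post x \<in> wgen Bs \<and> put pre us vs post y \<in> wgen Bs} \<union>
     {e (put pre us vs post (r \<odot>\<^bsub>M\<^esub> x)) \<ominus>\<^bsub>L\<^esub> (r \<odot>\<^bsub>L\<^esub> e (put pre us vs post x))
        | pre us vs post r x. r \<in> carrier R \<and> put pre us vs post x \<in> wgen Bs} \<union>
     {e xss | xss. xss \<in> wgen Bs \<and> (\<exists>k<length Bs. \<not> distinct (xss ! k))} \<union>
     {e xss | xss. xss \<in> wgen Bs \<and> (\<exists>k<length Bs. set (xss ! k) \<inter> snd (snd (Bs ! k)) \<noteq> {})})"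

definition wedges :: "'r ring \<Rightarrow> ('r, 'm) module \<Rightarrow> 'm block list \<Rightarrow> ('r, ('m, 'r) wedge) module" where
  "wedges R M Bs = pres R (wgen Bs) (wrel R M Bs)"

definition wsym :: "'r ring \<Rightarrow> ('r, 'm) module \<Rightarrow> 'm block list \<Rightarrow> 'm list list \<Rightarrow> ('m, 'r) wedge" where
  "wsym R M Bs xss = psym R (wgen Bs) (wrel R M Bs) xss"

text \<open>For linear maps \<open>g\<close> compatible with the blocks: the induced map.\<close>

definition wmap :: "'r ring \<Rightarrow> ('r, 'n) module \<Rightarrow> 'n block list \<Rightarrow> ('m \<Rightarrow> 'n) \<Rightarrow>
    ('m, 'r) wedge \<Rightarrow> ('n, 'r) wedge" where
  "wmap R N Cs g = lext R (wedges R N Cs) (\<lambda>xss. wsym R N Cs (map (map g) xss))"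

definition wtensor :: "'r ring \<Rightarrow> ('r, 'm) module \<Rightarrow> 'm block list \<Rightarrow>
    ('m, 'r) wedge \<Rightarrow> ('m, 'r) wedge \<Rightarrow> ('m, 'r) wedge" where
  "wtensor R M Bs C D = lext R (wedges R M Bs)
     (\<lambda>xss. lext R (wedges R M Bs) (\<lambda>yss. wsym R M Bs (xss @ yss)) D) C"

definition tw_blocks :: "'r ring \<Rightarrow> nat \<Rightarrow> ('r, 'm) module \<Rightarrow> 'm block list \<Rightarrow> ('m \<Rightarrow> 'r) set block list" where
  "tw_blocks R q M Bs = map (\<lambda>(a, A, B). (a, tw_sub R q M A, tw_sub R q M B)) Bs"

text \<open>\<open>(\<Otimes>\<Lambda>(A/B))\<^sup>(\<^sup>q\<^sup>)\<close> is taken to be \<open>\<Otimes>\<Lambda>(A\<^sup>(\<^sup>q\<^sup>)/B\<^sup>(\<^sup>q\<^sup>))\<close>. For a line bundle this is the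
  \<open>q\<close>-th tensor power.\<close>

definition wtwist :: "'r ring \<Rightarrow> nat \<Rightarrow> ('r, 'm) module \<Rightarrow> 'm block list \<Rightarrow>
    ('r, (('m \<Rightarrow> 'r) set, 'r) wedge) module" where
  "wtwist R q M Bs = wedges R (twist R q M) (tw_blocks R q M Bs)"

text \<open>The \<open>q\<close>-semilinear map \<open>x \<mapsto> 1 \<otimes> x\<close> from \<open>wedges R M Bs\<close> to its twist; and the
  \<open>q'\<close>-semilinear one from the twist by \<open>q\<close> to the twist by \<open>qq'\<close>.\<close>

definition wtw_in :: "'r ring \<Rightarrow> nat \<Rightarrow> ('r, 'm) module \<Rightarrow> 'm block list \<Rightarrow>
    ('m, 'r) wedge \<Rightarrow> (('m \<Rightarrow> 'r) set, 'r) wedge" where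
  "wtw_in R q M Bs = sext R (frob_pow R q) (wtwist R q M Bs)
     (\<lambda>xss. wsym R (twist R q M) (tw_blocks R q M Bs) (map (map (tw_in R q M)) xss))"

definition wtw_tw :: "'r ring \<Rightarrow> nat \<Rightarrow> nat \<Rightarrow> ('r, 'm) module \<Rightarrow> 'm block list \<Rightarrow>
    (('m \<Rightarrow> 'r) set, 'r) wedge \<Rightarrow> (('m \<Rightarrow> 'r) set, 'r) wedge" where
  "wtw_tw R q q' M Bs = sext R (frob_pow R q') (wtwist R (q * q') M Bs)
     (\<lambda>xss. wsym R (twist R (q * q') M) (tw_blocks R (q * q') M Bs) (map (map (tw_tw R q q' M)) xss))"

text \<open>For a linear map \<open>u\<close> from \<open>wedges R M Bs\<close> to the \<open>p\<close>-twist of \<open>wedges R N Cs\<close>: its twist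
  \<open>u\<^sup>(\<^sup>q\<^sup>)\<close>, the linear map with \<open>u\<^sup>(\<^sup>q\<^sup>) (1 \<otimes> x) = 1 \<otimes> u x\<close>. If source and target have rank one,
  so that \<open>u\<close> is an element of \<open>Hom(L, L'\<^sup>p) = L'\<^sup>p L\<^sup>-\<^sup>1\<close>, this is the \<open>q\<close>-th power of that element.\<close>

definition htwist :: "'r ring \<Rightarrow> nat \<Rightarrow> nat \<Rightarrow> ('r, 'm) module \<Rightarrow> 'm block list \<Rightarrow>
    ('r, 'm) module \<Rightarrow> 'm block list \<Rightarrow> (('m, 'r) wedge \<Rightarrow> (('m \<Rightarrow> 'r) set, 'r) wedge) \<Rightarrow>
    (('m \<Rightarrow> 'r) set, 'r) wedge \<Rightarrow> (('m \<Rightarrow> 'r) set, 'r) wedge" where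
  "htwist R p q M Bs N Cs u = (THE u'. u' \<in> lin_map R (wtwist R q M Bs) (wtwist R (p * q) N Cs) \<and>
     (\<forall>x\<in>carrier (wedges R M Bs). u' (wtw_in R q M Bs x) = wtw_tw R p q N Cs (u x)))"


section \<open>Hasse invariants of filtered Dieudonne modules over a ring\<close>

text \<open>The types \<open>d\<^sub>i\<close>: \<open>step_list\<close> is \<open>\<delta>\<^sub>1 < \<dots> < \<delta>\<^sub>r\<close>.\<close>

definition step_list :: "nat \<Rightarrow> (int \<Rightarrow> nat) \<Rightarrow> nat list" where
  "step_list h d = sorted_list_of_set (range d \<inter> {1..h - 1})"

definition nsteps :: "nat \<Rightarrow> (int \<Rightarrow> nat) \<Rightarrow> nat" where
  "nsteps h d = length (step_list h d)"

definition delta :: "nat \<Rightarrow> (int \<Rightarrow> nat) \<Rightarrow> nat \<Rightarrow> nat" where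
  "delta h d j = (0 # step_list h d @ [h]) ! j"

definition sidx :: "nat \<Rightarrow> (int \<Rightarrow> nat) \<Rightarrow> int \<Rightarrow> nat" where
  "sidx h d i = (THE j. j \<le> nsteps h d + 1 \<and> delta h d j = d i)"

text \<open>Over the ring \<open>base\<close> of characteristic \<open>chr\<close>: the modules \<open>\<E>\<^sub>i\<close>, the maps
  \<open>F\<^sub>i : \<E>\<^sub>i\<^sub>-\<^sub>1\<^sup>(\<^sup>p\<^sup>) \<rightarrow> \<E>\<^sub>i\<close> and \<open>V\<^sub>i : \<E>\<^sub>i \<rightarrow> \<E>\<^sub>i\<^sub>-\<^sub>1\<^sup>(\<^sup>p\<^sup>)\<close>, the Hodge filtrations \<open>\<F>\<^sub>i\<close> of
  ranks \<open>dm i\<close> and the members \<open>\<F>\<^sub>i\<^sup>[\<^sup>j\<^sup>]\<close> of a filtration. The \<open>\<int>/f\<int>\<close>-indexing is by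
  \<open>f\<close>-periodic families on the integers.\<close>

record ('r, 'e) fdm =
  base :: "'r ring"
  chr :: nat
  dg :: nat
  hgt :: nat
  dm :: "int \<Rightarrow> nat"
  Em :: "int \<Rightarrow> ('r, 'e) module"
  Fm :: "int \<Rightarrow> ('e \<Rightarrow> 'r) set \<Rightarrow> 'e"
  Vm :: "int \<Rightarrow> 'e \<Rightarrow> ('e \<Rightarrow> 'r) set"
  hdg :: "int \<Rightarrow> 'e set"
  flt :: "int \<Rightarrow> nat \<Rightarrow> 'e set"

abbreviation dlt :: "('r, 'e) fdm \<Rightarrow> nat \<Rightarrow> nat" where
  "dlt D j \<equiv> delta (hgt D) (dm D) j"

abbreviation sx :: "('r, 'e) fdm \<Rightarrow> int \<Rightarrow> nat" where
  "sx D i \<equiv> sidx (hgt D) (dm D) i"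

text \<open>The convention \<open>\<F>\<^sub>i\<^sup>[\<^sup>s\<^sup>(\<^sup>i\<^sup>)\<^sup>] = 0\<close>.\<close>

definition Fil :: "('r, 'e) fdm \<Rightarrow> int \<Rightarrow> nat \<Rightarrow> 'e set" where
  "Fil D i j = (if j = sx D i then {\<zero>\<^bsub>Em D i\<^esub>} else flt D i j)"

definition tFil :: "('r, 'e) fdm \<Rightarrow> int \<Rightarrow> nat \<Rightarrow> 'e set" where
  "tFil D i j = (let T = tw_sub (base D) (chr D) (Em D (i - 1)) (Fil D (i - 1) j) in
     if j \<le> sx D (i - 1) then {x \<in> carrier (Em D i). Vm D i x \<in> T} else Fm D i ` T)"

text \<open>Blocks of \<open>\<L>\<^sub>i\<^sup>[\<^sup>j\<^sup>]\<close> and of \<open>det(\<E>\<^sub>i/\<F>\<^sup>~\<^sub>i\<^sup>[\<^sup>j\<^sup>])\<close> (which has rank \<open>\<delta>\<^sub>j\<close>).\<close>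

definition Lblk :: "('r, 'e) fdm \<Rightarrow> int \<Rightarrow> nat \<Rightarrow> 'e block list" where
  "Lblk D i j = (if j \<le> sx D i then [(dlt D j, hdg D i, Fil D i j)]
     else [(dlt D j - dm D i, carrier (Em D i), Fil D i j), (dm D i, hdg D i, {\<zero>\<^bsub>Em D i\<^esub>})])"

definition Qblk :: "('r, 'e) fdm \<Rightarrow> int \<Rightarrow> nat \<Rightarrow> 'e block list" where
  "Qblk D i j = [(dlt D j, carrier (Em D i), tFil D i j)]"

text \<open>
  The isomorphism \<open>det(\<E>\<^sub>i/\<F>\<^sup>~\<^sub>i\<^sup>[\<^sup>j\<^sup>]) \<rightarrow> (\<L>\<^sub>i\<^sub>-\<^sub>1\<^sup>[\<^sup>j\<^sup>])\<^sup>p\<close>. For \<open>j > s(i-1)\<close> it is the composite of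
  \<open>det(\<E>\<^sub>i/\<F>\<^sup>~\<^sub>i\<^sup>[\<^sup>j\<^sup>]) = det(\<E>\<^sub>i/\<F>\<^sup>~\<^sub>i) \<otimes> det(\<F>\<^sup>~\<^sub>i/\<F>\<^sup>~\<^sub>i\<^sup>[\<^sup>j\<^sup>])\<close>, \<open>x \<and> F\<^sub>i y \<leftrightarrow> x \<otimes> F\<^sub>i y\<close>, with \<open>V\<^sub>i\<close> on the
  first factor and the inverse of \<open>F\<^sub>i\<close> on the second.\<close>

definition theta :: "('r, 'e) fdm \<Rightarrow> int \<Rightarrow> nat \<Rightarrow> ('e, 'r) wedge \<Rightarrow> (('e \<Rightarrow> 'r) set, 'r) wedge" where
  "theta D i j = (let R = base D; p = chr D; E = Em D i; E' = Em D (i - 1);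
       T = twist R p E'; Cs = tw_blocks R p E' (Lblk D (i - 1) j) in
     if j \<le> sx D (i - 1) then wmap R T Cs (Vm D i)
     else (THE u. u \<in> lin_map R (wedges R E (Qblk D i j)) (wedges R T Cs) \<and>
       (\<forall>xs ys. set xs \<subseteq> carrier E \<and> length xs = dm D (i - 1) \<and>
          set ys \<subseteq> carrier T \<and> length ys = dlt D j - dm D (i - 1) \<longrightarrow>
          u (wsym R E (Qblk D i j) [xs @ map (Fm D i) ys]) = wsym R T Cs [ys, map (Vm D i) xs])))"

text \<open>
  The determinant of \<open>H\<^sub>i\<^sup>[\<^sup>j\<^sup>]\<close> as a map \<open>\<L>\<^sub>i\<^sup>[\<^sup>j\<^sup>] \<rightarrow> det(\<E>\<^sub>i/\<F>\<^sup>~\<^sub>i\<^sup>[\<^sup>j\<^sup>])\<close>. For \<open>j \<le> s(i)\<close> this is literally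
  the determinant. For \<open>j > s(i)\<close> it is obtained from
  \<open>det H : det \<F>\<^sup>~\<^sub>i\<^sup>[\<^sup>j\<^sup>] \<rightarrow> det(\<F>\<^sub>i\<^sup>[\<^sup>j\<^sup>]/\<F>\<^sub>i)\<close> through the multiplicativity isomorphisms
  \<open>det \<F>\<^sup>~\<^sub>i\<^sup>[\<^sup>j\<^sup>] \<otimes> det(\<E>\<^sub>i/\<F>\<^sup>~\<^sub>i\<^sup>[\<^sup>j\<^sup>]) \<rightarrow> det \<E>\<^sub>i\<close>, \<open>y \<otimes> w \<mapsto> y \<and> w\<close>, and
  \<open>det(\<F>\<^sub>i\<^sup>[\<^sup>j\<^sup>]/\<F>\<^sub>i) \<otimes> det(\<E>\<^sub>i/\<F>\<^sub>i\<^sup>[\<^sup>j\<^sup>]) \<otimes> det \<F>\<^sub>i \<rightarrow> det \<E>\<^sub>i\<close>, \<open>y \<otimes> z \<otimes> x \<mapsto> y \<and> x \<and> z\<close>. The last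
  choice of order fixes the sign with which the determinant factors are identified.\<close>

definition chi :: "('r, 'e) fdm \<Rightarrow> int \<Rightarrow> nat \<Rightarrow> ('e, 'r) wedge \<Rightarrow> ('e, 'r) wedge" where
  "chi D i j = (let R = base D; E = Em D i; z = {\<zero>\<^bsub>E\<^esub>}; m = hgt D - dlt D j;
       src = [(m, tFil D i j, z)];
       tgt = [(m, Fil D i j, hdg D i)];
       top = [(hgt D, carrier E, z)];
       detH = wmap R E tgt (\<lambda>y. y);
       mul2 = lext R (wedges R E top) (\<lambda>xss. wsym R E top [xss ! 0 @ xss ! 1]);
       mul3 = lext R (wedges R E top) (\<lambda>xss. wsym R E top [xss ! 0 @ xss ! 2 @ xss ! 1]) in
     if j \<le> sx D i then wmap R E (Qblk D i j) (\<lambda>x. x)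
     else (THE u. u \<in> lin_map R (wedges R E (Lblk D i j)) (wedges R E (Qblk D i j)) \<and>
       (\<forall>y\<in>carrier (wedges R E src). \<forall>l\<in>carrier (wedges R E (Lblk D i j)).
          mul2 (wtensor R E (src @ Qblk D i j) y (u l)) =
          mul3 (wtensor R E (tgt @ Lblk D i j) (detH y) l))))"

definition hasse :: "('r, 'e) fdm \<Rightarrow> int \<Rightarrow> nat \<Rightarrow> ('e, 'r) wedge \<Rightarrow> (('e \<Rightarrow> 'r) set, 'r) wedge" where
  "hasse D i j = (\<lambda>x\<in>carrier (wedges (base D) (Em D i) (Lblk D i j)). theta D i j (chi D i j x))"

text \<open>\<open>hasse_pow D i j l\<close> is \<open>(h\<^sub>i\<^sup>[\<^sup>j\<^sup>])\<^bsup>p^l\<^esup>\<close>, from \<open>(\<L>\<^sub>i\<^sup>[\<^sup>j\<^sup>])\<^bsup>p^l\<^esup>\<close> to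
  \<open>(\<L>\<^sub>i\<^sub>-\<^sub>1\<^sup>[\<^sup>j\<^sup>])\<^bsup>p^(l+1)\<^esup>\<close>. The product \<open>\<Prod>\<^sub>l (h\<^sub>i\<^sub>-\<^sub>l\<^sup>[\<^sup>j\<^sup>])\<^bsup>p^l\<^esup>\<close> is composition, since
  \<open>Hom(L, L') \<otimes> Hom(L', L'') = Hom(L, L'')\<close> for invertible modules.\<close>

definition hasse_pow :: "('r, 'e) fdm \<Rightarrow> int \<Rightarrow> nat \<Rightarrow> nat \<Rightarrow>
    (('e \<Rightarrow> 'r) set, 'r) wedge \<Rightarrow> (('e \<Rightarrow> 'r) set, 'r) wedge" where
  "hasse_pow D i j l = htwist (base D) (chr D) (chr D ^ l)
     (Em D i) (Lblk D i j) (Em D (i - 1)) (Lblk D (i - 1) j) (hasse D i j)"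

primrec hasse_prod_upto :: "('r, 'e) fdm \<Rightarrow> int \<Rightarrow> nat \<Rightarrow> nat \<Rightarrow>
    ('e, 'r) wedge \<Rightarrow> (('e \<Rightarrow> 'r) set, 'r) wedge" where
  "hasse_prod_upto D i j 0 = wtw_in (base D) 1 (Em D i) (Lblk D i j)"
| "hasse_prod_upto D i j (Suc l) = (\<lambda>x. hasse_pow D (i - int l) j l (hasse_prod_upto D i j l x))"

definition hasse_prod :: "('r, 'e) fdm \<Rightarrow> int \<Rightarrow> nat \<Rightarrow> ('e, 'r) wedge \<Rightarrow> (('e \<Rightarrow> 'r) set, 'r) wedge" where
  "hasse_prod D i j = (\<lambda>x\<in>carrier (wedges (base D) (Em D i) (Lblk D i j)). hasse_prod_upto D i j (dg D) x)"

text \<open>\<open>fd D i n\<close> is the map \<open>f\<^sub>i\<^sup>n : \<Lambda>\<^sup>n \<E>\<^sub>i \<rightarrow> \<Lambda>\<^sup>n \<E>\<^sub>i\<^sub>-\<^sub>1\<^sup>(\<^sup>p\<^sup>)\<close>.\<close>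

definition Eblk :: "('r, 'e) fdm \<Rightarrow> int \<Rightarrow> nat \<Rightarrow> 'e block list" where
  "Eblk D i n = [(n, carrier (Em D i), {\<zero>\<^bsub>Em D i\<^esub>})]"

definition Hblk :: "('r, 'e) fdm \<Rightarrow> int \<Rightarrow> nat \<Rightarrow> 'e block list" where
  "Hblk D i n = [(n, hdg D i, {\<zero>\<^bsub>Em D i\<^esub>})]"

definition fd :: "('r, 'e) fdm \<Rightarrow> int \<Rightarrow> nat \<Rightarrow> ('e, 'r) wedge \<Rightarrow> (('e \<Rightarrow> 'r) set, 'r) wedge" where
  "fd D i n = (let R = base D; p = chr D; E = Em D i; E' = Em D (i - 1); T = twist R p E';
       Cs = tw_blocks R p E' (Eblk D (i - 1) n) in
     if n \<le> dm D (i - 1) then wmap R T Cs (Vm D i)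
     else (THE u. u \<in> lin_map R (wedges R E (Eblk D i n)) (wedges R T Cs) \<and>
       (\<forall>xs ys. set xs \<subseteq> carrier E \<and> length xs = dm D (i - 1) \<and>
          set ys \<subseteq> carrier T \<and> length ys = n - dm D (i - 1) \<longrightarrow>
          u (wsym R E (Eblk D i n) [xs @ map (Fm D i) ys]) = wsym R T Cs [map (Vm D i) xs @ ys])))"

primrec ha_upto :: "('r, 'e) fdm \<Rightarrow> int \<Rightarrow> nat \<Rightarrow> nat \<Rightarrow>
    ('e, 'r) wedge \<Rightarrow> (('e \<Rightarrow> 'r) set, 'r) wedge" where
  "ha_upto D i n 0 = wtw_in (base D) 1 (Em D i) (Eblk D i n)"
| "ha_upto D i n (Suc l) = (\<lambda>x. htwist (base D) (chr D) (chr D ^ l)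
     (Em D (i - int l)) (Eblk D (i - int l) n) (Em D (i - int l - 1)) (Eblk D (i - int l - 1) n)
     (fd D (i - int l) n) (ha_upto D i n l x))"

text \<open>The last map is \<open>(\<Lambda>\<^bsup>d_i\<^esup> V\<^sub>i\<^sub>+\<^sub>1)\<close> with values in \<open>\<Lambda>\<^bsup>d_i\<^esup> \<F>\<^sub>i\<^sup>(\<^sup>p\<^sup>)\<close>, twisted by \<open>p^(f-1)\<close>; the index
  \<open>i + 1\<close> appears as \<open>i - (f - 1)\<close>.\<close>

definition ha :: "('r, 'e) fdm \<Rightarrow> int \<Rightarrow> ('e, 'r) wedge \<Rightarrow> (('e \<Rightarrow> 'r) set, 'r) wedge" where
  "ha D i = (let R = base D; p = chr D; n = dm D i; k = dg D - 1; i' = i - int k;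
       E' = Em D (i' - 1);
       lastV = wmap R (twist R p E') (tw_blocks R p E' (Hblk D (i' - 1) n)) (Vm D i') in
     (\<lambda>x\<in>carrier (wedges R (Em D i) (Hblk D i n)).
       htwist R p (p ^ k) (Em D i') (Eblk D i' n) E' (Hblk D (i' - 1) n) lastV
         (ha_upto D i n k (wmap R (Em D i) (Eblk D i n) (\<lambda>x. x) x))))"


section \<open>Schemes\<close>

record ('s, 'r) ringed_space =
  topo :: "'s topology"
  sec :: "'s set \<Rightarrow> 'r ring"
  rest :: "'s set \<Rightarrow> 's set \<Rightarrow> 'r \<Rightarrow> 'r"

definition ringed_space :: "('s, 'r, 'z) ringed_space_scheme \<Rightarrow> bool" where
  "ringed_space X \<longleftrightarrow>
     (\<forall>U. openin (topo X) U \<longrightarrow> cring (sec X U)) \<and>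
     (\<forall>U V. openin (topo X) U \<and> openin (topo X) V \<and> V \<subseteq> U \<longrightarrow>
        rest X U V \<in> ring_hom (sec X U) (sec X V)) \<and>
     (\<forall>U. openin (topo X) U \<longrightarrow> (\<forall>a\<in>carrier (sec X U). rest X U U a = a)) \<and>
     (\<forall>U V W. openin (topo X) U \<and> openin (topo X) V \<and> openin (topo X) W \<and> W \<subseteq> V \<and> V \<subseteq> U \<longrightarrow>
        (\<forall>a\<in>carrier (sec X U). rest X V W (rest X U V a) = rest X U W a)) \<and>
     (\<forall>\<V>. (\<forall>V\<in>\<V>. openin (topo X) V) \<longrightarrow>
        (\<forall>t. (\<forall>V\<in>\<V>. t V \<in> carrier (sec X V)) \<and>
             (\<forall>V\<in>\<V>. \<forall>W\<in>\<V>. rest X V (V \<inter> W) (t V) = rest X W (V \<inter> W) (t W)) \<longrightarrow>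
             (\<exists>!a. a \<in> carrier (sec X (\<Union>\<V>)) \<and> (\<forall>V\<in>\<V>. rest X (\<Union>\<V>) V a = t V))))"

definition zariski :: "'r ring \<Rightarrow> 'r set topology" where
  "zariski A = topology (\<lambda>Z. \<exists>I\<subseteq>carrier A. Z = {P. primeideal P A \<and> \<not> I \<subseteq> P})"

text \<open>The fraction \<open>a/b\<close> in the localisation \<open>A\<^sub>P\<close>, as an equivalence class of pairs.\<close>

definition local_frac :: "'r ring \<Rightarrow> 'r set \<Rightarrow> 'r \<Rightarrow> 'r \<Rightarrow> ('r \<times> 'r) set" where
  "local_frac A P a b = {(x, y). x \<in> carrier A \<and> y \<in> carrier A - P \<and>
     (\<exists>u\<in>carrier A - P. u \<otimes>\<^bsub>A\<^esub> (a \<otimes>\<^bsub>A\<^esub> y) = u \<otimes>\<^bsub>A\<^esub> (x \<otimes>\<^bsub>A\<^esub> b))}"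

definition spec_sec :: "'r ring \<Rightarrow> 'r set set \<Rightarrow> ('r set \<Rightarrow> ('r \<times> 'r) set) ring" where
  "spec_sec A Z = \<lparr>
     carrier = {t \<in> extensional Z. \<forall>P\<in>Z. \<exists>Z' a b. openin (zariski A) Z' \<and> P \<in> Z' \<and> Z' \<subseteq> Z \<and>
        a \<in> carrier A \<and> b \<in> carrier A \<and> (\<forall>Q\<in>Z'. b \<notin> Q \<and> t Q = local_frac A Q a b)},
     monoid.mult = (\<lambda>t t'. \<lambda>P\<in>Z. \<Union>(a, b)\<in>t P. \<Union>(c, d)\<in>t' P. local_frac A P (a \<otimes>\<^bsub>A\<^esub> c) (b \<otimes>\<^bsub>A\<^esub> d)),
     one = (\<lambda>P\<in>Z. local_frac A P \<one>\<^bsub>A\<^esub> \<one>\<^bsub>A\<^esub>),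
     zero = (\<lambda>P\<in>Z. local_frac A P \<zero>\<^bsub>A\<^esub> \<one>\<^bsub>A\<^esub>),
     add = (\<lambda>t t'. \<lambda>P\<in>Z. \<Union>(a, b)\<in>t P. \<Union>(c, d)\<in>t' P.
        local_frac A P ((a \<otimes>\<^bsub>A\<^esub> d) \<oplus>\<^bsub>A\<^esub> (c \<otimes>\<^bsub>A\<^esub> b)) (b \<otimes>\<^bsub>A\<^esub> d))\<rparr>"

text \<open>\<open>U\<close> is open and \<open>(U, \<O>|U)\<close> is isomorphic, as a ringed space, to the spectrum of \<open>\<O>(U)\<close>.\<close>

definition affine_open :: "('s, 'r, 'z) ringed_space_scheme \<Rightarrow> 's set \<Rightarrow> bool" where
  "affine_open X U \<longleftrightarrow> openin (topo X) U \<and>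
     (\<exists>\<psi> \<eta>. homeomorphic_map (subtopology (topo X) U) (zariski (sec X U)) \<psi> \<and>
        (\<forall>V. openin (topo X) V \<and> V \<subseteq> U \<longrightarrow>
           \<eta> V \<in> ring_iso (sec X V) (spec_sec (sec X U) (\<psi> ` V))) \<and>
        (\<forall>V W. openin (topo X) V \<and> openin (topo X) W \<and> W \<subseteq> V \<and> V \<subseteq> U \<longrightarrow>
           (\<forall>a\<in>carrier (sec X V). \<eta> W (rest X V W a) = restrict (\<eta> V a) (\<psi> ` W))))"

definition scheme :: "('s, 'r, 'z) ringed_space_scheme \<Rightarrow> bool" where
  "scheme X \<longleftrightarrow> ringed_space X \<and> (\<forall>x\<in>topspace (topo X). \<exists>U. affine_open X U \<and> x \<in> U)"

text \<open>A morphism to \<open>Spec k\<close> is a ring homomorphism from \<open>k\<close> to the global sections.\<close>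

record ('s, 'r, 'k) kscheme = "('s, 'r) ringed_space" +
  kstr :: "'k \<Rightarrow> 'r"

definition k_scheme :: "'k ring \<Rightarrow> ('s, 'r, 'k) kscheme \<Rightarrow> bool" where
  "k_scheme k S \<longleftrightarrow> scheme S \<and> kstr S \<in> ring_hom k (sec S (topspace (topo S)))"


section \<open>Coefficients\<close>

text \<open>\<open>coefs\<close>: the prime \<open>p\<close>, the degree \<open>f\<close>, the ring \<open>O\<^sub>F\<close>, its residue field \<open>k\<close> and the
  reduction map. The ring of integers of the unramified extension of degree \<open>f\<close> of \<open>\<rat>\<^sub>p\<close> is the domain
  of characteristic zero that is separated and complete for the \<open>p\<close>-adic topology and whose quotient by
  \<open>p\<close> is a field with \<open>p\<^sup>f\<close> elements.\<close>

record ('o, 'k) coefs =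
  cp :: nat
  cf :: nat
  OF :: "'o ring"
  kk :: "'k ring"
  red :: "'o \<Rightarrow> 'k"

definition p_multiples :: "'o ring \<Rightarrow> nat \<Rightarrow> nat \<Rightarrow> 'o set" where
  "p_multiples A p n = {add_pow A (p ^ n) x | x. x \<in> carrier A}"

definition unramified_integers :: "('o, 'k) coefs \<Rightarrow> bool" where
  "unramified_integers Q \<longleftrightarrow> prime (cp Q) \<and> 1 \<le> cf Q \<and> domain (OF Q) \<and> field (kk Q) \<and>
     card (carrier (kk Q)) = cp Q ^ cf Q \<and>
     (\<forall>n. add_pow (OF Q) (cp Q ^ n) \<one>\<^bsub>OF Q\<^esub> \<noteq> \<zero>\<^bsub>OF Q\<^esub>) \<and>
     red Q \<in> ring_hom (OF Q) (kk Q) \<and> red Q ` carrier (OF Q) = carrier (kk Q) \<and>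
     {x \<in> carrier (OF Q). red Q x = \<zero>\<^bsub>kk Q\<^esub>} = p_multiples (OF Q) (cp Q) 1 \<and>
     (\<Inter>n. p_multiples (OF Q) (cp Q) n) = {\<zero>\<^bsub>OF Q\<^esub>} \<and>
     (\<forall>x. (\<forall>n. x n \<in> carrier (OF Q)) \<and>
          (\<forall>n. x (Suc n) \<ominus>\<^bsub>OF Q\<^esub> x n \<in> p_multiples (OF Q) (cp Q) n) \<longrightarrow>
          (\<exists>y\<in>carrier (OF Q). \<forall>n. y \<ominus>\<^bsub>OF Q\<^esub> x n \<in> p_multiples (OF Q) (cp Q) n))"


section \<open>Commutative affine group schemes as Hopf algebras\<close>

record ('a, 'r) alg = "'a ring" +
  str :: "'r \<Rightarrow> 'a"

record ('a, 'r) hopf = "('a, 'r) alg" +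
  comul :: "'a \<Rightarrow> ('a, 'r) wedge"
  counit :: "'a \<Rightarrow> 'r"
  antip :: "'a \<Rightarrow> 'a"

definition amod :: "('a, 'r, 'z) alg_scheme \<Rightarrow> ('r, 'a) module" where
  "amod A = \<lparr>carrier = carrier A, monoid.mult = monoid.mult A, one = one A, zero = zero A, add = add A,
     smult = (\<lambda>r x. str A r \<otimes>\<^bsub>A\<^esub> x)\<rparr>"

text \<open>The \<open>n\<close>-th tensor power of \<open>A\<close> over \<open>R\<close>, as an \<open>R\<close>-algebra; \<open>[[a], [b]]\<close> is \<open>a \<otimes> b\<close>.\<close>

definition tblk :: "('a, 'r, 'z) alg_scheme \<Rightarrow> nat \<Rightarrow> 'a block list" where
  "tblk A n = replicate n (1, carrier A, {\<zero>\<^bsub>A\<^esub>})"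

definition tsym :: "'r ring \<Rightarrow> ('a, 'r, 'z) alg_scheme \<Rightarrow> nat \<Rightarrow> 'a list list \<Rightarrow> ('a, 'r) wedge" where
  "tsym R A n = wsym R (amod A) (tblk A n)"

definition tpow :: "'r ring \<Rightarrow> ('a, 'r, 'z) alg_scheme \<Rightarrow> nat \<Rightarrow> ('r, ('a, 'r) wedge) module" where
  "tpow R A n = (let W = wedges R (amod A) (tblk A n) in
     W\<lparr>monoid.mult := (\<lambda>C D. lext R W (\<lambda>xss. lext R W
          (\<lambda>yss. tsym R A n (map2 (map2 (monoid.mult A)) xss yss)) D) C),
       one := tsym R A n (replicate n [\<one>\<^bsub>A\<^esub>])\<rparr>)"

text \<open>The linear map \<open>A \<otimes> A \<rightarrow> N\<close> with \<open>a \<otimes> b \<mapsto> g a b\<close>.\<close>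

definition lext2 :: "'r ring \<Rightarrow> ('r, 'n) module \<Rightarrow> ('a \<Rightarrow> 'a \<Rightarrow> 'n) \<Rightarrow> ('a, 'r) wedge \<Rightarrow> 'n" where
  "lext2 R N g = lext R N (\<lambda>xss. g (xss ! 0 ! 0) (xss ! 1 ! 0))"

definition comul_left :: "'r ring \<Rightarrow> ('a, 'r) hopf \<Rightarrow> ('a, 'r) wedge \<Rightarrow> ('a, 'r) wedge" where
  "comul_left R A = lext2 R (tpow R A 3)
     (\<lambda>a b. lext R (tpow R A 3) (\<lambda>yss. tsym R A 3 (yss @ [[b]])) (comul A a))"

definition comul_right :: "'r ring \<Rightarrow> ('a, 'r) hopf \<Rightarrow> ('a, 'r) wedge \<Rightarrow> ('a, 'r) wedge" where
  "comul_right R A = lext2 R (tpow R A 3)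
     (\<lambda>a b. lext R (tpow R A 3) (\<lambda>yss. tsym R A 3 ([a] # yss)) (comul A b))"

definition comm_hopf :: "'r ring \<Rightarrow> ('a, 'r) hopf \<Rightarrow> bool" where
  "comm_hopf R A \<longleftrightarrow> cring R \<and> cring A \<and> str A \<in> ring_hom R A \<and>
     comul A \<in> ring_hom A (tpow R A 2) \<and>
     (\<forall>r\<in>carrier R. comul A (str A r) = r \<odot>\<^bsub>tpow R A 2\<^esub> \<one>\<^bsub>tpow R A 2\<^esub>) \<and>
     counit A \<in> ring_hom A R \<and> (\<forall>r\<in>carrier R. counit A (str A r) = r) \<and>
     antip A \<in> ring_hom A A \<and> (\<forall>r\<in>carrier R. antip A (str A r) = str A r) \<and>
     (\<forall>x\<in>carrier A.
        comul_left R A (comul A x) = comul_right R A (comul A x) \<and>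
        lext2 R (amod A) (\<lambda>a b. str A (counit A a) \<otimes>\<^bsub>A\<^esub> b) (comul A x) = x \<and>
        lext2 R (amod A) (\<lambda>a b. antip A a \<otimes>\<^bsub>A\<^esub> b) (comul A x) = str A (counit A x) \<and>
        lext2 R (tpow R A 2) (\<lambda>a b. tsym R A 2 [[b], [a]]) (comul A x) = comul A x)"

text \<open>A \<open>\<phi>\<close>-semilinear homomorphism of Hopf algebras.\<close>

definition hopf_hom :: "'r ring \<Rightarrow> ('a, 'r) hopf \<Rightarrow> ('r \<Rightarrow> 'q) \<Rightarrow> 'q ring \<Rightarrow> ('b, 'q) hopf \<Rightarrow>
    ('a \<Rightarrow> 'b) \<Rightarrow> bool" where
  "hopf_hom R A \<phi> R' B g \<longleftrightarrow> g \<in> ring_hom A B \<and>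
     (\<forall>r\<in>carrier R. g (str A r) = str B (\<phi> r)) \<and>
     (\<forall>x\<in>carrier A. counit B (g x) = \<phi> (counit A x) \<and>
        comul B (g x) = sext R \<phi> (tpow R' B 2) (\<lambda>xss. tsym R' B 2 (map (map g) xss)) (comul A x))"

text \<open>The sum of two homomorphisms into a commutative group scheme, and multiplication by \<open>n\<close>.\<close>

definition conv :: "'r ring \<Rightarrow> ('a, 'r) hopf \<Rightarrow> ('a \<Rightarrow> 'a) \<Rightarrow> ('a \<Rightarrow> 'a) \<Rightarrow> 'a \<Rightarrow> 'a" where
  "conv R A g g' x = lext2 R (amod A) (\<lambda>a b. g a \<otimes>\<^bsub>A\<^esub> g' b) (comul A x)"

primrec nmul :: "'r ring \<Rightarrow> ('a, 'r) hopf \<Rightarrow> nat \<Rightarrow> 'a \<Rightarrow> 'a" where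
  "nmul R A 0 = (\<lambda>x. str A (counit A x))"
| "nmul R A (Suc n) = conv R A (nmul R A n) (\<lambda>x. x)"

definition aug :: "'r ring \<Rightarrow> ('a, 'r) hopf \<Rightarrow> 'a set" where
  "aug R A = {x \<in> carrier A. counit A x = \<zero>\<^bsub>R\<^esub>}"

text \<open>\<open>A \<otimes>\<^bsub>R,Frob\<^esub> R\<close>, and the relative Frobenius \<open>a \<otimes> r \<mapsto> r a\<^sup>p\<close>.\<close>

definition tw_alg :: "'r ring \<Rightarrow> nat \<Rightarrow> ('a, 'r) hopf \<Rightarrow> (('a \<Rightarrow> 'r) set, 'r) alg" where
  "tw_alg R p A = (let T = twist R p (amod A); e = tw_in R p (amod A) in
     \<lparr>carrier = carrier T,
      monoid.mult = (\<lambda>C D. lext R T (\<lambda>a. lext R T (\<lambda>b. e (a \<otimes>\<^bsub>A\<^esub> b)) D) C),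
      one = e \<one>\<^bsub>A\<^esub>, zero = zero T, add = add T, str = (\<lambda>r. r \<odot>\<^bsub>T\<^esub> e \<one>\<^bsub>A\<^esub>)\<rparr>)"

definition self_mod :: "'r ring \<Rightarrow> ('r, 'r) module" where
  "self_mod R = \<lparr>carrier = carrier R, monoid.mult = monoid.mult R, one = one R, zero = zero R, add = add R,
     smult = monoid.mult R\<rparr>"

definition tw_hopf :: "'r ring \<Rightarrow> nat \<Rightarrow> ('a, 'r) hopf \<Rightarrow> (('a \<Rightarrow> 'r) set, 'r) hopf" where
  "tw_hopf R p A = (let B = tw_alg R p A; T = twist R p (amod A); e = tw_in R p (amod A) in
     \<lparr>carrier = carrier B, monoid.mult = monoid.mult B, one = one B, zero = zero B, add = add B, str = str B,
      comul = lext R (tpow R B 2) (\<lambda>a. sext R (frob_pow R p) (tpow R B 2)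
                (\<lambda>xss. tsym R B 2 (map (map e) xss)) (comul A a)),
      counit = lext R (self_mod R) (\<lambda>a. frob_pow R p (counit A a)),
      antip = lext R T (\<lambda>a. e (antip A a))\<rparr>)"

definition rel_frob :: "'r ring \<Rightarrow> nat \<Rightarrow> ('a, 'r) hopf \<Rightarrow> ('a \<Rightarrow> 'r) set \<Rightarrow> 'a" where
  "rel_frob R p A = lext R (amod A) (\<lambda>a. a [^]\<^bsub>A\<^esub> p)"


section \<open>p-divisible groups\<close>

text \<open>The coordinate rings of the \<open>p\<^sup>n\<close>-torsion subgroups \<open>G\<^sub>n\<close>, and the restriction maps along
  \<open>G\<^sub>n \<rightarrow> G\<^sub>n\<^sub>+\<^sub>1\<close>.\<close>

record ('a, 'r) tower =
  lev :: "nat \<Rightarrow> ('a, 'r) hopf"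
  trn :: "nat \<Rightarrow> 'a \<Rightarrow> 'a"

text \<open>A homomorphism of towers corresponds to a homomorphism of groups in the other direction.\<close>

definition tower_hom :: "'r ring \<Rightarrow> ('a, 'r) tower \<Rightarrow> ('r \<Rightarrow> 'q) \<Rightarrow> 'q ring \<Rightarrow> ('b, 'q) tower \<Rightarrow>
    (nat \<Rightarrow> 'a \<Rightarrow> 'b) \<Rightarrow> bool" where
  "tower_hom R T \<phi> R' T' g \<longleftrightarrow> (\<forall>n. hopf_hom R (lev T n) \<phi> R' (lev T' n) (g n) \<and>
     (\<forall>x\<in>carrier (lev T (Suc n)). trn T' n (g (Suc n) x) = g n (trn T n x)))"

text \<open>Exactness of \<open>0 \<rightarrow> G\<^sub>n \<rightarrow> G\<^sub>n\<^sub>+\<^sub>1 \<rightarrow> G\<^sub>n\<^sub>+\<^sub>1\<close>, the second map being multiplication by \<open>p\<^sup>n\<close>.\<close>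

definition bt_tower :: "'r ring \<Rightarrow> nat \<Rightarrow> ('a, 'r) tower \<Rightarrow> bool" where
  "bt_tower R p T \<longleftrightarrow> (\<forall>n. comm_hopf R (lev T n) \<and>
     hopf_hom R (lev T (Suc n)) (\<lambda>r. r) R (lev T n) (trn T n) \<and>
     trn T n ` carrier (lev T (Suc n)) = carrier (lev T n) \<and>
     {x \<in> carrier (lev T (Suc n)). trn T n x = \<zero>\<^bsub>lev T n\<^esub>} =
       Idl\<^bsub>lev T (Suc n)\<^esub> (nmul R (lev T (Suc n)) (p ^ n) ` aug R (lev T (Suc n))))"

text \<open>A group over \<open>S\<close>, given on affine opens, with its restriction maps and with operators.\<close>

record ('s, 'r, 'a, 'o) bt_group =
  tow :: "'s set \<Rightarrow> ('a, 'r) tower"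
  gres :: "'s set \<Rightarrow> 's set \<Rightarrow> nat \<Rightarrow> 'a \<Rightarrow> 'a"
  act :: "'o \<Rightarrow> 's set \<Rightarrow> nat \<Rightarrow> 'a \<Rightarrow> 'a"

definition p_divisible_group ::
    "nat \<Rightarrow> nat \<Rightarrow> ('s, 'r, 'z) ringed_space_scheme \<Rightarrow> ('s, 'r, 'a, 'o) bt_group \<Rightarrow> bool" where
  "p_divisible_group p H S G \<longleftrightarrow>
     (\<forall>U. affine_open S U \<longrightarrow> bt_tower (sec S U) p (tow G U)) \<and>
     (\<forall>U V. affine_open S U \<and> affine_open S V \<and> V \<subseteq> U \<longrightarrow>
        tower_hom (sec S U) (tow G U) (rest S U V) (sec S V) (tow G V) (gres G U V) \<and>
        (\<forall>n. bij_betw (lext (sec S V) (amod (lev (tow G V) n)) (gres G U V n))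
               (carrier (base_change (sec S U) (rest S U V) (sec S V) (amod (lev (tow G U) n))))
               (carrier (lev (tow G V) n)))) \<and>
     (\<forall>U n. affine_open S U \<longrightarrow> (\<forall>x\<in>carrier (lev (tow G U) n). gres G U U n x = x)) \<and>
     (\<forall>U V W n. affine_open S U \<and> affine_open S V \<and> affine_open S W \<and> W \<subseteq> V \<and> V \<subseteq> U \<longrightarrow>
        (\<forall>x\<in>carrier (lev (tow G U) n). gres G V W n (gres G U V n x) = gres G U W n x)) \<and>
     (\<forall>n. \<forall>s\<in>topspace (topo S). \<exists>U. affine_open S U \<and> s \<in> U \<and>
        free_rank (sec S U) (amod (lev (tow G U) n)) (p ^ (n * H)))"

text \<open>An action of \<open>O\<^sub>F\<close>, written on coordinate rings; the order of composition is immaterial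
  because \<open>O\<^sub>F\<close> is commutative.\<close>

definition ring_action :: "'o ring \<Rightarrow> ('s, 'r, 'z) ringed_space_scheme \<Rightarrow> ('s, 'r, 'a, 'o) bt_group \<Rightarrow> bool" where
  "ring_action A S G \<longleftrightarrow>
     (\<forall>a\<in>carrier A. \<forall>U. affine_open S U \<longrightarrow>
        tower_hom (sec S U) (tow G U) (\<lambda>r. r) (sec S U) (tow G U) (act G a U) \<and>
        (\<forall>V n. affine_open S V \<and> V \<subseteq> U \<longrightarrow> (\<forall>x\<in>carrier (lev (tow G U) n).
           gres G U V n (act G a U n x) = act G a V n (gres G U V n x)))) \<and>
     (\<forall>U n. affine_open S U \<longrightarrow> (\<forall>x\<in>carrier (lev (tow G U) n).
        act G \<one>\<^bsub>A\<^esub> U n x = x \<and>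
        (\<forall>a\<in>carrier A. \<forall>b\<in>carrier A.
           act G (a \<otimes>\<^bsub>A\<^esub> b) U n x = act G a U n (act G b U n x) \<and>
           act G (a \<oplus>\<^bsub>A\<^esub> b) U n x = conv (sec S U) (lev (tow G U) n) (act G a U n) (act G b U n) x)))"


section \<open>The Dieudonne crystal evaluated at the base\<close>

text \<open>
  Over a base on which \<open>p\<close> is nilpotent, the contravariant Dieudonne crystal of \<open>G\<close> evaluated at the base
  is the module of isomorphism classes of rigidified extensions of \<open>G\<close> by the additive group (Mazur--Messing):
  extensions together with a lift of the first infinitesimal neighbourhood of the unit section of \<open>G\<close>.

  Over an affine base every extension of \<open>G\<close> by \<open>G\<^sub>a\<close> is trivial as a torsor over each \<open>G\<^sub>n\<close>, compatibly in
  \<open>n\<close>, so it is given by compatible normalised symmetric 2-cocycles \<open>c\<^sub>n \<in> A\<^sub>n \<otimes> A\<^sub>n\<close>. The rigidification is then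
  a compatible system \<open>s\<^sub>n \<in> I\<^sub>n/I\<^sub>n\<^sup>2\<close>, where \<open>I\<^sub>n\<close> is the augmentation ideal. Changing the trivialisations
  by \<open>a\<^sub>n \<in> I\<^sub>n\<close> adds \<open>(\<Delta>a\<^sub>n - a\<^sub>n \<otimes> 1 - 1 \<otimes> a\<^sub>n, a\<^sub>n mod I\<^sub>n\<^sup>2)\<close>.\<close>

type_synonym ('a, 'r) cochain = "nat \<Rightarrow> ('a, 'r) wedge \<times> 'a set"
type_synonym ('a, 'r) crys = "('a, 'r) cochain set"

definition cot :: "'r ring \<Rightarrow> ('a, 'r) hopf \<Rightarrow> ('r, 'a set) module" where
  "cot R A = quot_mod (amod A\<lparr>carrier := aug R A\<rparr>) (ideal_prod A (aug R A) (aug R A))"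

definition cot_class :: "'r ring \<Rightarrow> ('a, 'r) hopf \<Rightarrow> 'a \<Rightarrow> 'a set" where
  "cot_class R A x = ideal_prod A (aug R A) (aug R A) +>\<^bsub>amod A\<^esub> x"

definition cocycle :: "'r ring \<Rightarrow> ('a, 'r) hopf \<Rightarrow> ('a, 'r) wedge \<Rightarrow> bool" where
  "cocycle R A c \<longleftrightarrow> c \<in> carrier (tpow R A 2) \<and>
     lext2 R (tpow R A 2) (\<lambda>a b. tsym R A 2 [[b], [a]]) c = c \<and>
     lext2 R (self_mod R) (\<lambda>a b. counit A a \<otimes>\<^bsub>R\<^esub> counit A b) c = \<zero>\<^bsub>R\<^esub> \<and>
     lext R (tpow R A 3) (\<lambda>xss. tsym R A 3 (xss @ [[\<one>\<^bsub>A\<^esub>]])) c \<oplus>\<^bsub>tpow R A 3\<^esub> comul_left R A c =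
     lext R (tpow R A 3) (\<lambda>xss. tsym R A 3 ([\<one>\<^bsub>A\<^esub>] # xss)) c \<oplus>\<^bsub>tpow R A 3\<^esub> comul_right R A c"

text \<open>The action on cochains of a semilinear homomorphism of towers.\<close>

definition tens2_map :: "'r ring \<Rightarrow> ('r \<Rightarrow> 'q) \<Rightarrow> 'q ring \<Rightarrow> ('b, 'q) hopf \<Rightarrow> ('a \<Rightarrow> 'b) \<Rightarrow>
    ('a, 'r) wedge \<Rightarrow> ('b, 'q) wedge" where
  "tens2_map R \<phi> R' B g = sext R \<phi> (tpow R' B 2) (\<lambda>xss. tsym R' B 2 (map (map g) xss))"

definition cot_map :: "'q ring \<Rightarrow> ('b, 'q) hopf \<Rightarrow> ('a \<Rightarrow> 'b) \<Rightarrow> 'a set \<Rightarrow> 'b set" where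
  "cot_map R' B g s = (\<Union>x\<in>s. cot_class R' B (g x))"

definition rig_ext :: "'r ring \<Rightarrow> ('a, 'r) tower \<Rightarrow> ('r, ('a, 'r) cochain) module" where
  "rig_ext R T = \<lparr>
     carrier = {e. \<forall>n. cocycle R (lev T n) (fst (e n)) \<and> snd (e n) \<in> carrier (cot R (lev T n)) \<and>
        tens2_map R (\<lambda>r. r) R (lev T n) (trn T n) (fst (e (Suc n))) = fst (e n) \<and>
        cot_map R (lev T n) (trn T n) (snd (e (Suc n))) = snd (e n)},
     monoid.mult = undefined, one = undefined,
     zero = (\<lambda>n. (\<zero>\<^bsub>tpow R (lev T n) 2\<^esub>, \<zero>\<^bsub>cot R (lev T n)\<^esub>)),
     add = (\<lambda>e e' n. (fst (e n) \<oplus>\<^bsub>tpow R (lev T n) 2\<^esub> fst (e' n),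
                      snd (e n) \<oplus>\<^bsub>cot R (lev T n)\<^esub> snd (e' n))),
     smult = (\<lambda>r e n. (r \<odot>\<^bsub>tpow R (lev T n) 2\<^esub> fst (e n), r \<odot>\<^bsub>cot R (lev T n)\<^esub> snd (e n)))\<rparr>"

definition rig_triv :: "'r ring \<Rightarrow> ('a, 'r) tower \<Rightarrow> ('a, 'r) cochain set" where
  "rig_triv R T = {(\<lambda>n. let A = lev T n; W = tpow R A 2 in
      (comul A (a n) \<ominus>\<^bsub>W\<^esub> (tsym R A 2 [[a n], [\<one>\<^bsub>A\<^esub>]] \<oplus>\<^bsub>W\<^esub> tsym R A 2 [[\<one>\<^bsub>A\<^esub>], [a n]]),
       cot_class R A (a n))) | a. \<forall>n. a n \<in> aug R (lev T n) \<and> trn T n (a (Suc n)) = a n}"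

definition crystal :: "'r ring \<Rightarrow> ('a, 'r) tower \<Rightarrow> ('r, ('a, 'r) crys) module" where
  "crystal R T = quot_mod (rig_ext R T) (rig_triv R T)"

definition crys_class :: "'r ring \<Rightarrow> ('a, 'r) tower \<Rightarrow> ('a, 'r) cochain \<Rightarrow> ('a, 'r) crys" where
  "crys_class R T e = rig_triv R T +>\<^bsub>rig_ext R T\<^esub> e"

definition crys_map :: "'r ring \<Rightarrow> ('r \<Rightarrow> 'q) \<Rightarrow> 'q ring \<Rightarrow> ('b, 'q) tower \<Rightarrow> (nat \<Rightarrow> 'a \<Rightarrow> 'b) \<Rightarrow>
    ('a, 'r) crys \<Rightarrow> ('b, 'q) crys" where
  "crys_map R \<phi> R' T' g C = (\<Union>e\<in>C. crys_class R' T'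
     (\<lambda>n. (tens2_map R \<phi> R' (lev T' n) (g n) (fst (e n)), cot_map R' (lev T' n) (g n) (snd (e n)))))"

text \<open>\<open>\<omega>\<^sub>G\<close>: rigidifications of the trivial extension.\<close>

definition crys_hodge :: "'r ring \<Rightarrow> ('a, 'r) tower \<Rightarrow> ('a, 'r) crys set" where
  "crys_hodge R T = {crys_class R T (\<lambda>n. (\<zero>\<^bsub>tpow R (lev T n) 2\<^esub>, s n)) | s.
     (\<lambda>n. (\<zero>\<^bsub>tpow R (lev T n) 2\<^esub>, s n)) \<in> carrier (rig_ext R T)}"

subsection \<open>Frobenius and Verschiebung\<close>

definition tw_tower :: "'r ring \<Rightarrow> nat \<Rightarrow> ('a, 'r) tower \<Rightarrow> (('a \<Rightarrow> 'r) set, 'r) tower" where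
  "tw_tower R p T = \<lparr>lev = (\<lambda>n. tw_hopf R p (lev T n)),
     trn = (\<lambda>n. lext R (twist R p (amod (lev T n))) (\<lambda>a. tw_in R p (amod (lev T n)) (trn T n a)))\<rparr>"

text \<open>On a \<open>p\<close>-divisible group the relative Frobenius is an epimorphism, so the Verschiebung
  \<open>G\<^sup>(\<^sup>p\<^sup>) \<rightarrow> G\<close> is the only homomorphism whose composite with it is multiplication by \<open>p\<close>.\<close>

definition verschiebung :: "'r ring \<Rightarrow> nat \<Rightarrow> ('a, 'r) tower \<Rightarrow> nat \<Rightarrow> 'a \<Rightarrow> ('a \<Rightarrow> 'r) set" where
  "verschiebung R p T = (SOME g. tower_hom R T (\<lambda>r. r) R (tw_tower R p T) g \<and>
     (\<forall>n. \<forall>x\<in>carrier (lev T n). rel_frob R p (lev T n) (g n x) = nmul R (lev T n) p x))"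

text \<open>The canonical map from the twist of a submodule \<open>E\<close> of the crystal of \<open>G\<close> to the crystal
  of \<open>G\<^sup>(\<^sup>p\<^sup>)\<close>.\<close>

definition crys_bc :: "'r ring \<Rightarrow> nat \<Rightarrow> ('a, 'r) tower \<Rightarrow>
    (('a, 'r) crys \<Rightarrow> 'r) set \<Rightarrow> (('a \<Rightarrow> 'r) set, 'r) crys" where
  "crys_bc R p T = lext R (crystal R (tw_tower R p T))
     (crys_map R (frob_pow R p) R (tw_tower R p T) (\<lambda>n. tw_in R p (amod (lev T n))))"

definition crys_F :: "'r ring \<Rightarrow> nat \<Rightarrow> ('a, 'r) tower \<Rightarrow> ('r, ('a, 'r) crys) module \<Rightarrow>
    (('a, 'r) crys \<Rightarrow> 'r) set \<Rightarrow> ('a, 'r) crys" where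
  "crys_F R p T E = (\<lambda>t\<in>carrier (twist R p E).
     crys_map R (\<lambda>r. r) R T (\<lambda>n. rel_frob R p (lev T n)) (crys_bc R p T t))"

definition crys_V :: "'r ring \<Rightarrow> nat \<Rightarrow> ('a, 'r) tower \<Rightarrow> ('r, ('a, 'r) crys) module \<Rightarrow>
    ('r, ('a, 'r) crys) module \<Rightarrow> ('a, 'r) crys \<Rightarrow> (('a, 'r) crys \<Rightarrow> 'r) set" where
  "crys_V R p T E E' = (\<lambda>x\<in>carrier E. THE t. t \<in> carrier (twist R p E') \<and>
     crys_bc R p T t = crys_map R (\<lambda>r. r) R (tw_tower R p T) (verschiebung R p T) x)"

subsection \<open>Over a scheme, with an action\<close>

abbreviation crysU ::
    "('s, 'r, 'k) kscheme \<Rightarrow> ('s, 'r, 'a, 'o) bt_group \<Rightarrow> 's set \<Rightarrow> ('r, ('a, 'r) crys) module" where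
  "crysU S G U \<equiv> crystal (sec S U) (tow G U)"

text \<open>The summand \<open>\<E>\<^sub>i\<close> on \<open>U\<close>: \<open>O\<^sub>F\<close> acts through \<open>\<sigma>\<^sup>i : O\<^sub>F \<rightarrow> k \<rightarrow> k\<close>, \<open>a \<mapsto> a\<^bsup>p^i\<^esup>\<close>.\<close>

definition sigma :: "('o, 'k) coefs \<Rightarrow> ('s, 'r, 'k) kscheme \<Rightarrow> 's set \<Rightarrow> int \<Rightarrow> 'o \<Rightarrow> 'r" where
  "sigma Q S U i a = rest S (topspace (topo S)) U
     (kstr S (red Q a [^]\<^bsub>kk Q\<^esub> (cp Q ^ nat (i mod int (cf Q)))))"

definition crysi :: "('o, 'k) coefs \<Rightarrow> ('s, 'r, 'k) kscheme \<Rightarrow> ('s, 'r, 'a, 'o) bt_group \<Rightarrow>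
    's set \<Rightarrow> int \<Rightarrow> ('r, ('a, 'r) crys) module" where
  "crysi Q S G U i = crysU S G U\<lparr>carrier := {x \<in> carrier (crysU S G U). \<forall>a\<in>carrier (OF Q).
     crys_map (sec S U) (\<lambda>r. r) (sec S U) (tow G U) (act G a U) x =
     sigma Q S U i a \<odot>\<^bsub>crysU S G U\<^esub> x}\<rparr>"

definition crys_res :: "('s, 'r, 'k) kscheme \<Rightarrow> ('s, 'r, 'a, 'o) bt_group \<Rightarrow>
    's set \<Rightarrow> 's set \<Rightarrow> ('a, 'r) crys \<Rightarrow> ('a, 'r) crys" where
  "crys_res S G U V = crys_map (sec S U) (rest S U V) (sec S V) (tow G V) (gres G U V)"

definition hodgei :: "('o, 'k) coefs \<Rightarrow> ('s, 'r, 'k) kscheme \<Rightarrow> ('s, 'r, 'a, 'o) bt_group \<Rightarrow>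
    's set \<Rightarrow> int \<Rightarrow> ('a, 'r) crys set" where
  "hodgei Q S G U i = carrier (crysi Q S G U i) \<inter> crys_hodge (sec S U) (tow G U)"

definition frobi :: "('o, 'k) coefs \<Rightarrow> ('s, 'r, 'k) kscheme \<Rightarrow> ('s, 'r, 'a, 'o) bt_group \<Rightarrow>
    's set \<Rightarrow> int \<Rightarrow> (('a, 'r) crys \<Rightarrow> 'r) set \<Rightarrow> ('a, 'r) crys" where
  "frobi Q S G U i = crys_F (sec S U) (cp Q) (tow G U) (crysi Q S G U (i - 1))"

definition veri :: "('o, 'k) coefs \<Rightarrow> ('s, 'r, 'k) kscheme \<Rightarrow> ('s, 'r, 'a, 'o) bt_group \<Rightarrow>
    's set \<Rightarrow> int \<Rightarrow> ('a, 'r) crys \<Rightarrow> (('a, 'r) crys \<Rightarrow> 'r) set" where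
  "veri Q S G U i = crys_V (sec S U) (cp Q) (tow G U) (crysi Q S G U i) (crysi Q S G U (i - 1))"

text \<open>Quasi-coherent submodules of \<open>\<E>\<^sub>i\<close>, and those that are locally a direct factor of rank \<open>n\<close>.\<close>

definition qc_sub :: "('o, 'k) coefs \<Rightarrow> ('s, 'r, 'k) kscheme \<Rightarrow> ('s, 'r, 'a, 'o) bt_group \<Rightarrow>
    int \<Rightarrow> ('s set \<Rightarrow> ('a, 'r) crys set) \<Rightarrow> bool" where
  "qc_sub Q S G i N \<longleftrightarrow>
     (\<forall>U. affine_open S U \<longrightarrow> submodule (N U) (sec S U) (crysi Q S G U i)) \<and>
     (\<forall>U V. affine_open S U \<and> affine_open S V \<and> V \<subseteq> U \<longrightarrow>
        N V = mspan (sec S V) (crysi Q S G V i) (crys_res S G U V ` N U))"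

definition locally_direct_factor :: "('o, 'k) coefs \<Rightarrow> ('s, 'r, 'k) kscheme \<Rightarrow> ('s, 'r, 'a, 'o) bt_group \<Rightarrow>
    int \<Rightarrow> ('s set \<Rightarrow> ('a, 'r) crys set) \<Rightarrow> nat \<Rightarrow> bool" where
  "locally_direct_factor Q S G i N n \<longleftrightarrow> qc_sub Q S G i N \<and>
     (\<forall>s\<in>topspace (topo S). \<exists>U. affine_open S U \<and> s \<in> U \<and>
        free_rank (sec S U) (crysi Q S G U i\<lparr>carrier := N U\<rparr>) n \<and>
        (\<exists>C. submodule C (sec S U) (crysi Q S G U i) \<and>
           N U \<inter> C = {\<zero>\<^bsub>crysi Q S G U i\<^esub>} \<and>
           N U <+>\<^bsub>crysi Q S G U i\<^esub> C = carrier (crysi Q S G U i)))"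

text \<open>
  The standard facts of crystalline Dieudonne theory for \<open>G\<close>: \<open>\<E>\<close> is a locally free sheaf of rank \<open>fh\<close>
  compatible with Frobenius base change, is the direct sum of the \<open>\<E>\<^sub>i\<close>, which are locally free of
  rank \<open>h\<close>, and \<open>F\<^sub>i\<close> and \<open>V\<^sub>i\<close> are linear with \<open>Ker V\<^sub>i = Im F\<^sub>i\<close> and
  \<open>Im V\<^sub>i = Ker F\<^sub>i = \<F>\<^sub>i\<^sub>-\<^sub>1\<^sup>(\<^sup>p\<^sup>)\<close>. They hold for every \<open>p\<close>-divisible group of height \<open>fh\<close> with
  \<open>O\<^sub>F\<close>-action over a \<open>k\<close>-scheme (Mazur--Messing, Berthelot--Breen--Messing).\<close>

definition dieudonne_theory ::
    "('o, 'k) coefs \<Rightarrow> nat \<Rightarrow> ('s, 'r, 'k) kscheme \<Rightarrow> ('s, 'r, 'a, 'o) bt_group \<Rightarrow> bool" where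
  "dieudonne_theory Q h S G \<longleftrightarrow>
     (\<forall>U. affine_open S U \<longrightarrow> Module.module (sec S U) (crysU S G U)) \<and>
     (\<forall>U V. affine_open S U \<and> affine_open S V \<and> V \<subseteq> U \<longrightarrow>
        bij_betw (lext (sec S V) (crysU S G V) (crys_res S G U V))
          (carrier (base_change (sec S U) (rest S U V) (sec S V) (crysU S G U)))
          (carrier (crysU S G V))) \<and>
     (\<forall>s\<in>topspace (topo S). \<exists>U. affine_open S U \<and> s \<in> U \<and>
        free_rank (sec S U) (crysU S G U) (cf Q * h)) \<and>
     (\<forall>U. affine_open S U \<longrightarrow>
        bij_betw (crys_bc (sec S U) (cp Q) (tow G U))
          (carrier (twist (sec S U) (cp Q) (crysU S G U)))
          (carrier (crystal (sec S U) (tw_tower (sec S U) (cp Q) (tow G U))))) \<and>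
     (\<forall>U. affine_open S U \<longrightarrow> (\<forall>x\<in>carrier (crysU S G U).
        \<exists>!c. c \<in> (\<Pi>\<^sub>E i\<in>{1..int (cf Q)}. carrier (crysi Q S G U i)) \<and>
          x = finsum (crysU S G U) c {1..int (cf Q)})) \<and>
     (\<forall>i. locally_direct_factor Q S G i (\<lambda>U. carrier (crysi Q S G U i)) h) \<and>
     (\<forall>i U. affine_open S U \<longrightarrow>
        (let R = sec S U; E = crysi Q S G U i; E' = crysi Q S G U (i - 1); T = twist R (cp Q) E';
             F = frobi Q S G U i; V = veri Q S G U i in
          F \<in> lin_map R T E \<and> V \<in> lin_map R E T \<and>
          {x \<in> carrier E. V x = \<zero>\<^bsub>T\<^esub>} = F ` carrier T \<and>
          {t \<in> carrier T. F t = \<zero>\<^bsub>E\<^esub>} = V ` carrier E \<and>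
          V ` carrier E = tw_sub R (cp Q) E' (hodgei Q S G U (i - 1))))"

definition hodge_ranks :: "('o, 'k) coefs \<Rightarrow> nat \<Rightarrow> ('s, 'r, 'k) kscheme \<Rightarrow> ('s, 'r, 'a, 'o) bt_group \<Rightarrow>
    (int \<Rightarrow> nat) \<Rightarrow> bool" where
  "hodge_ranks Q h S G d \<longleftrightarrow> (\<forall>i. d (i + int (cf Q)) = d i \<and> d i \<le> h \<and>
     locally_direct_factor Q S G i (\<lambda>U. hodgei Q S G U i) (d i))"

text \<open>The data on one affine open. \<open>Phi i j U\<close> is \<open>\<F>\<^sub>i\<^sup>[\<^sup>j\<^sup>](U)\<close>.\<close>

definition fdm_on :: "('o, 'k) coefs \<Rightarrow> nat \<Rightarrow> ('s, 'r, 'k) kscheme \<Rightarrow> ('s, 'r, 'a, 'o) bt_group \<Rightarrow>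
    (int \<Rightarrow> nat) \<Rightarrow> (int \<Rightarrow> nat \<Rightarrow> 's set \<Rightarrow> ('a, 'r) crys set) \<Rightarrow> 's set \<Rightarrow> ('r, ('a, 'r) crys) fdm" where
  "fdm_on Q h S G d Phi U = \<lparr>base = sec S U, chr = cp Q, dg = cf Q, hgt = h, dm = d,
     Em = crysi Q S G U, Fm = frobi Q S G U, Vm = veri Q S G U,
     hdg = hodgei Q S G U, flt = (\<lambda>i j. Phi i j U)\<rparr>"

definition fil_rank :: "nat \<Rightarrow> (int \<Rightarrow> nat) \<Rightarrow> int \<Rightarrow> nat \<Rightarrow> nat" where
  "fil_rank h d i j = (if j < sidx h d i then d i - delta h d j else h + d i - delta h d j)"

definition adequate_filtrations ::
    "('o, 'k) coefs \<Rightarrow> nat \<Rightarrow> ('s, 'r, 'k) kscheme \<Rightarrow> ('s, 'r, 'a, 'o) bt_group \<Rightarrow>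
     (int \<Rightarrow> nat) \<Rightarrow> (int \<Rightarrow> nat \<Rightarrow> 's set \<Rightarrow> ('a, 'r) crys set) \<Rightarrow> bool" where
  "adequate_filtrations Q h S G d Phi \<longleftrightarrow> (\<forall>i.
     Phi (i + int (cf Q)) = Phi i \<and>
     (\<forall>j\<in>{1..nsteps h d} - {sidx h d i}.
        locally_direct_factor Q S G i (Phi i j) (fil_rank h d i j)) \<and>
     (\<forall>U. affine_open S U \<longrightarrow>
        (\<forall>j j'. 1 \<le> j \<and> j < j' \<and> j' < sidx h d i \<and> j' \<le> nsteps h d \<longrightarrow> Phi i j' U \<subseteq> Phi i j U) \<and>
        (\<forall>j j'. sidx h d i < j \<and> j < j' \<and> j' \<le> nsteps h d \<longrightarrow> Phi i j' U \<subseteq> Phi i j U) \<and>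
        (\<forall>j. 1 \<le> j \<and> j < sidx h d i \<and> j \<le> nsteps h d \<longrightarrow>
           Phi i j U \<subseteq> hodgei Q S G U i \<and> Phi i j U \<subseteq> tFil (fdm_on Q h S G d Phi U) i j) \<and>
        (\<forall>j. sidx h d i < j \<and> j \<le> nsteps h d \<longrightarrow>
           hodgei Q S G U i \<subseteq> Phi i j U \<and> tFil (fdm_on Q h S G d Phi U) i j \<subseteq> Phi i j U)))"

subsection \<open>Sections of the line bundles\<close>

text \<open>
  The affine opens on which every \<open>\<E>\<^sub>i\<close> has a basis adapted to \<open>\<F>\<^sub>i\<close> and all the \<open>\<F>\<^sub>i\<^sup>[\<^sup>j\<^sup>]\<close>. As these submodules
  form a chain of local direct factors, such opens form a base of the topology of \<open>S\<close>; on them formation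
  of the twists, exterior powers and determinants commutes with taking sections. So a global section of one
  of the invertible sheaves is given by its values on these opens.\<close>

definition trivializing :: "('o, 'k) coefs \<Rightarrow> nat \<Rightarrow> ('s, 'r, 'k) kscheme \<Rightarrow> ('s, 'r, 'a, 'o) bt_group \<Rightarrow>
    (int \<Rightarrow> nat) \<Rightarrow> (int \<Rightarrow> nat \<Rightarrow> 's set \<Rightarrow> ('a, 'r) crys set) \<Rightarrow> 's set set" where
  "trivializing Q h S G d Phi = {U. affine_open S U \<and>
     (\<forall>i. \<exists>bs. length bs = h \<and> basis (sec S U) (crysi Q S G U i) bs \<and>
        hodgei Q S G U i = mspan (sec S U) (crysi Q S G U i) (set (take (d i) bs)) \<and>
        (\<forall>j\<in>{1..nsteps h d} - {sidx h d i}.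
           Phi i j U = mspan (sec S U) (crysi Q S G U i) (set (take (fil_rank h d i j) bs))))}"

text \<open>\<open>Ha\<^sub>i(G)\<close>, a section of \<open>(det \<omega>\<^bsub>G,i\<^esub>)\<^bsup>p^f - 1\<^esup> = Hom(det \<omega>\<^bsub>G,i\<^esub>, (det \<omega>\<^bsub>G,i\<^esub>)\<^bsup>p^f\<^esup>)\<close>, and the product
  \<open>\<Prod>\<^sub>l (h\<^sub>i\<^sub>-\<^sub>l\<^sup>[\<^sup>j\<^sup>])\<^bsup>p^l\<^esup>\<close>.\<close>

definition Ha :: "('o, 'k) coefs \<Rightarrow> nat \<Rightarrow> ('s, 'r, 'k) kscheme \<Rightarrow> ('s, 'r, 'a, 'o) bt_group \<Rightarrow>
    (int \<Rightarrow> nat) \<Rightarrow> (int \<Rightarrow> nat \<Rightarrow> 's set \<Rightarrow> ('a, 'r) crys set) \<Rightarrow> int \<Rightarrow> 's set \<Rightarrow>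
    (('a, 'r) crys, 'r) wedge \<Rightarrow> ((('a, 'r) crys \<Rightarrow> 'r) set, 'r) wedge" where
  "Ha Q h S G d Phi i = (\<lambda>U\<in>trivializing Q h S G d Phi. ha (fdm_on Q h S G d Phi U) i)"

definition refined_hasse_product ::
    "('o, 'k) coefs \<Rightarrow> nat \<Rightarrow> ('s, 'r, 'k) kscheme \<Rightarrow> ('s, 'r, 'a, 'o) bt_group \<Rightarrow>
    (int \<Rightarrow> nat) \<Rightarrow> (int \<Rightarrow> nat \<Rightarrow> 's set \<Rightarrow> ('a, 'r) crys set) \<Rightarrow> int \<Rightarrow> nat \<Rightarrow> 's set \<Rightarrow>
    (('a, 'r) crys, 'r) wedge \<Rightarrow> ((('a, 'r) crys \<Rightarrow> 'r) set, 'r) wedge" where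
  "refined_hasse_product Q h S G d Phi i j =
     (\<lambda>U\<in>trivializing Q h S G d Phi. hasse_prod (fdm_on Q h S G d Phi U) i j)"

end

theory Submission
  imports Defs
begin

text \<open>
  Fix \<open>n = d\<^sub>i = \<delta>\<^sub>j\<close>. For each \<open>k\<close> there is a module \<open>P\<^sub>k\<close>, namely \<open>\<Lambda>\<^sup>n\<F>\<^sub>k\<close> if \<open>n \<le> d\<^sub>k\<close> and
  \<open>\<Lambda>\<^sup>n\<^sup>-\<^sup>d(\<E>\<^sub>k/\<F>\<^sub>k) \<otimes> det \<F>\<^sub>k\<close> with \<open>d = d\<^sub>k\<close> otherwise, which maps to \<open>\<Lambda>\<^sup>n\<E>\<^sub>k\<close> by the wedge product and
  projects onto \<open>\<L>\<^sub>k\<^sup>[\<^sup>j\<^sup>]\<close>. The map \<open>f\<^sub>k\<^sup>n\<close> factors through a map \<open>\<Lambda>\<^sup>n\<E>\<^sub>k \<rightarrow> P\<^sub>k\<^sub>-\<^sub>1\<^sup>(\<^sup>p\<^sup>)\<close>, and the composite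
  \<open>P\<^sub>k \<rightarrow> \<Lambda>\<^sup>n\<E>\<^sub>k \<rightarrow> P\<^sub>k\<^sub>-\<^sub>1\<^sup>(\<^sup>p\<^sup>)\<close> induces the refined Hasse invariant on the quotients \<open>\<L>\<^sup>[\<^sup>j\<^sup>]\<close>. So along the
  two chains of maps the images of a section of \<open>det \<F>\<^sub>i\<close> are both images of the same element of
  \<open>P\<^sub>i\<^sub>-\<^sub>l\<^sup>(\<^sup>q\<^sup>)\<close>, \<open>q = p\<^sup>l\<close>; after \<open>f\<close> steps \<open>P = det \<F>\<^sub>i = \<L>\<^sub>i\<^sup>[\<^sup>j\<^sup>]\<close>, and the two chains agree.

  Twisting a linear map by \<open>p\<^sup>l\<close> needs a map on symbols after base change. For \<open>\<Lambda>\<^sup>n\<E>\<^sub>k \<rightarrow> P\<^sub>k\<^sub>-\<^sub>1\<^sup>(\<^sup>p\<^sup>)\<close> this is a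
  contraction with explicit linear functionals; for the Hasse invariants it exists because the sources
  are free of rank one.
\<close>

section \<open>Modules given by generators and relations, and maps out of them\<close>

section \<open>Semilinear maps and submodules\<close>

text \<open>Why \<open>f_k^n\<close> makes sense for n > d, where d is the Hodge rank at k - 1: a
  preimage y under F is determined up to Ker F = Im V, the twisted Hodge submodule, of rank d. The d
  vectors V x already fill its top exterior power, so the ambiguity dies. The same count (too many
  vectors in a submodule of small rank) lets all products descend to quotients. The obstacle is that
  no single basis fits everything. A basis adapted to the filtration of the k-th module is not
  adapted to the filtration transported from index k - 1 by V and F. For the latter another basis is
  built from V-preimages and F-images of a twisted basis; the two are linked only by the inclusions
  required of adequate filtrations. \<open>htwist\<close>, and \<open>theta\<close>,
  \<open>chi\<close> and \<open>fd\<close> when n exceeds the relevant Hodge rank, are definite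
  descriptions: each is evaluated by exhibiting one candidate and proving uniqueness. Alternating
  forms are compared by showing that their difference vanishes. Vanishing does not depend on the
  order of the entries, so no sign of a permutation is ever computed.\<close>

locale rmod = Module.module R M for R :: "'r ring" (structure) and M :: "('r, 'm) module" (structure)

text \<open>Unlike in \<open>lin_map\<close>, nothing is prescribed off the carrier, because the
  maps produced by \<open>sext\<close> and their composites are not extensional.
  \<open>lin_map_restrict\<close> passes to the extensional notion where a definite description asks
  for it.\<close>

definition slin :: "'r ring \<Rightarrow> ('r \<Rightarrow> 'r) \<Rightarrow> ('r, 'm) module \<Rightarrow> ('r, 'n) module \<Rightarrow> ('m \<Rightarrow> 'n) \<Rightarrow> bool" where
  "slin R \<phi> M N u \<longleftrightarrow> u \<in> carrier M \<rightarrow> carrier N \<and>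
     (\<forall>x\<in>carrier M. \<forall>y\<in>carrier M. u (x \<oplus>\<^bsub>M\<^esub> y) = u x \<oplus>\<^bsub>N\<^esub> u y) \<and>
     (\<forall>r\<in>carrier R. \<forall>x\<in>carrier M. u (r \<odot>\<^bsub>M\<^esub> x) = \<phi> r \<odot>\<^bsub>N\<^esub> u x)"

abbreviation lin :: "'r ring \<Rightarrow> ('r, 'm) module \<Rightarrow> ('r, 'n) module \<Rightarrow> ('m \<Rightarrow> 'n) \<Rightarrow> bool" where
  "lin R M N u \<equiv> slin R (\<lambda>r. r) M N u"

lemma slinI:
  assumes "\<And>x. x \<in> carrier M \<Longrightarrow> u x \<in> carrier N"
    and "\<And>x y. x \<in> carrier M \<Longrightarrow> y \<in> carrier M \<Longrightarrow> u (x \<oplus>\<^bsub>M\<^esub> y) = u x \<oplus>\<^bsub>N\<^esub> u y"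
    and "\<And>r x. r \<in> carrier R \<Longrightarrow> x \<in> carrier M \<Longrightarrow> u (r \<odot>\<^bsub>M\<^esub> x) = \<phi> r \<odot>\<^bsub>N\<^esub> u x"
  shows "slin R \<phi> M N u"
  using assms by (auto simp: slin_def)

lemma slin_closed: "slin R \<phi> M N u \<Longrightarrow> x \<in> carrier M \<Longrightarrow> u x \<in> carrier N"
  by (auto simp: slin_def)

lemma slin_add: "slin R \<phi> M N u \<Longrightarrow> x \<in> carrier M \<Longrightarrow> y \<in> carrier M \<Longrightarrow> u (x \<oplus>\<^bsub>M\<^esub> y) = u x \<oplus>\<^bsub>N\<^esub> u y"
  by (auto simp: slin_def)

lemma slin_smult: "slin R \<phi> M N u \<Longrightarrow> r \<in> carrier R \<Longrightarrow> x \<in> carrier M \<Longrightarrow> u (r \<odot>\<^bsub>M\<^esub> x) = \<phi> r \<odot>\<^bsub>N\<^esub> u x"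
  by (auto simp: slin_def)

lemma slin_comp:
  "slin R \<phi> M N u \<Longrightarrow> slin R \<psi> N P v \<Longrightarrow> \<phi> \<in> carrier R \<rightarrow> carrier R \<Longrightarrow>
   slin R (\<lambda>r. \<psi> (\<phi> r)) M P (\<lambda>x. v (u x))"
  by (auto simp: slin_def Pi_def)

lemma slin_cong:
  assumes "slin R \<phi> M N u" "\<And>x. x \<in> carrier M \<Longrightarrow> u x = v x" "rmod R M"
  shows "slin R \<phi> M N v"
proof -
  interpret M: rmod R M by fact
  show ?thesis using assms(1,2) by (auto simp: slin_def Pi_iff)
qed

lemma lin_map_iff: "u \<in> lin_map R M N \<longleftrightarrow> u \<in> extensional (carrier M) \<and> lin R M N u"
  by (auto simp: lin_map_def slin_def PiE_def)

lemma lin_map_restrict: "rmod R M \<Longrightarrow> lin R M N u \<Longrightarrow> restrict u (carrier M) \<in> lin_map R M N"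
  unfolding lin_map_iff by (auto intro: slin_cong)

context rmod
begin

lemma diff_eq_zero:
  assumes "x \<in> carrier M" "y \<in> carrier M"
  shows "x \<ominus>\<^bsub>M\<^esub> y = \<zero>\<^bsub>M\<^esub> \<longleftrightarrow> x = y"
proof
  assume "x \<ominus>\<^bsub>M\<^esub> y = \<zero>\<^bsub>M\<^esub>"
  then have "\<ominus>\<^bsub>M\<^esub> (\<ominus>\<^bsub>M\<^esub> y) = x" using assms by (intro M.minus_equality) (auto simp: a_minus_def)
  then show "x = y" using assms by simp
qed (use assms in \<open>simp add: a_minus_def M.r_neg\<close>)

lemma slin_zero: "rmod R N \<Longrightarrow> slin R \<phi> M N u \<Longrightarrow> u \<zero>\<^bsub>M\<^esub> = \<zero>\<^bsub>N\<^esub>"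
proof -
  assume N: "rmod R N" and u: "slin R \<phi> M N u"
  interpret N: rmod R N by (rule N)
  have "u \<zero>\<^bsub>M\<^esub> = u \<zero>\<^bsub>M\<^esub> \<oplus>\<^bsub>N\<^esub> u \<zero>\<^bsub>M\<^esub>"
    using slin_add[OF u, of "\<zero>\<^bsub>M\<^esub>" "\<zero>\<^bsub>M\<^esub>"] by simp
  then show ?thesis using slin_closed[OF u M.zero_closed]
    by (metis N.M.add.r_cancel_one')
qed

lemma slin_minus:
  assumes "rmod R N" and u: "slin R \<phi> M N u" and x: "x \<in> carrier M"
  shows "u (\<ominus>\<^bsub>M\<^esub> x) = \<ominus>\<^bsub>N\<^esub> u x"
proof -
  interpret N: rmod R N by fact
  have "u x \<oplus>\<^bsub>N\<^esub> u (\<ominus>\<^bsub>M\<^esub> x) = \<zero>\<^bsub>N\<^esub>"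
    using slin_add[OF u x, of "\<ominus>\<^bsub>M\<^esub> x"] x slin_zero[OF assms(1) u] by (simp add: M.r_neg)
  then show ?thesis using slin_closed[OF u] x
    by (metis M.a_inv_closed N.M.minus_equality N.M.a_comm)
qed

lemma slin_diff:
  assumes "rmod R N" and u: "slin R \<phi> M N u" and x: "x \<in> carrier M" "y \<in> carrier M"
  shows "u (x \<ominus>\<^bsub>M\<^esub> y) = u x \<ominus>\<^bsub>N\<^esub> u y"
  using slin_minus[OF assms(1,2)] x slin_add[OF u] by (simp add: a_minus_def)

lemma slin_finsum:
  assumes "rmod R N" and u: "slin R \<phi> M N u" and f: "f \<in> A \<rightarrow> carrier M" and fin: "finite A"
  shows "u (finsum M f A) = finsum N (\<lambda>k. u (f k)) A"
proof -
  interpret N: rmod R N by fact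
  show ?thesis using fin f
  proof (induction A rule: finite_induct)
    case empty then show ?case using slin_zero[OF assms(1) u] by simp
  next
    case (insert a A)
    then have "f \<in> A \<rightarrow> carrier M" "f a \<in> carrier M" by auto
    moreover from this have "(\<lambda>k. u (f k)) \<in> A \<rightarrow> carrier N" "u (f a) \<in> carrier N"
      using slin_closed[OF u] by auto
    ultimately show ?case using insert slin_add[OF u] by (simp add: M.finsum_closed)
  qed
qed

lemma submodule_closed:
  assumes "submodule N R M"
  shows "x \<in> N \<Longrightarrow> x \<in> carrier M" "\<zero>\<^bsub>M\<^esub> \<in> N" "x \<in> N \<Longrightarrow> y \<in> N \<Longrightarrow> x \<oplus>\<^bsub>M\<^esub> y \<in> N"
    "r \<in> carrier R \<Longrightarrow> x \<in> N \<Longrightarrow> r \<odot>\<^bsub>M\<^esub> x \<in> N" "x \<in> N \<Longrightarrow> \<ominus>\<^bsub>M\<^esub> x \<in> N"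
    "x \<in> N \<Longrightarrow> y \<in> N \<Longrightarrow> x \<ominus>\<^bsub>M\<^esub> y \<in> N"
proof -
  have s: "subgroup N (add_monoid M)" using assms by (simp add: submodule_def)
  show "\<zero>\<^bsub>M\<^esub> \<in> N" using subgroup.one_closed[OF s] by simp
qed (use submoduleE[OF assms] in \<open>auto simp: a_minus_def\<close>)

text \<open>Closure under negatives follows because they are multiples by minus one.\<close>

lemma submoduleI':
  assumes "H \<subseteq> carrier M" "\<zero>\<^bsub>M\<^esub> \<in> H"
    and "\<And>a b. a \<in> H \<Longrightarrow> b \<in> H \<Longrightarrow> a \<oplus>\<^bsub>M\<^esub> b \<in> H"
    and "\<And>a x. a \<in> carrier R \<Longrightarrow> x \<in> H \<Longrightarrow> a \<odot>\<^bsub>M\<^esub> x \<in> H"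
  shows "submodule H R M"
proof (rule submoduleI)
  fix a assume "a \<in> H"
  moreover have "\<ominus>\<^bsub>M\<^esub> a = (\<ominus> \<one>) \<odot>\<^bsub>M\<^esub> a" if "a \<in> carrier M"
    using that by (simp add: smult_l_minus)
  ultimately show "\<ominus>\<^bsub>M\<^esub> a \<in> H" using assms by auto
qed (use assms in auto)

lemma zero_submodule: "submodule {\<zero>\<^bsub>M\<^esub>} R M"
  by (rule submoduleI') auto

lemma mspan_submodule:
  assumes "X \<subseteq> carrier M" shows "submodule (mspan R M X) R M"
proof (rule submoduleI')
  have c: "submodule (carrier M) R M" by (rule carrier_is_submodule)
  then show "mspan R M X \<subseteq> carrier M" using assms by (auto simp: mspan_def)
qed (auto simp: mspan_def intro: submodule_closed)

lemma mspan_incl: "x \<in> X \<Longrightarrow> x \<in> mspan R M X"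
  by (auto simp: mspan_def)

lemma mspan_least: "submodule N R M \<Longrightarrow> X \<subseteq> N \<Longrightarrow> mspan R M X \<subseteq> N"
  by (auto simp: mspan_def)

lemma mspan_carrier: "X \<subseteq> carrier M \<Longrightarrow> mspan R M X \<subseteq> carrier M"
  by (rule mspan_least[OF carrier_is_submodule])

lemma mspan_mono: "X \<subseteq> Y \<Longrightarrow> mspan R M X \<subseteq> mspan R M Y"
  by (auto simp: mspan_def)

lemma mspan_id: "submodule N R M \<Longrightarrow> mspan R M N = N"
  by (auto simp: mspan_def)

text \<open>The elements of the span with property \<open>P\<close> form a submodule containing
  \<open>X\<close>.\<close>

lemma mspan_induct [consumes 2, case_names zero base add smult]:
  assumes x: "x \<in> mspan R M X" and X: "X \<subseteq> carrier M"
    and "P \<zero>\<^bsub>M\<^esub>" "\<And>x. x \<in> X \<Longrightarrow> P x"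
    and "\<And>x y. x \<in> mspan R M X \<Longrightarrow> y \<in> mspan R M X \<Longrightarrow> P x \<Longrightarrow> P y \<Longrightarrow> P (x \<oplus>\<^bsub>M\<^esub> y)"
    and "\<And>r x. r \<in> carrier R \<Longrightarrow> x \<in> mspan R M X \<Longrightarrow> P x \<Longrightarrow> P (r \<odot>\<^bsub>M\<^esub> x)"
  shows "P x"
proof -
  have s: "submodule (mspan R M X) R M" by (rule mspan_submodule[OF X])
  have "submodule {x \<in> mspan R M X. P x} R M"
    by (rule submoduleI') (use assms submodule_closed[OF s] in auto)
  then have "mspan R M X \<subseteq> {x \<in> mspan R M X. P x}"
    by (rule mspan_least) (use assms in \<open>auto intro: mspan_incl\<close>)
  then show ?thesis using x by auto
qed

lemma slin_eq_mspan:
  assumes "rmod R N" "slin R \<phi> M N u" "slin R \<phi> M N v" "X \<subseteq> carrier M"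
    "\<And>x. x \<in> X \<Longrightarrow> u x = v x" "x \<in> mspan R M X"
  shows "u x = v x"
  using assms(6,4)
proof (induction rule: mspan_induct)
  case zero then show ?case using slin_zero[OF assms(1,2)] slin_zero[OF assms(1,3)] by simp
next
  case (add x y)
  then have "x \<in> carrier M" "y \<in> carrier M" using mspan_carrier[OF assms(4)] by auto
  then show ?case using add by (simp add: slin_add[OF assms(2)] slin_add[OF assms(3)])
next
  case (smult r x)
  then have "x \<in> carrier M" using mspan_carrier[OF assms(4)] by auto
  then show ?case using smult by (simp add: slin_smult[OF assms(2)] slin_smult[OF assms(3)])
qed (use assms in auto)

lemma finsum_mspan:
  assumes "X \<subseteq> carrier M" "finite A" "\<And>k. k \<in> A \<Longrightarrow> f k \<in> mspan R M X"
  shows "finsum M f A \<in> mspan R M X"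
  using assms(2,3)
proof (induction A rule: finite_induct)
  case empty then show ?case using submodule_closed(2)[OF mspan_submodule[OF assms(1)]] by simp
next
  case (insert a A)
  have "f \<in> A \<rightarrow> carrier M" "f a \<in> carrier M" using insert mspan_carrier[OF assms(1)] by auto
  then show ?case using insert submodule_closed(3)[OF mspan_submodule[OF assms(1)]] by simp
qed

lemma finsum_single:
  assumes "finite A" "a \<in> A" "f a \<in> carrier M" "\<And>k. k \<in> A \<Longrightarrow> k \<noteq> a \<Longrightarrow> f k = \<zero>\<^bsub>M\<^esub>"
  shows "finsum M f A = f a"
proof -
  have "finsum M f A = finsum M f (insert a (A - {a}))" using assms by (simp add: insert_absorb)
  also have "\<dots> = f a \<oplus>\<^bsub>M\<^esub> finsum M f (A - {a})"
    using assms by (intro M.finsum_insert) (auto intro!: Pi_I)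
  also have "finsum M f (A - {a}) = \<zero>\<^bsub>M\<^esub>"
    using assms by (intro M.add.finprod_one_eqI) auto
  finally show ?thesis using assms by simp
qed

lemma finsum_superset:
  assumes "finite B" "A \<subseteq> B" "f \<in> A \<rightarrow> carrier M" "\<And>k. k \<in> B - A \<Longrightarrow> f k = \<zero>\<^bsub>M\<^esub>"
  shows "finsum M f B = finsum M f A"
proof (rule M.add.finprod_mono_neutral_cong_left[symmetric])
  show "f \<in> B \<rightarrow> carrier M" using assms(3,4) by (auto simp: Pi_iff)
qed (use assms in auto)

end

lemma module_cring: "rmod R M \<Longrightarrow> cring R"
  by (simp add: rmod_def Module.module_def)

lemma slin_id: "rmod R M \<Longrightarrow> lin R M M (\<lambda>x. x)"
  by (auto simp: slin_def)

section \<open>Quotients and presented modules\<close>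

lemma (in rmod) quot_eq_iff:
  assumes N: "submodule N R M" and x: "x \<in> carrier M" "y \<in> carrier M"
  shows "N +>\<^bsub>M\<^esub> x = N +>\<^bsub>M\<^esub> y \<longleftrightarrow> x \<ominus>\<^bsub>M\<^esub> y \<in> N"
proof -
  have s: "subgroup N (add_monoid M)" using N by (simp add: submodule_def)
  have sub: "N \<subseteq> carrier M" using submodule_closed[OF N] by auto
  show ?thesis
  proof
    assume "N +>\<^bsub>M\<^esub> x = N +>\<^bsub>M\<^esub> y"
    then have "N +>\<^bsub>M\<^esub> (x \<ominus>\<^bsub>M\<^esub> y) = N"
      using M.a_coset_add_inv2[of N x y] x sub by (simp add: a_minus_def)
    then show "x \<ominus>\<^bsub>M\<^esub> y \<in> N" using M.a_coset_join1[OF _ _ s] x by simp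
  next
    assume "x \<ominus>\<^bsub>M\<^esub> y \<in> N"
    then have "N +>\<^bsub>M\<^esub> (x \<ominus>\<^bsub>M\<^esub> y) = N" using M.a_coset_join2[OF _ s] x by simp
    then show "N +>\<^bsub>M\<^esub> x = N +>\<^bsub>M\<^esub> y"
      using M.a_coset_add_inv1[of N x y] x sub by (simp add: a_minus_def)
  qed
qed

lemma (in rmod) quot_repr:
  assumes N: "submodule N R M" and x: "x \<in> carrier M" and y: "y \<in> N +>\<^bsub>M\<^esub> x"
  shows "y \<in> carrier M" "N +>\<^bsub>M\<^esub> y = N +>\<^bsub>M\<^esub> x"
proof -
  have s: "subgroup N (add_monoid M)" using N by (simp add: submodule_def)
  show "y \<in> carrier M" using submodule_closed[OF N] x y by (auto simp: a_r_coset_def')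
  show "N +>\<^bsub>M\<^esub> y = N +>\<^bsub>M\<^esub> x" using M.a_repr_independence[OF y x s] by simp
qed

lemma (in rmod) quot_self:
  assumes N: "submodule N R M" and x: "x \<in> carrier M"
  shows "x \<in> N +>\<^bsub>M\<^esub> x"
  using submodule_closed[OF N] x by (auto simp: a_r_coset_def' intro!: bexI[of _ "\<zero>\<^bsub>M\<^esub>"])

lemma (in rmod) quot_ops:
  assumes N: "submodule N R M"
  shows "carrier (quot_mod M N) = {N +>\<^bsub>M\<^esub> x | x. x \<in> carrier M}"
    and "\<zero>\<^bsub>quot_mod M N\<^esub> = N +>\<^bsub>M\<^esub> \<zero>\<^bsub>M\<^esub>"
    and "x \<in> carrier M \<Longrightarrow> y \<in> carrier M \<Longrightarrow>
      (N +>\<^bsub>M\<^esub> x) \<oplus>\<^bsub>quot_mod M N\<^esub> (N +>\<^bsub>M\<^esub> y) = N +>\<^bsub>M\<^esub> (x \<oplus>\<^bsub>M\<^esub> y)"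
    and "r \<in> carrier R \<Longrightarrow> x \<in> carrier M \<Longrightarrow>
      r \<odot>\<^bsub>quot_mod M N\<^esub> (N +>\<^bsub>M\<^esub> x) = N +>\<^bsub>M\<^esub> (r \<odot>\<^bsub>M\<^esub> x)"
proof -
  have s: "subgroup N (add_monoid M)" using N by (simp add: submodule_def)
  interpret abelian_subgroup N M
    by (intro abelian_subgroupI3 additive_subgroupI s M.abelian_group_axioms)
  show "carrier (quot_mod M N) = {N +>\<^bsub>M\<^esub> x | x. x \<in> carrier M}"
    by (auto simp: quot_mod_def A_RCOSETS_def')
  show "\<zero>\<^bsub>quot_mod M N\<^esub> = N +>\<^bsub>M\<^esub> \<zero>\<^bsub>M\<^esub>"
    using submodule_closed[OF N] by (simp add: quot_mod_def M.a_coset_add_zero subset_iff)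
  show "x \<in> carrier M \<Longrightarrow> y \<in> carrier M \<Longrightarrow>
      (N +>\<^bsub>M\<^esub> x) \<oplus>\<^bsub>quot_mod M N\<^esub> (N +>\<^bsub>M\<^esub> y) = N +>\<^bsub>M\<^esub> (x \<oplus>\<^bsub>M\<^esub> y)"
    by (simp add: quot_mod_def a_rcos_sum)
  assume rx: "r \<in> carrier R" "x \<in> carrier M"
  \<comment> \<open>The scalar action on a coset is defined as a union over its representatives; all
    members of that union are the same coset.\<close>
  have "N +>\<^bsub>M\<^esub> (r \<odot>\<^bsub>M\<^esub> c) = N +>\<^bsub>M\<^esub> (r \<odot>\<^bsub>M\<^esub> x)" if c: "c \<in> N +>\<^bsub>M\<^esub> x" for c
  proof -
    have "c \<ominus>\<^bsub>M\<^esub> x \<in> N" using quot_eq_iff[OF N, of c x] quot_repr[OF N rx(2) c] rx by simp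
    then have "r \<odot>\<^bsub>M\<^esub> (c \<ominus>\<^bsub>M\<^esub> x) \<in> N" using rx submodule_closed[OF N] by simp
    moreover have "r \<odot>\<^bsub>M\<^esub> (c \<ominus>\<^bsub>M\<^esub> x) = r \<odot>\<^bsub>M\<^esub> c \<ominus>\<^bsub>M\<^esub> r \<odot>\<^bsub>M\<^esub> x"
      using rx quot_repr[OF N rx(2) c] by (simp add: a_minus_def smult_r_distr smult_r_minus)
    ultimately show ?thesis using quot_eq_iff[OF N] quot_repr[OF N rx(2) c] rx by simp
  qed
  then have "(\<Union>c\<in>N +>\<^bsub>M\<^esub> x. N +>\<^bsub>M\<^esub> (r \<odot>\<^bsub>M\<^esub> c)) = (\<Union>c\<in>N +>\<^bsub>M\<^esub> x. N +>\<^bsub>M\<^esub> (r \<odot>\<^bsub>M\<^esub> x))"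
    by (rule SUP_cong[OF refl])
  also have "\<dots> = N +>\<^bsub>M\<^esub> (r \<odot>\<^bsub>M\<^esub> x)" using quot_self[OF N rx(2)] by auto
  finally show "r \<odot>\<^bsub>quot_mod M N\<^esub> (N +>\<^bsub>M\<^esub> x) = N +>\<^bsub>M\<^esub> (r \<odot>\<^bsub>M\<^esub> x)"
    by (simp add: quot_mod_def)
qed

lemma (in rmod) quot_module:
  assumes N: "submodule N R M"
  shows "rmod R (quot_mod M N)"
proof -
  note q = quot_ops[OF N]
  have ex: "\<exists>x'\<in>carrier M. x = N +>\<^bsub>M\<^esub> x'" if "x \<in> carrier (quot_mod M N)" for x
    using that by (auto simp: q(1))
  have cl: "N +>\<^bsub>M\<^esub> x \<in> carrier (quot_mod M N)" if "x \<in> carrier M" for x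
    using that by (auto simp: q(1))
  have ag: "abelian_group (quot_mod M N)"
  proof (rule abelian_groupI)
    show "\<zero>\<^bsub>quot_mod M N\<^esub> \<in> carrier (quot_mod M N)" by (simp add: q(2) cl)
  next
    fix x y assume "x \<in> carrier (quot_mod M N)" "y \<in> carrier (quot_mod M N)"
    then obtain x' y' where x': "x = N +>\<^bsub>M\<^esub> x'" "x' \<in> carrier M" "y = N +>\<^bsub>M\<^esub> y'" "y' \<in> carrier M"
      using ex by metis
    then show "x \<oplus>\<^bsub>quot_mod M N\<^esub> y \<in> carrier (quot_mod M N)"
      "x \<oplus>\<^bsub>quot_mod M N\<^esub> y = y \<oplus>\<^bsub>quot_mod M N\<^esub> x"
      by (simp_all add: q(3) cl M.a_comm)
    fix z assume "z \<in> carrier (quot_mod M N)"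
    then obtain z' where "z = N +>\<^bsub>M\<^esub> z'" "z' \<in> carrier M" using ex by metis
    then show "x \<oplus>\<^bsub>quot_mod M N\<^esub> y \<oplus>\<^bsub>quot_mod M N\<^esub> z = x \<oplus>\<^bsub>quot_mod M N\<^esub> (y \<oplus>\<^bsub>quot_mod M N\<^esub> z)"
      using x' by (simp add: q(3) M.a_assoc)
  next
    fix x assume "x \<in> carrier (quot_mod M N)"
    then obtain x' where x': "x = N +>\<^bsub>M\<^esub> x'" "x' \<in> carrier M" using ex by metis
    then show "\<zero>\<^bsub>quot_mod M N\<^esub> \<oplus>\<^bsub>quot_mod M N\<^esub> x = x" by (simp add: q(2,3))
    show "\<exists>y\<in>carrier (quot_mod M N). y \<oplus>\<^bsub>quot_mod M N\<^esub> x = \<zero>\<^bsub>quot_mod M N\<^esub>"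
      using x' by (intro bexI[of _ "N +>\<^bsub>M\<^esub> (\<ominus>\<^bsub>M\<^esub> x')"] cl) (simp_all add: q(2,3) M.l_neg)
  qed
  show ?thesis unfolding rmod_def
  proof (rule moduleI[OF module_cring[OF rmod_axioms] ag])
    fix a b x assume ab: "a \<in> carrier R" "b \<in> carrier R" "x \<in> carrier (quot_mod M N)"
    then obtain x' where x': "x = N +>\<^bsub>M\<^esub> x'" "x' \<in> carrier M" using ex by metis
    show "(a \<oplus> b) \<odot>\<^bsub>quot_mod M N\<^esub> x = (a \<odot>\<^bsub>quot_mod M N\<^esub> x) \<oplus>\<^bsub>quot_mod M N\<^esub> (b \<odot>\<^bsub>quot_mod M N\<^esub> x)"
      "(a \<otimes> b) \<odot>\<^bsub>quot_mod M N\<^esub> x = a \<odot>\<^bsub>quot_mod M N\<^esub> (b \<odot>\<^bsub>quot_mod M N\<^esub> x)"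
      using x' ab by (simp_all add: q(3,4) smult_l_distr smult_assoc1)
  next
    fix a x assume ab: "a \<in> carrier R" "x \<in> carrier (quot_mod M N)"
    then obtain x' where x': "x = N +>\<^bsub>M\<^esub> x'" "x' \<in> carrier M" using ex by metis
    show "a \<odot>\<^bsub>quot_mod M N\<^esub> x \<in> carrier (quot_mod M N)" using ab x' by (simp add: q(4) cl)
    fix y assume "y \<in> carrier (quot_mod M N)"
    then obtain y' where "y = N +>\<^bsub>M\<^esub> y'" "y' \<in> carrier M" using ex by metis
    then show "a \<odot>\<^bsub>quot_mod M N\<^esub> (x \<oplus>\<^bsub>quot_mod M N\<^esub> y) = (a \<odot>\<^bsub>quot_mod M N\<^esub> x) \<oplus>\<^bsub>quot_mod M N\<^esub> (a \<odot>\<^bsub>quot_mod M N\<^esub> y)"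
      using ab x' by (simp add: q(3,4) smult_r_distr)
  next
    fix x assume "x \<in> carrier (quot_mod M N)"
    then obtain x' where x': "x = N +>\<^bsub>M\<^esub> x'" "x' \<in> carrier M" using ex by metis
    then show "\<one> \<odot>\<^bsub>quot_mod M N\<^esub> x = x" by (simp add: q(4))
  qed
qed

lemma free_mod_simps:
  "carrier (free_mod R X) = {v. (\<forall>x. v x \<in> carrier R) \<and> (\<forall>x. x \<notin> X \<longrightarrow> v x = \<zero>\<^bsub>R\<^esub>) \<and>
        finite {x. v x \<noteq> \<zero>\<^bsub>R\<^esub>}}"
  "\<zero>\<^bsub>free_mod R X\<^esub> = (\<lambda>_. \<zero>\<^bsub>R\<^esub>)"
  "v \<oplus>\<^bsub>free_mod R X\<^esub> w = (\<lambda>x. v x \<oplus>\<^bsub>R\<^esub> w x)"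
  "r \<odot>\<^bsub>free_mod R X\<^esub> v = (\<lambda>x. r \<otimes>\<^bsub>R\<^esub> v x)"
  by (simp_all add: free_mod_def)

lemma free_mod_module:
  fixes R (structure)
  assumes "cring R" shows "rmod R (free_mod R X)"
proof -
  interpret cring R by fact
  have fin_add: "finite {x. v x \<oplus> w x \<noteq> \<zero>}"
    if "v \<in> carrier (free_mod R X)" "w \<in> carrier (free_mod R X)" for v w
    by (rule finite_subset[of _ "{x. v x \<noteq> \<zero>} \<union> {x. w x \<noteq> \<zero>}"])
       (use that in \<open>auto simp: free_mod_simps\<close>)
  have fin_smult: "finite {x. r \<otimes> v x \<noteq> \<zero>}"
    if "v \<in> carrier (free_mod R X)" "r \<in> carrier R" for v r
    by (rule finite_subset[of _ "{x. v x \<noteq> \<zero>}"]) (use that in \<open>auto simp: free_mod_simps\<close>)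
  show ?thesis
  proof (unfold rmod_def, rule moduleI)
    show "abelian_group (free_mod R X)"
    proof (rule abelian_groupI)
      fix v assume v: "v \<in> carrier (free_mod R X)"
      have "finite {x. \<ominus> v x \<noteq> \<zero>}"
        by (rule finite_subset[of _ "{x. v x \<noteq> \<zero>}"]) (use v in \<open>auto simp: free_mod_simps\<close>)
      then show "\<exists>w\<in>carrier (free_mod R X). w \<oplus>\<^bsub>free_mod R X\<^esub> v = \<zero>\<^bsub>free_mod R X\<^esub>"
        using v by (intro bexI[of _ "\<lambda>x. \<ominus> v x"]) (auto simp: free_mod_simps l_neg)
    qed (use fin_add in \<open>auto simp: free_mod_simps a_ac\<close>)
  qed (use fin_smult assms in \<open>auto simp: free_mod_simps r_distr l_distr m_assoc\<close>)
qed

lemma delta_fun_closed: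
  fixes R (structure)
  shows "cring R \<Longrightarrow> x \<in> X \<Longrightarrow> delta_fun R x \<in> carrier (free_mod R X)"
proof -
  assume "cring R" and x: "x \<in> X"
  then interpret cring R by simp
  have "finite {y. delta_fun R x y \<noteq> \<zero>}" by (rule finite_subset[of _ "{x}"]) (auto simp: delta_fun_def)
  then show ?thesis using x by (auto simp: free_mod_simps delta_fun_def)
qed

text \<open>Induction on a finite set containing the support, removing one coordinate at a
  time.\<close>

lemma free_mod_span:
  fixes R (structure)
  assumes "cring R" and v: "v \<in> carrier (free_mod R X)"
  shows "v \<in> mspan R (free_mod R X) (delta_fun R ` X)"
proof -
  interpret cring R by fact
  interpret L: rmod R "free_mod R X" by (rule free_mod_module) fact
  have D: "delta_fun R ` X \<subseteq> carrier (free_mod R X)" using delta_fun_closed assms by auto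
  note sub = L.submodule_closed[OF L.mspan_submodule[OF D]]
  have "finite S \<Longrightarrow> v \<in> carrier (free_mod R X) \<Longrightarrow> {x. v x \<noteq> \<zero>} \<subseteq> S \<Longrightarrow>
     v \<in> mspan R (free_mod R X) (delta_fun R ` X)" for S
  proof (induction S arbitrary: v rule: finite_induct)
    case empty
    then have "v = \<zero>\<^bsub>free_mod R X\<^esub>" by (auto simp: free_mod_simps)
    then show ?case using sub by simp
  next
    case (insert s S)
    show ?case
    proof (cases "s \<in> X")
      case False
      then have "v s = \<zero>" using insert by (auto simp: free_mod_simps)
      then show ?thesis using insert by (intro insert.IH) auto
    next
      case True
      \<comment> \<open>The remainder after removing the coordinate at \<open>s\<close>; its support
        lies in \<open>S\<close>.\<close>
      define w where "w = v(s := \<zero>)"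
      have fw: "finite {x. w x \<noteq> \<zero>}"
        by (rule finite_subset[of _ "{x. v x \<noteq> \<zero>}"]) (use insert in \<open>auto simp: free_mod_simps w_def\<close>)
      have w: "w \<in> mspan R (free_mod R X) (delta_fun R ` X)"
        by (rule insert.IH) (use insert fw in \<open>auto simp: free_mod_simps w_def\<close>)
      have vs: "v s \<in> carrier R" using insert by (auto simp: free_mod_simps)
      have "v = (v s \<odot>\<^bsub>free_mod R X\<^esub> delta_fun R s) \<oplus>\<^bsub>free_mod R X\<^esub> w"
        using insert by (auto simp: free_mod_simps w_def delta_fun_def)
      moreover have "v s \<odot>\<^bsub>free_mod R X\<^esub> delta_fun R s \<in> mspan R (free_mod R X) (delta_fun R ` X)"
        using True vs by (intro sub L.mspan_incl) auto
      ultimately show ?thesis using sub(3)[OF _ w] by metis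
    qed
  qed
  moreover have "finite {x. v x \<noteq> \<zero>}" using v by (auto simp: free_mod_simps)
  ultimately show ?thesis using v by blast
qed

text \<open>What \<open>sext\<close> computes on a chosen representative, considered as a map on the
  free module.\<close>

definition fext :: "'r ring \<Rightarrow> ('r \<Rightarrow> 'r) \<Rightarrow> ('r, 'n) module \<Rightarrow> ('x \<Rightarrow> 'n) \<Rightarrow> ('x \<Rightarrow> 'r) \<Rightarrow> 'n" where
  "fext R \<phi> N g v = finsum N (\<lambda>x. \<phi> (v x) \<odot>\<^bsub>N\<^esub> g x) {x. v x \<noteq> \<zero>\<^bsub>R\<^esub>}"

lemma fext:
  assumes N: "rmod R N" and \<phi>: "\<phi> \<in> ring_hom R R" and g: "g \<in> X \<rightarrow> carrier N"
  shows "slin R \<phi> (free_mod R X) N (fext R \<phi> N g)"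
    and "x \<in> X \<Longrightarrow> fext R \<phi> N g (delta_fun R x) = g x"
proof -
  interpret N: rmod R N by fact
  have cr: "cring R" by (rule module_cring[OF N])
  interpret L: rmod R "free_mod R X" by (rule free_mod_module[OF cr])
  interpret h: ring_hom_ring R R \<phi>
    by (rule ring_hom_ringI2) (use \<phi> N.R.ring_axioms in auto)
  have t: "\<phi> (v x) \<odot>\<^bsub>N\<^esub> g x \<in> carrier N" if "v \<in> carrier (free_mod R X)" "x \<in> X" for v x
    using that g by (auto simp: free_mod_simps)
  \<comment> \<open>Any finite set of generators containing the support gives the same sum, so the
    different supports of two vectors and of their sum can be replaced by a common index
    set.\<close>
  have sup: "fext R \<phi> N g v = finsum N (\<lambda>x. \<phi> (v x) \<odot>\<^bsub>N\<^esub> g x) S"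
    if "v \<in> carrier (free_mod R X)" "finite S" "{x. v x \<noteq> \<zero>\<^bsub>R\<^esub>} \<subseteq> S" "S \<subseteq> X" for v S
    unfolding fext_def
    by (rule N.finsum_superset[symmetric]) (use that t g in \<open>auto simp: free_mod_simps Pi_iff subset_iff\<close>)
  show "slin R \<phi> (free_mod R X) N (fext R \<phi> N g)"
  proof (rule slinI)
    fix v assume v: "v \<in> carrier (free_mod R X)"
    then show "fext R \<phi> N g v \<in> carrier N"
      unfolding fext_def using t by (intro N.M.finsum_closed) (auto simp: free_mod_simps)
    fix r assume r: "r \<in> carrier R"
    let ?S = "{x. v x \<noteq> \<zero>\<^bsub>R\<^esub>}"
    have S: "finite ?S" "?S \<subseteq> X" using v by (auto simp: free_mod_simps)
    have "fext R \<phi> N g (r \<odot>\<^bsub>free_mod R X\<^esub> v) =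
        finsum N (\<lambda>x. \<phi> ((r \<odot>\<^bsub>free_mod R X\<^esub> v) x) \<odot>\<^bsub>N\<^esub> g x) ?S"
      by (rule sup) (use S v r L.smult_closed[OF r v] in \<open>auto simp: free_mod_simps\<close>)
    also have "\<dots> = finsum N (\<lambda>x. \<phi> r \<odot>\<^bsub>N\<^esub> (\<phi> (v x) \<odot>\<^bsub>N\<^esub> g x)) ?S"
      by (rule N.M.finsum_cong)
         (use v r g S in \<open>auto simp: free_mod_simps simp_implies_def N.smult_assoc1 Pi_iff subset_iff\<close>)
    also have "\<dots> = \<phi> r \<odot>\<^bsub>N\<^esub> fext R \<phi> N g v" unfolding fext_def
      by (rule N.finsum_smult_ldistr[symmetric]) (use S v r t in \<open>auto simp: Pi_iff\<close>)
    finally show "fext R \<phi> N g (r \<odot>\<^bsub>free_mod R X\<^esub> v) = \<phi> r \<odot>\<^bsub>N\<^esub> fext R \<phi> N g v" .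
  next
    fix v w assume v: "v \<in> carrier (free_mod R X)" and w: "w \<in> carrier (free_mod R X)"
    let ?S = "{x. v x \<noteq> \<zero>\<^bsub>R\<^esub>} \<union> {x. w x \<noteq> \<zero>\<^bsub>R\<^esub>}"
    have S: "finite ?S" "?S \<subseteq> X" using v w by (auto simp: free_mod_simps)
    have "fext R \<phi> N g (v \<oplus>\<^bsub>free_mod R X\<^esub> w) =
        finsum N (\<lambda>x. \<phi> ((v \<oplus>\<^bsub>free_mod R X\<^esub> w) x) \<odot>\<^bsub>N\<^esub> g x) ?S"
      by (rule sup) (use S v w L.M.a_closed[OF v w] in \<open>auto simp: free_mod_simps\<close>)
    also have "\<dots> = finsum N (\<lambda>x. \<phi> (v x) \<odot>\<^bsub>N\<^esub> g x \<oplus>\<^bsub>N\<^esub> \<phi> (w x) \<odot>\<^bsub>N\<^esub> g x) ?S"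
      by (rule N.M.finsum_cong)
         (use v w g S in \<open>auto simp: free_mod_simps simp_implies_def N.smult_l_distr Pi_iff subset_iff\<close>)
    also have "\<dots> = finsum N (\<lambda>x. \<phi> (v x) \<odot>\<^bsub>N\<^esub> g x) ?S \<oplus>\<^bsub>N\<^esub> finsum N (\<lambda>x. \<phi> (w x) \<odot>\<^bsub>N\<^esub> g x) ?S"
      by (rule N.M.finsum_addf) (use t v w S in \<open>auto simp: Pi_iff subset_iff\<close>)
    also have "\<dots> = fext R \<phi> N g v \<oplus>\<^bsub>N\<^esub> fext R \<phi> N g w"
      using sup[OF v S(1) _ S(2)] sup[OF w S(1) _ S(2)] by simp
    finally show "fext R \<phi> N g (v \<oplus>\<^bsub>free_mod R X\<^esub> w) = fext R \<phi> N g v \<oplus>\<^bsub>N\<^esub> fext R \<phi> N g w" .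
  qed
  assume x: "x \<in> X"
  have "fext R \<phi> N g (delta_fun R x) = finsum N (\<lambda>y. \<phi> (delta_fun R x y) \<odot>\<^bsub>N\<^esub> g y) {x}"
    by (rule sup) (use x delta_fun_closed[OF cr x] in \<open>auto simp: delta_fun_def\<close>)
  then show "fext R \<phi> N g (delta_fun R x) = g x"
    using x g by (simp add: delta_fun_def Pi_iff)
qed

lemma pres_module:
  assumes "cring R" "Rel \<subseteq> carrier (free_mod R X)"
  shows "rmod R (pres R X Rel)"
  unfolding pres_def
  by (intro rmod.quot_module rmod.mspan_submodule free_mod_module assms)

lemma psym_closed:
  assumes "cring R" "Rel \<subseteq> carrier (free_mod R X)" "x \<in> X"
  shows "psym R X Rel x \<in> carrier (pres R X Rel)"
proof -
  interpret L: rmod R "free_mod R X" by (rule free_mod_module) fact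
  show ?thesis unfolding pres_def psym_def
    unfolding L.quot_ops(1)[OF L.mspan_submodule[OF assms(2)]]
    using delta_fun_closed[OF assms(1,3)] by blast
qed

lemma pres_proj:
  assumes "cring R" "Rel \<subseteq> carrier (free_mod R X)"
  shows "lin R (free_mod R X) (pres R X Rel) (\<lambda>v. mspan R (free_mod R X) Rel +>\<^bsub>free_mod R X\<^esub> v)"
    and "v \<in> mspan R (free_mod R X) Rel \<Longrightarrow>
      mspan R (free_mod R X) Rel +>\<^bsub>free_mod R X\<^esub> v = \<zero>\<^bsub>pres R X Rel\<^esub>"
    and "C \<in> carrier (pres R X Rel) \<Longrightarrow> v \<in> C \<Longrightarrow> v \<in> carrier (free_mod R X) \<and>
      C = mspan R (free_mod R X) Rel +>\<^bsub>free_mod R X\<^esub> v"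
    and "C \<in> carrier (pres R X Rel) \<Longrightarrow> \<exists>v. v \<in> C"
proof -
  interpret L: rmod R "free_mod R X" by (rule free_mod_module) fact
  have s: "submodule (mspan R (free_mod R X) Rel) R (free_mod R X)"
    by (rule L.mspan_submodule[OF assms(2)])
  note q = L.quot_ops[OF s]
  show "lin R (free_mod R X) (pres R X Rel) (\<lambda>v. mspan R (free_mod R X) Rel +>\<^bsub>free_mod R X\<^esub> v)"
    unfolding pres_def by (rule slinI) (auto simp: q)
  show "v \<in> mspan R (free_mod R X) Rel \<Longrightarrow>
      mspan R (free_mod R X) Rel +>\<^bsub>free_mod R X\<^esub> v = \<zero>\<^bsub>pres R X Rel\<^esub>"
    unfolding pres_def q(2) using L.quot_eq_iff[OF s, of v "\<zero>\<^bsub>free_mod R X\<^esub>"] L.submodule_closed[OF s]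
    by (simp add: a_minus_def)
  show "C \<in> carrier (pres R X Rel) \<Longrightarrow> v \<in> C \<Longrightarrow> v \<in> carrier (free_mod R X) \<and>
      C = mspan R (free_mod R X) Rel +>\<^bsub>free_mod R X\<^esub> v"
    unfolding pres_def q(1) using L.quot_repr[OF s] by blast
  show "C \<in> carrier (pres R X Rel) \<Longrightarrow> \<exists>v. v \<in> C"
    unfolding pres_def q(1) using L.quot_self[OF s] by blast
qed

text \<open>Every class lifts to the free module, and there the functions
  \<open>delta_fun R x\<close> span.\<close>

lemma pres_induct [consumes 3, case_names zero sym add smult]:
  assumes "cring R" "Rel \<subseteq> carrier (free_mod R X)" and C: "C \<in> carrier (pres R X Rel)"
    and P: "P \<zero>\<^bsub>pres R X Rel\<^esub>" "\<And>x. x \<in> X \<Longrightarrow> P (psym R X Rel x)"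
     "\<And>x y. x \<in> carrier (pres R X Rel) \<Longrightarrow> y \<in> carrier (pres R X Rel) \<Longrightarrow> P x \<Longrightarrow> P y \<Longrightarrow> P (x \<oplus>\<^bsub>pres R X Rel\<^esub> y)"
     "\<And>r x. r \<in> carrier R \<Longrightarrow> x \<in> carrier (pres R X Rel) \<Longrightarrow> P x \<Longrightarrow> P (r \<odot>\<^bsub>pres R X Rel\<^esub> x)"
  shows "P C"
proof -
  interpret L: rmod R "free_mod R X" by (rule free_mod_module) fact
  interpret P: rmod R "pres R X Rel" by (rule pres_module) fact+
  define \<pi> where "\<pi> v = mspan R (free_mod R X) Rel +>\<^bsub>free_mod R X\<^esub> v" for v
  have \<pi>: "lin R (free_mod R X) (pres R X Rel) \<pi>"
    using pres_proj(1)[OF assms(1,2)] by (simp add: \<pi>_def[abs_def])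
  obtain v where v: "v \<in> carrier (free_mod R X)" "C = \<pi> v"
    using pres_proj(3,4)[OF assms(1,2) C] by (auto simp: \<pi>_def)
  have D: "delta_fun R ` X \<subseteq> carrier (free_mod R X)" using delta_fun_closed assms by auto
  have "v \<in> mspan R (free_mod R X) (delta_fun R ` X)" by (rule free_mod_span[OF assms(1) v(1)])
  then have "P (\<pi> v)" using D
  proof (induction rule: L.mspan_induct)
    case zero then show ?case using P L.slin_zero[OF P.rmod_axioms \<pi>] by simp
  next
    case (base x) then show ?case using P(2) by (auto simp: \<pi>_def psym_def)
  next
    case (add x y)
    then have "x \<in> carrier (free_mod R X)" "y \<in> carrier (free_mod R X)" using L.mspan_carrier[OF D] by auto
    then show ?case using add P(3)[of "\<pi> x" "\<pi> y"] slin_closed[OF \<pi>] by (simp add: slin_add[OF \<pi>])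
  next
    case (smult r x)
    then have "x \<in> carrier (free_mod R X)" using L.mspan_carrier[OF D] by auto
    then show ?case using smult P(4)[of r "\<pi> x"] slin_closed[OF \<pi>] by (simp add: slin_smult[OF \<pi>])
  qed
  then show ?thesis using v by simp
qed

text \<open>The extension to the free module kills the relations, hence the submodule they span; so
  the representative picked by \<open>SOME\<close> does not affect the value.\<close>

lemma sext:
  assumes Rel: "Rel \<subseteq> carrier (free_mod R X)"
    and N: "rmod R N" and \<phi>: "\<phi> \<in> ring_hom R R" and g: "g \<in> X \<rightarrow> carrier N"
    and rel: "\<And>v. v \<in> Rel \<Longrightarrow> fext R \<phi> N g v = \<zero>\<^bsub>N\<^esub>"
  shows "slin R \<phi> (pres R X Rel) N (sext R \<phi> N g)"
    and "x \<in> X \<Longrightarrow> sext R \<phi> N g (psym R X Rel x) = g x"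
proof -
  interpret N: rmod R N by fact
  have cr: "cring R" by (rule module_cring[OF N])
  interpret L: rmod R "free_mod R X" by (rule free_mod_module[OF cr])
  define S where "S = mspan R (free_mod R X) Rel"
  have s: "submodule S R (free_mod R X)" unfolding S_def
    by (rule L.mspan_submodule[OF Rel])
  note q = L.quot_ops[OF s]
  note fl = fext(1)[OF N \<phi> g]
  have "submodule {v \<in> carrier (free_mod R X). fext R \<phi> N g v = \<zero>\<^bsub>N\<^esub>} R (free_mod R X)"
    using slin_add[OF fl] slin_smult[OF fl] L.slin_zero[OF N fl] \<phi>
    by (intro L.submoduleI') (auto simp: ring_hom_def Pi_iff)
  then have S0: "S \<subseteq> {v \<in> carrier (free_mod R X). fext R \<phi> N g v = \<zero>\<^bsub>N\<^esub>}"
    unfolding S_def by (rule L.mspan_least) (use rel Rel in auto)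
  have sx: "sext R \<phi> N g (S +>\<^bsub>free_mod R X\<^esub> v) = fext R \<phi> N g v" if v: "v \<in> carrier (free_mod R X)" for v
  proof -
    define w where "w = (SOME w. w \<in> S +>\<^bsub>free_mod R X\<^esub> v)"
    have w: "w \<in> S +>\<^bsub>free_mod R X\<^esub> v" unfolding w_def
      by (rule someI[of _ v]) (rule L.quot_self[OF s v])
    have wc: "w \<in> carrier (free_mod R X)" "S +>\<^bsub>free_mod R X\<^esub> w = S +>\<^bsub>free_mod R X\<^esub> v"
      using L.quot_repr[OF s v w] by auto
    have "w \<ominus>\<^bsub>free_mod R X\<^esub> v \<in> S" using L.quot_eq_iff[OF s wc(1) v] wc by simp
    then have "fext R \<phi> N g (w \<ominus>\<^bsub>free_mod R X\<^esub> v) = \<zero>\<^bsub>N\<^esub>" using S0 by auto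
    then have "fext R \<phi> N g w \<ominus>\<^bsub>N\<^esub> fext R \<phi> N g v = \<zero>\<^bsub>N\<^esub>"
      using L.slin_diff[OF N fl wc(1) v] by simp
    then have "fext R \<phi> N g w = fext R \<phi> N g v" using slin_closed[OF fl] wc v
      by (simp add: N.diff_eq_zero)
    then show ?thesis by (simp add: sext_def fext_def Let_def w_def)
  qed
  show "slin R \<phi> (pres R X Rel) N (sext R \<phi> N g)"
    unfolding pres_def S_def[symmetric]
    by (rule slinI) (auto simp: q sx slin_closed[OF fl] slin_add[OF fl] slin_smult[OF fl])
  show "x \<in> X \<Longrightarrow> sext R \<phi> N g (psym R X Rel x) = g x"
    unfolding psym_def S_def[symmetric]
    by (simp add: sx delta_fun_closed[OF cr] fext(2)[OF N \<phi> g])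
qed

lemma pres_eq:
  assumes Rel: "Rel \<subseteq> carrier (free_mod R X)" "rmod R N"
    "slin R \<phi> (pres R X Rel) N u" "slin R \<phi> (pres R X Rel) N v"
    "\<And>x. x \<in> X \<Longrightarrow> u (psym R X Rel x) = v (psym R X Rel x)" "C \<in> carrier (pres R X Rel)"
  shows "u C = v C"
proof -
  have cr: "cring R" by (rule module_cring) fact
  interpret P: rmod R "pres R X Rel" by (rule pres_module) fact+
  show ?thesis using cr assms(1,6)
  proof (induction rule: pres_induct)
    case zero then show ?case using P.slin_zero[OF assms(2,3)] P.slin_zero[OF assms(2,4)] by simp
  next
    case (add x y) then show ?case by (simp add: slin_add[OF assms(3)] slin_add[OF assms(4)])
  next
    case (smult r x) then show ?case by (simp add: slin_smult[OF assms(3)] slin_smult[OF assms(4)])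
  qed (use assms in auto)
qed

section \<open>Base change\<close>

lemma bc_rel_closed:
  assumes "rmod R M" "\<phi> \<in> ring_hom R R"
  shows "bc_rel R \<phi> R M \<subseteq> carrier (free_mod R (carrier M))"
proof -
  interpret M: rmod R M by fact
  have cr: "cring R" by (rule module_cring) fact
  interpret L: rmod R "free_mod R (carrier M)" by (rule free_mod_module[OF cr])
  note d = delta_fun_closed[OF cr, of _ "carrier M"]
  have \<phi>c: "\<phi> r \<in> carrier R" if "r \<in> carrier R" for r using that assms(2) by (auto simp: ring_hom_def)
  show ?thesis
  proof
    fix v assume "v \<in> bc_rel R \<phi> R M"
    then show "v \<in> carrier (free_mod R (carrier M))" unfolding bc_rel_def Let_def
    proof (elim UnE CollectE exE conjE, goal_cases)
      case (1 x y) then show ?case using d by simp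
    next
      case (2 r x) then show ?case using d \<phi>c by simp
    qed
  qed
qed

text \<open>The two families in \<open>bc_rel\<close> are exactly additivity and semilinearity of
  the map from \<open>x\<close> to \<open>1 \<otimes> x\<close>.\<close>

lemma base_change_sym:
  assumes M: "rmod R M" and \<phi>: "\<phi> \<in> ring_hom R R"
  shows "rmod R (base_change R \<phi> R M)"
    and "slin R \<phi> M (base_change R \<phi> R M) (psym R (carrier M) (bc_rel R \<phi> R M))"
proof -
  interpret M: rmod R M by fact
  have cr: "cring R" by (rule module_cring) fact
  interpret L: rmod R "free_mod R (carrier M)" by (rule free_mod_module[OF cr])
  note rel = bc_rel_closed[OF M \<phi>]
  show m: "rmod R (base_change R \<phi> R M)"
    unfolding base_change_def by (rule pres_module[OF cr rel])
  interpret B: rmod R "base_change R \<phi> R M" by fact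
  define \<pi> where "\<pi> v = mspan R (free_mod R (carrier M)) (bc_rel R \<phi> R M) +>\<^bsub>free_mod R (carrier M)\<^esub> v" for v
  have \<pi>: "lin R (free_mod R (carrier M)) (base_change R \<phi> R M) \<pi>"
    using pres_proj(1)[OF cr rel] by (simp add: \<pi>_def[abs_def] base_change_def)
  have \<pi>0: "\<pi> v = \<zero>\<^bsub>base_change R \<phi> R M\<^esub>" if "v \<in> bc_rel R \<phi> R M" for v
    using pres_proj(2)[OF cr rel] L.mspan_incl[OF that] by (simp add: \<pi>_def base_change_def)
  have sym: "psym R (carrier M) (bc_rel R \<phi> R M) x = \<pi> (delta_fun R x)" for x
    by (simp add: psym_def \<pi>_def)
  have eq: "\<pi> v = \<pi> w" if "v \<ominus>\<^bsub>free_mod R (carrier M)\<^esub> w \<in> bc_rel R \<phi> R M"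
    "v \<in> carrier (free_mod R (carrier M))" "w \<in> carrier (free_mod R (carrier M))" for v w
    using \<pi>0[OF that(1)] L.slin_diff[OF m \<pi> that(2,3)] slin_closed[OF \<pi>] that
    by (simp add: B.diff_eq_zero)
  note d = delta_fun_closed[OF cr, of _ "carrier M"]
  show "slin R \<phi> M (base_change R \<phi> R M) (psym R (carrier M) (bc_rel R \<phi> R M))"
    unfolding sym
  proof (rule slinI)
    fix x assume x: "x \<in> carrier M"
    show "\<pi> (delta_fun R x) \<in> carrier (base_change R \<phi> R M)" by (rule slin_closed[OF \<pi> d[OF x]])
    fix y assume y: "y \<in> carrier M"
    have "\<pi> (delta_fun R (x \<oplus>\<^bsub>M\<^esub> y)) =
        \<pi> (delta_fun R x \<oplus>\<^bsub>free_mod R (carrier M)\<^esub> delta_fun R y)"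
      by (rule eq) (use x y d in \<open>auto simp: bc_rel_def Let_def\<close>)
    then show "\<pi> (delta_fun R (x \<oplus>\<^bsub>M\<^esub> y)) = \<pi> (delta_fun R x) \<oplus>\<^bsub>base_change R \<phi> R M\<^esub> \<pi> (delta_fun R y)"
      using slin_add[OF \<pi>] d x y by simp
  next
    fix r x assume x: "x \<in> carrier M" and r: "r \<in> carrier R"
    have \<phi>r: "\<phi> r \<in> carrier R" using r \<phi> by (auto simp: ring_hom_def)
    have "\<pi> (delta_fun R (r \<odot>\<^bsub>M\<^esub> x)) = \<pi> (\<phi> r \<odot>\<^bsub>free_mod R (carrier M)\<^esub> delta_fun R x)"
      by (rule eq) (use x r d \<phi>r in \<open>auto simp: bc_rel_def Let_def\<close>)
    then show "\<pi> (delta_fun R (r \<odot>\<^bsub>M\<^esub> x)) = \<phi> r \<odot>\<^bsub>base_change R \<phi> R M\<^esub> \<pi> (delta_fun R x)"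
      using slin_smult[OF \<pi> \<phi>r] d x by simp
  qed
qed

text \<open>Universal property of base change: \<open>\<psi>\<close>-semilinear maps out of it come
  from maps on \<open>M\<close> that are semilinear for \<open>\<phi>\<close> followed by
  \<open>\<psi>\<close>.\<close>

lemma base_change_sext:
  assumes M: "rmod R M" and \<phi>: "\<phi> \<in> ring_hom R R" and N: "rmod R N" and \<psi>: "\<psi> \<in> ring_hom R R"
    and g: "slin R (\<lambda>r. \<psi> (\<phi> r)) M N g"
  shows "slin R \<psi> (base_change R \<phi> R M) N (sext R \<psi> N g)"
    and "x \<in> carrier M \<Longrightarrow> sext R \<psi> N g (psym R (carrier M) (bc_rel R \<phi> R M) x) = g x"
proof -
  interpret M: rmod R M by fact
  interpret N: rmod R N by fact
  have cr: "cring R" by (rule module_cring) fact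
  interpret L: rmod R "free_mod R (carrier M)" by (rule free_mod_module[OF cr])
  note rel = bc_rel_closed[OF M \<phi>]
  have gc: "g \<in> carrier M \<rightarrow> carrier N" using slin_closed[OF g] by auto
  note fl = fext[OF N \<psi> gc]
  note d = delta_fun_closed[OF cr, of _ "carrier M"]
  have \<phi>c: "\<phi> r \<in> carrier R" if "r \<in> carrier R" for r using that \<phi> by (auto simp: ring_hom_def)
  have \<psi>c: "\<psi> r \<in> carrier R" if "r \<in> carrier R" for r using that \<psi> by (auto simp: ring_hom_def)
  have z: "fext R \<psi> N g v = \<zero>\<^bsub>N\<^esub>" if "v \<in> bc_rel R \<phi> R M" for v
    using that unfolding bc_rel_def Let_def
  proof (elim UnE CollectE exE conjE, goal_cases)
    case (1 x y)
    then show ?case using gc d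
      by (simp add: L.slin_diff[OF N fl(1)] slin_add[OF fl(1)] fl(2) slin_add[OF g]
          Pi_iff N.diff_eq_zero)
  next
    case (2 r x)
    then show ?case using gc d \<phi>c \<psi>c
      by (simp add: L.slin_diff[OF N fl(1)] slin_smult[OF fl(1)] fl(2) slin_smult[OF g]
          Pi_iff N.diff_eq_zero)
  qed
  show "slin R \<psi> (base_change R \<phi> R M) N (sext R \<psi> N g)"
    unfolding base_change_def by (rule sext(1)[OF rel N \<psi> gc z])
  show "x \<in> carrier M \<Longrightarrow> sext R \<psi> N g (psym R (carrier M) (bc_rel R \<phi> R M) x) = g x"
    by (rule sext(2)[OF rel N \<psi> gc z])
qed

lemma base_change_span:
  assumes M: "rmod R M" and \<phi>: "\<phi> \<in> ring_hom R R"
  shows "mspan R (base_change R \<phi> R M) (psym R (carrier M) (bc_rel R \<phi> R M) ` carrier M) =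
     carrier (base_change R \<phi> R M)" (is "mspan R ?B ?X = _")
proof -
  have cr: "cring R" by (rule module_cring) fact
  note rel = bc_rel_closed[OF M \<phi>]
  interpret B: rmod R ?B by (rule base_change_sym(1)[OF M \<phi>])
  have X: "?X \<subseteq> carrier ?B" using psym_closed[OF cr rel] by (auto simp: base_change_def)
  note s = B.submodule_closed[OF B.mspan_submodule[OF X]]
  have "C \<in> mspan R ?B ?X" if "C \<in> carrier ?B" for C
    using cr rel that[unfolded base_change_def]
    by (induction rule: pres_induct) (auto intro: s B.mspan_incl simp: base_change_def[symmetric])
  then show ?thesis using B.mspan_carrier[OF X] by auto
qed

lemma (in rmod) diff_zero: "x \<in> carrier M \<Longrightarrow> x \<ominus>\<^bsub>M\<^esub> \<zero>\<^bsub>M\<^esub> = x"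
  by (simp add: a_minus_def)

section \<open>Alternating forms and tensor products of exterior powers\<close>

section \<open>Alternating forms\<close>

text \<open>Zero is demanded only at equal neighbours; \<open>aform_not_distinct\<close> extends
  this to any repetition. The domain \<open>A\<close> is kept apart from \<open>M\<close> because
  the blocks of a symbol take their entries from various submodules of one fixed module.\<close>

definition aform :: "'r ring \<Rightarrow> ('r \<Rightarrow> 'r) \<Rightarrow> ('r, 'm) module \<Rightarrow> 'm set \<Rightarrow> ('r, 'n) module \<Rightarrow> nat \<Rightarrow>
    ('m list \<Rightarrow> 'n) \<Rightarrow> bool" where
  "aform R \<phi> M A N n g \<longleftrightarrow>
     (\<forall>xs. length xs = n \<and> set xs \<subseteq> A \<longrightarrow> g xs \<in> carrier N) \<and>
     (\<forall>us vs x y. length us + Suc (length vs) = n \<and> set us \<subseteq> A \<and> set vs \<subseteq> A \<and> x \<in> A \<and> y \<in> A \<longrightarrow>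
        g (us @ (x \<oplus>\<^bsub>M\<^esub> y) # vs) = g (us @ x # vs) \<oplus>\<^bsub>N\<^esub> g (us @ y # vs)) \<and>
     (\<forall>us vs r x. length us + Suc (length vs) = n \<and> set us \<subseteq> A \<and> set vs \<subseteq> A \<and> r \<in> carrier R \<and> x \<in> A \<longrightarrow>
        g (us @ (r \<odot>\<^bsub>M\<^esub> x) # vs) = \<phi> r \<odot>\<^bsub>N\<^esub> g (us @ x # vs)) \<and>
     (\<forall>us vs x. length us + Suc (Suc (length vs)) = n \<and> set us \<subseteq> A \<and> set vs \<subseteq> A \<and> x \<in> A \<longrightarrow>
        g (us @ x # x # vs) = \<zero>\<^bsub>N\<^esub>)"

lemma aformI:
  assumes "\<And>xs. length xs = n \<Longrightarrow> set xs \<subseteq> A \<Longrightarrow> g xs \<in> carrier N"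
    "\<And>us vs x y. length us + Suc (length vs) = n \<Longrightarrow> set us \<subseteq> A \<Longrightarrow> set vs \<subseteq> A \<Longrightarrow> x \<in> A \<Longrightarrow> y \<in> A \<Longrightarrow>
        g (us @ (x \<oplus>\<^bsub>M\<^esub> y) # vs) = g (us @ x # vs) \<oplus>\<^bsub>N\<^esub> g (us @ y # vs)"
    "\<And>us vs r x. length us + Suc (length vs) = n \<Longrightarrow> set us \<subseteq> A \<Longrightarrow> set vs \<subseteq> A \<Longrightarrow> r \<in> carrier R \<Longrightarrow> x \<in> A \<Longrightarrow>
        g (us @ (r \<odot>\<^bsub>M\<^esub> x) # vs) = \<phi> r \<odot>\<^bsub>N\<^esub> g (us @ x # vs)"
    "\<And>us vs x. length us + Suc (Suc (length vs)) = n \<Longrightarrow> set us \<subseteq> A \<Longrightarrow> set vs \<subseteq> A \<Longrightarrow> x \<in> A \<Longrightarrow>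
        g (us @ x # x # vs) = \<zero>\<^bsub>N\<^esub>"
  shows "aform R \<phi> M A N n g"
  using assms unfolding aform_def by blast

lemma aformD:
  assumes "aform R \<phi> M A N n g"
  shows "length xs = n \<Longrightarrow> set xs \<subseteq> A \<Longrightarrow> g xs \<in> carrier N"
    "length us + Suc (length vs) = n \<Longrightarrow> set us \<subseteq> A \<Longrightarrow> set vs \<subseteq> A \<Longrightarrow> x \<in> A \<Longrightarrow> y \<in> A \<Longrightarrow>
        g (us @ (x \<oplus>\<^bsub>M\<^esub> y) # vs) = g (us @ x # vs) \<oplus>\<^bsub>N\<^esub> g (us @ y # vs)"
    "length us + Suc (length vs) = n \<Longrightarrow> set us \<subseteq> A \<Longrightarrow> set vs \<subseteq> A \<Longrightarrow> r \<in> carrier R \<Longrightarrow> x \<in> A \<Longrightarrow>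
        g (us @ (r \<odot>\<^bsub>M\<^esub> x) # vs) = \<phi> r \<odot>\<^bsub>N\<^esub> g (us @ x # vs)"
    "length us + Suc (Suc (length vs)) = n \<Longrightarrow> set us \<subseteq> A \<Longrightarrow> set vs \<subseteq> A \<Longrightarrow> x \<in> A \<Longrightarrow>
        g (us @ x # x # vs) = \<zero>\<^bsub>N\<^esub>"
  using assms unfolding aform_def by blast+

lemma aform_cong:
  assumes g: "aform R \<phi> M A N n g" and e: "\<And>xs. length xs = n \<Longrightarrow> set xs \<subseteq> A \<Longrightarrow> g xs = h xs"
    and A: "submodule A R M" and M: "rmod R M"
  shows "aform R \<phi> M A N n h"
proof -
  interpret M: rmod R M by fact
  note c = M.submodule_closed[OF A]
  show ?thesis
    by (rule aformI) (use aformD[OF g] c in \<open>simp_all add: e[symmetric]\<close>)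
qed

lemma aform_Cons:
  assumes "aform R \<phi> M A N (Suc n) g" "v \<in> A"
  shows "aform R \<phi> M A N n (\<lambda>xs. g (v # xs))"
proof (rule aformI)
  fix xs assume "length xs = n" "set xs \<subseteq> A"
  then show "g (v # xs) \<in> carrier N" using aformD(1)[OF assms(1), of "v # xs"] assms(2) by simp
next
  fix us vs x y assume "length us + Suc (length vs) = n" "set us \<subseteq> A" "set vs \<subseteq> A" "x \<in> A" "y \<in> A"
  then show "g (v # us @ (x \<oplus>\<^bsub>M\<^esub> y) # vs) = g (v # us @ x # vs) \<oplus>\<^bsub>N\<^esub> g (v # us @ y # vs)"
    using aformD(2)[OF assms(1), of "v # us" vs x y] assms(2) by simp
next
  fix us vs r x assume "length us + Suc (length vs) = n" "set us \<subseteq> A" "set vs \<subseteq> A" "r \<in> carrier R" "x \<in> A"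
  then show "g (v # us @ (r \<odot>\<^bsub>M\<^esub> x) # vs) = \<phi> r \<odot>\<^bsub>N\<^esub> g (v # us @ x # vs)"
    using aformD(3)[OF assms(1), of "v # us" vs r x] assms(2) by simp
next
  fix us vs x assume "length us + Suc (Suc (length vs)) = n" "set us \<subseteq> A" "set vs \<subseteq> A" "x \<in> A"
  then show "g (v # us @ x # x # vs) = \<zero>\<^bsub>N\<^esub>"
    using aformD(4)[OF assms(1), of "v # us" vs x] assms(2) by simp
qed

lemma aform_append:
  assumes "aform R \<phi> M A N (length us + n) g" "set us \<subseteq> A"
  shows "aform R \<phi> M A N n (\<lambda>xs. g (us @ xs))"
  using assms
proof (induction us arbitrary: g)
  case (Cons u us)
  have "aform R \<phi> M A N (length us + n) (\<lambda>xs. g (u # xs))"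
    using aform_Cons[of R \<phi> M A N "length us + n" g u] Cons.prems by simp
  from Cons.IH[OF this] show ?case using Cons.prems by simp
qed simp

lemma aform_append2:
  assumes g: "aform R \<phi> M A N (n + length vs) g" "set vs \<subseteq> A"
  shows "aform R \<phi> M A N n (\<lambda>xs. g (xs @ vs))"
proof (rule aformI)
  fix us ws x y assume "length us + Suc (length ws) = n" "set us \<subseteq> A" "set ws \<subseteq> A" "x \<in> A" "y \<in> A"
  then show "g ((us @ (x \<oplus>\<^bsub>M\<^esub> y) # ws) @ vs) = g ((us @ x # ws) @ vs) \<oplus>\<^bsub>N\<^esub> g ((us @ y # ws) @ vs)"
    using aformD(2)[OF g(1), of us "ws @ vs" x y] assms(2) by simp
next
  fix us ws r x assume "length us + Suc (length ws) = n" "set us \<subseteq> A" "set ws \<subseteq> A" "r \<in> carrier R" "x \<in> A"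
  then show "g ((us @ (r \<odot>\<^bsub>M\<^esub> x) # ws) @ vs) = \<phi> r \<odot>\<^bsub>N\<^esub> g ((us @ x # ws) @ vs)"
    using aformD(3)[OF g(1), of us "ws @ vs" r x] assms(2) by simp
next
  fix us ws x assume "length us + Suc (Suc (length ws)) = n" "set us \<subseteq> A" "set ws \<subseteq> A" "x \<in> A"
  then show "g ((us @ x # x # ws) @ vs) = \<zero>\<^bsub>N\<^esub>"
    using aformD(4)[OF g(1), of us "ws @ vs" x] assms(2) by simp
qed (use aformD(1)[OF g(1)] assms(2) in auto)

lemma aform_comp:
  assumes g: "aform R \<phi> M A N n g" and u: "slin R \<psi> N P u" and N: "rmod R N" and P: "rmod R P"
    and \<phi>: "\<phi> \<in> carrier R \<rightarrow> carrier R"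
  shows "aform R (\<lambda>r. \<psi> (\<phi> r)) M A P n (\<lambda>xs. u (g xs))"
proof -
  interpret N: rmod R N by fact
  have z: "u \<zero>\<^bsub>N\<^esub> = \<zero>\<^bsub>P\<^esub>" by (rule N.slin_zero[OF P u])
  show ?thesis
  proof (rule aformI)
    fix us vs x y assume "length us + Suc (length vs) = n" "set us \<subseteq> A" "set vs \<subseteq> A" "x \<in> A" "y \<in> A"
    then show "u (g (us @ (x \<oplus>\<^bsub>M\<^esub> y) # vs)) = u (g (us @ x # vs)) \<oplus>\<^bsub>P\<^esub> u (g (us @ y # vs))"
      using aformD(1)[OF g, of "us @ x # vs"] aformD(1)[OF g, of "us @ y # vs"]
      by (simp add: aformD(2)[OF g] slin_add[OF u])
  next
    fix us vs r x assume "length us + Suc (length vs) = n" "set us \<subseteq> A" "set vs \<subseteq> A" "r \<in> carrier R" "x \<in> A"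
    then show "u (g (us @ (r \<odot>\<^bsub>M\<^esub> x) # vs)) = \<psi> (\<phi> r) \<odot>\<^bsub>P\<^esub> u (g (us @ x # vs))"
      using aformD(1)[OF g, of "us @ x # vs"] \<phi>
      by (simp add: aformD(3)[OF g] slin_smult[OF u] Pi_iff)
  qed (use aformD[OF g] slin_closed[OF u] z in auto)
qed

lemma aform_map:
  assumes g: "aform R \<phi> N A' P n g" and u: "slin R \<psi> M N u" and A: "A \<subseteq> carrier M" "u ` A \<subseteq> A'"
    and \<psi>: "\<psi> \<in> carrier R \<rightarrow> carrier R"
  shows "aform R (\<lambda>r. \<phi> (\<psi> r)) M A P n (\<lambda>xs. g (map u xs))"
proof -
  have s: "set (map u xs) \<subseteq> A'" if "set xs \<subseteq> A" for xs using that A by auto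
  show ?thesis
  proof (rule aformI)
    fix us vs x y assume "length us + Suc (length vs) = n" "set us \<subseteq> A" "set vs \<subseteq> A" "x \<in> A" "y \<in> A"
    then show "g (map u (us @ (x \<oplus>\<^bsub>M\<^esub> y) # vs)) = g (map u (us @ x # vs)) \<oplus>\<^bsub>P\<^esub> g (map u (us @ y # vs))"
      using aformD(2)[OF g, of "map u us" "map u vs" "u x" "u y"] s A
      by (simp add: slin_add[OF u] subset_iff)
  next
    fix us vs r x assume "length us + Suc (length vs) = n" "set us \<subseteq> A" "set vs \<subseteq> A" "r \<in> carrier R" "x \<in> A"
    then show "g (map u (us @ (r \<odot>\<^bsub>M\<^esub> x) # vs)) = \<phi> (\<psi> r) \<odot>\<^bsub>P\<^esub> g (map u (us @ x # vs))"
      using aformD(3)[OF g, of "map u us" "map u vs" "\<psi> r" "u x"] s A \<psi>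
      by (simp add: slin_smult[OF u] subset_iff Pi_iff)
  next
    fix us vs x assume "length us + Suc (Suc (length vs)) = n" "set us \<subseteq> A" "set vs \<subseteq> A" "x \<in> A"
    then show "g (map u (us @ x # x # vs)) = \<zero>\<^bsub>P\<^esub>"
      using aformD(4)[OF g, of "map u us" "map u vs" "u x"] s A by (simp add: image_subset_iff)
  qed (use aformD(1)[OF g] s in auto)
qed

lemma aform_subset:
  assumes g: "aform R \<phi> M A N n g" and "A' \<subseteq> A"
  shows "aform R \<phi> M A' N n g"
proof (rule aformI)
qed (use assms(2) aformD[OF g] in \<open>auto simp: subset_iff\<close>)

text \<open>Two forms are compared through their difference, to which the vanishing criteria below
  apply.\<close>

lemma aform_diff:
  assumes g: "aform R \<phi> M A N n g" and h: "aform R \<phi> M A N n h" and N: "rmod R N"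
    and \<phi>: "\<phi> \<in> carrier R \<rightarrow> carrier R" and A: "submodule A R M" and M: "rmod R M"
  shows "aform R \<phi> M A N n (\<lambda>xs. g xs \<ominus>\<^bsub>N\<^esub> h xs)"
proof -
  interpret N: rmod R N by fact
  interpret M: rmod R M by fact
  note gD = aformD[OF g] and hD = aformD[OF h]
  have g1: "g (us @ x # vs) \<in> carrier N" "h (us @ x # vs) \<in> carrier N"
    if "length us + Suc (length vs) = n" "set us \<subseteq> A" "set vs \<subseteq> A" "x \<in> A" for us vs x
    using gD(1)[of "us @ x # vs"] hD(1)[of "us @ x # vs"] that by auto
  show ?thesis
  proof (rule aformI)
    fix us vs x y assume a: "length us + Suc (length vs) = n" "set us \<subseteq> A" "set vs \<subseteq> A" "x \<in> A" "y \<in> A"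
    then show "g (us @ (x \<oplus>\<^bsub>M\<^esub> y) # vs) \<ominus>\<^bsub>N\<^esub> h (us @ (x \<oplus>\<^bsub>M\<^esub> y) # vs) =
        (g (us @ x # vs) \<ominus>\<^bsub>N\<^esub> h (us @ x # vs)) \<oplus>\<^bsub>N\<^esub> (g (us @ y # vs) \<ominus>\<^bsub>N\<^esub> h (us @ y # vs))"
      by (simp add: gD(2) hD(2) g1 a_minus_def N.M.minus_add N.M.a_ac)
  next
    fix us vs r x assume "length us + Suc (length vs) = n" "set us \<subseteq> A" "set vs \<subseteq> A" "r \<in> carrier R" "x \<in> A"
    then show "g (us @ (r \<odot>\<^bsub>M\<^esub> x) # vs) \<ominus>\<^bsub>N\<^esub> h (us @ (r \<odot>\<^bsub>M\<^esub> x) # vs) =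
       \<phi> r \<odot>\<^bsub>N\<^esub> (g (us @ x # vs) \<ominus>\<^bsub>N\<^esub> h (us @ x # vs))"
      using \<phi> by (simp add: gD(3) hD(3) g1 a_minus_def N.smult_r_distr N.smult_r_minus Pi_iff)
  qed (use gD hD in \<open>auto simp: a_minus_def\<close>)
qed

text \<open>Polarisation: expand the value at two neighbours both equal to the sum of
  \<open>x\<close> and \<open>y\<close>. Only vanishing is carried over, so the sign of the
  transposition does not appear.\<close>

lemma aform_swap0:
  assumes g: "aform R \<phi> M A N n g" and N: "rmod R N" and M: "rmod R M" and A: "submodule A R M"
    and l: "length us + Suc (Suc (length vs)) = n" "set us \<subseteq> A" "set vs \<subseteq> A" "x \<in> A" "y \<in> A"
    and z: "g (us @ x # y # vs) = \<zero>\<^bsub>N\<^esub>"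
  shows "g (us @ y # x # vs) = \<zero>\<^bsub>N\<^esub>"
proof -
  interpret N: rmod R N by fact
  interpret M: rmod R M by fact
  let ?s = "x \<oplus>\<^bsub>M\<^esub> y"
  have s: "?s \<in> A" using l M.submodule_closed[OF A] by auto
  have c: "g (us @ a # b # vs) \<in> carrier N" if "a \<in> A" "b \<in> A" for a b
    using aformD(1)[OF g, of "us @ a # b # vs"] l that by simp
  have "\<zero>\<^bsub>N\<^esub> = g (us @ ?s # ?s # vs)" using aformD(4)[OF g, of us vs ?s] l s by simp
  also have "\<dots> = g (us @ x # ?s # vs) \<oplus>\<^bsub>N\<^esub> g (us @ y # ?s # vs)"
    using aformD(2)[OF g, of us "?s # vs" x y] l s by simp
  also have "g (us @ x # ?s # vs) = g (us @ x # x # vs) \<oplus>\<^bsub>N\<^esub> g (us @ x # y # vs)"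
    using aformD(2)[OF g, of "us @ [x]" "vs" x y] l by simp
  also have "g (us @ y # ?s # vs) = g (us @ y # x # vs) \<oplus>\<^bsub>N\<^esub> g (us @ y # y # vs)"
    using aformD(2)[OF g, of "us @ [y]" "vs" x y] l by simp
  finally show ?thesis using z aformD(4)[OF g, of us vs x] aformD(4)[OF g, of us vs y] l c by simp
qed

lemma aform_move0:
  assumes N: "rmod R N" and M: "rmod R M" and A: "submodule A R M"
  shows "aform R \<phi> M A N n g \<Longrightarrow> length us + Suc (length vs) = n \<Longrightarrow> set us \<subseteq> A \<Longrightarrow> set vs \<subseteq> A \<Longrightarrow> x \<in> A \<Longrightarrow>
    g (us @ x # vs) = \<zero>\<^bsub>N\<^esub> \<longleftrightarrow> g (x # us @ vs) = \<zero>\<^bsub>N\<^esub>"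
proof (induction us arbitrary: g n)
  case (Cons u us)
  have f: "aform R \<phi> M A N (n - 1) (\<lambda>xs. g (u # xs))"
    using aform_Cons[of R \<phi> M A N "n - 1" g u] Cons.prems by auto
  have "g ((u # us) @ x # vs) = \<zero>\<^bsub>N\<^esub> \<longleftrightarrow> g (u # x # us @ vs) = \<zero>\<^bsub>N\<^esub>"
    using Cons.IH[OF f] Cons.prems by auto
  also have "\<dots> \<longleftrightarrow> g (x # u # us @ vs) = \<zero>\<^bsub>N\<^esub>"
    using aform_swap0[OF Cons.prems(1) N M A, of "[]" "us @ vs" u x]
      aform_swap0[OF Cons.prems(1) N M A, of "[]" "us @ vs" x u] Cons.prems by auto
  finally show ?case by simp
qed simp

text \<open>The head of the target list is moved to the front; the remaining entries are permuted in
  the form with that entry fixed.\<close>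

lemma aform_perm0:
  assumes N: "rmod R N" and M: "rmod R M" and A: "submodule A R M"
  shows "aform R \<phi> M A N n g \<Longrightarrow> length xs = n \<Longrightarrow> set xs \<subseteq> A \<Longrightarrow> mset xs = mset ys \<Longrightarrow>
    g xs = \<zero>\<^bsub>N\<^esub> \<Longrightarrow> g ys = \<zero>\<^bsub>N\<^esub>"
proof (induction ys arbitrary: g n xs)
  case (Cons y ys)
  then have "y \<in> set xs" by (metis list.set_intros(1) mset_eq_setD)
  then obtain us vs where xs: "xs = us @ y # vs" by (meson split_list)
  have m: "mset (us @ vs) = mset ys" using Cons.prems(4) by (simp add: xs)
  have f: "aform R \<phi> M A N (n - 1) (\<lambda>xs. g (y # xs))"
    using aform_Cons[of R \<phi> M A N "n - 1" g y] Cons.prems xs by auto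
  have "g (y # us @ vs) = \<zero>\<^bsub>N\<^esub>"
    using aform_move0[OF N M A Cons.prems(1), of us vs y] Cons.prems xs by auto
  then show ?case using Cons.IH[OF f, of "us @ vs"] Cons.prems xs m by auto
qed simp

text \<open>Both copies of the repeated entry are brought to the front, where they are
  neighbours.\<close>

lemma aform_not_distinct:
  assumes N: "rmod R N" and M: "rmod R M" and A: "submodule A R M"
    and g: "aform R \<phi> M A N n g" and l: "length xs = n" "set xs \<subseteq> A" and d: "\<not> distinct xs"
  shows "g xs = \<zero>\<^bsub>N\<^esub>"
proof -
  obtain as x bs cs where xs: "xs = as @ [x] @ bs @ [x] @ cs"
    using d not_distinct_decomp by blast
  have z: "g ([] @ x # x # as @ bs @ cs) = \<zero>\<^bsub>N\<^esub>"
    by (rule aformD(4)[OF g]) (use xs l in auto)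
  show ?thesis
    by (rule aform_perm0[OF N M A g _ _ _ z]) (use xs l in auto)
qed

text \<open>By multilinearity each entry may be taken from \<open>X\<close>. The induction fixes the
  head and passes to the form in the remaining entries.\<close>

lemma aform_span0:
  assumes N: "rmod R N" and M: "rmod R M" and X: "X \<subseteq> carrier M"
    and \<phi>: "\<phi> \<in> carrier R \<rightarrow> carrier R"
  shows "aform R \<phi> M (mspan R M X) N n g \<Longrightarrow>
    (\<And>xs. length xs = n \<Longrightarrow> set xs \<subseteq> X \<Longrightarrow> g xs = \<zero>\<^bsub>N\<^esub>) \<Longrightarrow>
    length ys = n \<Longrightarrow> set ys \<subseteq> mspan R M X \<Longrightarrow> g ys = \<zero>\<^bsub>N\<^esub>"
proof (induction ys arbitrary: g n)
  case (Cons y ys)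
  interpret N: rmod R N by fact
  interpret M: rmod R M by fact
  let ?A = "mspan R M X"
  note A = M.mspan_submodule[OF X]
  note c = M.submodule_closed[OF A]
  have n: "n = Suc (length ys)" and ys: "set ys \<subseteq> ?A" and y: "y \<in> ?A" using Cons.prems by auto
  note gD = aformD[OF Cons.prems(1)[unfolded n]]
  have "y \<in> ?A \<Longrightarrow> g (y # ys) = \<zero>\<^bsub>N\<^esub>" using y X
  proof (induction rule: M.mspan_induct)
    case zero
    have "g ([] @ (\<zero>\<^bsub>R\<^esub> \<odot>\<^bsub>M\<^esub> \<zero>\<^bsub>M\<^esub>) # ys) = \<phi> \<zero>\<^bsub>R\<^esub> \<odot>\<^bsub>N\<^esub> g ([] @ \<zero>\<^bsub>M\<^esub> # ys)"
      by (rule gD(3)) (use ys c in auto)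
    \<comment> \<open>Additivity shows that the value at a zero entry equals twice itself.\<close>
    moreover have "g ([] @ (\<zero>\<^bsub>M\<^esub> \<oplus>\<^bsub>M\<^esub> \<zero>\<^bsub>M\<^esub>) # ys) = g ([] @ \<zero>\<^bsub>M\<^esub> # ys) \<oplus>\<^bsub>N\<^esub> g ([] @ \<zero>\<^bsub>M\<^esub> # ys)"
      by (rule gD(2)) (use ys c in auto)
    moreover have "g ([] @ \<zero>\<^bsub>M\<^esub> # ys) \<in> carrier N"
      by (rule gD(1)) (use ys c in auto)
    ultimately show ?case by simp
  next
    case (base x)
    have f: "aform R \<phi> M ?A N (length ys) (\<lambda>xs. g (x # xs))"
      using aform_Cons[of R \<phi> M ?A N "length ys" g x] Cons.prems n base M.mspan_incl[of x X] by auto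
    show ?case by (rule Cons.IH[OF f]) (use Cons.prems(2) n ys base in auto)
  next
    case (add x y)
    then show ?case using gD(2)[of "[]" ys x y] ys by simp
  next
    case (smult r x)
    then show ?case using gD(3)[of "[]" ys r x] ys \<phi> by (simp add: Pi_iff)
  qed
  then show ?case using y by simp
qed auto

text \<open>Expansion along the first functional: \<open>lift \<phi> g\<close> is, up to sign, the wedge product of \<open>\<phi>\<close> and \<open>g\<close>.\<close>

fun lift :: "('r, 'n) module \<Rightarrow> ('m \<Rightarrow> 'r) \<Rightarrow> ('m list \<Rightarrow> 'n) \<Rightarrow> 'm list \<Rightarrow> 'n" where
  "lift N c g [] = \<zero>\<^bsub>N\<^esub>"
| "lift N c g (v # vs) = c v \<odot>\<^bsub>N\<^esub> g vs \<ominus>\<^bsub>N\<^esub> lift N c (\<lambda>ws. g (v # ws)) vs"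

text \<open>The expansion evaluates \<open>g\<close> only at lists that are one shorter than
  \<open>vs\<close> and have entries among those of \<open>vs\<close>. This explains the shape of
  the hypothesis on \<open>g\<close>, here and in the next lemmas.\<close>

lemma lift_zero:
  assumes N: "rmod R N" and "set vs \<subseteq> carrier M" "\<And>v. v \<in> carrier M \<Longrightarrow> c v \<in> carrier R"
    "\<And>ws. set ws \<subseteq> set vs \<Longrightarrow> Suc (length ws) = length vs \<Longrightarrow> g ws = \<zero>\<^bsub>N\<^esub>"
  shows "lift N c g vs = \<zero>\<^bsub>N\<^esub>"
proof -
  interpret N: rmod R N by fact
  show ?thesis using assms(2-)
  proof (induction vs arbitrary: g)
    case (Cons v vs)
    have "lift N c (\<lambda>ws. g (v # ws)) vs = \<zero>\<^bsub>N\<^esub>"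
      by (rule Cons.IH) (use Cons.prems in \<open>auto simp: subset_insertI2\<close>)
    moreover have "g vs = \<zero>\<^bsub>N\<^esub>" by (rule Cons.prems(3)) auto
    ultimately show ?case using Cons.prems by (simp add: a_minus_def)
  qed simp
qed

lemma lift_closed:
  assumes N: "rmod R N" and "set vs \<subseteq> carrier M" "\<And>v. v \<in> carrier M \<Longrightarrow> c v \<in> carrier R"
    "\<And>ws. set ws \<subseteq> set vs \<Longrightarrow> Suc (length ws) = length vs \<Longrightarrow> g ws \<in> carrier N"
  shows "lift N c g vs \<in> carrier N"
proof -
  interpret N: rmod R N by fact
  show ?thesis using assms(2-)
  proof (induction vs arbitrary: g)
    case (Cons v vs)
    have "lift N c (\<lambda>ws. g (v # ws)) vs \<in> carrier N"
      by (rule Cons.IH) (use Cons.prems in \<open>auto simp: subset_insertI2\<close>)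
    moreover have "g vs \<in> carrier N" by (rule Cons.prems(3)) auto
    ultimately show ?case using Cons.prems by (simp add: a_minus_def)
  qed simp
qed

lemma lift_cong:
  "(\<And>ws. set ws \<subseteq> set vs \<Longrightarrow> Suc (length ws) = length vs \<Longrightarrow> g ws = h ws) \<Longrightarrow> lift N c g vs = lift N c h vs"
proof (induction vs arbitrary: g h)
  case (Cons v vs)
  have "lift N c (\<lambda>ws. g (v # ws)) vs = lift N c (\<lambda>ws. h (v # ws)) vs"
    by (rule Cons.IH) (use Cons.prems in \<open>auto simp: subset_insertI2\<close>)
  moreover have "g vs = h vs" by (rule Cons.prems) auto
  ultimately show ?case by simp
qed simp

lemma lift_add:
  assumes N: "rmod R N" and "set vs \<subseteq> carrier M" "\<And>v. v \<in> carrier M \<Longrightarrow> c v \<in> carrier R"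
    "\<And>ws. set ws \<subseteq> set vs \<Longrightarrow> Suc (length ws) = length vs \<Longrightarrow> g ws \<in> carrier N \<and> h ws \<in> carrier N"
  shows "lift N c (\<lambda>ws. g ws \<oplus>\<^bsub>N\<^esub> h ws) vs = lift N c g vs \<oplus>\<^bsub>N\<^esub> lift N c h vs"
proof -
  interpret N: rmod R N by fact
  show ?thesis using assms(2-)
  proof (induction vs arbitrary: g h)
    case (Cons v vs)
    have 1: "lift N c (\<lambda>ws. g (v # ws) \<oplus>\<^bsub>N\<^esub> h (v # ws)) vs =
        lift N c (\<lambda>ws. g (v # ws)) vs \<oplus>\<^bsub>N\<^esub> lift N c (\<lambda>ws. h (v # ws)) vs"
      by (rule Cons.IH) (use Cons.prems in \<open>auto simp: subset_insertI2\<close>)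
    have 2: "lift N c (\<lambda>ws. g (v # ws)) vs \<in> carrier N" "lift N c (\<lambda>ws. h (v # ws)) vs \<in> carrier N"
      by (rule lift_closed[OF N, where M = M]; use Cons.prems in \<open>auto simp: subset_insertI2\<close>)+
    have 3: "g vs \<in> carrier N" "h vs \<in> carrier N" using Cons.prems(3)[of vs] by auto
    show ?case using 1 2 3 Cons.prems
      by (simp add: a_minus_def N.smult_r_distr N.M.minus_add N.M.a_ac)
  qed simp
qed

lemma lift_smult:
  assumes N: "rmod R N" and "set vs \<subseteq> carrier M" "\<And>v. v \<in> carrier M \<Longrightarrow> c v \<in> carrier R"
    "\<And>ws. set ws \<subseteq> set vs \<Longrightarrow> Suc (length ws) = length vs \<Longrightarrow> g ws \<in> carrier N" "r \<in> carrier R"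
  shows "lift N c (\<lambda>ws. r \<odot>\<^bsub>N\<^esub> g ws) vs = r \<odot>\<^bsub>N\<^esub> lift N c g vs"
proof -
  interpret N: rmod R N by fact
  show ?thesis using assms(2-)
  proof (induction vs arbitrary: g)
    case (Cons v vs)
    have 1: "lift N c (\<lambda>ws. r \<odot>\<^bsub>N\<^esub> g (v # ws)) vs = r \<odot>\<^bsub>N\<^esub> lift N c (\<lambda>ws. g (v # ws)) vs"
      by (rule Cons.IH) (use Cons.prems in \<open>auto simp: subset_insertI2\<close>)
    have 2: "lift N c (\<lambda>ws. g (v # ws)) vs \<in> carrier N"
      by (rule lift_closed[OF N, where M = M]; use Cons.prems in \<open>auto simp: subset_insertI2\<close>)+
    have 3: "g vs \<in> carrier N" using Cons.prems(3)[of vs] by auto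
    show ?case using 1 2 3 Cons.prems
      by (simp add: a_minus_def N.smult_r_distr N.smult_r_minus N.smult_assoc1[symmetric] N.R.m_comm)
  qed simp
qed

lemma self_mod_simps:
  "carrier (self_mod R) = carrier R" "\<zero>\<^bsub>self_mod R\<^esub> = \<zero>\<^bsub>R\<^esub>" "x \<oplus>\<^bsub>self_mod R\<^esub> y = x \<oplus>\<^bsub>R\<^esub> y"
  "r \<odot>\<^bsub>self_mod R\<^esub> x = r \<otimes>\<^bsub>R\<^esub> x"
  by (simp_all add: self_mod_def)

lemma self_mod_module: "cring R \<Longrightarrow> rmod R (self_mod R)"
proof -
  assume "cring R"
  then interpret cring R by simp
  show ?thesis unfolding rmod_def
  proof (rule moduleI)
    show "abelian_group (self_mod R)"
      by (rule abelian_groupI) (auto simp: self_mod_simps a_ac intro: l_neg)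
  qed (auto simp: self_mod_simps \<open>cring R\<close> l_distr r_distr m_assoc)
qed

text \<open>Induction on the entries before the place that varies: each unfolding of the expansion
  fixes one of them as first argument of \<open>g\<close> and leaves a form of one degree
  less.\<close>

lemma lift_aform:
  assumes N: "rmod R N" and M: "rmod R M" and c: "lin R M (self_mod R) c"
  shows "aform R (\<lambda>r. r) M (carrier M) N n g \<Longrightarrow> aform R (\<lambda>r. r) M (carrier M) N (Suc n) (lift N c g)"
proof -
  interpret N: rmod R N by fact
  interpret M: rmod R M by fact
  have cc: "v \<in> carrier M \<Longrightarrow> c v \<in> carrier R" for v using slin_closed[OF c] by (simp add: self_mod_simps)
  have cadd: "v \<in> carrier M \<Longrightarrow> w \<in> carrier M \<Longrightarrow> c (v \<oplus>\<^bsub>M\<^esub> w) = c v \<oplus>\<^bsub>R\<^esub> c w" for v w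
    using slin_add[OF c] by (simp add: self_mod_simps)
  have csm: "v \<in> carrier M \<Longrightarrow> r \<in> carrier R \<Longrightarrow> c (r \<odot>\<^bsub>M\<^esub> v) = r \<otimes>\<^bsub>R\<^esub> c v" for v r
    using slin_smult[OF c] by (simp add: self_mod_simps)
  have lc: "lift N c h ws \<in> carrier N" if "set ws \<subseteq> carrier M"
    "\<And>zs. set zs \<subseteq> set ws \<Longrightarrow> Suc (length zs) = length ws \<Longrightarrow> h zs \<in> carrier N" for h ws
    by (rule lift_closed[OF N that(1) _ that(2)]) (rule cc)
  assume g: "aform R (\<lambda>r. r) M (carrier M) N n g"
  show ?thesis
  proof (rule aformI)
    fix xs assume "length xs = Suc n" "set xs \<subseteq> carrier M"
    then show "lift N c g xs \<in> carrier N" using aformD(1)[OF g] by (intro lc) auto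
  next
    fix us vs x y
    assume "length us + Suc (length vs) = Suc n" "set us \<subseteq> carrier M" "set vs \<subseteq> carrier M"
      "x \<in> carrier M" "y \<in> carrier M"
    then show "lift N c g (us @ (x \<oplus>\<^bsub>M\<^esub> y) # vs) = lift N c g (us @ x # vs) \<oplus>\<^bsub>N\<^esub> lift N c g (us @ y # vs)"
      using g
    proof (induction us arbitrary: g n)
      case Nil
      note gD = aformD[OF Nil(6)]
      have "lift N c (\<lambda>ws. g ((x \<oplus>\<^bsub>M\<^esub> y) # ws)) vs = lift N c (\<lambda>ws. g (x # ws) \<oplus>\<^bsub>N\<^esub> g (y # ws)) vs"
        using gD(2)[of "[]"] Nil by (intro lift_cong) auto
      also have "\<dots> = lift N c (\<lambda>ws. g (x # ws)) vs \<oplus>\<^bsub>N\<^esub> lift N c (\<lambda>ws. g (y # ws)) vs"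
        using gD(1) Nil by (intro lift_add[OF N, where M = M]) (auto simp: cc)
      finally show ?case
        using lc[where ws = vs and h = "\<lambda>ws. g (x # ws)"] lc[where ws = vs and h = "\<lambda>ws. g (y # ws)"] gD(1) Nil
        by (simp add: cadd cc N.smult_l_distr a_minus_def N.M.minus_add N.M.a_ac)
    next
      case (Cons u us)
      have n: "n = Suc (n - 1)" using Cons.prems by auto
      note gD = aformD[OF Cons.prems(6)]
      have f: "aform R (\<lambda>r. r) M (carrier M) N (n - 1) (\<lambda>xs. g (u # xs))"
        using aform_Cons[of R _ M "carrier M" N "n - 1" g u] n Cons.prems by auto
      have 1: "lift N c (\<lambda>ws. g (u # ws)) (us @ (x \<oplus>\<^bsub>M\<^esub> y) # vs) =
          lift N c (\<lambda>ws. g (u # ws)) (us @ x # vs) \<oplus>\<^bsub>N\<^esub> lift N c (\<lambda>ws. g (u # ws)) (us @ y # vs)"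
        by (rule Cons.IH[OF _ _ _ _ _ f]) (use Cons.prems in auto)
      have 2: "g (us @ (x \<oplus>\<^bsub>M\<^esub> y) # vs) = g (us @ x # vs) \<oplus>\<^bsub>N\<^esub> g (us @ y # vs)"
        by (rule gD(2)) (use Cons.prems in auto)
      have 3: "g (us @ x # vs) \<in> carrier N" "g (us @ y # vs) \<in> carrier N"
        by (rule gD(1); use Cons.prems in simp)+
      have 4: "lift N c (\<lambda>ws. g (u # ws)) (us @ x # vs) \<in> carrier N"
        "lift N c (\<lambda>ws. g (u # ws)) (us @ y # vs) \<in> carrier N"
        by (rule lc, use Cons.prems in simp, rule gD(1), (use Cons.prems in \<open>auto simp: subset_iff\<close>)[2])+
      show ?case using 1 2 3 4 Cons.prems cc
        by (simp add: N.smult_r_distr a_minus_def N.M.minus_add N.M.a_ac)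
    qed
  next
    fix us vs r x
    assume "length us + Suc (length vs) = Suc n" "set us \<subseteq> carrier M" "set vs \<subseteq> carrier M"
      "r \<in> carrier R" "x \<in> carrier M"
    then show "lift N c g (us @ (r \<odot>\<^bsub>M\<^esub> x) # vs) = r \<odot>\<^bsub>N\<^esub> lift N c g (us @ x # vs)"
      using g
    proof (induction us arbitrary: g n)
      case Nil
      note gD = aformD[OF Nil(6)]
      have "lift N c (\<lambda>ws. g ((r \<odot>\<^bsub>M\<^esub> x) # ws)) vs = lift N c (\<lambda>ws. r \<odot>\<^bsub>N\<^esub> g (x # ws)) vs"
        using gD(3)[of "[]"] Nil by (intro lift_cong) auto
      also have "\<dots> = r \<odot>\<^bsub>N\<^esub> lift N c (\<lambda>ws. g (x # ws)) vs"
        using gD(1) Nil by (intro lift_smult[OF N, where M = M]) (auto simp: cc)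
      finally show ?case
        using lc[where ws = vs and h = "\<lambda>ws. g (x # ws)"] gD(1) Nil
        by (simp add: csm cc N.smult_assoc1 N.smult_r_distr N.smult_r_minus a_minus_def)
    next
      case (Cons u us)
      have n: "n = Suc (n - 1)" using Cons.prems by auto
      note gD = aformD[OF Cons.prems(6)]
      have f: "aform R (\<lambda>r. r) M (carrier M) N (n - 1) (\<lambda>xs. g (u # xs))"
        using aform_Cons[of R _ M "carrier M" N "n - 1" g u] n Cons.prems by auto
      have 1: "lift N c (\<lambda>ws. g (u # ws)) (us @ (r \<odot>\<^bsub>M\<^esub> x) # vs) =
          r \<odot>\<^bsub>N\<^esub> lift N c (\<lambda>ws. g (u # ws)) (us @ x # vs)"
        by (rule Cons.IH[OF _ _ _ _ _ f]) (use Cons.prems in auto)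
      have 2: "g (us @ (r \<odot>\<^bsub>M\<^esub> x) # vs) = r \<odot>\<^bsub>N\<^esub> g (us @ x # vs)"
        by (rule gD(3)) (use Cons.prems in auto)
      have 3: "g (us @ x # vs) \<in> carrier N"
        by (rule gD(1); use Cons.prems in simp)+
      have 4: "lift N c (\<lambda>ws. g (u # ws)) (us @ x # vs) \<in> carrier N"
        by (rule lc, use Cons.prems in simp, rule gD(1), (use Cons.prems in \<open>auto simp: subset_iff\<close>)[2])+
      show ?case using 1 2 3 4 Cons.prems cc
        by (simp add: N.smult_r_distr N.smult_r_minus a_minus_def N.smult_assoc1[symmetric] N.R.m_comm)
    qed
  next
    fix us vs x
    assume "length us + Suc (Suc (length vs)) = Suc n" "set us \<subseteq> carrier M" "set vs \<subseteq> carrier M"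
      "x \<in> carrier M"
    then show "lift N c g (us @ x # x # vs) = \<zero>\<^bsub>N\<^esub>" using g
    proof (induction us arbitrary: g n)
      \<comment> \<open>The terms in which \<open>c\<close> takes the first and the second copy of
        \<open>x\<close> cancel; the others evaluate \<open>g\<close> at two equal
        neighbours.\<close>
      case Nil
      note gD = aformD[OF Nil(5)]
      have "lift N c (\<lambda>ws. g (x # x # ws)) vs = \<zero>\<^bsub>N\<^esub>"
        using gD(4)[of "[]"] Nil by (intro lift_zero[OF N, where M = M]) (auto simp: cc)
      moreover have "g (x # vs) \<in> carrier N" using gD(1) Nil by auto
      ultimately show ?case using Nil cc by (simp add: N.diff_zero N.diff_eq_zero)
    next
      case (Cons u us)
      have n: "n = Suc (n - 1)" using Cons.prems by auto
      note gD = aformD[OF Cons.prems(5)]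
      have f: "aform R (\<lambda>r. r) M (carrier M) N (n - 1) (\<lambda>xs. g (u # xs))"
        using aform_Cons[of R _ M "carrier M" N "n - 1" g u] n Cons.prems by auto
      have 1: "lift N c (\<lambda>ws. g (u # ws)) (us @ x # x # vs) = \<zero>\<^bsub>N\<^esub>"
        by (rule Cons.IH[OF _ _ _ _ f]) (use Cons.prems in auto)
      have 2: "g (us @ x # x # vs) = \<zero>\<^bsub>N\<^esub>"
        by (rule gD(4)) (use Cons.prems in auto)
      show ?case using 1 2 Cons.prems cc by (simp add: a_minus_def)
    qed
  qed
qed

text \<open>A term of the expansion either carries the factor \<open>c b\<close>, which is zero, or
  leaves \<open>b\<close> among the arguments of \<open>g\<close>.\<close>

lemma lift_kill:
  assumes N: "rmod R N" and M: "rmod R M" and c: "\<And>v. v \<in> carrier M \<Longrightarrow> c v \<in> carrier R"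
    and b: "c b = \<zero>\<^bsub>R\<^esub>" "b \<in> carrier M"
  shows "(\<And>xs. length xs = n \<Longrightarrow> set xs \<subseteq> carrier M \<Longrightarrow> g xs \<in> carrier N) \<Longrightarrow>
    (\<And>xs. length xs = n \<Longrightarrow> set xs \<subseteq> carrier M \<Longrightarrow> b \<in> set xs \<Longrightarrow> g xs = \<zero>\<^bsub>N\<^esub>) \<Longrightarrow>
    length ys = Suc n \<Longrightarrow> set ys \<subseteq> carrier M \<Longrightarrow> b \<in> set ys \<Longrightarrow> lift N c g ys = \<zero>\<^bsub>N\<^esub>"
proof (induction ys arbitrary: g n)
  case (Cons y ys)
  interpret N: rmod R N by fact
  show ?case
  proof (cases "y = b")
    case True
    have "lift N c (\<lambda>ws. g (y # ws)) ys = \<zero>\<^bsub>N\<^esub>"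
      by (rule lift_zero[OF N, where M = M]) (use Cons.prems True c in auto)
    moreover have "g ys \<in> carrier N" using Cons.prems by auto
    ultimately show ?thesis using True b by (simp add: a_minus_def)
  next
    case False
    then have bs: "b \<in> set ys" using Cons.prems by auto
    then obtain m where m: "n = Suc m" using Cons.prems by (cases n) auto
    have "lift N c (\<lambda>ws. g (y # ws)) ys = \<zero>\<^bsub>N\<^esub>"
      by (rule Cons.IH[of m]) (use Cons.prems m bs in auto)
    moreover have "g ys = \<zero>\<^bsub>N\<^esub>" using Cons.prems bs by auto
    ultimately show ?thesis using Cons.prems c by (simp add: a_minus_def)
  qed
qed auto

text \<open>Every term except the leading one keeps \<open>y\<close> as first argument of
  \<open>g\<close>.\<close>

lemma lift_hd:
  assumes N: "rmod R N" and c: "c y = \<one>\<^bsub>R\<^esub>" "\<And>v. v \<in> carrier M \<Longrightarrow> c v \<in> carrier R"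
    and g: "g vs \<in> carrier N" "set vs \<subseteq> carrier M"
    and z: "\<And>ws. set ws \<subseteq> set vs \<Longrightarrow> Suc (length ws) = length vs \<Longrightarrow> g (y # ws) = \<zero>\<^bsub>N\<^esub>"
  shows "lift N c g (y # vs) = g vs"
proof -
  interpret N: rmod R N by fact
  have "lift N c (\<lambda>ws. g (y # ws)) vs = \<zero>\<^bsub>N\<^esub>"
    by (rule lift_zero[OF N g(2)]) (use z c in auto)
  then show ?thesis using c g by (simp add: a_minus_def)
qed

text \<open>The expansion involves only the scalars \<open>c v\<close> and values of
  \<open>g\<close>, so it commutes with a semilinear \<open>\<sigma>\<close> that respects both.
  This is how contractions pass to twists.\<close>

lemma lift_slin:
  assumes N: "rmod R N" and P: "rmod R P" and \<sigma>: "slin R \<phi> N P \<sigma>"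
    and c: "\<And>v. v \<in> carrier M \<Longrightarrow> c v \<in> carrier R"
    and c': "\<And>v. v \<in> carrier M \<Longrightarrow> c' (\<tau> v) = \<phi> (c v)"
  shows "(\<And>xs. length xs = n \<Longrightarrow> set xs \<subseteq> carrier M \<Longrightarrow> g xs \<in> carrier N \<and> g' (map \<tau> xs) = \<sigma> (g xs)) \<Longrightarrow>
    length ys = Suc n \<Longrightarrow> set ys \<subseteq> carrier M \<Longrightarrow> lift P c' g' (map \<tau> ys) = \<sigma> (lift N c g ys)"
proof (induction ys arbitrary: g g' n)
  case (Cons y ys)
  interpret N: rmod R N by fact
  interpret P: rmod R P by fact
  have l: "lift N c (\<lambda>ws. g (y # ws)) ys \<in> carrier N"
    by (rule lift_closed[OF N, where M = M]) (use Cons.prems c in auto)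
  have gy: "g ys \<in> carrier N" "g' (map \<tau> ys) = \<sigma> (g ys)" using Cons.prems(1)[of ys] Cons.prems by auto
  have "lift P c' (\<lambda>ws. g' (\<tau> y # ws)) (map \<tau> ys) = \<sigma> (lift N c (\<lambda>ws. g (y # ws)) ys)"
  proof (cases n)
    case 0 then show ?thesis using Cons.prems N.slin_zero[OF P \<sigma>] by simp
  next
    case (Suc m)
    show ?thesis
      by (rule Cons.IH[of m]) (use Cons.prems(1)[of "y # _"] Cons.prems(2,3) Suc in auto)
  qed
  then show ?case using l gy c c' Cons.prems
    by (simp add: N.slin_diff[OF P \<sigma>] slin_smult[OF \<sigma>])
qed simp

section \<open>Tensor products of exterior powers\<close>

definition blocks_ok :: "'r ring \<Rightarrow> ('r, 'm) module \<Rightarrow> 'm block list \<Rightarrow> bool" where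
  "blocks_ok R M Bs \<longleftrightarrow> (\<forall>(a, A, B)\<in>set Bs. submodule A R M \<and> B \<subseteq> carrier M)"

text \<open>The functions on symbols that factor through \<open>wedges\<close>:
  \<open>multi_wsym\<close> is the universal one, \<open>multi_sext\<close> the
  factorisation.\<close>

definition multi :: "'r ring \<Rightarrow> ('r \<Rightarrow> 'r) \<Rightarrow> ('r, 'm) module \<Rightarrow> 'm block list \<Rightarrow> ('r, 'n) module \<Rightarrow>
    ('m list list \<Rightarrow> 'n) \<Rightarrow> bool" where
  "multi R \<phi> M Bs N G \<longleftrightarrow> (\<forall>xss\<in>wgen Bs. G xss \<in> carrier N) \<and>
     (\<forall>B1 a A B B2 pre post. Bs = B1 @ (a, A, B) # B2 \<and> pre \<in> wgen B1 \<and> post \<in> wgen B2 \<longrightarrow>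
        aform R \<phi> M A N a (\<lambda>xs. G (pre @ xs # post)) \<and>
        (\<forall>xs. length xs = a \<and> set xs \<subseteq> A \<and> set xs \<inter> B \<noteq> {} \<longrightarrow> G (pre @ xs # post) = \<zero>\<^bsub>N\<^esub>))"

lemma multiI:
  assumes "\<And>xss. xss \<in> wgen Bs \<Longrightarrow> G xss \<in> carrier N"
    "\<And>B1 a A B B2 pre post. Bs = B1 @ (a, A, B) # B2 \<Longrightarrow> pre \<in> wgen B1 \<Longrightarrow> post \<in> wgen B2 \<Longrightarrow>
        aform R \<phi> M A N a (\<lambda>xs. G (pre @ xs # post))"
    "\<And>B1 a A B B2 pre post xs. Bs = B1 @ (a, A, B) # B2 \<Longrightarrow> pre \<in> wgen B1 \<Longrightarrow> post \<in> wgen B2 \<Longrightarrow>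
        length xs = a \<Longrightarrow> set xs \<subseteq> A \<Longrightarrow> set xs \<inter> B \<noteq> {} \<Longrightarrow> G (pre @ xs # post) = \<zero>\<^bsub>N\<^esub>"
  shows "multi R \<phi> M Bs N G"
  unfolding multi_def by (intro conjI ballI allI impI; (elim conjE)?; rule assms; assumption)

lemma multiD:
  assumes "multi R \<phi> M Bs N G"
  shows "xss \<in> wgen Bs \<Longrightarrow> G xss \<in> carrier N"
    "Bs = B1 @ (a, A, B) # B2 \<Longrightarrow> pre \<in> wgen B1 \<Longrightarrow> post \<in> wgen B2 \<Longrightarrow>
        aform R \<phi> M A N a (\<lambda>xs. G (pre @ xs # post))"
    "Bs = B1 @ (a, A, B) # B2 \<Longrightarrow> pre \<in> wgen B1 \<Longrightarrow> post \<in> wgen B2 \<Longrightarrow>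
        length xs = a \<Longrightarrow> set xs \<subseteq> A \<Longrightarrow> set xs \<inter> B \<noteq> {} \<Longrightarrow> G (pre @ xs # post) = \<zero>\<^bsub>N\<^esub>"
proof -
  note m = assms[unfolded multi_def, THEN conjunct2, rule_format]
  show "xss \<in> wgen Bs \<Longrightarrow> G xss \<in> carrier N" using assms unfolding multi_def by simp
  show "aform R \<phi> M A N a (\<lambda>xs. G (pre @ xs # post))"
    if "Bs = B1 @ (a, A, B) # B2" "pre \<in> wgen B1" "post \<in> wgen B2"
    using m[of B1 a A B B2 pre post] that by simp
  show "G (pre @ xs # post) = \<zero>\<^bsub>N\<^esub>"
    if "Bs = B1 @ (a, A, B) # B2" "pre \<in> wgen B1" "post \<in> wgen B2"
     "length xs = a" "set xs \<subseteq> A" "set xs \<inter> B \<noteq> {}"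
    using m[of B1 a A B B2 pre post] that by simp
qed

lemma wgen_Nil [simp]: "wgen [] = {[]}"
  by (auto simp: wgen_def)

lemma wgen_Cons: "wgen ((a, A, B) # Bs) = {xs # xss | xs xss. length xs = a \<and> set xs \<subseteq> A \<and> xss \<in> wgen Bs}"
  by (auto simp: wgen_def list_all2_Cons2)

lemma wgen_length: "xss \<in> wgen Bs \<Longrightarrow> length xss = length Bs"
  by (auto simp: wgen_def dest: list_all2_lengthD)

lemma wgen_split:
  "pre @ xs # post \<in> wgen Bs \<longleftrightarrow> (\<exists>B1 a A B B2. Bs = B1 @ (a, A, B) # B2 \<and>
     pre \<in> wgen B1 \<and> post \<in> wgen B2 \<and> length xs = a \<and> set xs \<subseteq> A)" (is "_ = ?r")
proof
  assume "pre @ xs # post \<in> wgen Bs"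
  then obtain B1 b B2 where "Bs = B1 @ b # B2" "pre \<in> wgen B1" "post \<in> wgen B2"
    "case b of (a, A, B) \<Rightarrow> length xs = a \<and> set xs \<subseteq> A"
    by (auto simp: wgen_def list_all2_append1 list_all2_Cons1)
  then show ?r by (cases b) auto
next
  assume ?r
  then show "pre @ xs # post \<in> wgen Bs"
    by (auto simp: wgen_def intro!: list_all2_appendI)
qed

text \<open>The relations in \<open>wrel\<close> vary one entry of a symbol without naming its
  block. This recovers the block and tells which entries may stand in that place.\<close>

lemma wgen_put:
  assumes "pre @ (us @ x # vs) # post \<in> wgen Bs"
  obtains B1 a A B B2 where "Bs = B1 @ (a, A, B) # B2" "pre \<in> wgen B1" "post \<in> wgen B2"
    "length us + Suc (length vs) = a" "set us \<subseteq> A" "set vs \<subseteq> A" "x \<in> A"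
    "\<And>z. z \<in> A \<Longrightarrow> pre @ (us @ z # vs) # post \<in> wgen Bs"
    "\<And>y. pre @ (us @ y # vs) # post \<in> wgen Bs \<Longrightarrow> y \<in> A"
proof -
  obtain B1 a A B B2 where b: "Bs = B1 @ (a, A, B) # B2" "pre \<in> wgen B1" "post \<in> wgen B2"
      "length (us @ x # vs) = a" "set (us @ x # vs) \<subseteq> A"
    using assms unfolding wgen_split by blast
  show thesis
  proof (rule that[OF b(1-3)])
    show "pre @ (us @ z # vs) # post \<in> wgen Bs" if "z \<in> A" for z
      unfolding wgen_split using that b by (intro exI[of _ B1] exI[of _ a] exI[of _ A] exI[of _ B] exI[of _ B2]) auto
    show "y \<in> A" if y: "pre @ (us @ y # vs) # post \<in> wgen Bs" for y
    proof -
      obtain B1' a' A' B' B2' where b': "Bs = B1' @ (a', A', B') # B2'"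
        "pre \<in> wgen B1'" "set (us @ y # vs) \<subseteq> A'"
        using y unfolding wgen_split by blast
      \<comment> \<open>The length of \<open>pre\<close> fixes the position of the block, so both
        decompositions meet the same block.\<close>
      have "length B1 = length B1'" using wgen_length[OF b(2)] wgen_length[OF b'(2)] by simp
      then have "A = A'" using b(1) b'(1) by simp
      then show ?thesis using b' by simp
    qed
  qed (use b in auto)
qed

lemma wrel_closed:
  assumes M: "rmod R M" and ok: "blocks_ok R M Bs"
  shows "wrel R M Bs \<subseteq> carrier (free_mod R (wgen Bs))"
proof
  interpret M: rmod R M by fact
  have cr: "cring R" by (rule module_cring) fact
  interpret L: rmod R "free_mod R (wgen Bs)" by (rule free_mod_module[OF cr])
  note d = delta_fun_closed[OF cr, of _ "wgen Bs"]
  have sub: "submodule A R M" if "Bs = B1 @ (a, A, B) # B2" for B1 a A B B2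
    using ok that by (auto simp: blocks_ok_def)
  fix v assume "v \<in> wrel R M Bs"
  then show "v \<in> carrier (free_mod R (wgen Bs))" unfolding wrel_def Let_def
  proof (elim UnE CollectE exE conjE, goal_cases)
    case (1 pre us vs post x y)
    from 1(2) obtain B1 a A B B2 where b: "Bs = B1 @ (a, A, B) # B2" "x \<in> A"
      "\<And>z. z \<in> A \<Longrightarrow> pre @ (us @ z # vs) # post \<in> wgen Bs"
      "\<And>y. pre @ (us @ y # vs) # post \<in> wgen Bs \<Longrightarrow> y \<in> A" by (rule wgen_put) (rule that, (assumption | simp)+)
    have "pre @ (us @ (x \<oplus>\<^bsub>M\<^esub> y) # vs) # post \<in> wgen Bs"
      by (rule b(3)[OF M.submodule_closed(3)[OF sub[OF b(1)] b(2) b(4)[OF 1(3)]]])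
    then show ?case using 1 d by simp
  next
    case (2 pre us vs post r x)
    from 2(3) obtain B1 a A B B2 where b: "Bs = B1 @ (a, A, B) # B2" "x \<in> A"
      "\<And>z. z \<in> A \<Longrightarrow> pre @ (us @ z # vs) # post \<in> wgen Bs" by (rule wgen_put) (rule that, (assumption | simp)+)
    have "pre @ (us @ (r \<odot>\<^bsub>M\<^esub> x) # vs) # post \<in> wgen Bs"
      by (rule b(3)[OF M.submodule_closed(4)[OF sub[OF b(1)] 2(2) b(2)]])
    then show ?case using 2 d by simp
  qed (simp_all add: d)
qed

lemma wedges_module:
  "rmod R M \<Longrightarrow> blocks_ok R M Bs \<Longrightarrow> rmod R (wedges R M Bs)"
  unfolding wedges_def by (rule pres_module[OF module_cring wrel_closed])

lemma wsym_closed: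
  "rmod R M \<Longrightarrow> blocks_ok R M Bs \<Longrightarrow> xss \<in> wgen Bs \<Longrightarrow> wsym R M Bs xss \<in> carrier (wedges R M Bs)"
  unfolding wedges_def wsym_def by (rule psym_closed[OF module_cring wrel_closed])

lemma wedges_eq:
  assumes "rmod R M" "blocks_ok R M Bs" "rmod R N"
    "slin R \<phi> (wedges R M Bs) N u" "slin R \<phi> (wedges R M Bs) N v"
    "\<And>xss. xss \<in> wgen Bs \<Longrightarrow> u (wsym R M Bs xss) = v (wsym R M Bs xss)" "C \<in> carrier (wedges R M Bs)"
  shows "u C = v C"
  using pres_eq[OF wrel_closed[OF assms(1,2)] assms(3) assms(4)[unfolded wedges_def]
      assms(5)[unfolded wedges_def] _ assms(7)[unfolded wedges_def]] assms(6)
  by (simp add: wsym_def)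

text \<open>Each family of relations in \<open>wrel\<close> supplies one of the clauses.\<close>

lemma multi_wsym:
  assumes M: "rmod R M" and ok: "blocks_ok R M Bs"
  shows "multi R (\<lambda>r. r) M Bs (wedges R M Bs) (wsym R M Bs)"
proof -
  interpret M: rmod R M by fact
  have cr: "cring R" by (rule module_cring) fact
  interpret L: rmod R "free_mod R (wgen Bs)" by (rule free_mod_module[OF cr])
  interpret W: rmod R "wedges R M Bs" by (rule wedges_module) fact+
  note rel = wrel_closed[OF M ok]
  note d = delta_fun_closed[OF cr, of _ "wgen Bs"]
  have sub: "submodule A R M" if "Bs = B1 @ (a, A, B) # B2" for B1 a A B B2
    using ok that by (auto simp: blocks_ok_def)
  define \<pi> where "\<pi> v = mspan R (free_mod R (wgen Bs)) (wrel R M Bs) +>\<^bsub>free_mod R (wgen Bs)\<^esub> v" for v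
  have \<pi>: "lin R (free_mod R (wgen Bs)) (wedges R M Bs) \<pi>"
    using pres_proj(1)[OF cr rel] by (simp add: \<pi>_def[abs_def] wedges_def)
  have \<pi>0: "\<pi> v = \<zero>\<^bsub>wedges R M Bs\<^esub>" if "v \<in> wrel R M Bs" for v
    using pres_proj(2)[OF cr rel] L.mspan_incl[OF that] by (simp add: \<pi>_def wedges_def)
  have sym: "wsym R M Bs x = \<pi> (delta_fun R x)" for x
    by (simp add: wsym_def psym_def \<pi>_def)
  have eq: "\<pi> v = \<pi> w" if "v \<ominus>\<^bsub>free_mod R (wgen Bs)\<^esub> w \<in> wrel R M Bs"
    "v \<in> carrier (free_mod R (wgen Bs))" "w \<in> carrier (free_mod R (wgen Bs))" for v w
    using \<pi>0[OF that(1)] L.slin_diff[OF W.rmod_axioms \<pi> that(2,3)] slin_closed[OF \<pi>] that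
    by (simp add: W.diff_eq_zero)
  show ?thesis
  proof (rule multiI)
    fix xss assume "xss \<in> wgen Bs"
    then show "wsym R M Bs xss \<in> carrier (wedges R M Bs)" by (rule wsym_closed[OF M ok])
  next
    fix B1 a A B B2 pre post
    assume Bs: "Bs = B1 @ (a, A, B) # B2" and pp: "pre \<in> wgen B1" "post \<in> wgen B2"
    note c = M.submodule_closed[OF sub[OF Bs]]
    have w: "pre @ xs # post \<in> wgen Bs" if "length xs = a" "set xs \<subseteq> A" for xs
      unfolding wgen_split using Bs pp that by blast
    show "aform R (\<lambda>r. r) M A (wedges R M Bs) a (\<lambda>xs. wsym R M Bs (pre @ xs # post))"
    proof (rule aformI)
      fix xs assume "length xs = a" "set xs \<subseteq> A"
      then show "wsym R M Bs (pre @ xs # post) \<in> carrier (wedges R M Bs)"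
        by (intro wsym_closed[OF M ok] w)
    next
      fix us vs x y assume a: "length us + Suc (length vs) = a" "set us \<subseteq> A" "set vs \<subseteq> A" "x \<in> A" "y \<in> A"
      have g: "pre @ (us @ z # vs) # post \<in> wgen Bs" if "z \<in> A" for z
        by (rule w) (use a that in auto)
      have "\<pi> (delta_fun R (pre @ (us @ (x \<oplus>\<^bsub>M\<^esub> y) # vs) # post)) =
          \<pi> (delta_fun R (pre @ (us @ x # vs) # post) \<oplus>\<^bsub>free_mod R (wgen Bs)\<^esub>
             delta_fun R (pre @ (us @ y # vs) # post))"
      proof (rule eq)
        show "delta_fun R (pre @ (us @ (x \<oplus>\<^bsub>M\<^esub> y) # vs) # post) \<ominus>\<^bsub>free_mod R (wgen Bs)\<^esub>
          (delta_fun R (pre @ (us @ x # vs) # post) \<oplus>\<^bsub>free_mod R (wgen Bs)\<^esub>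
             delta_fun R (pre @ (us @ y # vs) # post)) \<in> wrel R M Bs"
          unfolding wrel_def Let_def using g[OF a(4)] g[OF a(5)] by blast
      qed (use g[OF a(4)] g[OF a(5)] g[of "x \<oplus>\<^bsub>M\<^esub> y"] c a d in auto)
      then show "wsym R M Bs (pre @ (us @ (x \<oplus>\<^bsub>M\<^esub> y) # vs) # post) =
         wsym R M Bs (pre @ (us @ x # vs) # post) \<oplus>\<^bsub>wedges R M Bs\<^esub> wsym R M Bs (pre @ (us @ y # vs) # post)"
        using g[OF a(4)] g[OF a(5)] d by (simp add: sym slin_add[OF \<pi>])
    next
      fix us vs r x assume a: "length us + Suc (length vs) = a" "set us \<subseteq> A" "set vs \<subseteq> A" "r \<in> carrier R" "x \<in> A"
      have g: "pre @ (us @ z # vs) # post \<in> wgen Bs" if "z \<in> A" for z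
        by (rule w) (use a that in auto)
      have "\<pi> (delta_fun R (pre @ (us @ (r \<odot>\<^bsub>M\<^esub> x) # vs) # post)) =
          \<pi> (r \<odot>\<^bsub>free_mod R (wgen Bs)\<^esub> delta_fun R (pre @ (us @ x # vs) # post))"
      proof (rule eq)
        show "delta_fun R (pre @ (us @ (r \<odot>\<^bsub>M\<^esub> x) # vs) # post) \<ominus>\<^bsub>free_mod R (wgen Bs)\<^esub>
          (r \<odot>\<^bsub>free_mod R (wgen Bs)\<^esub> delta_fun R (pre @ (us @ x # vs) # post)) \<in> wrel R M Bs"
          unfolding wrel_def Let_def using g[OF a(5)] a(4) by blast
      qed (use g[OF a(5)] g[of "r \<odot>\<^bsub>M\<^esub> x"] c a d in auto)
      then show "wsym R M Bs (pre @ (us @ (r \<odot>\<^bsub>M\<^esub> x) # vs) # post) =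
         r \<odot>\<^bsub>wedges R M Bs\<^esub> wsym R M Bs (pre @ (us @ x # vs) # post)"
        using g[OF a(5)] d a by (simp add: sym slin_smult[OF \<pi>])
    next
      fix us vs x assume a: "length us + Suc (Suc (length vs)) = a" "set us \<subseteq> A" "set vs \<subseteq> A" "x \<in> A"
      have "pre @ (us @ x # x # vs) # post \<in> wgen Bs" by (rule w) (use a in auto)
      moreover have "\<not> distinct ((pre @ (us @ x # x # vs) # post) ! length pre)" by simp
      moreover have "length pre < length Bs" using wgen_length[OF pp(1)] Bs by simp
      ultimately have "delta_fun R (pre @ (us @ x # x # vs) # post) \<in> wrel R M Bs"
        unfolding wrel_def Let_def by blast
      then show "wsym R M Bs (pre @ (us @ x # x # vs) # post) = \<zero>\<^bsub>wedges R M Bs\<^esub>"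
        using \<pi>0 by (simp add: sym)
    qed
    fix xs assume xs: "length xs = a" "set xs \<subseteq> A" "set xs \<inter> B \<noteq> {}"
    have "set ((pre @ xs # post) ! length pre) \<inter> snd (snd (Bs ! length pre)) \<noteq> {}"
      using wgen_length[OF pp(1)] Bs xs by (simp add: nth_append)
    moreover have "length pre < length Bs" using wgen_length[OF pp(1)] Bs by simp
    ultimately have "delta_fun R (pre @ xs # post) \<in> wrel R M Bs"
      using w[OF xs(1,2)] unfolding wrel_def Let_def by blast
    then show "wsym R M Bs (pre @ xs # post) = \<zero>\<^bsub>wedges R M Bs\<^esub>"
      using \<pi>0 by (simp add: sym)
  qed
qed

lemma multi_sext:
  assumes M: "rmod R M" and ok: "blocks_ok R M Bs" and N: "rmod R N" and \<phi>: "\<phi> \<in> ring_hom R R"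
    and G: "multi R \<phi> M Bs N G"
  shows "slin R \<phi> (wedges R M Bs) N (sext R \<phi> N G)"
    and "xss \<in> wgen Bs \<Longrightarrow> sext R \<phi> N G (wsym R M Bs xss) = G xss"
proof -
  interpret M: rmod R M by fact
  interpret N: rmod R N by fact
  have cr: "cring R" by (rule module_cring) fact
  interpret L: rmod R "free_mod R (wgen Bs)" by (rule free_mod_module[OF cr])
  note rel = wrel_closed[OF M ok]
  note d = delta_fun_closed[OF cr, of _ "wgen Bs"]
  have sub: "submodule A R M" if "Bs = B1 @ (a, A, B) # B2" for B1 a A B B2
    using ok that by (auto simp: blocks_ok_def)
  have Gc: "G \<in> wgen Bs \<rightarrow> carrier N" using multiD(1)[OF G] by auto
  note fl = fext[OF N \<phi> Gc]
  have \<phi>c: "\<phi> r \<in> carrier R" if "r \<in> carrier R" for r using that \<phi> by (auto simp: ring_hom_def)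
  have z: "fext R \<phi> N G v = \<zero>\<^bsub>N\<^esub>" if "v \<in> wrel R M Bs" for v
    using that unfolding wrel_def Let_def
  proof (elim UnE CollectE exE conjE, goal_cases)
    case (1 pre us vs post x y)
    from 1(2) obtain B1 a A B B2 where b: "Bs = B1 @ (a, A, B) # B2"
      "pre \<in> wgen B1" "post \<in> wgen B2" "length us + Suc (length vs) = a" "set us \<subseteq> A" "set vs \<subseteq> A" "x \<in> A"
      "\<And>z. z \<in> A \<Longrightarrow> pre @ (us @ z # vs) # post \<in> wgen Bs"
      "\<And>y. pre @ (us @ y # vs) # post \<in> wgen Bs \<Longrightarrow> y \<in> A" by (rule wgen_put) (rule that, (assumption | simp)+)
    have y: "y \<in> A" by (rule b(9)[OF 1(3)])
    have s: "pre @ (us @ (x \<oplus>\<^bsub>M\<^esub> y) # vs) # post \<in> wgen Bs"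
      by (rule b(8)[OF M.submodule_closed(3)[OF sub[OF b(1)] b(7) y]])
    have "G (pre @ (us @ (x \<oplus>\<^bsub>M\<^esub> y) # vs) # post) =
      G (pre @ (us @ x # vs) # post) \<oplus>\<^bsub>N\<^esub> G (pre @ (us @ y # vs) # post)"
      by (rule aformD(2)[OF multiD(2)[OF G b(1-3)] b(4-7) y])
    then show ?case using 1 s d Gc
      by (simp add: L.slin_diff[OF N fl(1)] slin_add[OF fl(1)] fl(2) Pi_iff N.diff_eq_zero)
  next
    case (2 pre us vs post r x)
    from 2(3) obtain B1 a A B B2 where b: "Bs = B1 @ (a, A, B) # B2"
      "pre \<in> wgen B1" "post \<in> wgen B2" "length us + Suc (length vs) = a" "set us \<subseteq> A" "set vs \<subseteq> A" "x \<in> A"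
      "\<And>z. z \<in> A \<Longrightarrow> pre @ (us @ z # vs) # post \<in> wgen Bs" by (rule wgen_put) (rule that, (assumption | simp)+)
    have s: "pre @ (us @ (r \<odot>\<^bsub>M\<^esub> x) # vs) # post \<in> wgen Bs"
      by (rule b(8)[OF M.submodule_closed(4)[OF sub[OF b(1)] 2(2) b(7)]])
    have "G (pre @ (us @ (r \<odot>\<^bsub>M\<^esub> x) # vs) # post) = \<phi> r \<odot>\<^bsub>N\<^esub> G (pre @ (us @ x # vs) # post)"
      by (rule aformD(3)[OF multiD(2)[OF G b(1-3)] b(4-6) 2(2) b(7)])
    then show ?case using 2 s d Gc \<phi>c
      by (simp add: L.slin_diff[OF N fl(1)] slin_smult[OF fl(1)] fl(2) Pi_iff N.diff_eq_zero)
  next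
    \<comment> \<open>This relation kills symbols with any repeated entry, whereas a form is only
      required to vanish at equal neighbours.\<close>
    case (3 xss)
    then obtain k where k: "k < length Bs" "\<not> distinct (xss ! k)" by blast
    have "xss = take k xss @ (xss ! k) # drop (Suc k) xss"
      using k wgen_length[OF 3(2)] by (intro id_take_nth_drop) auto
    then obtain pre xs post where e: "xss = pre @ xs # post" "\<not> distinct xs" using k by metis
    from 3(2)[unfolded e] obtain B1 a A B B2 where b: "Bs = B1 @ (a, A, B) # B2"
      "pre \<in> wgen B1" "post \<in> wgen B2" "length xs = a" "set xs \<subseteq> A"
      unfolding wgen_split by blast
    have "G xss = \<zero>\<^bsub>N\<^esub>" unfolding e
      by (rule aform_not_distinct[OF N M sub[OF b(1)] multiD(2)[OF G b(1-3)] b(4,5) e(2)])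
    then show ?case using 3 fl(2) by simp
  next
    case (4 xss)
    then obtain k where k: "k < length Bs" "set (xss ! k) \<inter> snd (snd (Bs ! k)) \<noteq> {}" by blast
    have l: "length xss = length Bs" by (rule wgen_length[OF 4(2)])
    have e: "xss = take k xss @ (xss ! k) # drop (Suc k) xss"
      using k l by (intro id_take_nth_drop) auto
    have "take k xss @ (xss ! k) # drop (Suc k) xss \<in> wgen Bs" using e 4(2) by simp
    then obtain B1 a A B B2 where b: "Bs = B1 @ (a, A, B) # B2"
      "take k xss \<in> wgen B1" "drop (Suc k) xss \<in> wgen B2" "length (xss ! k) = a" "set (xss ! k) \<subseteq> A"
      unfolding wgen_split by blast
    have "length B1 = k" using wgen_length[OF b(2)] k l by simp
    then have "set (xss ! k) \<inter> B \<noteq> {}" using k b(1) by (simp add: nth_append)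
    then have "G (take k xss @ (xss ! k) # drop (Suc k) xss) = \<zero>\<^bsub>N\<^esub>"
      by (rule multiD(3)[OF G b])
    then have "G xss = \<zero>\<^bsub>N\<^esub>" using e by simp
    then show ?case using 4 fl(2) by simp
  qed
  show "slin R \<phi> (wedges R M Bs) N (sext R \<phi> N G)"
    unfolding wedges_def by (rule sext(1)[OF rel N \<phi> Gc z])
  show "xss \<in> wgen Bs \<Longrightarrow> sext R \<phi> N G (wsym R M Bs xss) = G xss"
    unfolding wsym_def by (rule sext(2)[OF rel N \<phi> Gc z])
qed

lemma id_ring_hom: "(\<lambda>r. r) \<in> ring_hom R R"
  by (auto simp: ring_hom_def)

lemma multi_lext:
  assumes "rmod R M" "blocks_ok R M Bs" "rmod R N" "multi R (\<lambda>r. r) M Bs N G"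
  shows "lin R (wedges R M Bs) N (lext R N G)"
    and "xss \<in> wgen Bs \<Longrightarrow> lext R N G (wsym R M Bs xss) = G xss"
  using multi_sext[OF assms(1-3) id_ring_hom assms(4)] by (simp_all add: lext_def)

lemma multi_comp:
  assumes G: "multi R \<phi> M Bs N G" and u: "slin R \<psi> N P u" and N: "rmod R N" and P: "rmod R P"
    and \<phi>: "\<phi> \<in> carrier R \<rightarrow> carrier R"
  shows "multi R (\<lambda>r. \<psi> (\<phi> r)) M Bs P (\<lambda>xss. u (G xss))"
proof (rule multiI)
  interpret N: rmod R N by fact
  fix B1 a A B B2 pre post
  assume b: "Bs = B1 @ (a, A, B) # B2" "pre \<in> wgen B1" "post \<in> wgen B2"
  show "aform R (\<lambda>r. \<psi> (\<phi> r)) M A P a (\<lambda>xs. u (G (pre @ xs # post)))"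
    by (rule aform_comp[OF multiD(2)[OF G b] u N P \<phi>])
  fix xs assume "length xs = a" "set xs \<subseteq> A" "set xs \<inter> B \<noteq> {}"
  then show "u (G (pre @ xs # post)) = \<zero>\<^bsub>P\<^esub>"
    using multiD(3)[OF G b] N.slin_zero[OF P u] by simp
qed (use multiD(1)[OF G] slin_closed[OF u] in auto)

text \<open>Only \<open>A \<inter> B\<close> is constrained, because the entries of a block lie in
  \<open>A\<close>.\<close>

definition bmap :: "('m \<Rightarrow> 'n) \<Rightarrow> 'm block list \<Rightarrow> 'n block list \<Rightarrow> bool" where
  "bmap u = list_all2 (\<lambda>(a, A, B) (a', A', B'). a = a' \<and> u ` A \<subseteq> A' \<and> u ` (A \<inter> B) \<subseteq> B')"

lemma bmap_wgen:
  assumes "bmap u Bs Cs" "xss \<in> wgen Bs" shows "map (map u) xss \<in> wgen Cs"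
proof -
  have "list_all2 (\<lambda>xs (a, A, B). length (map u xs) = a \<and> set (map u xs) \<subseteq> A) xss Cs"
    by (rule list_all2_trans[OF _ assms(2)[unfolded wgen_def mem_Collect_eq] assms(1)[unfolded bmap_def]])
      (auto split: prod.splits simp: image_subset_iff subset_iff)
  then show ?thesis by (simp add: wgen_def list_all2_map1)
qed

lemma multi_map:
  assumes G: "multi R \<phi> N Cs P G" and u: "slin R \<psi> M N u" and b: "bmap u Bs Cs"
    and ok: "blocks_ok R M Bs" and M: "rmod R M" and \<psi>: "\<psi> \<in> carrier R \<rightarrow> carrier R"
  shows "multi R (\<lambda>r. \<phi> (\<psi> r)) M Bs P (\<lambda>xss. G (map (map u) xss))"
proof (rule multiI)
  interpret M: rmod R M by fact
  fix B1 a A B B2 pre post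
  assume b1: "Bs = B1 @ (a, A, B) # B2" "pre \<in> wgen B1" "post \<in> wgen B2"
  obtain C1 A' B' C2 where c: "Cs = C1 @ (a, A', B') # C2" "bmap u B1 C1" "bmap u B2 C2"
    "u ` A \<subseteq> A'" "u ` (A \<inter> B) \<subseteq> B'"
    using b unfolding b1 bmap_def by (auto simp: list_all2_append1 list_all2_Cons1)
  have pp: "map (map u) pre \<in> wgen C1" "map (map u) post \<in> wgen C2"
    using bmap_wgen c b1 by blast+
  have A: "A \<subseteq> carrier M" using ok b1 M.submodule_closed(1)[of A] by (auto simp: blocks_ok_def)
  show "aform R (\<lambda>r. \<phi> (\<psi> r)) M A P a (\<lambda>xs. G (map (map u) (pre @ xs # post)))"
    using aform_map[OF multiD(2)[OF G c(1) pp] u A c(4) \<psi>] by simp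
  fix xs assume xs: "length xs = a" "set xs \<subseteq> A" "set xs \<inter> B \<noteq> {}"
  then obtain x where "x \<in> set xs" "x \<in> A \<inter> B" by auto
  then have "u x \<in> set (map u xs) \<inter> B'" using c(5) by auto
  then have "G (map (map u) pre @ map u xs # map (map u) post) = \<zero>\<^bsub>P\<^esub>"
    by (intro multiD(3)[OF G c(1) pp]) (use xs c in auto)
  then show "G (map (map u) (pre @ xs # post)) = \<zero>\<^bsub>P\<^esub>" by simp
next
  fix xss assume "xss \<in> wgen Bs"
  then show "G (map (map u) xss) \<in> carrier P" using multiD(1)[OF G] bmap_wgen[OF b] by blast
qed

lemma wmap:
  assumes M: "rmod R M" and N: "rmod R N" and u: "lin R M N u" and b: "bmap u Bs Cs"
    and ok: "blocks_ok R M Bs" "blocks_ok R N Cs"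
  shows "lin R (wedges R M Bs) (wedges R N Cs) (wmap R N Cs u)"
    and "xss \<in> wgen Bs \<Longrightarrow> wmap R N Cs u (wsym R M Bs xss) = wsym R N Cs (map (map u) xss)"
proof -
  have m: "multi R (\<lambda>r. r) M Bs (wedges R N Cs) (\<lambda>xss. wsym R N Cs (map (map u) xss))"
    by (rule multi_map[OF multi_wsym[OF N ok(2)] u b ok(1) M]) auto
  note l = multi_lext[OF M ok(1) wedges_module[OF N ok(2)] m]
  show "lin R (wedges R M Bs) (wedges R N Cs) (wmap R N Cs u)" unfolding wmap_def by (rule l(1))
  show "xss \<in> wgen Bs \<Longrightarrow> wmap R N Cs u (wsym R M Bs xss) = wsym R N Cs (map (map u) xss)"
    unfolding wmap_def by (rule l(2))
qed

text \<open>Each block of \<open>map f Bs\<close> is spanned by images under \<open>h\<close>, and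
  the blocks are treated one at a time with \<open>aform_span0\<close>. With \<open>h\<close> equal
  to \<open>tw_in\<close> this reduces statements about a twist to symbols whose entries have the
  form \<open>1 \<otimes> x\<close>.\<close>

lemma multi_vanish:
  assumes N: "rmod R N" and T: "rmod R T" and \<phi>: "\<phi> \<in> carrier R \<rightarrow> carrier R"
    and f: "\<And>a A B. (a, A, B) \<in> set Bs \<Longrightarrow> h ` A \<subseteq> carrier T \<and> fst (f (a, A, B)) = a \<and>
      fst (snd (f (a, A, B))) = mspan R T (h ` A)"
    and G: "multi R \<phi> T (map f Bs) N G"
    and z: "\<And>xss. xss \<in> wgen Bs \<Longrightarrow> G (map (map h) xss) = \<zero>\<^bsub>N\<^esub>"
    and t: "tss \<in> wgen (map f Bs)"
  shows "G tss = \<zero>\<^bsub>N\<^esub>"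
  using f G z t
proof (induction Bs arbitrary: G tss)
  case (Cons b Bs)
  obtain a A B where b: "b = (a, A, B)" by (cases b)
  obtain B' where fb: "f b = (a, mspan R T (h ` A), B')" and hA: "h ` A \<subseteq> carrier T"
    using Cons.prems(1)[of a A B] b by (cases "f b") auto
  obtain ts tss' where ts: "tss = ts # tss'" "length ts = a" "set ts \<subseteq> mspan R T (h ` A)"
     "tss' \<in> wgen (map f Bs)" using Cons.prems(4) fb by (auto simp: wgen_Cons)
  have af: "aform R \<phi> T (mspan R T (h ` A)) N a (\<lambda>xs. G (xs # tss'))"
    using multiD(2)[OF Cons.prems(2), of "[]"] ts fb by simp
  show ?case unfolding ts(1)
  proof (rule aform_span0[OF N T hA \<phi> af _ ts(2,3)])
    fix ys assume ys: "length ys = a" "set ys \<subseteq> h ` A"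
    then have "ys \<in> lists (h ` A)" by auto
    then obtain xs where xs: "ys = map h xs" "set xs \<subseteq> A" unfolding lists_image by auto
    have ysA: "set ys \<subseteq> mspan R T (h ` A)" using ys rmod.mspan_incl[OF T] by auto
    \<comment> \<open>Fixing the first block at \<open>ys\<close> leaves a multilinear function of
      the other blocks, to which the induction hypothesis applies.\<close>
    have "multi R \<phi> T (map f Bs) N (\<lambda>tss. G (ys # tss))"
    proof (rule multiI)
      fix tss assume "tss \<in> wgen (map f Bs)"
      then show "G (ys # tss) \<in> carrier N"
        using multiD(1)[OF Cons.prems(2), of "ys # tss"] ys ysA fb by (auto simp: wgen_Cons)
    next
      fix B1 a' A' B'' B2 pre post
      assume b1: "map f Bs = B1 @ (a', A', B'') # B2" "pre \<in> wgen B1" "post \<in> wgen B2"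
      have p: "ys # pre \<in> wgen (f b # B1)" using fb ys ysA b1 by (auto simp: wgen_Cons)
      have e: "map f (b # Bs) = (f b # B1) @ (a', A', B'') # B2" using b1 by simp
      show "aform R \<phi> T A' N a' (\<lambda>xs. G (ys # pre @ xs # post))"
        using multiD(2)[OF Cons.prems(2) e p b1(3)] by simp
      fix xs assume "length xs = a'" "set xs \<subseteq> A'" "set xs \<inter> B'' \<noteq> {}"
      then show "G (ys # pre @ xs # post) = \<zero>\<^bsub>N\<^esub>"
        using multiD(3)[OF Cons.prems(2) e p b1(3)] by simp
    qed
    then show "G (ys # tss') = \<zero>\<^bsub>N\<^esub>"
    proof (rule Cons.IH[rotated])
      fix xss assume "xss \<in> wgen Bs"
      then show "G (ys # map (map h) xss) = \<zero>\<^bsub>N\<^esub>"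
        using Cons.prems(3)[of "xs # xss"] xs ys b by (auto simp: wgen_Cons)
    next
      fix a A B assume "(a, A, B) \<in> set Bs"
      then show "h ` A \<subseteq> carrier T \<and> fst (f (a, A, B)) = a \<and> fst (snd (f (a, A, B))) = mspan R T (h ` A)"
        by (intro Cons.prems(1)) simp
    qed (use ts in auto)
  qed
qed auto

section \<open>Frobenius and base change along its powers\<close>

section \<open>The Frobenius endomorphism\<close>

text \<open>Pascal's rule: the products of the expansion with \<open>a\<close> and with
  \<open>b\<close> are brought to sums over the same monomials.\<close>

lemma (in cring) binomial_expansion:
  assumes a: "a \<in> carrier R" and b: "b \<in> carrier R"
  shows "(a \<oplus> b) [^] n = finsum R (\<lambda>k. add_pow R (n choose k) (a [^] k \<otimes> b [^] (n - k))) {..n}"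
proof (induction n)
  case 0 then show ?case using a b by simp
next
  case (Suc n)
  let ?t = "\<lambda>c k. add_pow R (c :: nat) (a [^] Suc k \<otimes> b [^] (n - k))"
  let ?S = "finsum R (\<lambda>k. add_pow R (n choose k) (a [^] k \<otimes> b [^] (n - k))) {..n}"
  have cl: "add_pow R (c :: nat) (a [^] (k :: nat) \<otimes> b [^] (m :: nat)) \<in> carrier R" for c k m
    using a b by simp
  have A: "a \<otimes> ?S = finsum R (\<lambda>k. ?t (n choose k) k) {..n}"
  proof -
    have "a \<otimes> ?S = finsum R (\<lambda>k. a \<otimes> add_pow R (n choose k) (a [^] k \<otimes> b [^] (n - k))) {..n}"
      by (rule finsum_rdistr) (use a cl in auto)
    also have "\<dots> = finsum R (\<lambda>k. ?t (n choose k) k) {..n}"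
      by (rule finsum_cong) (use a b in \<open>auto simp: add_pow_rdistr simp_implies_def m_ac simp del: nat_pow_Suc
          simp: nat_pow_Suc2\<close>)
    finally show ?thesis .
  qed
  have z0: "add_pow R (n choose Suc n) x = \<zero>" for x
    by (simp add: binomial_eq_0 add_pow_def)
  have B: "b \<otimes> ?S = finsum R (\<lambda>k. ?t (n choose Suc k) k) {..n} \<oplus> b [^] Suc n"
  proof -
    have "b \<otimes> ?S = finsum R (\<lambda>k. b \<otimes> add_pow R (n choose k) (a [^] k \<otimes> b [^] (n - k))) {..n}"
      by (rule finsum_rdistr) (use b cl in auto)
    also have "\<dots> = finsum R (\<lambda>k. add_pow R (n choose k) (a [^] k \<otimes> b [^] (Suc n - k))) {..n}"
    proof (rule finsum_cong)
      show "k \<in> {..n} =simp=> b \<otimes> add_pow R (n choose k) (a [^] k \<otimes> b [^] (n - k)) =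
        add_pow R (n choose k) (a [^] k \<otimes> b [^] (Suc n - k))" for k
        using a b by (auto simp: add_pow_rdistr simp_implies_def Suc_diff_le m_ac)
    qed (use a b in auto)
    \<comment> \<open>The term added at \<open>Suc n\<close> vanishes because
      \<open>n choose Suc n\<close> is zero. The index can then be shifted, with the term at
      \<open>0\<close> split off.\<close>
    also have "\<dots> = finsum R (\<lambda>k. add_pow R (n choose k) (a [^] k \<otimes> b [^] (Suc n - k))) {..Suc n}"
      by (rule add.finprod_mono_neutral_cong_left) (use a b z0 in \<open>auto simp: le_Suc_eq\<close>)
    also have "\<dots> = finsum R (\<lambda>k. ?t (n choose Suc k) k) {..n} \<oplus> b [^] Suc n"
      using a b by (subst finsum_Suc2) auto
    finally show ?thesis .
  qed
  have "(a \<oplus> b) [^] Suc n = (a \<oplus> b) \<otimes> ?S" using Suc a b by (simp add: m_comm)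
  also have "\<dots> = a \<otimes> ?S \<oplus> b \<otimes> ?S" using a b cl by (simp add: l_distr finsum_closed Pi_iff)
  also have "\<dots> = finsum R (\<lambda>k. ?t (n choose k) k) {..n} \<oplus> finsum R (\<lambda>k. ?t (n choose Suc k) k) {..n} \<oplus> b [^] Suc n"
    unfolding A B using a b cl by (simp add: a_assoc finsum_closed Pi_iff del: nat_pow_Suc)
  also have "finsum R (\<lambda>k. ?t (n choose k) k) {..n} \<oplus> finsum R (\<lambda>k. ?t (n choose Suc k) k) {..n} =
      finsum R (\<lambda>k. ?t (n choose k) k \<oplus> ?t (n choose Suc k) k) {..n}"
    by (rule finsum_addf[symmetric]) (use a b in auto)
  also have "\<dots> = finsum R (\<lambda>k. ?t (Suc n choose Suc k) k) {..n}"
    by (rule finsum_cong) (use a b in \<open>auto simp: simp_implies_def add.nat_pow_mult simp del: nat_pow_Suc\<close>)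
  also have "\<dots> \<oplus> b [^] Suc n =
      finsum R (\<lambda>k. add_pow R (Suc n choose k) (a [^] k \<otimes> b [^] (Suc n - k))) {..Suc n}"
    using a b by (subst finsum_Suc2) auto
  finally show ?case .
qed

text \<open>\<open>p\<close> divides every binomial coefficient except the two extreme ones, and
  \<open>p\<close> is zero in the ring.\<close>

lemma (in cring) frob_add:
  assumes p: "prime p" "add_pow R p \<one> = \<zero>" and a: "a \<in> carrier R" and b: "b \<in> carrier R"
  shows "(a \<oplus> b) [^] p = a [^] p \<oplus> b [^] (p :: nat)"
proof -
  have z: "add_pow R (p choose k) x = \<zero>" if k: "0 < k" "k < p" "x \<in> carrier R" for k x
  proof -
    obtain m where m: "p choose k = p * m" using dvd_choose_prime[of k p] k p by (auto elim: dvdE)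
    have "add_pow R p y = \<zero>" if "y \<in> carrier R" for y
      using add_pow_ldistr[of \<one> y p] p(2) that by simp
    then show ?thesis using m k add.nat_pow_pow[of x m p] by (simp add: mult.commute)
  qed
  have p0: "p > 0" using p(1) by (simp add: prime_gt_0_nat)
  have "(a \<oplus> b) [^] p = finsum R (\<lambda>k. add_pow R (p choose k) (a [^] k \<otimes> b [^] (p - k))) {..p}"
    by (rule binomial_expansion[OF a b])
  also have "\<dots> = finsum R (\<lambda>k. add_pow R (p choose k) (a [^] k \<otimes> b [^] (p - k))) {0, p}"
    by (rule add.finprod_mono_neutral_cong_right) (use z a b in auto)
  also have "\<dots> = a [^] p \<oplus> b [^] p"
    using a b p0 by (subst finsum_insert) (auto simp: a_comm)
  finally show ?thesis .
qed

lemma frob_pow_hom: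
  assumes "cring R" "prime p" "add_pow R p \<one>\<^bsub>R\<^esub> = \<zero>\<^bsub>R\<^esub>"
  shows "frob_pow R (p ^ k) \<in> ring_hom R R"
proof -
  interpret cring R by fact
  show ?thesis
  proof (induction k)
    case 0 then show ?case by (auto simp: ring_hom_def frob_pow_def)
  next
    case (Suc k)
    have e: "frob_pow R (p ^ Suc k) a = frob_pow R p (frob_pow R (p ^ k) a)" if "a \<in> carrier R" for a
      using that by (simp add: frob_pow_def nat_pow_pow mult.commute)
    have "frob_pow R p \<in> ring_hom R R"
      using frob_add[OF assms(2,3)] by (auto simp: ring_hom_def frob_pow_def nat_pow_distrib)
    then show ?case using Suc e by (auto simp: ring_hom_def Pi_iff)
  qed
qed

lemma frob_frob:
  assumes "cring R" "r \<in> carrier R"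
  shows "frob_pow R q' (frob_pow R q r) = frob_pow R (q * q') r"
proof -
  interpret cring R by fact
  show ?thesis using assms by (simp add: frob_pow_def nat_pow_pow)
qed

lemma frob_one: "cring R \<Longrightarrow> r \<in> carrier R \<Longrightarrow> frob_pow R 1 r = r"
proof -
  assume "cring R" then interpret cring R by simp
  show "r \<in> carrier R \<Longrightarrow> frob_pow R 1 r = r" by (simp add: frob_pow_def)
qed

lemma slin_ident: "slin R \<phi> M N u \<Longrightarrow> (\<And>r. r \<in> carrier R \<Longrightarrow> \<phi> r = \<psi> r) \<Longrightarrow> slin R \<psi> M N u"
  by (simp add: slin_def)

lemma slin_mspan_image:
  assumes M: "rmod R M" and N: "rmod R N" and u: "slin R \<phi> M N u" and X: "X \<subseteq> carrier M"
    and B: "submodule B R N" and XB: "u ` X \<subseteq> B" and \<phi>: "\<phi> \<in> carrier R \<rightarrow> carrier R"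
  shows "u ` mspan R M X \<subseteq> B"
proof -
  interpret M: rmod R M by fact
  interpret N: rmod R N by fact
  note c = N.submodule_closed[OF B]
  have "u x \<in> B" if "x \<in> mspan R M X" for x using that X
  proof (induction rule: M.mspan_induct)
    case zero then show ?case using M.slin_zero[OF N u] c by simp
  next
    case (add x y)
    then have "x \<in> carrier M" "y \<in> carrier M" using M.mspan_carrier[OF X] by auto
    then show ?case using add c by (simp add: slin_add[OF u])
  next
    case (smult r x)
    then have "x \<in> carrier M" using M.mspan_carrier[OF X] by auto
    then show ?case using smult c \<phi> by (simp add: slin_smult[OF u] Pi_iff)
  qed (use XB in auto)
  then show ?thesis by auto
qed

section \<open>Twists\<close>

lemma ring_hom_Pi: "\<phi> \<in> ring_hom R R \<Longrightarrow> \<phi> \<in> carrier R \<rightarrow> carrier R"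
  by (auto simp: ring_hom_def)

section \<open>Twists by an exponent \<open>q\<close> whose power map is a ring endomorphism\<close>

context
  fixes R :: "'r ring" and q :: nat
  assumes q: "frob_pow R q \<in> ring_hom R R"
begin

lemma twist_module: "rmod R M \<Longrightarrow> rmod R (twist R q M)"
  unfolding twist_def by (rule base_change_sym(1)[OF _ q])

lemma tw_in_slin: "rmod R M \<Longrightarrow> slin R (frob_pow R q) M (twist R q M) (tw_in R q M)"
  unfolding twist_def tw_in_def[abs_def] using base_change_sym(2)[OF _ q, of M] by simp

lemma tw_in_span: "rmod R M \<Longrightarrow> mspan R (twist R q M) (tw_in R q M ` carrier M) = carrier (twist R q M)"
  unfolding twist_def tw_in_def using base_change_span[OF _ q] by blast

lemma tw_in_closed: "rmod R M \<Longrightarrow> x \<in> carrier M \<Longrightarrow> tw_in R q M x \<in> carrier (twist R q M)"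
  by (rule slin_closed[OF tw_in_slin])

lemma twist_sext:
  assumes "rmod R M" "rmod R N" "\<psi> \<in> ring_hom R R" "slin R (\<lambda>r. \<psi> (frob_pow R q r)) M N g"
  shows "slin R \<psi> (twist R q M) N (sext R \<psi> N g)"
    and "x \<in> carrier M \<Longrightarrow> sext R \<psi> N g (tw_in R q M x) = g x"
  unfolding twist_def tw_in_def using base_change_sext[OF assms(1) q assms(2-4)] by simp_all

lemma tw_sub_submodule:
  assumes "rmod R M" "N \<subseteq> carrier M"
  shows "submodule (tw_sub R q M N) R (twist R q M)"
  unfolding tw_sub_def
  by (rule rmod.mspan_submodule[OF twist_module[OF assms(1)]])
     (use assms(2) tw_in_closed[OF assms(1)] in auto)

lemma tw_sub_incl: "rmod R M \<Longrightarrow> x \<in> N \<Longrightarrow> tw_in R q M x \<in> tw_sub R q M N"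
  unfolding tw_sub_def by (rule rmod.mspan_incl[OF twist_module]) auto

lemma tw_sub_carrier: "rmod R M \<Longrightarrow> tw_sub R q M (carrier M) = carrier (twist R q M)"
  unfolding tw_sub_def by (rule tw_in_span)

lemma tw_sub_subset: "rmod R M \<Longrightarrow> N \<subseteq> carrier M \<Longrightarrow> tw_sub R q M N \<subseteq> carrier (twist R q M)"
  using rmod.submodule_closed(1)[OF twist_module tw_sub_submodule] by blast

lemma tw_sub_zero:
  assumes M: "rmod R M" shows "tw_sub R q M {\<zero>\<^bsub>M\<^esub>} = {\<zero>\<^bsub>twist R q M\<^esub>}"
proof -
  interpret M: rmod R M by fact
  interpret T: rmod R "twist R q M" by (rule twist_module[OF M])
  have "tw_in R q M \<zero>\<^bsub>M\<^esub> = \<zero>\<^bsub>twist R q M\<^esub>" by (rule M.slin_zero[OF T.rmod_axioms tw_in_slin[OF M]])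
  then have "tw_sub R q M {\<zero>\<^bsub>M\<^esub>} = mspan R (twist R q M) {\<zero>\<^bsub>twist R q M\<^esub>}" by (simp add: tw_sub_def)
  then show ?thesis by (simp add: T.mspan_id[OF T.zero_submodule])
qed

lemma tw_sub_mono: "rmod R M \<Longrightarrow> A \<subseteq> B \<Longrightarrow> tw_sub R q M A \<subseteq> tw_sub R q M B"
  unfolding tw_sub_def by (rule rmod.mspan_mono[OF twist_module]) auto

lemma slin_tw_sub:
  assumes M: "rmod R M" and N: "rmod R N" and u: "slin R \<phi> (twist R q M) N u" and A: "A \<subseteq> carrier M"
    and B: "submodule B R N" and AB: "\<And>x. x \<in> A \<Longrightarrow> u (tw_in R q M x) \<in> B" and \<phi>: "\<phi> \<in> carrier R \<rightarrow> carrier R"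
  shows "u ` tw_sub R q M A \<subseteq> B"
  unfolding tw_sub_def
  by (rule slin_mspan_image[OF twist_module[OF M] N u _ B _ \<phi>]) (use A AB tw_in_closed[OF M] in auto)

lemma tw_blocks_ok:
  assumes M: "rmod R M" and "blocks_ok R M Bs"
  shows "blocks_ok R (twist R q M) (tw_blocks R q M Bs)"
  using assms(2) rmod.submodule_closed(1)[OF M]
  by (auto simp: blocks_ok_def tw_blocks_def intro!: tw_sub_submodule[OF M]
      dest!: bspec dest: subsetD[OF tw_sub_subset[OF M]])

lemma wtwist_module: "rmod R M \<Longrightarrow> blocks_ok R M Bs \<Longrightarrow> rmod R (wtwist R q M Bs)"
  unfolding wtwist_def by (intro wedges_module twist_module tw_blocks_ok)

lemma bmap_tw_in: "rmod R M \<Longrightarrow> blocks_ok R M Bs \<Longrightarrow> bmap (tw_in R q M) Bs (tw_blocks R q M Bs)"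
  unfolding bmap_def tw_blocks_def
  by (auto simp: list_all2_map2 intro!: list_all2_refl tw_sub_incl split: prod.splits)

lemma wtw_in:
  assumes M: "rmod R M" and ok: "blocks_ok R M Bs"
  shows "slin R (frob_pow R q) (wedges R M Bs) (wtwist R q M Bs) (wtw_in R q M Bs)"
    and "xss \<in> wgen Bs \<Longrightarrow> wtw_in R q M Bs (wsym R M Bs xss) =
      wsym R (twist R q M) (tw_blocks R q M Bs) (map (map (tw_in R q M)) xss)"
proof -
  have m: "multi R (frob_pow R q) M Bs (wtwist R q M Bs)
     (\<lambda>xss. wsym R (twist R q M) (tw_blocks R q M Bs) (map (map (tw_in R q M)) xss))"
    unfolding wtwist_def
    by (rule multi_map[OF multi_wsym[OF twist_module[OF M] tw_blocks_ok[OF M ok]] tw_in_slin[OF M]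
        bmap_tw_in[OF M ok] ok M ring_hom_Pi[OF q]])
  note l = multi_sext[OF M ok wtwist_module[OF M ok] q m]
  show "slin R (frob_pow R q) (wedges R M Bs) (wtwist R q M Bs) (wtw_in R q M Bs)"
    unfolding wtw_in_def by (rule l(1))
  show "xss \<in> wgen Bs \<Longrightarrow> wtw_in R q M Bs (wsym R M Bs xss) =
      wsym R (twist R q M) (tw_blocks R q M Bs) (map (map (tw_in R q M)) xss)"
    unfolding wtw_in_def by (rule l(2))
qed

lemma multi_diff:
  assumes N: "rmod R N" and M: "rmod R M" and ok: "blocks_ok R M Bs"
   and G: "multi R \<phi> M Bs N G" and H: "multi R \<phi> M Bs N H" and \<phi>: "\<phi> \<in> carrier R \<rightarrow> carrier R"
  shows "multi R \<phi> M Bs N (\<lambda>xss. G xss \<ominus>\<^bsub>N\<^esub> H xss)"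
proof (rule multiI)
  interpret N: rmod R N by fact
  show "xss \<in> wgen Bs \<Longrightarrow> G xss \<ominus>\<^bsub>N\<^esub> H xss \<in> carrier N" for xss
    using multiD(1)[OF G] multiD(1)[OF H] by simp
  fix B1 a A B B2 pre post
  assume b: "Bs = B1 @ (a, A, B) # B2" "pre \<in> wgen B1" "post \<in> wgen B2"
  then have A: "submodule A R M" using ok by (auto simp: blocks_ok_def)
  show "aform R \<phi> M A N a (\<lambda>xs. G (pre @ xs # post) \<ominus>\<^bsub>N\<^esub> H (pre @ xs # post))"
    by (rule aform_diff[OF multiD(2)[OF G b] multiD(2)[OF H b] N \<phi> A M])
  fix xs assume "length xs = a" "set xs \<subseteq> A" "set xs \<inter> B \<noteq> {}"
  then show "G (pre @ xs # post) \<ominus>\<^bsub>N\<^esub> H (pre @ xs # post) = \<zero>\<^bsub>N\<^esub>"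
    using multiD(3)[OF G b] multiD(3)[OF H b] by (simp add: N.diff_zero)
qed

text \<open>The difference of the two maps is multilinear on symbols and vanishes when all entries
  have the form \<open>1 \<otimes> x\<close>; such elements span every twisted block. This is the
  uniqueness behind \<open>htwist\<close>.\<close>

lemma wtwist_eq:
  assumes M: "rmod R M" and ok: "blocks_ok R M Bs" and N: "rmod R N" and \<phi>: "\<phi> \<in> carrier R \<rightarrow> carrier R"
    and u: "slin R \<phi> (wtwist R q M Bs) N u" and v: "slin R \<phi> (wtwist R q M Bs) N v"
    and e: "\<And>xss. xss \<in> wgen Bs \<Longrightarrow> u (wtw_in R q M Bs (wsym R M Bs xss)) = v (wtw_in R q M Bs (wsym R M Bs xss))"
    and w: "w \<in> carrier (wtwist R q M Bs)"
  shows "u w = v w"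
proof -
  interpret N: rmod R N by fact
  interpret M: rmod R M by fact
  let ?T = "twist R q M" and ?Cs = "tw_blocks R q M Bs"
  interpret T: rmod R ?T by (rule twist_module[OF M])
  note ok' = tw_blocks_ok[OF M ok]
  note W = wtwist_module[OF M ok]
  have mm: "multi R (\<lambda>r. r) ?T ?Cs (wtwist R q M Bs) (wsym R ?T ?Cs)"
    unfolding wtwist_def by (rule multi_wsym[OF T.rmod_axioms ok'])
  have id: "(\<lambda>r. r) \<in> carrier R \<rightarrow> carrier R" by auto
  have G: "multi R \<phi> ?T ?Cs N (\<lambda>xss. u (wsym R ?T ?Cs xss) \<ominus>\<^bsub>N\<^esub> v (wsym R ?T ?Cs xss))"
    by (rule multi_diff[OF N T.rmod_axioms ok' multi_comp[OF mm u W N id] multi_comp[OF mm v W N id] \<phi>])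
  let ?f = "\<lambda>(a, A, B). (a, tw_sub R q M A, tw_sub R q M B)"
  have G': "multi R \<phi> ?T (map ?f Bs) N (\<lambda>xss. u (wsym R ?T ?Cs xss) \<ominus>\<^bsub>N\<^esub> v (wsym R ?T ?Cs xss))"
    using G unfolding tw_blocks_def .
  have z: "u (wsym R ?T ?Cs tss) \<ominus>\<^bsub>N\<^esub> v (wsym R ?T ?Cs tss) = \<zero>\<^bsub>N\<^esub>"
    if t: "tss \<in> wgen ?Cs" for tss
  proof (rule multi_vanish[where h = "tw_in R q M" and f = ?f, OF N T.rmod_axioms \<phi> _ G' _ t[unfolded tw_blocks_def]])
    fix a A B assume "(a, A, B) \<in> set Bs"
    then have "A \<subseteq> carrier M" using ok M.submodule_closed(1)[of A] by (auto simp: blocks_ok_def)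
    then show "tw_in R q M ` A \<subseteq> carrier ?T \<and>
       fst (?f (a, A, B)) = a \<and> fst (snd (?f (a, A, B))) = mspan R ?T (tw_in R q M ` A)"
      using tw_in_closed[OF M] by (auto simp: tw_sub_def)
  next
    fix xss assume x: "xss \<in> wgen Bs"
    have "map (map (tw_in R q M)) xss \<in> wgen ?Cs" by (rule bmap_wgen[OF bmap_tw_in[OF M ok] x])
    then have "wsym R ?T ?Cs (map (map (tw_in R q M)) xss) \<in> carrier (wtwist R q M Bs)"
      unfolding wtwist_def by (rule wsym_closed[OF T.rmod_axioms ok'])
    then show "u (wsym R ?T ?Cs (map (map (tw_in R q M)) xss)) \<ominus>\<^bsub>N\<^esub>
        v (wsym R ?T ?Cs (map (map (tw_in R q M)) xss)) = \<zero>\<^bsub>N\<^esub>"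
      using e[OF x] x slin_closed[OF u] slin_closed[OF v]
      by (simp add: wtw_in(2)[OF M ok] N.diff_eq_zero)
  qed
  show ?thesis
  proof (rule wedges_eq[OF T.rmod_axioms ok' N u[unfolded wtwist_def] v[unfolded wtwist_def] _ w[unfolded wtwist_def]])
    fix tss assume t: "tss \<in> wgen ?Cs"
    then have "wsym R ?T ?Cs tss \<in> carrier (wtwist R q M Bs)"
      unfolding wtwist_def by (rule wsym_closed[OF T.rmod_axioms ok'])
    then show "u (wsym R ?T ?Cs tss) = v (wsym R ?T ?Cs tss)"
      using z[OF t] slin_closed[OF u] slin_closed[OF v] by (simp add: N.diff_eq_zero)
  qed
qed

end

lemma tw_tw:
  assumes q: "frob_pow R q \<in> ring_hom R R" "frob_pow R q' \<in> ring_hom R R" "frob_pow R (q * q') \<in> ring_hom R R"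
    and M: "rmod R M"
  shows "slin R (frob_pow R q') (twist R q M) (twist R (q * q') M) (tw_tw R q q' M)"
    and "x \<in> carrier M \<Longrightarrow> tw_tw R q q' M (tw_in R q M x) = tw_in R (q * q') M x"
proof -
  have cr: "cring R" by (rule module_cring[OF M])
  have s: "slin R (\<lambda>r. frob_pow R q' (frob_pow R q r)) M (twist R (q * q') M) (tw_in R (q * q') M)"
    by (rule slin_ident[OF tw_in_slin[OF q(3) M]]) (simp add: frob_frob[OF cr])
  note l = twist_sext[OF q(1) M twist_module[OF q(3) M] q(2) s]
  show "slin R (frob_pow R q') (twist R q M) (twist R (q * q') M) (tw_tw R q q' M)"
    unfolding tw_tw_def using l(1) by simp
  show "x \<in> carrier M \<Longrightarrow> tw_tw R q q' M (tw_in R q M x) = tw_in R (q * q') M x"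
    unfolding tw_tw_def using l(2) by simp
qed

lemma tw_tw_sub:
  assumes q: "frob_pow R q \<in> ring_hom R R" "frob_pow R q' \<in> ring_hom R R" "frob_pow R (q * q') \<in> ring_hom R R"
    and M: "rmod R M" and A: "A \<subseteq> carrier M"
  shows "tw_tw R q q' M ` tw_sub R q M A \<subseteq> tw_sub R (q * q') M A"
  by (rule slin_tw_sub[OF q(1) M twist_module[OF q(3) M] tw_tw(1)[OF q M] A tw_sub_submodule[OF q(3) M A]])
     (use A tw_tw(2)[OF q M] tw_sub_incl[OF q(3) M] ring_hom_Pi[OF q(2)] in \<open>auto simp: subset_iff\<close>)

lemma wtw_tw:
  assumes q: "frob_pow R q \<in> ring_hom R R" "frob_pow R q' \<in> ring_hom R R" "frob_pow R (q * q') \<in> ring_hom R R"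
    and M: "rmod R M" and ok: "blocks_ok R M Bs"
  shows "slin R (frob_pow R q') (wtwist R q M Bs) (wtwist R (q * q') M Bs) (wtw_tw R q q' M Bs)"
    and "tss \<in> wgen (tw_blocks R q M Bs) \<Longrightarrow>
      wtw_tw R q q' M Bs (wsym R (twist R q M) (tw_blocks R q M Bs) tss) =
      wsym R (twist R (q * q') M) (tw_blocks R (q * q') M Bs) (map (map (tw_tw R q q' M)) tss)"
    and "bmap (tw_tw R q q' M) (tw_blocks R q M Bs) (tw_blocks R (q * q') M Bs)"
proof -
  show b: "bmap (tw_tw R q q' M) (tw_blocks R q M Bs) (tw_blocks R (q * q') M Bs)"
    unfolding bmap_def tw_blocks_def list_all2_map1 list_all2_map2 list_all2_same
  proof (clarsimp, intro conjI)
    fix a A B assume "(a, A, B) \<in> set Bs"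
    then have "A \<subseteq> carrier M" "B \<subseteq> carrier M"
      using ok rmod.submodule_closed(1)[OF M, of A] by (auto simp: blocks_ok_def)
    then show "tw_tw R q q' M ` tw_sub R q M A \<subseteq> tw_sub R (q * q') M A"
      "tw_tw R q q' M ` (tw_sub R q M A \<inter> tw_sub R q M B) \<subseteq> tw_sub R (q * q') M B"
      using tw_tw_sub[OF q M] by blast+
  qed
  note M1 = twist_module[OF q(1) M] and M3 = twist_module[OF q(3) M]
  note ok1 = tw_blocks_ok[OF q(1) M ok] and ok3 = tw_blocks_ok[OF q(3) M ok]
  have m: "multi R (frob_pow R q') (twist R q M) (tw_blocks R q M Bs) (wtwist R (q * q') M Bs)
     (\<lambda>tss. wsym R (twist R (q * q') M) (tw_blocks R (q * q') M Bs) (map (map (tw_tw R q q' M)) tss))"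
    unfolding wtwist_def
    by (rule multi_map[OF multi_wsym[OF M3 ok3] tw_tw(1)[OF q M] b ok1 M1 ring_hom_Pi[OF q(2)]])
  note l = multi_sext[OF M1 ok1 wtwist_module[OF q(3) M ok] q(2) m]
  show "slin R (frob_pow R q') (wtwist R q M Bs) (wtwist R (q * q') M Bs) (wtw_tw R q q' M Bs)"
    unfolding wtw_tw_def wtwist_def[of R q] by (rule l(1))
  show "tss \<in> wgen (tw_blocks R q M Bs) \<Longrightarrow>
      wtw_tw R q q' M Bs (wsym R (twist R q M) (tw_blocks R q M Bs) tss) =
      wsym R (twist R (q * q') M) (tw_blocks R (q * q') M Bs) (map (map (tw_tw R q q' M)) tss)"
    unfolding wtw_tw_def by (rule l(2))
qed

text \<open>Uniqueness is \<open>wtwist_eq\<close>, so any linear map with the right values on the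
  elements \<open>1 \<otimes> x\<close> is the one described by \<open>THE\<close>.\<close>

lemma htwist:
  assumes q: "frob_pow R q \<in> ring_hom R R" and M: "rmod R M" and ok: "blocks_ok R M Bs"
    and W: "rmod R (wtwist R (p * q) N Cs)"
    and u': "lin R (wtwist R q M Bs) (wtwist R (p * q) N Cs) u'"
    and e: "\<And>x. x \<in> carrier (wedges R M Bs) \<Longrightarrow> u' (wtw_in R q M Bs x) = wtw_tw R p q N Cs (u x)"
    and w: "w \<in> carrier (wtwist R q M Bs)"
  shows "htwist R p q M Bs N Cs u w = u' w"
proof -
  let ?W = "wtwist R q M Bs"
  have id: "(\<lambda>r. r) \<in> carrier R \<rightarrow> carrier R" by auto
  have "htwist R p q M Bs N Cs u = restrict u' (carrier ?W)"
    unfolding htwist_def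
  proof (rule the_equality)
    show "restrict u' (carrier ?W) \<in> lin_map R ?W (wtwist R (p * q) N Cs) \<and>
     (\<forall>x\<in>carrier (wedges R M Bs). restrict u' (carrier ?W) (wtw_in R q M Bs x) = wtw_tw R p q N Cs (u x))"
      using lin_map_restrict[OF wtwist_module[OF q M ok] u'] e slin_closed[OF wtw_in(1)[OF q M ok]] by simp
  next
    fix v assume v: "v \<in> lin_map R ?W (wtwist R (p * q) N Cs) \<and>
     (\<forall>x\<in>carrier (wedges R M Bs). v (wtw_in R q M Bs x) = wtw_tw R p q N Cs (u x))"
    then have vl: "lin R ?W (wtwist R (p * q) N Cs) v" and ve: "v \<in> extensional (carrier ?W)"
      by (auto simp: lin_map_iff)
    show "v = restrict u' (carrier ?W)"
    proof (rule extensionalityI[OF ve])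
      fix x assume x: "x \<in> carrier ?W"
      have "v x = u' x"
        by (rule wtwist_eq[OF q M ok W id vl u' _ x]) (use e v wsym_closed[OF M ok] in auto)
      then show "v x = restrict u' (carrier ?W) x" using x by simp
    qed auto
  qed
  then show ?thesis using w by simp
qed

lemma fun_closed: "lin R M (self_mod R) c \<Longrightarrow> v \<in> carrier M \<Longrightarrow> c v \<in> carrier R"
  using slin_closed[of R _ M "self_mod R" c v] by (simp add: self_mod_simps)

section \<open>Free modules: coordinates, determinant forms and free modules of rank one\<close>

section \<open>Dual bases\<close>

text \<open>The coordinate functionals are part of the data: submodules will be cut out by them,
  contractions will be made of them, and they pass to twists by \<open>tw_fun\<close>.\<close>

definition dual_basis :: "'r ring \<Rightarrow> ('r, 'm) module \<Rightarrow> nat \<Rightarrow> (nat \<Rightarrow> 'm) \<Rightarrow> (nat \<Rightarrow> 'm \<Rightarrow> 'r) \<Rightarrow> bool" where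
  "dual_basis R M n b c \<longleftrightarrow> (\<forall>k<n. b k \<in> carrier M) \<and> (\<forall>k<n. lin R M (self_mod R) (c k)) \<and>
     (\<forall>k<n. \<forall>l<n. c k (b l) = (if k = l then \<one>\<^bsub>R\<^esub> else \<zero>\<^bsub>R\<^esub>)) \<and>
     (\<forall>x\<in>carrier M. x = finsum M (\<lambda>k. c k x \<odot>\<^bsub>M\<^esub> b k) {..<n})"

lemma dual_basisD:
  assumes "dual_basis R M n b c"
  shows "k < n \<Longrightarrow> b k \<in> carrier M" "k < n \<Longrightarrow> lin R M (self_mod R) (c k)"
    "k < n \<Longrightarrow> c k (b k) = \<one>\<^bsub>R\<^esub>" "k < n \<Longrightarrow> l < n \<Longrightarrow> k \<noteq> l \<Longrightarrow> c k (b l) = \<zero>\<^bsub>R\<^esub>"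
    "x \<in> carrier M \<Longrightarrow> finsum M (\<lambda>k. c k x \<odot>\<^bsub>M\<^esub> b k) {..<n} = x"
    "k < n \<Longrightarrow> x \<in> carrier M \<Longrightarrow> c k x \<in> carrier R"
proof -
  show l: "k < n \<Longrightarrow> lin R M (self_mod R) (c k)" using assms unfolding dual_basis_def by blast
  show "k < n \<Longrightarrow> x \<in> carrier M \<Longrightarrow> c k x \<in> carrier R" using slin_closed[OF l] by (simp add: self_mod_simps)
  show "x \<in> carrier M \<Longrightarrow> finsum M (\<lambda>k. c k x \<odot>\<^bsub>M\<^esub> b k) {..<n} = x"
    using assms unfolding dual_basis_def by simp
qed (use assms in \<open>auto simp: dual_basis_def\<close>)

text \<open>A submodule spanned by part of a basis, described by the coordinates that vanish on it.
  Inclusions, preimages and twists of such submodules become statements about index sets.\<close>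

definition csub :: "'r ring \<Rightarrow> ('r, 'm) module \<Rightarrow> (nat \<Rightarrow> 'm \<Rightarrow> 'r) \<Rightarrow> nat set \<Rightarrow> 'm set" where
  "csub R M c K = {x \<in> carrier M. \<forall>k\<in>K. c k x = \<zero>\<^bsub>R\<^esub>}"

lemma csub_submodule:
  assumes M: "rmod R M" and l: "\<And>k. k \<in> K \<Longrightarrow> lin R M (self_mod R) (c k)"
  shows "submodule (csub R M c K) R M"
proof -
  interpret M: rmod R M by fact
  have sm: "rmod R (self_mod R)" by (rule self_mod_module[OF module_cring[OF M]])
  have z: "c k \<zero>\<^bsub>M\<^esub> = \<zero>\<^bsub>R\<^esub>" if "k \<in> K" for k
    using M.slin_zero[OF sm l[OF that]] by (simp add: self_mod_simps)
  show ?thesis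
    by (rule M.submoduleI')
       (use z slin_add[OF l] slin_smult[OF l] in \<open>auto simp: csub_def self_mod_simps\<close>)
qed

text \<open>In the expansion of an element of the left side the terms with index in \<open>K\<close>
  drop out.\<close>

lemma csub_span:
  assumes M: "rmod R M" and d: "dual_basis R M n b c" and K: "K \<subseteq> {..<n}"
  shows "csub R M c K = mspan R M (b ` ({..<n} - K))"
proof
  interpret M: rmod R M by fact
  note D = dual_basisD[OF d]
  have X: "b ` ({..<n} - K) \<subseteq> carrier M" using D(1) by auto
  note s = M.submodule_closed[OF M.mspan_submodule[OF X]]
  have "c k (b l) = \<zero>\<^bsub>R\<^esub>" if "k \<in> K" "l \<in> {..<n} - K" for k l
    using that K by (intro D(4)) auto
  then show "mspan R M (b ` ({..<n} - K)) \<subseteq> csub R M c K"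
    by (intro M.mspan_least[OF csub_submodule[OF M]])
       (use K D(1,2) in \<open>auto simp: csub_def subset_iff\<close>)
  show "csub R M c K \<subseteq> mspan R M (b ` ({..<n} - K))"
  proof
    fix x assume x: "x \<in> csub R M c K"
    then have xc: "x \<in> carrier M" by (simp add: csub_def)
    have "c k x \<odot>\<^bsub>M\<^esub> b k \<in> mspan R M (b ` ({..<n} - K))" if "k < n" for k
    proof (cases "k \<in> K")
      case True
      then show ?thesis using x D(1)[OF that] s by (simp add: csub_def)
    next
      case False
      then show ?thesis using that D(6)[OF that xc] by (intro s(4) M.mspan_incl) auto
    qed
    then have "finsum M (\<lambda>k. c k x \<odot>\<^bsub>M\<^esub> b k) {..<n} \<in> mspan R M (b ` ({..<n} - K))"
      by (intro M.finsum_mspan X) auto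
    then show "x \<in> mspan R M (b ` ({..<n} - K))" using D(5)[OF xc] by simp
  qed
qed

lemma csub_all:
  assumes M: "rmod R M" and d: "dual_basis R M n b c"
  shows "csub R M c {..<n} = {\<zero>\<^bsub>M\<^esub>}"
proof -
  interpret M: rmod R M by fact
  have "mspan R M {} = {\<zero>\<^bsub>M\<^esub>}"
    using M.mspan_least[OF M.zero_submodule, of "{}"] M.submodule_closed(2)[OF M.mspan_submodule, of "{}"] by auto
  then show ?thesis using csub_span[OF M d, of "{..<n}"] by simp
qed

text \<open>The coefficients of a vector are unique, hence depend linearly on it.\<close>

lemma basis_dual:
  assumes M: "rmod R M" and bs: "basis R M bs"
  obtains c where "dual_basis R M (length bs) (\<lambda>k. bs ! k) c"
proof -
  interpret M: rmod R M by fact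
  let ?n = "length bs"
  let ?P = "\<lambda>x c. c \<in> {..<?n} \<rightarrow>\<^sub>E carrier R \<and> x = finsum M (\<lambda>k. c k \<odot>\<^bsub>M\<^esub> (bs ! k)) {..<?n}"
  have ex: "\<exists>!c. ?P x c" if "x \<in> carrier M" for x using bs that unfolding basis_def by blast
  have bc: "bs ! k \<in> carrier M" if "k < ?n" for k using bs that by (auto simp: basis_def)
  define d where "d x = (THE c. ?P x c)" for x
  have dP: "?P x (d x)" if "x \<in> carrier M" for x unfolding d_def by (rule theI'[OF ex[OF that]])
  \<comment> \<open>Any expansion in the basis computes the coordinates; linearity and the values on
    basis vectors are instances of this.\<close>
  have du: "d x = restrict c' {..<?n}" if "x \<in> carrier M" "c' \<in> {..<?n} \<rightarrow> carrier R"
    "x = finsum M (\<lambda>k. c' k \<odot>\<^bsub>M\<^esub> (bs ! k)) {..<?n}" for x c'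
  proof -
    have "finsum M (\<lambda>k. restrict c' {..<?n} k \<odot>\<^bsub>M\<^esub> (bs ! k)) {..<?n} = x"
      unfolding that(3) by (rule M.M.finsum_cong) (use that(2) bc in \<open>auto simp: simp_implies_def Pi_iff\<close>)
    then have "?P x (restrict c' {..<?n})" using that(2) by auto
    then show ?thesis using ex[OF that(1)] dP[OF that(1)] by blast
  qed
  have dc: "d x k \<in> carrier R" if "x \<in> carrier M" "k < ?n" for x k using dP[OF that(1)] that(2) by (auto simp: PiE_iff)
  have "dual_basis R M ?n (\<lambda>k. bs ! k) (\<lambda>k x. d x k)"
    unfolding dual_basis_def
  proof (intro conjI allI impI ballI)
    fix k assume k: "k < ?n"
    show "lin R M (self_mod R) (\<lambda>x. d x k)"
    proof (rule slinI)
      fix x y assume x: "x \<in> carrier M" and y: "y \<in> carrier M"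
      have "x \<oplus>\<^bsub>M\<^esub> y = finsum M (\<lambda>k. d x k \<odot>\<^bsub>M\<^esub> (bs ! k)) {..<?n} \<oplus>\<^bsub>M\<^esub> finsum M (\<lambda>k. d y k \<odot>\<^bsub>M\<^esub> (bs ! k)) {..<?n}"
        using dP[OF x] dP[OF y] by simp
      also have "\<dots> = finsum M (\<lambda>k. d x k \<odot>\<^bsub>M\<^esub> (bs ! k) \<oplus>\<^bsub>M\<^esub> d y k \<odot>\<^bsub>M\<^esub> (bs ! k)) {..<?n}"
        by (rule M.M.finsum_addf[symmetric]) (use dc[OF x] dc[OF y] bc in auto)
      also have "\<dots> = finsum M (\<lambda>k. (d x k \<oplus>\<^bsub>R\<^esub> d y k) \<odot>\<^bsub>M\<^esub> (bs ! k)) {..<?n}"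
        by (rule M.M.finsum_cong) (use dc[OF x] dc[OF y] bc in \<open>auto simp: simp_implies_def M.smult_l_distr\<close>)
      finally have e: "x \<oplus>\<^bsub>M\<^esub> y = finsum M (\<lambda>k. (d x k \<oplus>\<^bsub>R\<^esub> d y k) \<odot>\<^bsub>M\<^esub> (bs ! k)) {..<?n}" .
      have "d (x \<oplus>\<^bsub>M\<^esub> y) = restrict (\<lambda>k. d x k \<oplus>\<^bsub>R\<^esub> d y k) {..<?n}"
        by (rule du[OF _ _ e]) (use x y dc[OF x] dc[OF y] in auto)
      then show "d (x \<oplus>\<^bsub>M\<^esub> y) k = d x k \<oplus>\<^bsub>self_mod R\<^esub> d y k" using k by (simp add: self_mod_simps)
    next
      fix r x assume r: "r \<in> carrier R" and x: "x \<in> carrier M"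
      have "r \<odot>\<^bsub>M\<^esub> x = r \<odot>\<^bsub>M\<^esub> finsum M (\<lambda>k. d x k \<odot>\<^bsub>M\<^esub> (bs ! k)) {..<?n}"
        using dP[OF x] by simp
      also have "\<dots> = finsum M (\<lambda>k. r \<odot>\<^bsub>M\<^esub> (d x k \<odot>\<^bsub>M\<^esub> (bs ! k))) {..<?n}"
        by (rule M.finsum_smult_ldistr) (use r dc[OF x] bc in auto)
      also have "\<dots> = finsum M (\<lambda>k. (r \<otimes>\<^bsub>R\<^esub> d x k) \<odot>\<^bsub>M\<^esub> (bs ! k)) {..<?n}"
        by (rule M.M.finsum_cong) (use r dc[OF x] bc in \<open>auto simp: simp_implies_def M.smult_assoc1\<close>)
      finally have e: "r \<odot>\<^bsub>M\<^esub> x = finsum M (\<lambda>k. (r \<otimes>\<^bsub>R\<^esub> d x k) \<odot>\<^bsub>M\<^esub> (bs ! k)) {..<?n}" .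
      have "d (r \<odot>\<^bsub>M\<^esub> x) = restrict (\<lambda>k. r \<otimes>\<^bsub>R\<^esub> d x k) {..<?n}"
        by (rule du[OF _ _ e]) (use x r dc[OF x] in auto)
      then show "d (r \<odot>\<^bsub>M\<^esub> x) k = r \<odot>\<^bsub>self_mod R\<^esub> d x k" using k by (simp add: self_mod_simps)
    qed (use dc k in \<open>auto simp: self_mod_simps\<close>)
  next
    fix k l assume k: "k < ?n" and l: "l < ?n"
    let ?e = "\<lambda>k. if k = l then \<one>\<^bsub>R\<^esub> else \<zero>\<^bsub>R\<^esub>"
    have "finsum M (\<lambda>k. ?e k \<odot>\<^bsub>M\<^esub> (bs ! k)) {..<?n} = ?e l \<odot>\<^bsub>M\<^esub> (bs ! l)"
      by (rule M.finsum_single) (use l bc in auto)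
    then have "d (bs ! l) = restrict ?e {..<?n}"
      by (intro du) (use l bc in auto)
    then show "d (bs ! l) k = ?e k" using k by simp
  next
    fix x assume "x \<in> carrier M"
    then show "x = finsum M (\<lambda>k. d x k \<odot>\<^bsub>M\<^esub> bs ! k) {..<?n}" using dP by blast
  qed (use bc in auto)
  then show thesis by (rule that)
qed

text \<open>Translates the adapted bases of \<open>trivializing\<close>, where submodules are
  spanned by initial segments, into vanishing coordinates.\<close>

lemma mspan_take:
  assumes M: "rmod R M" and d: "dual_basis R M (length bs) (\<lambda>k. bs ! k) c"
  shows "mspan R M (set (take m bs)) = csub R M c {m..<length bs}"
proof -
  have "set (take m bs) = (\<lambda>k. bs ! k) ` ({..<length bs} - {m..<length bs})"
  proof -
    have "take m bs = map (\<lambda>k. bs ! k) [0..<min m (length bs)]" by (rule nth_equalityI) auto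
    then have "set (take m bs) = (\<lambda>k. bs ! k) ` set [0..<min m (length bs)]" by (metis set_map)
    also have "set [0..<min m (length bs)] = {..<length bs} - {m..<length bs}" by auto
    finally show ?thesis .
  qed
  moreover have "{m..<length bs} \<subseteq> {..<length bs}" by auto
  ultimately show ?thesis using csub_span[OF M d, of "{m..<length bs}"] by simp
qed

lemma lin_comb:
  assumes M: "rmod R M" and N: "rmod R N" and A: "finite A"
    and c: "\<And>k. k \<in> A \<Longrightarrow> lin R M (self_mod R) (c k)" and y: "\<And>k. k \<in> A \<Longrightarrow> y k \<in> carrier N"
  shows "lin R M N (\<lambda>x. finsum N (\<lambda>k. c k x \<odot>\<^bsub>N\<^esub> y k) A)"
proof (rule slinI)
  interpret N: rmod R N by fact
  interpret M: rmod R M by fact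
  have cc: "c k x \<in> carrier R" if "k \<in> A" "x \<in> carrier M" for k x
    using slin_closed[OF c] that by (simp add: self_mod_simps)
  show "x \<in> carrier M \<Longrightarrow> finsum N (\<lambda>k. c k x \<odot>\<^bsub>N\<^esub> y k) A \<in> carrier N" for x
    by (rule N.M.finsum_closed) (use cc y in auto)
  fix x assume x: "x \<in> carrier M"
  {
    fix z assume z: "z \<in> carrier M"
    have "finsum N (\<lambda>k. c k (x \<oplus>\<^bsub>M\<^esub> z) \<odot>\<^bsub>N\<^esub> y k) A = finsum N (\<lambda>k. c k x \<odot>\<^bsub>N\<^esub> y k \<oplus>\<^bsub>N\<^esub> c k z \<odot>\<^bsub>N\<^esub> y k) A"
      by (rule N.M.finsum_cong)
         (use x z cc y slin_add[OF c] in \<open>auto simp: simp_implies_def self_mod_simps N.smult_l_distr\<close>)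
    also have "\<dots> = finsum N (\<lambda>k. c k x \<odot>\<^bsub>N\<^esub> y k) A \<oplus>\<^bsub>N\<^esub> finsum N (\<lambda>k. c k z \<odot>\<^bsub>N\<^esub> y k) A"
      by (rule N.M.finsum_addf) (use x z cc y in auto)
    finally show "finsum N (\<lambda>k. c k (x \<oplus>\<^bsub>M\<^esub> z) \<odot>\<^bsub>N\<^esub> y k) A =
       finsum N (\<lambda>k. c k x \<odot>\<^bsub>N\<^esub> y k) A \<oplus>\<^bsub>N\<^esub> finsum N (\<lambda>k. c k z \<odot>\<^bsub>N\<^esub> y k) A" .
  }
  fix r assume r: "r \<in> carrier R"
  have "finsum N (\<lambda>k. c k (r \<odot>\<^bsub>M\<^esub> x) \<odot>\<^bsub>N\<^esub> y k) A = finsum N (\<lambda>k. r \<odot>\<^bsub>N\<^esub> (c k x \<odot>\<^bsub>N\<^esub> y k)) A"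
    by (rule N.M.finsum_cong)
       (use x r cc y slin_smult[OF c] in \<open>auto simp: simp_implies_def self_mod_simps N.smult_assoc1\<close>)
  also have "\<dots> = r \<odot>\<^bsub>N\<^esub> finsum N (\<lambda>k. c k x \<odot>\<^bsub>N\<^esub> y k) A"
    by (rule N.finsum_smult_ldistr[symmetric]) (use A x r cc y in auto)
  finally show "finsum N (\<lambda>k. c k (r \<odot>\<^bsub>M\<^esub> x) \<odot>\<^bsub>N\<^esub> y k) A = r \<odot>\<^bsub>N\<^esub> finsum N (\<lambda>k. c k x \<odot>\<^bsub>N\<^esub> y k) A" .
qed

lemma self_slin:
  assumes "cring R" "\<phi> \<in> ring_hom R R" shows "slin R \<phi> (self_mod R) (self_mod R) \<phi>"
  using assms by (auto simp: slin_def self_mod_simps ring_hom_def)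

definition tw_fun :: "'r ring \<Rightarrow> nat \<Rightarrow> ('m \<Rightarrow> 'r) \<Rightarrow> ('m \<Rightarrow> 'r) set \<Rightarrow> 'r" where
  "tw_fun R q c = sext R (\<lambda>r. r) (self_mod R) (\<lambda>x. frob_pow R q (c x))"

lemma tw_fun:
  assumes q: "frob_pow R q \<in> ring_hom R R" and M: "rmod R M" and c: "lin R M (self_mod R) c"
  shows "lin R (twist R q M) (self_mod R) (tw_fun R q c)"
    and "x \<in> carrier M \<Longrightarrow> tw_fun R q c (tw_in R q M x) = frob_pow R q (c x)"
proof -
  have cr: "cring R" by (rule module_cring[OF M])
  have s: "slin R (\<lambda>r. frob_pow R q r) M (self_mod R) (\<lambda>x. frob_pow R q (c x))"
    using slin_comp[OF c self_slin[OF cr q]] by simp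
  note l = twist_sext[OF q M self_mod_module[OF cr] id_ring_hom s]
  show "lin R (twist R q M) (self_mod R) (tw_fun R q c)" unfolding tw_fun_def by (rule l(1))
  show "x \<in> carrier M \<Longrightarrow> tw_fun R q c (tw_in R q M x) = frob_pow R q (c x)"
    unfolding tw_fun_def by (rule l(2))
qed

lemma frob_zero_one:
  assumes "cring R" "frob_pow R q \<in> ring_hom R R"
  shows "frob_pow R q \<zero>\<^bsub>R\<^esub> = \<zero>\<^bsub>R\<^esub>" "frob_pow R q \<one>\<^bsub>R\<^esub> = \<one>\<^bsub>R\<^esub>"
proof -
  interpret cring R by fact
  interpret h: ring_hom_ring R R "frob_pow R q"
    by (rule ring_hom_ringI2) (use assms ring_axioms in auto)
  show "frob_pow R q \<zero>\<^bsub>R\<^esub> = \<zero>\<^bsub>R\<^esub>" "frob_pow R q \<one>\<^bsub>R\<^esub> = \<one>\<^bsub>R\<^esub>" by simp_all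
qed

lemma twist_dual_basis:
  assumes q: "frob_pow R q \<in> ring_hom R R" and M: "rmod R M" and d: "dual_basis R M n b c"
  shows "dual_basis R (twist R q M) n (\<lambda>k. tw_in R q M (b k)) (\<lambda>k. tw_fun R q (c k))"
  unfolding dual_basis_def
proof (intro conjI allI impI ballI)
  note D = dual_basisD[OF d]
  interpret M: rmod R M by fact
  let ?T = "twist R q M"
  interpret T: rmod R ?T by (rule twist_module[OF q M])
  have cr: "cring R" by (rule module_cring[OF M])
  show bk: "k < n \<Longrightarrow> tw_in R q M (b k) \<in> carrier ?T" for k by (rule tw_in_closed[OF q M D(1)])
  show ck: "k < n \<Longrightarrow> lin R ?T (self_mod R) (tw_fun R q (c k))" for k by (rule tw_fun(1)[OF q M D(2)])
  show "k < n \<Longrightarrow> l < n \<Longrightarrow> tw_fun R q (c k) (tw_in R q M (b l)) = (if k = l then \<one>\<^bsub>R\<^esub> else \<zero>\<^bsub>R\<^esub>)" for k l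
    using D(1,3,4) by (auto simp: tw_fun(2)[OF q M D(2)] frob_zero_one[OF cr q])
  fix t assume t: "t \<in> carrier ?T"
  let ?L = "\<lambda>t. finsum ?T (\<lambda>k. tw_fun R q (c k) t \<odot>\<^bsub>?T\<^esub> tw_in R q M (b k)) {..<n}"
  have L: "lin R ?T ?T ?L"
    by (rule lin_comb[OF T.rmod_axioms T.rmod_axioms]) (use ck bk in auto)
  have X: "tw_in R q M ` carrier M \<subseteq> carrier ?T" using tw_in_closed[OF q M] by auto
  \<comment> \<open>Both sides are linear in \<open>t\<close>, so it is enough to take
    \<open>t\<close> of the form \<open>1 \<otimes> x\<close> and to twist the expansion of
    \<open>x\<close>.\<close>
  show "t = ?L t"
  proof (rule T.slin_eq_mspan[OF T.rmod_axioms slin_id[OF T.rmod_axioms] L X])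
    show "t \<in> mspan R ?T (tw_in R q M ` carrier M)" using t tw_in_span[OF q M] by simp
    fix s assume "s \<in> tw_in R q M ` carrier M"
    then obtain x where x: "s = tw_in R q M x" "x \<in> carrier M" by auto
    note tl = tw_in_slin[OF q M]
    have "s = tw_in R q M (finsum M (\<lambda>k. c k x \<odot>\<^bsub>M\<^esub> b k) {..<n})" using x D(5) by simp
    also have "\<dots> = finsum ?T (\<lambda>k. tw_in R q M (c k x \<odot>\<^bsub>M\<^esub> b k)) {..<n}"
      by (rule M.slin_finsum[OF T.rmod_axioms tl]) (use D(1,6) x in auto)
    also have "\<dots> = ?L s"
      by (rule T.M.finsum_cong)
         (use D(1,6) x bk q in \<open>auto simp: simp_implies_def slin_smult[OF tl] tw_fun(2)[OF q M D(2)] ring_hom_def Pi_iff\<close>)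
    finally show "s = ?L s" .
  qed
qed

text \<open>Both sides are spanned by the twisted basis vectors outside \<open>K\<close>.\<close>

lemma tw_sub_csub:
  assumes q: "frob_pow R q \<in> ring_hom R R" and M: "rmod R M" and d: "dual_basis R M n b c" and K: "K \<subseteq> {..<n}"
  shows "tw_sub R q M (csub R M c K) = csub R (twist R q M) (\<lambda>k. tw_fun R q (c k)) K"
proof
  note D = dual_basisD[OF d]
  note d' = twist_dual_basis[OF q M d]
  interpret T: rmod R "twist R q M" by (rule twist_module[OF q M])
  have cr: "cring R" by (rule module_cring[OF M])
  show "tw_sub R q M (csub R M c K) \<subseteq> csub R (twist R q M) (\<lambda>k. tw_fun R q (c k)) K"
    unfolding tw_sub_def
  proof (rule T.mspan_least[OF csub_submodule[OF T.rmod_axioms]])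
    show "tw_in R q M ` csub R M c K \<subseteq> csub R (twist R q M) (\<lambda>k. tw_fun R q (c k)) K"
      using K tw_in_closed[OF q M]
      by (auto simp: csub_def subset_iff tw_fun(2)[OF q M D(2)] frob_zero_one[OF cr q])
  qed (use K dual_basisD(2)[OF d'] in auto)
  show "csub R (twist R q M) (\<lambda>k. tw_fun R q (c k)) K \<subseteq> tw_sub R q M (csub R M c K)"
    unfolding csub_span[OF T.rmod_axioms d' K] tw_sub_def
  proof (rule T.mspan_mono)
    have "b l \<in> csub R M c K" if l: "l \<in> {..<n} - K" for l
    proof -
      have "c k (b l) = \<zero>\<^bsub>R\<^esub>" if "k \<in> K" for k using that l K by (intro D(4)) auto
      then show ?thesis using l D(1) by (simp add: csub_def)
    qed
    then show "(\<lambda>k. tw_in R q M (b k)) ` ({..<n} - K) \<subseteq> tw_in R q M ` csub R M c K" by auto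
  qed
qed

section \<open>Alternating forms on free modules\<close>

text \<open>By multilinearity lists of basis vectors suffice. Repetitions give zero and the other
  lists may be sorted, so only strictly increasing index lists remain.\<close>

lemma aform_basis0:
  assumes N: "rmod R N" and M: "rmod R M" and b: "b ` I \<subseteq> carrier M"
    and \<phi>: "\<phi> \<in> carrier R \<rightarrow> carrier R"
    and h: "aform R \<phi> M (mspan R M (b ` I)) N n h"
    and z: "\<And>ks :: nat list. length ks = n \<Longrightarrow> sorted_wrt (<) ks \<Longrightarrow> set ks \<subseteq> I \<Longrightarrow> h (map b ks) = \<zero>\<^bsub>N\<^esub>"
    and xs: "length xs = n" "set xs \<subseteq> mspan R M (b ` I)"
  shows "h xs = \<zero>\<^bsub>N\<^esub>"
proof (rule aform_span0[OF N M b \<phi> h _ xs])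
  interpret M: rmod R M by fact
  note A = M.mspan_submodule[OF b]
  fix ys assume ys: "length ys = n" "set ys \<subseteq> b ` I"
  then have "ys \<in> lists (b ` I)" by auto
  then obtain ks where ks: "ys = map b ks" "set ks \<subseteq> I" unfolding lists_image by auto
  have bi: "b k \<in> mspan R M (b ` I)" if "k \<in> I" for k using that by (intro M.mspan_incl) auto
  show "h ys = \<zero>\<^bsub>N\<^esub>"
  proof (cases "distinct ks")
    case False
    have "\<not> distinct ys" using False ks(1) by (simp add: distinct_map)
    then show ?thesis
      by (intro aform_not_distinct[OF N M A h ys(1)]) (use ks bi in auto)
  next
    case True
    have "h (map b (sort ks)) = \<zero>\<^bsub>N\<^esub>"
      by (rule z) (use True ks ys in \<open>auto simp: strict_sorted_iff\<close>)
    then show ?thesis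
      by (rule aform_perm0[OF N M A h, rotated -1]) (use ks ys bi in auto)
  qed
qed

text \<open>There is no strictly increasing list of that length in \<open>I\<close>.\<close>

lemma aform_many0:
  assumes N: "rmod R N" and M: "rmod R M" and b: "b ` I \<subseteq> carrier M"
    and \<phi>: "\<phi> \<in> carrier R \<rightarrow> carrier R"
    and h: "aform R \<phi> M (mspan R M (b ` I)) N n h"
    and I: "finite I" "card (I :: nat set) < n"
    and xs: "length xs = n" "set xs \<subseteq> mspan R M (b ` I)"
  shows "h xs = \<zero>\<^bsub>N\<^esub>"
proof (rule aform_basis0[OF N M b \<phi> h _ xs])
  fix ks assume k: "length ks = n" "sorted_wrt (<) ks" "set ks \<subseteq> I"
  have "n = card (set ks)" using k strict_sorted_iff distinct_card by metis
  also have "\<dots> \<le> card I" by (rule card_mono) (use k I in auto)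
  finally show "h (map b ks) = \<zero>\<^bsub>N\<^esub>" using I by simp
qed

text \<open>A strictly increasing list of \<open>card K\<close> indices either enumerates
  \<open>K\<close> or contains an index outside \<open>K\<close>, where the form is killed. So a
  single value decides.\<close>

lemma aform_top0:
  assumes N: "rmod R N" and M: "rmod R M" and b: "b ` I \<subseteq> carrier M"
    and \<phi>: "\<phi> \<in> carrier R \<rightarrow> carrier R"
    and h: "aform R \<phi> M (mspan R M (b ` I)) N (card K) h"
    and K: "finite (K :: nat set)"
    and kill: "\<And>xs k. k \<in> I - K \<Longrightarrow> length xs = card K \<Longrightarrow> set xs \<subseteq> mspan R M (b ` I) \<Longrightarrow> b k \<in> set xs \<Longrightarrow> h xs = \<zero>\<^bsub>N\<^esub>"
    and z: "h (map b (sorted_list_of_set K)) = \<zero>\<^bsub>N\<^esub>"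
    and xs: "length xs = card K" "set xs \<subseteq> mspan R M (b ` I)"
  shows "h xs = \<zero>\<^bsub>N\<^esub>"
proof (rule aform_basis0[OF N M b \<phi> h _ xs])
  interpret M: rmod R M by fact
  fix ks assume k: "length ks = card K" "sorted_wrt (<) ks" "set ks \<subseteq> I"
  have bi: "b k \<in> mspan R M (b ` I)" if "k \<in> I" for k using that by (intro M.mspan_incl) auto
  show "h (map b ks) = \<zero>\<^bsub>N\<^esub>"
  proof (cases "set ks \<subseteq> K")
    case True
    have "card (set ks) = card K" using k strict_sorted_iff distinct_card by metis
    then have "set ks = K" using True K card_subset_eq by blast
    then have "ks = sorted_list_of_set K"
      using k strict_sorted_iff sorted_list_of_set.idem_if_sorted_distinct by metis
    then show ?thesis using z by simp
  next
    case False
    then obtain j where "j \<in> set ks" "j \<in> I - K" using k by auto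
    then show ?thesis by (intro kill) (use k bi in auto)
  qed
qed

fun lifts :: "('r, 'n) module \<Rightarrow> ('m \<Rightarrow> 'r) list \<Rightarrow> ('m list \<Rightarrow> 'n) \<Rightarrow> 'm list \<Rightarrow> 'n" where
  "lifts N [] g = g"
| "lifts N (c # cs) g = lift N c (lifts N cs g)"

lemma lifts_aform:
  assumes N: "rmod R N" and M: "rmod R M" and g: "aform R (\<lambda>r. r) M (carrier M) N n g"
  shows "(\<And>c. c \<in> set cs \<Longrightarrow> lin R M (self_mod R) c) \<Longrightarrow>
    aform R (\<lambda>r. r) M (carrier M) N (n + length cs) (lifts N cs g)"
proof (induction cs)
  case (Cons c cs)
  then show ?case using lift_aform[OF N M, of c "n + length cs" "lifts N cs g"] by simp
qed (use g in simp)

lemma lifts_kill: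
  assumes N: "rmod R N" and M: "rmod R M" and g: "aform R (\<lambda>r. r) M (carrier M) N n g"
    and b: "b \<in> carrier M"
    and k: "\<And>xs. length xs = n \<Longrightarrow> set xs \<subseteq> carrier M \<Longrightarrow> b \<in> set xs \<Longrightarrow> g xs = \<zero>\<^bsub>N\<^esub>"
  shows "(\<And>c. c \<in> set cs \<Longrightarrow> lin R M (self_mod R) c \<and> c b = \<zero>\<^bsub>R\<^esub>) \<Longrightarrow>
    length ys = n + length cs \<Longrightarrow> set ys \<subseteq> carrier M \<Longrightarrow> b \<in> set ys \<Longrightarrow> lifts N cs g ys = \<zero>\<^bsub>N\<^esub>"
proof (induction cs arbitrary: ys)
  case (Cons c cs)
  have af: "aform R (\<lambda>r. r) M (carrier M) N (n + length cs) (lifts N cs g)"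
    by (rule lifts_aform[OF N M g]) (use Cons.prems(1) in auto)
  have cc: "c v \<in> carrier R" if "v \<in> carrier M" for v
    using Cons.prems(1)[of c] fun_closed[of R M c v] that by simp
  show ?case unfolding lifts.simps
    by (rule lift_kill[where n = "n + length cs", OF N M _ _ b])
       (use Cons cc aformD(1)[OF af] in auto)
qed (use k in simp)

text \<open>At each stage \<open>c k\<close> takes \<open>b k\<close>; in all other terms
  \<open>b k\<close> survives among the arguments and is killed by the remaining functionals and by
  \<open>g\<close>.\<close>

lemma lifts_basis:
  assumes N: "rmod R N" and M: "rmod R M" and g: "aform R (\<lambda>r. r) M (carrier M) N n g"
    and d: "dual_basis R M m b c"
    and vs: "length vs = n" "set vs \<subseteq> carrier M"
  shows "distinct ks \<Longrightarrow> set ks \<subseteq> {..<m} \<Longrightarrow>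
    (\<And>k xs. k \<in> set ks \<Longrightarrow> length xs = n \<Longrightarrow> set xs \<subseteq> carrier M \<Longrightarrow> b k \<in> set xs \<Longrightarrow> g xs = \<zero>\<^bsub>N\<^esub>) \<Longrightarrow>
    lifts N (map c ks) g (map b ks @ vs) = g vs"
proof (induction ks)
  case (Cons k ks)
  note D = dual_basisD[OF d]
  have cc: "c k v \<in> carrier R" if "v \<in> carrier M" for v using D(6) Cons.prems that by auto
  have af: "aform R (\<lambda>r. r) M (carrier M) N (n + length (map c ks)) (lifts N (map c ks) g)"
    by (rule lifts_aform[OF N M g]) (use Cons.prems D(2) in auto)
  have bs: "set (map b ks @ vs) \<subseteq> carrier M" using Cons.prems vs D(1) by auto
  have "lift N (c k) (lifts N (map c ks) g) (b k # map b ks @ vs) = lifts N (map c ks) g (map b ks @ vs)"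
  proof (rule lift_hd[OF N _ cc _ bs])
    show "c k (b k) = \<one>\<^bsub>R\<^esub>" using D(3) Cons.prems by auto
    show "lifts N (map c ks) g (map b ks @ vs) \<in> carrier N"
      by (rule aformD(1)[OF af _ bs]) (use vs in simp)
    fix ws assume w: "set ws \<subseteq> set (map b ks @ vs)" "Suc (length ws) = length (map b ks @ vs)"
    show "lifts N (map c ks) g (b k # ws) = \<zero>\<^bsub>N\<^esub>"
    proof (rule lifts_kill[OF N M g, of "b k"])
      fix c' assume "c' \<in> set (map c ks)"
      then obtain j where j: "c' = c j" "j \<in> set ks" by auto
      then have "j < m" "k < m" "j \<noteq> k" using Cons.prems by auto
      then show "lin R M (self_mod R) c' \<and> c' (b k) = \<zero>\<^bsub>R\<^esub>" using D(2)[of j] D(4)[of j k] j by simp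
    next
      show "length xs = n \<Longrightarrow> set xs \<subseteq> carrier M \<Longrightarrow> b k \<in> set xs \<Longrightarrow> g xs = \<zero>\<^bsub>N\<^esub>" for xs
        by (rule Cons.prems(3)[of k]) auto
    qed (use w bs vs Cons.prems(1,2) D(1) in auto)
  qed
  moreover have "lifts N (map c ks) g (map b ks @ vs) = g vs"
    by (rule Cons.IH) (use Cons.prems(1,2) in auto, rule Cons.prems(3), auto)
  ultimately show ?case by simp
qed simp

text \<open>A term in which \<open>c\<close> takes an entry satisfying \<open>Z\<close> has
  coefficient zero, so the surviving terms keep all these entries. The bound \<open>m\<close> is
  left free for the induction.\<close>

lemma lift_count:
  assumes N: "rmod R N" and c: "\<And>v. v \<in> carrier M \<Longrightarrow> c v \<in> carrier R" "\<And>v. Z v \<Longrightarrow> c v = \<zero>\<^bsub>R\<^esub>"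
  shows "(\<And>xs. length xs = n \<Longrightarrow> set xs \<subseteq> carrier M \<Longrightarrow> g xs \<in> carrier N) \<Longrightarrow>
    (\<And>xs. length xs = n \<Longrightarrow> set xs \<subseteq> carrier M \<Longrightarrow> m \<le> length (filter Z xs) \<Longrightarrow> g xs = \<zero>\<^bsub>N\<^esub>) \<Longrightarrow>
    length ys = Suc n \<Longrightarrow> set ys \<subseteq> carrier M \<Longrightarrow> m \<le> length (filter Z ys) \<Longrightarrow> lift N c g ys = \<zero>\<^bsub>N\<^esub>"
proof (induction ys arbitrary: g n m)
  case (Cons y ys)
  interpret N: rmod R N by fact
  have gy: "g ys \<in> carrier N" using Cons.prems by auto
  have 1: "c y \<odot>\<^bsub>N\<^esub> g ys = \<zero>\<^bsub>N\<^esub>"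
  proof (cases "Z y")
    case True then show ?thesis using c gy by simp
  next
    case False then show ?thesis using Cons.prems c by simp
  qed
  have 2: "lift N c (\<lambda>ws. g (y # ws)) ys = \<zero>\<^bsub>N\<^esub>"
  proof (cases n)
    case 0 then show ?thesis using Cons.prems by simp
  next
    case (Suc n')
    show ?thesis
    \<comment> \<open>Fixing \<open>y\<close> as first argument lowers the required count by one
      when \<open>y\<close> itself satisfies \<open>Z\<close>.\<close>
    proof (rule Cons.IH[of n' _ "m - (if Z y then 1 else 0)"])
      fix xs assume "length xs = n'" "set xs \<subseteq> carrier M" "m - (if Z y then 1 else 0) \<le> length (filter Z xs)"
      then show "g (y # xs) = \<zero>\<^bsub>N\<^esub>" by (intro Cons.prems(2)) (use Suc Cons.prems in \<open>auto split: if_splits\<close>)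
    qed (use Suc Cons.prems in \<open>auto split: if_splits\<close>)
  qed
  show ?case using 1 2 by (simp add: N.diff_zero)
qed simp

text \<open>Pigeonhole: entries satisfying \<open>Z\<close> can only go to the \<open>n\<close>
  arguments of \<open>g\<close>, so with more than \<open>n\<close> of them no term
  survives.\<close>

lemma lifts_count:
  assumes N: "rmod R N" and M: "rmod R M" and g: "aform R (\<lambda>r. r) M (carrier M) N n g"
  shows "(\<And>c. c \<in> set cs \<Longrightarrow> lin R M (self_mod R) c \<and> (\<forall>v. Z v \<longrightarrow> c v = \<zero>\<^bsub>R\<^esub>)) \<Longrightarrow>
    length ys = n + length cs \<Longrightarrow> set ys \<subseteq> carrier M \<Longrightarrow> n < length (filter Z ys) \<Longrightarrow> lifts N cs g ys = \<zero>\<^bsub>N\<^esub>"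
proof (induction cs arbitrary: ys)
  case Nil
  then show ?case using length_filter_le[of Z ys] by simp
next
  case (Cons c cs)
  have af: "aform R (\<lambda>r. r) M (carrier M) N (n + length cs) (lifts N cs g)"
    by (rule lifts_aform[OF N M g]) (use Cons.prems(1) in auto)
  have cc: "c v \<in> carrier R" if "v \<in> carrier M" for v
    using Cons.prems(1)[of c] fun_closed[of R M c v] that by simp
  show ?case unfolding lifts.simps
    by (rule lift_count[where M = M and Z = Z and n = "n + length cs" and m = "Suc n", OF N])
       (use Cons cc aformD(1)[OF af] in auto)
qed

lemma lifts_slin:
  assumes N: "rmod R N" and P: "rmod R P" and \<sigma>: "slin R \<phi> N P \<sigma>" and M: "rmod R M"
    and g: "aform R (\<lambda>r. r) M (carrier M) N n g"
    and g': "\<And>xs. length xs = n \<Longrightarrow> set xs \<subseteq> carrier M \<Longrightarrow> g' (map \<tau> xs) = \<sigma> (g xs)"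
  shows "(\<And>k. k \<in> set ks \<Longrightarrow> lin R M (self_mod R) (c k) \<and> (\<forall>v\<in>carrier M. c' k (\<tau> v) = \<phi> (c k v))) \<Longrightarrow>
    length ys = n + length ks \<Longrightarrow> set ys \<subseteq> carrier M \<Longrightarrow>
    lifts P (map c' ks) g' (map \<tau> ys) = \<sigma> (lifts N (map c ks) g ys)"
proof (induction ks arbitrary: ys)
  case (Cons k ks)
  have af: "aform R (\<lambda>r. r) M (carrier M) N (n + length (map c ks)) (lifts N (map c ks) g)"
    by (rule lifts_aform[OF N M g]) (use Cons.prems in auto)
  have cc: "c k v \<in> carrier R" if "v \<in> carrier M" for v
    using Cons.prems(1)[of k] fun_closed[of R M "c k" v] that by simp
  show ?case unfolding lifts.simps list.map(2)
    by (rule lift_slin[where n = "n + length ks" and M = M, OF N P \<sigma>])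
       (use Cons cc aformD(1)[OF af] in auto)
qed (use g' in simp)

text \<open>The determinant form, normalised to one on the basis vectors indexed by \<open>ks\<close>.\<close>

definition dform :: "'r ring \<Rightarrow> (nat \<Rightarrow> 'm \<Rightarrow> 'r) \<Rightarrow> nat list \<Rightarrow> 'm list \<Rightarrow> 'r" where
  "dform R c ks = lifts (self_mod R) (map c ks) (\<lambda>_. \<one>\<^bsub>R\<^esub>)"

lemma dform:
  assumes M: "rmod R M" and d: "dual_basis R M m b c" and ks: "set ks \<subseteq> {..<m}"
  shows "aform R (\<lambda>r. r) M (carrier M) (self_mod R) (length ks) (dform R c ks)"
    and "distinct ks \<Longrightarrow> dform R c ks (map b ks) = \<one>\<^bsub>R\<^esub>"
    and "length xs = length ks \<Longrightarrow> set xs \<subseteq> carrier M \<Longrightarrow> set xs \<inter> csub R M c (set ks) \<noteq> {} \<Longrightarrow> dform R c ks xs = \<zero>\<^bsub>R\<^esub>"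
proof -
  interpret M: rmod R M by fact
  have cr: "cring R" by (rule module_cring[OF M])
  note sm = self_mod_module[OF cr]
  note D = dual_basisD[OF d]
  \<comment> \<open>The iteration starts from the form in no variables with value one.\<close>
  have one: "aform R (\<lambda>r. r) M (carrier M) (self_mod R) 0 (\<lambda>_. \<one>\<^bsub>R\<^esub>)"
    by (rule aformI) (auto simp: self_mod_simps)
  show "aform R (\<lambda>r. r) M (carrier M) (self_mod R) (length ks) (dform R c ks)"
    unfolding dform_def using lifts_aform[OF sm M one, of "map c ks"] D(2) ks by auto
  show "distinct ks \<Longrightarrow> dform R c ks (map b ks) = \<one>\<^bsub>R\<^esub>"
    unfolding dform_def using lifts_basis[OF sm M one d, of "[]" ks] ks by simp
  assume x: "length xs = length ks" "set xs \<subseteq> carrier M" "set xs \<inter> csub R M c (set ks) \<noteq> {}"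
  then obtain y where y: "y \<in> set xs" "y \<in> csub R M c (set ks)" by auto
  then have "dform R c ks xs = \<zero>\<^bsub>self_mod R\<^esub>" unfolding dform_def
    by (intro lifts_kill[OF sm M one, of y]) (use x D(2) ks in \<open>auto simp: csub_def\<close>)
  then show "dform R c ks xs = \<zero>\<^bsub>R\<^esub>" by (simp add: self_mod_simps)
qed

section \<open>Blocks adapted to a basis\<close>

lemma multi_single:
  "multi R \<phi> M [(a, A, B)] N G \<longleftrightarrow> aform R \<phi> M A N a (\<lambda>xs. G [xs]) \<and>
     (\<forall>xs. length xs = a \<and> set xs \<subseteq> A \<and> set xs \<inter> B \<noteq> {} \<longrightarrow> G [xs] = \<zero>\<^bsub>N\<^esub>)" (is "_ = ?r")
proof
  assume m: "multi R \<phi> M [(a, A, B)] N G"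
  show ?r
    using multiD(2)[OF m, of "[]" a A B "[]" "[]" "[]"] multiD(3)[OF m, of "[]" a A B "[]" "[]" "[]"] by auto
next
  assume r: ?r
  then show "multi R \<phi> M [(a, A, B)] N G"
    by (intro multiI) (auto simp: wgen_Cons Cons_eq_append_conv aformD(1)[OF conjunct1[OF r]])
qed

lemma multi_pair:
  "multi R \<phi> M [(a, A, B), (a', A', B')] N G \<longleftrightarrow>
     (\<forall>ys. length ys = a' \<and> set ys \<subseteq> A' \<longrightarrow> aform R \<phi> M A N a (\<lambda>xs. G [xs, ys]) \<and>
        (\<forall>xs. length xs = a \<and> set xs \<subseteq> A \<and> set xs \<inter> B \<noteq> {} \<longrightarrow> G [xs, ys] = \<zero>\<^bsub>N\<^esub>)) \<and>
     (\<forall>xs. length xs = a \<and> set xs \<subseteq> A \<longrightarrow> aform R \<phi> M A' N a' (\<lambda>ys. G [xs, ys]) \<and>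
        (\<forall>ys. length ys = a' \<and> set ys \<subseteq> A' \<and> set ys \<inter> B' \<noteq> {} \<longrightarrow> G [xs, ys] = \<zero>\<^bsub>N\<^esub>))" (is "_ = ?r")
proof
  assume m: "multi R \<phi> M [(a, A, B), (a', A', B')] N G"
  show ?r
    using multiD(2)[OF m, of "[]" a A B "[(a', A', B')]" "[]"] multiD(3)[OF m, of "[]" a A B "[(a', A', B')]" "[]"]
      multiD(2)[OF m, of "[(a, A, B)]" a' A' B' "[]" _ "[]"] multiD(3)[OF m, of "[(a, A, B)]" a' A' B' "[]" _ "[]"]
    by (fastforce simp: wgen_Cons)
next
  assume r: ?r
  show "multi R \<phi> M [(a, A, B), (a', A', B')] N G"
  proof (rule multiI)
    fix xss assume "xss \<in> wgen [(a, A, B), (a', A', B')]"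
    then obtain xs ys where x: "xss = [xs, ys]" "length xs = a" "set xs \<subseteq> A" "length ys = a'" "set ys \<subseteq> A'"
      by (auto simp: wgen_Cons)
    then have "aform R \<phi> M A N a (\<lambda>xs. G [xs, ys])" using r by blast
    then show "G xss \<in> carrier N" using x by (auto dest: aformD(1))
  next
    fix B1 c C C' B2 pre post
    assume "[(a, A, B), (a', A', B')] = B1 @ (c, C, C') # B2" "pre \<in> wgen B1" "post \<in> wgen B2"
    then consider "pre = []" "(c, C, C') = (a, A, B)" "\<exists>ys. post = [ys] \<and> length ys = a' \<and> set ys \<subseteq> A'"
      | "post = []" "(c, C, C') = (a', A', B')" "\<exists>xs. pre = [xs] \<and> length xs = a \<and> set xs \<subseteq> A"
      by (auto simp: Cons_eq_append_conv wgen_Cons)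
    note cs = this
    show "aform R \<phi> M C N c (\<lambda>xs. G (pre @ xs # post))"
      using cs by cases (use r in auto)
    fix xs assume xs: "length xs = c" "set xs \<subseteq> C" "set xs \<inter> C' \<noteq> {}"
    show "G (pre @ xs # post) = \<zero>\<^bsub>N\<^esub>"
      using cs
    proof cases
      case 1
      then obtain ys where y: "post = [ys]" "length ys = a'" "set ys \<subseteq> A'" by blast
      show ?thesis using conjunct1[OF r, rule_format, of ys] 1 y xs by simp
    next
      case 2
      then obtain ys where y: "pre = [ys]" "length ys = a" "set ys \<subseteq> A" by blast
      show ?thesis using conjunct2[OF r, rule_format, of ys] 2 y xs by simp
    qed
  qed
qed

lemma multi_tripleI:
  assumes
    "\<And>ys zs. length ys = a' \<Longrightarrow> set ys \<subseteq> A' \<Longrightarrow> length zs = a'' \<Longrightarrow> set zs \<subseteq> A'' \<Longrightarrow>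
       aform R \<phi> M A N a (\<lambda>xs. G [xs, ys, zs]) \<and>
        (\<forall>xs. length xs = a \<and> set xs \<subseteq> A \<and> set xs \<inter> B \<noteq> {} \<longrightarrow> G [xs, ys, zs] = \<zero>\<^bsub>N\<^esub>)"
    "\<And>xs zs. length xs = a \<Longrightarrow> set xs \<subseteq> A \<Longrightarrow> length zs = a'' \<Longrightarrow> set zs \<subseteq> A'' \<Longrightarrow>
       aform R \<phi> M A' N a' (\<lambda>ys. G [xs, ys, zs]) \<and>
        (\<forall>ys. length ys = a' \<and> set ys \<subseteq> A' \<and> set ys \<inter> B' \<noteq> {} \<longrightarrow> G [xs, ys, zs] = \<zero>\<^bsub>N\<^esub>)"
    "\<And>xs ys. length xs = a \<Longrightarrow> set xs \<subseteq> A \<Longrightarrow> length ys = a' \<Longrightarrow> set ys \<subseteq> A' \<Longrightarrow>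
       aform R \<phi> M A'' N a'' (\<lambda>zs. G [xs, ys, zs]) \<and>
        (\<forall>zs. length zs = a'' \<and> set zs \<subseteq> A'' \<and> set zs \<inter> B'' \<noteq> {} \<longrightarrow> G [xs, ys, zs] = \<zero>\<^bsub>N\<^esub>)"
  shows "multi R \<phi> M [(a, A, B), (a', A', B'), (a'', A'', B'')] N G"
proof (rule multiI)
  fix xss assume "xss \<in> wgen [(a, A, B), (a', A', B'), (a'', A'', B'')]"
  then obtain xs ys zs where x: "xss = [xs, ys, zs]" "length xs = a" "set xs \<subseteq> A" "length ys = a'" "set ys \<subseteq> A'"
    "length zs = a''" "set zs \<subseteq> A''"
    by (auto simp: wgen_Cons)
  then have "aform R \<phi> M A N a (\<lambda>xs. G [xs, ys, zs])" using assms(1) by blast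
  then show "G xss \<in> carrier N" using x by (auto dest: aformD(1))
next
  fix B1 c C C' B2 pre post
  assume "[(a, A, B), (a', A', B'), (a'', A'', B'')] = B1 @ (c, C, C') # B2" "pre \<in> wgen B1" "post \<in> wgen B2"
  then consider "pre = []" "(c, C, C') = (a, A, B)"
        "\<exists>ys zs. post = [ys, zs] \<and> length ys = a' \<and> set ys \<subseteq> A' \<and> length zs = a'' \<and> set zs \<subseteq> A''"
    | "(c, C, C') = (a', A', B')" "\<exists>xs. pre = [xs] \<and> length xs = a \<and> set xs \<subseteq> A"
        "\<exists>zs. post = [zs] \<and> length zs = a'' \<and> set zs \<subseteq> A''"
    | "post = []" "(c, C, C') = (a'', A'', B'')"
       "\<exists>xs ys. pre = [xs, ys] \<and> length xs = a \<and> set xs \<subseteq> A \<and> length ys = a' \<and> set ys \<subseteq> A'"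
    by (auto simp: Cons_eq_append_conv wgen_Cons)
  note cs = this
  show "aform R \<phi> M C N c (\<lambda>xs. G (pre @ xs # post))"
    using cs
  proof cases
    case 1
    then obtain ys zs where y: "post = [ys, zs]" "length ys = a'" "set ys \<subseteq> A'" "length zs = a''" "set zs \<subseteq> A''" by blast
    show ?thesis using assms(1)[OF y(2-5)] 1 y(1) by simp
  next
    case 2
    then obtain ys zs where y: "pre = [ys]" "post = [zs]" "length ys = a" "set ys \<subseteq> A" "length zs = a''" "set zs \<subseteq> A''" by blast
    show ?thesis using assms(2)[OF y(3-6)] 2 y(1,2) by simp
  next
    case 3
    then obtain ys zs where y: "pre = [ys, zs]" "length ys = a" "set ys \<subseteq> A" "length zs = a'" "set zs \<subseteq> A'" by blast
    show ?thesis using assms(3)[OF y(2-5)] 3 y(1) by simp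
  qed
  fix xs assume xs: "length xs = c" "set xs \<subseteq> C" "set xs \<inter> C' \<noteq> {}"
  show "G (pre @ xs # post) = \<zero>\<^bsub>N\<^esub>"
    using cs
  proof cases
    case 1
    then obtain ys zs where y: "post = [ys, zs]" "length ys = a'" "set ys \<subseteq> A'" "length zs = a''" "set zs \<subseteq> A''" by blast
    show ?thesis using conjunct2[OF assms(1)[OF y(2-5)], rule_format, of xs] 1 y(1) xs by simp
  next
    case 2
    then obtain ys zs where y: "pre = [ys]" "post = [zs]" "length ys = a" "set ys \<subseteq> A" "length zs = a''" "set zs \<subseteq> A''" by blast
    show ?thesis using conjunct2[OF assms(2)[OF y(3-6)], rule_format, of xs] 2 y(1,2) xs by simp
  next
    case 3
    then obtain ys zs where y: "pre = [ys, zs]" "length ys = a" "set ys \<subseteq> A" "length zs = a'" "set zs \<subseteq> A'" by blast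
    show ?thesis using conjunct2[OF assms(3)[OF y(2-5)], rule_format, of xs] 3 y(1) xs by simp
  qed
qed

lemma slin_to_smult:
  assumes "rmod R N" "y \<in> carrier N" shows "lin R (self_mod R) N (\<lambda>r. r \<odot>\<^bsub>N\<^esub> y)"
proof -
  interpret N: rmod R N by fact
  show ?thesis using assms(2) by (auto simp: slin_def self_mod_simps N.smult_l_distr N.smult_assoc1)
qed

lemma lin_fun_smult:
  assumes "rmod R N" "y \<in> carrier N" "lin R M (self_mod R) \<kappa>"
  shows "lin R M N (\<lambda>w. \<kappa> w \<odot>\<^bsub>N\<^esub> y)"
  using slin_comp[OF assms(3) slin_to_smult[OF assms(1,2)]] by simp

text \<open>Free of rank one on a named symbol, together with its coordinate. Naming the symbol
  makes it possible to say that the generator of a twist is the twist of the generator.\<close>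

definition rank1 :: "'r ring \<Rightarrow> ('r, 'm) module \<Rightarrow> 'm block list \<Rightarrow> 'm list list \<Rightarrow> (('m, 'r) wedge \<Rightarrow> 'r) \<Rightarrow> bool" where
  "rank1 R M Bs gen \<kappa> \<longleftrightarrow> blocks_ok R M Bs \<and> gen \<in> wgen Bs \<and> lin R (wedges R M Bs) (self_mod R) \<kappa> \<and>
     \<kappa> (wsym R M Bs gen) = \<one>\<^bsub>R\<^esub> \<and>
     (\<forall>w\<in>carrier (wedges R M Bs). w = \<kappa> w \<odot>\<^bsub>wedges R M Bs\<^esub> wsym R M Bs gen)"

lemma rank1_eq:
  assumes r: "rank1 R M Bs gen \<kappa>" and M: "rmod R M"
    and u: "slin R \<phi> (wedges R M Bs) N u" and v: "slin R \<phi> (wedges R M Bs) N v"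
    and e: "u (wsym R M Bs gen) = v (wsym R M Bs gen)" and w: "w \<in> carrier (wedges R M Bs)"
  shows "u w = v w"
proof -
  have ok: "blocks_ok R M Bs" and g: "gen \<in> wgen Bs" and k: "lin R (wedges R M Bs) (self_mod R) \<kappa>"
   and w': "w = \<kappa> w \<odot>\<^bsub>wedges R M Bs\<^esub> wsym R M Bs gen" using r w by (auto simp: rank1_def)
  have kw: "\<kappa> w \<in> carrier R" by (rule fun_closed[OF k w])
  have gc: "wsym R M Bs gen \<in> carrier (wedges R M Bs)" by (rule wsym_closed[OF M ok g])
  have "u w = \<phi> (\<kappa> w) \<odot>\<^bsub>N\<^esub> u (wsym R M Bs gen)" using slin_smult[OF u kw gc] w' by simp
  also have "\<dots> = v w" using slin_smult[OF v kw gc] w' e by simp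
  finally show ?thesis .
qed

text \<open>For \<open>K \<subseteq> I\<close>, the submodule \<open>A\<close> is spanned by the
  basis vectors with index in \<open>I\<close> and \<open>B\<close> by those with index in
  \<open>I - K\<close>. So \<open>A/B\<close> has a basis indexed by \<open>K\<close>, and the block
  is its determinant.\<close>

definition blk :: "'r ring \<Rightarrow> ('r, 'm) module \<Rightarrow> (nat \<Rightarrow> 'm \<Rightarrow> 'r) \<Rightarrow> nat \<Rightarrow> nat set \<Rightarrow> nat set \<Rightarrow> 'm block" where
  "blk R M c n I K = (card K, csub R M c ({..<n} - I), csub R M c (({..<n} - I) \<union> K))"

lemma csub_subset_carrier: "csub R M c K \<subseteq> carrier M"
  by (auto simp: csub_def)

lemma csub_mono: "K \<subseteq> L \<Longrightarrow> csub R M c L \<subseteq> csub R M c K"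
  by (auto simp: csub_def)

lemma blk_ok:
  assumes "rmod R M" "dual_basis R M n b c"
  shows "submodule (csub R M c ({..<n} - I)) R M"
  by (rule csub_submodule[OF assms(1)]) (use dual_basisD(2)[OF assms(2)] in auto)

lemma blk_basis:
  assumes M: "rmod R M" and d: "dual_basis R M n b c" and k: "k \<in> I" "I \<subseteq> {..<n}"
  shows "b k \<in> csub R M c ({..<n} - I)"
proof -
  have "c l (b k) = \<zero>\<^bsub>R\<^esub>" if "l \<in> {..<n} - I" for l
    using that k by (intro dual_basisD(4)[OF d]) auto
  then show ?thesis using dual_basisD(1)[OF d] k by (auto simp: csub_def)
qed

text \<open>The basis vectors of the larger submodule with index outside \<open>K\<close> lie in the
  smaller one, so \<open>aform_top0\<close> applies.\<close>

lemma blk_top0: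
  assumes N: "rmod R N" and M: "rmod R M" and d: "dual_basis R M n b c" and IK: "K \<subseteq> I" "I \<subseteq> {..<n}"
    and \<phi>: "\<phi> \<in> carrier R \<rightarrow> carrier R"
    and h: "aform R \<phi> M (csub R M c ({..<n} - I)) N (card K) h"
    and kill: "\<And>xs. length xs = card K \<Longrightarrow> set xs \<subseteq> csub R M c ({..<n} - I) \<Longrightarrow>
       set xs \<inter> csub R M c (({..<n} - I) \<union> K) \<noteq> {} \<Longrightarrow> h xs = \<zero>\<^bsub>N\<^esub>"
    and z: "h (map b (sorted_list_of_set K)) = \<zero>\<^bsub>N\<^esub>"
    and xs: "length xs = card K" "set xs \<subseteq> csub R M c ({..<n} - I)"
  shows "h xs = \<zero>\<^bsub>N\<^esub>"
proof -
  have e: "csub R M c ({..<n} - I) = mspan R M (b ` I)"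
  proof -
    have "{..<n} - ({..<n} - I) = I" using IK by auto
    then show ?thesis using csub_span[OF M d, of "{..<n} - I"] by simp
  qed
  have fK: "finite K" using IK by (meson finite_lessThan finite_subset)
  have bI: "b ` I \<subseteq> carrier M" using dual_basisD(1)[OF d] IK by auto
  show ?thesis
  proof (rule aform_top0[OF N M bI \<phi> h[unfolded e] fK _ z xs[unfolded e]])
    fix xs k assume k: "k \<in> I - K" and x: "length xs = card K" "set xs \<subseteq> mspan R M (b ` I)" "b k \<in> set xs"
    have "c l (b k) = \<zero>\<^bsub>R\<^esub>" if "l \<in> ({..<n} - I) \<union> K" for l
      using that k IK by (intro dual_basisD(4)[OF d]) auto
    then have "b k \<in> csub R M c (({..<n} - I) \<union> K)" using k IK dual_basisD(1)[OF d] by (auto simp: csub_def)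
    then show "h xs = \<zero>\<^bsub>N\<^esub>" using kill x e by blast
  qed
qed

text \<open>The determinant form for the indices in \<open>K\<close> serves as coordinate. That the
  generator spans is the vanishing of a symbol minus its coordinate times the generator, a form to
  which \<open>blk_top0\<close> applies.\<close>

lemma rank1_single:
  assumes M: "rmod R M" and d: "dual_basis R M n b c" and IK: "K \<subseteq> I" "I \<subseteq> {..<n}"
  shows "\<exists>\<kappa>. rank1 R M [blk R M c n I K] [map b (sorted_list_of_set K)] \<kappa> \<and>
    (\<forall>xs. length xs = card K \<and> set xs \<subseteq> csub R M c ({..<n} - I) \<longrightarrow>
       \<kappa> (wsym R M [blk R M c n I K] [xs]) = dform R c (sorted_list_of_set K) xs)"
proof -
  interpret M: rmod R M by fact
  have cr: "cring R" by (rule module_cring[OF M])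
  note sm = self_mod_module[OF cr]
  let ?A = "csub R M c ({..<n} - I)" and ?B = "csub R M c (({..<n} - I) \<union> K)" and ?ks = "sorted_list_of_set K"
  let ?Bs = "[blk R M c n I K]" and ?g = "map b (sorted_list_of_set K)"
  have fK: "finite K" using IK by (meson finite_lessThan finite_subset)
  have ks: "set ?ks = K" "length ?ks = card K" "distinct ?ks" using fK by auto
  have A: "submodule ?A R M" by (rule blk_ok[OF M d])
  have AB: "?B \<subseteq> ?A" "?A \<subseteq> carrier M" by (auto simp: csub_def)
  have ok: "blocks_ok R M ?Bs" using A AB by (auto simp: blocks_ok_def blk_def)
  interpret W: rmod R "wedges R M ?Bs" by (rule wedges_module[OF M ok])
  have gA: "set ?g \<subseteq> ?A" using blk_basis[OF M d _ IK(2)] IK ks by auto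
  have g: "[?g] \<in> wgen ?Bs" using ks gA by (auto simp: wgen_Cons blk_def)
  note D = dform[OF M d, of ?ks]
  have ksn: "set ?ks \<subseteq> {..<n}" using ks IK by auto
  have DA: "aform R (\<lambda>r. r) M ?A (self_mod R) (card K) (dform R c ?ks)"
    using aform_subset[OF D(1)[OF ksn] AB(2)] ks by simp
  have DB: "dform R c ?ks xs = \<zero>\<^bsub>R\<^esub>" if "length xs = card K" "set xs \<subseteq> ?A" "set xs \<inter> ?B \<noteq> {}" for xs
  proof (rule D(3)[OF ksn])
    have "?B \<subseteq> csub R M c (set ?ks)" using ks by (intro csub_mono) auto
    then show "set xs \<inter> csub R M c (set ?ks) \<noteq> {}" using that by auto
  qed (use that ks AB in auto)
  have "multi R (\<lambda>r. r) M ?Bs (self_mod R) (\<lambda>xss. dform R c ?ks (hd xss))"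
    unfolding blk_def multi_single using DA DB by (simp add: self_mod_simps)
  note l = multi_lext[OF M ok sm this]
  define \<kappa> where "\<kappa> = lext R (self_mod R) (\<lambda>xss. dform R c ?ks (hd xss))"
  have k: "lin R (wedges R M ?Bs) (self_mod R) \<kappa>" using l(1) by (simp add: \<kappa>_def)
  have kv: "\<kappa> (wsym R M ?Bs [xs]) = dform R c ?ks xs" if "length xs = card K" "set xs \<subseteq> ?A" for xs
    using l(2)[of "[xs]"] that by (simp add: \<kappa>_def wgen_Cons blk_def)
  have gc: "wsym R M ?Bs [?g] \<in> carrier (wedges R M ?Bs)" by (rule wsym_closed[OF M ok g])
  have k1: "\<kappa> (wsym R M ?Bs [?g]) = \<one>\<^bsub>R\<^esub>" using kv[of ?g] D(2)[OF ksn ks(3)] ks gA by simp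
  have sy: "multi R (\<lambda>r. r) M ?Bs (wedges R M ?Bs) (wsym R M ?Bs)" by (rule multi_wsym[OF M ok])
  have sy1: "aform R (\<lambda>r. r) M ?A (wedges R M ?Bs) (card K) (\<lambda>xs. wsym R M ?Bs [xs])"
    and sy2: "length xs = card K \<Longrightarrow> set xs \<subseteq> ?A \<Longrightarrow> set xs \<inter> ?B \<noteq> {} \<Longrightarrow> wsym R M ?Bs [xs] = \<zero>\<^bsub>wedges R M ?Bs\<^esub>" for xs
    using sy[unfolded blk_def multi_single, folded blk_def] by auto
  have id: "(\<lambda>r. r) \<in> carrier R \<rightarrow> carrier R" by auto
  have h: "aform R (\<lambda>r. r) M ?A (wedges R M ?Bs) (card K)
     (\<lambda>xs. wsym R M ?Bs [xs] \<ominus>\<^bsub>wedges R M ?Bs\<^esub> dform R c ?ks xs \<odot>\<^bsub>wedges R M ?Bs\<^esub> wsym R M ?Bs [?g])"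
    by (rule aform_diff[OF sy1 _ W.rmod_axioms id A M])
       (use aform_comp[OF DA slin_to_smult[OF W.rmod_axioms gc] sm W.rmod_axioms id] in simp)
  have "w = \<kappa> w \<odot>\<^bsub>wedges R M ?Bs\<^esub> wsym R M ?Bs [?g]" if w: "w \<in> carrier (wedges R M ?Bs)" for w
  proof (rule wedges_eq[OF M ok W.rmod_axioms slin_id[OF W.rmod_axioms] lin_fun_smult[OF W.rmod_axioms gc k] _ w])
    fix xss assume "xss \<in> wgen ?Bs"
    then obtain xs where x: "xss = [xs]" "length xs = card K" "set xs \<subseteq> ?A"
      by (auto simp: wgen_Cons blk_def)
    have "wsym R M ?Bs [xs] \<ominus>\<^bsub>wedges R M ?Bs\<^esub> dform R c ?ks xs \<odot>\<^bsub>wedges R M ?Bs\<^esub> wsym R M ?Bs [?g] = \<zero>\<^bsub>wedges R M ?Bs\<^esub>"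
      by (rule blk_top0[OF W.rmod_axioms M d IK id h _ _ x(2,3)])
         (use sy2 DB gc D(2)[OF ksn ks(3)] in \<open>simp_all add: W.diff_zero W.diff_eq_zero\<close>)
    moreover have "dform R c ?ks xs \<in> carrier R" using aformD(1)[OF DA x(2,3)] by (simp add: self_mod_simps)
    moreover have "wsym R M ?Bs [xs] \<in> carrier (wedges R M ?Bs)" using aformD(1)[OF sy1 x(2,3)] .
    ultimately show "wsym R M ?Bs xss = \<kappa> (wsym R M ?Bs xss) \<odot>\<^bsub>wedges R M ?Bs\<^esub> wsym R M ?Bs [?g]"
      using kv[OF x(2,3)] gc by (simp add: x(1) W.diff_eq_zero)
  qed
  then have "rank1 R M ?Bs [?g] \<kappa>" using ok g k k1 unfolding rank1_def by simp
  then show ?thesis using kv by (intro exI[of _ \<kappa>]) simp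
qed

text \<open>The coordinate is the product of two determinant forms, and a symbol is reduced to the
  generator one block at a time.\<close>

lemma rank1_pair:
  assumes M: "rmod R M" and d: "dual_basis R M n b c" and IK: "K \<subseteq> I" "I \<subseteq> {..<n}" "K' \<subseteq> I'" "I' \<subseteq> {..<n}"
  shows "\<exists>\<kappa>. rank1 R M [blk R M c n I K, blk R M c n I' K'] [map b (sorted_list_of_set K), map b (sorted_list_of_set K')] \<kappa>"
proof -
  interpret M: rmod R M by fact
  have cr: "cring R" by (rule module_cring[OF M])
  note sm = self_mod_module[OF cr]
  let ?A = "csub R M c ({..<n} - I)" and ?B = "csub R M c (({..<n} - I) \<union> K)" and ?ks = "sorted_list_of_set K"
  let ?A' = "csub R M c ({..<n} - I')" and ?B' = "csub R M c (({..<n} - I') \<union> K')" and ?ks' = "sorted_list_of_set K'"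
  let ?Bs = "[blk R M c n I K, blk R M c n I' K']" and ?g = "map b ?ks" and ?g' = "map b ?ks'"
  have fK: "finite K" "finite K'" using IK by (meson finite_lessThan finite_subset)+
  have ks: "set ?ks = K" "length ?ks = card K" "distinct ?ks" "set ?ks' = K'" "length ?ks' = card K'" "distinct ?ks'"
    using fK by auto
  have A: "submodule ?A R M" "submodule ?A' R M" by (rule blk_ok[OF M d])+
  have AB: "?B \<subseteq> ?A" "?A \<subseteq> carrier M" "?B' \<subseteq> ?A'" "?A' \<subseteq> carrier M" by (auto simp: csub_def)
  have ok: "blocks_ok R M ?Bs" using A AB by (auto simp: blocks_ok_def blk_def)
  let ?W = "wedges R M ?Bs"
  interpret W: rmod R ?W by (rule wedges_module[OF M ok])
  have gA: "set ?g \<subseteq> ?A" "set ?g' \<subseteq> ?A'"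
    using blk_basis[OF M d _ IK(2)] blk_basis[OF M d _ IK(4)] IK ks by auto
  have g: "[?g, ?g'] \<in> wgen ?Bs" using ks gA by (auto simp: wgen_Cons blk_def)
  have ksn: "set ?ks \<subseteq> {..<n}" "set ?ks' \<subseteq> {..<n}" using ks IK by auto
  note D = dform[OF M d ksn(1)] and D' = dform[OF M d ksn(2)]
  have DA: "aform R (\<lambda>r. r) M ?A (self_mod R) (card K) (dform R c ?ks)"
    "aform R (\<lambda>r. r) M ?A' (self_mod R) (card K') (dform R c ?ks')"
    using aform_subset[OF D(1) AB(2)] aform_subset[OF D'(1) AB(4)] ks by simp_all
  have DB: "dform R c ?ks xs = \<zero>\<^bsub>R\<^esub>" if "length xs = card K" "set xs \<subseteq> ?A" "set xs \<inter> ?B \<noteq> {}" for xs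
  proof (rule D(3))
    have "?B \<subseteq> csub R M c (set ?ks)" using ks by (intro csub_mono) auto
    then show "set xs \<inter> csub R M c (set ?ks) \<noteq> {}" using that by auto
  qed (use that ks AB in auto)
  have DB': "dform R c ?ks' xs = \<zero>\<^bsub>R\<^esub>" if "length xs = card K'" "set xs \<subseteq> ?A'" "set xs \<inter> ?B' \<noteq> {}" for xs
  proof (rule D'(3))
    have "?B' \<subseteq> csub R M c (set ?ks')" using ks by (intro csub_mono) auto
    then show "set xs \<inter> csub R M c (set ?ks') \<noteq> {}" using that by auto
  qed (use that ks AB in auto)
  have Dc: "dform R c ?ks xs \<in> carrier R" if "length xs = card K" "set xs \<subseteq> ?A" for xs
    using aformD(1)[OF DA(1) that] by (simp add: self_mod_simps)
  have Dc': "dform R c ?ks' xs \<in> carrier R" if "length xs = card K'" "set xs \<subseteq> ?A'" for xs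
    using aformD(1)[OF DA(2) that] by (simp add: self_mod_simps)
  have id: "(\<lambda>r. r) \<in> carrier R \<rightarrow> carrier R" by auto
  have mulr: "lin R (self_mod R) (self_mod R) (\<lambda>r. r \<otimes>\<^bsub>R\<^esub> y)" if "y \<in> carrier R" for y
    using slin_to_smult[OF sm, of y] that by (simp add: self_mod_simps)
  have mull: "lin R (self_mod R) (self_mod R) (\<lambda>r. y \<otimes>\<^bsub>R\<^esub> r)" if "y \<in> carrier R" for y
    using that by (auto simp: slin_def self_mod_simps M.R.r_distr M.R.m_lcomm)
  have "multi R (\<lambda>r. r) M ?Bs (self_mod R) (\<lambda>xss. dform R c ?ks (xss ! 0) \<otimes>\<^bsub>R\<^esub> dform R c ?ks' (xss ! 1))"
    unfolding blk_def multi_pair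
    using aform_comp[OF DA(1) mulr[OF Dc'] sm sm id] aform_comp[OF DA(2) mull[OF Dc] sm sm id] DB DB' Dc Dc'
    by (simp add: self_mod_simps)
  note l = multi_lext[OF M ok sm this]
  define \<kappa> where "\<kappa> = lext R (self_mod R) (\<lambda>xss. dform R c ?ks (xss ! 0) \<otimes>\<^bsub>R\<^esub> dform R c ?ks' (xss ! 1))"
  have k: "lin R ?W (self_mod R) \<kappa>" using l(1) by (simp add: \<kappa>_def)
  have kv: "\<kappa> (wsym R M ?Bs [xs, ys]) = dform R c ?ks xs \<otimes>\<^bsub>R\<^esub> dform R c ?ks' ys"
    if "length xs = card K" "set xs \<subseteq> ?A" "length ys = card K'" "set ys \<subseteq> ?A'" for xs ys
    using l(2)[of "[xs, ys]"] that by (simp add: \<kappa>_def wgen_Cons blk_def)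
  have gc: "wsym R M ?Bs [?g, ?g'] \<in> carrier ?W" by (rule wsym_closed[OF M ok g])
  have k1: "\<kappa> (wsym R M ?Bs [?g, ?g']) = \<one>\<^bsub>R\<^esub>" using kv[of ?g ?g'] D(2) D'(2) ks gA by simp
  have sy: "multi R (\<lambda>r. r) M ?Bs ?W (wsym R M ?Bs)" by (rule multi_wsym[OF M ok])
  note sy' = sy[unfolded blk_def multi_pair, folded blk_def]
  have sy1: "aform R (\<lambda>r. r) M ?A ?W (card K) (\<lambda>xs. wsym R M ?Bs [xs, ys])"
    and sy2: "length xs = card K \<Longrightarrow> set xs \<subseteq> ?A \<Longrightarrow> set xs \<inter> ?B \<noteq> {} \<Longrightarrow> wsym R M ?Bs [xs, ys] = \<zero>\<^bsub>?W\<^esub>"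
    if "length ys = card K'" "set ys \<subseteq> ?A'" for xs ys
    using sy' that by auto
  have sy3: "aform R (\<lambda>r. r) M ?A' ?W (card K') (\<lambda>ys. wsym R M ?Bs [xs, ys])"
    and sy4: "length ys = card K' \<Longrightarrow> set ys \<subseteq> ?A' \<Longrightarrow> set ys \<inter> ?B' \<noteq> {} \<Longrightarrow> wsym R M ?Bs [xs, ys] = \<zero>\<^bsub>?W\<^esub>"
    if "length xs = card K" "set xs \<subseteq> ?A" for xs ys
    using sy' that by auto
  have 1: "wsym R M ?Bs [xs, ys] = dform R c ?ks xs \<odot>\<^bsub>?W\<^esub> wsym R M ?Bs [?g, ys]"
    if x: "length xs = card K" "set xs \<subseteq> ?A" and y: "length ys = card K'" "set ys \<subseteq> ?A'" for xs ys
  proof -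
    have gy: "wsym R M ?Bs [?g, ys] \<in> carrier ?W" using aformD(1)[OF sy1[OF y], of ?g] ks gA by simp
    have h: "aform R (\<lambda>r. r) M ?A ?W (card K)
       (\<lambda>xs. wsym R M ?Bs [xs, ys] \<ominus>\<^bsub>?W\<^esub> dform R c ?ks xs \<odot>\<^bsub>?W\<^esub> wsym R M ?Bs [?g, ys])"
      by (rule aform_diff[OF sy1[OF y] _ W.rmod_axioms id A(1) M])
         (use aform_comp[OF DA(1) slin_to_smult[OF W.rmod_axioms gy] sm W.rmod_axioms id] in simp)
    have "wsym R M ?Bs [xs, ys] \<ominus>\<^bsub>?W\<^esub> dform R c ?ks xs \<odot>\<^bsub>?W\<^esub> wsym R M ?Bs [?g, ys] = \<zero>\<^bsub>?W\<^esub>"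
      by (rule blk_top0[OF W.rmod_axioms M d IK(1,2) id h _ _ x])
         (use sy2[OF y] DB gy D(2) ks in \<open>simp_all add: W.diff_zero W.diff_eq_zero\<close>)
    then show ?thesis using Dc[OF x] gy aformD(1)[OF sy1[OF y] x] by (simp add: W.diff_eq_zero)
  qed
  have 2: "wsym R M ?Bs [xs, ys] = dform R c ?ks' ys \<odot>\<^bsub>?W\<^esub> wsym R M ?Bs [xs, ?g']"
    if x: "length xs = card K" "set xs \<subseteq> ?A" and y: "length ys = card K'" "set ys \<subseteq> ?A'" for xs ys
  proof -
    have gy: "wsym R M ?Bs [xs, ?g'] \<in> carrier ?W" using aformD(1)[OF sy3[OF x], of ?g'] ks gA by simp
    have h: "aform R (\<lambda>r. r) M ?A' ?W (card K')
       (\<lambda>ys. wsym R M ?Bs [xs, ys] \<ominus>\<^bsub>?W\<^esub> dform R c ?ks' ys \<odot>\<^bsub>?W\<^esub> wsym R M ?Bs [xs, ?g'])"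
      by (rule aform_diff[OF sy3[OF x] _ W.rmod_axioms id A(2) M])
         (use aform_comp[OF DA(2) slin_to_smult[OF W.rmod_axioms gy] sm W.rmod_axioms id] in simp)
    have "wsym R M ?Bs [xs, ys] \<ominus>\<^bsub>?W\<^esub> dform R c ?ks' ys \<odot>\<^bsub>?W\<^esub> wsym R M ?Bs [xs, ?g'] = \<zero>\<^bsub>?W\<^esub>"
      by (rule blk_top0[OF W.rmod_axioms M d IK(3,4) id h _ _ y])
         (use sy4[OF x] DB' gy D'(2) ks in \<open>simp_all add: W.diff_zero W.diff_eq_zero\<close>)
    then show ?thesis using Dc'[OF y] gy aformD(1)[OF sy3[OF x] y] by (simp add: W.diff_eq_zero)
  qed
  have "w = \<kappa> w \<odot>\<^bsub>?W\<^esub> wsym R M ?Bs [?g, ?g']" if w: "w \<in> carrier ?W" for w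
  proof (rule wedges_eq[OF M ok W.rmod_axioms slin_id[OF W.rmod_axioms] lin_fun_smult[OF W.rmod_axioms gc k] _ w])
    fix xss assume "xss \<in> wgen ?Bs"
    then obtain xs ys where x: "xss = [xs, ys]" "length xs = card K" "set xs \<subseteq> ?A" "length ys = card K'" "set ys \<subseteq> ?A'"
      by (auto simp: wgen_Cons blk_def)
    have "wsym R M ?Bs [xs, ys] = dform R c ?ks xs \<odot>\<^bsub>?W\<^esub> (dform R c ?ks' ys \<odot>\<^bsub>?W\<^esub> wsym R M ?Bs [?g, ?g'])"
      using 1[OF x(2-5)] 2[of ?g ys] x ks gA by simp
    then show "wsym R M ?Bs xss = \<kappa> (wsym R M ?Bs xss) \<odot>\<^bsub>?W\<^esub> wsym R M ?Bs [?g, ?g']"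
      using kv[OF x(2-5)] gc Dc[OF x(2,3)] Dc'[OF x(4,5)] by (simp add: x(1) W.smult_assoc1)
  qed
  then have "rank1 R M ?Bs [?g, ?g'] \<kappa>" using ok g k k1 unfolding rank1_def by simp
  then show ?thesis by (intro exI[of _ \<kappa>])
qed

text \<open>Twisting changes the basis and the coordinates of an adapted block but not its index
  sets.\<close>

lemma tw_blk:
  assumes "frob_pow R q \<in> ring_hom R R" "rmod R M" "dual_basis R M n b c" "K \<subseteq> {..<n}"
  shows "(case blk R M c n I K of (a, A, B) \<Rightarrow> (a, tw_sub R q M A, tw_sub R q M B)) =
    blk R (twist R q M) (\<lambda>k. tw_fun R q (c k)) n I K"
  unfolding blk_def using tw_sub_csub[OF assms(1-3), of "{..<n} - I"]
    tw_sub_csub[OF assms(1-3), of "({..<n} - I) \<union> K"] assms(4) by (simp add: Diff_subset)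

section \<open>Twists of linear maps, and their compatibility with natural maps\<close>

section \<open>Twisted maps\<close>

text \<open>The existence half of the description of \<open>htwist\<close>.\<close>

definition twistable :: "'r ring \<Rightarrow> nat \<Rightarrow> nat \<Rightarrow> ('r, 'm) module \<Rightarrow> 'm block list \<Rightarrow>
    ('r, 'm) module \<Rightarrow> 'm block list \<Rightarrow> (('m, 'r) wedge \<Rightarrow> (('m \<Rightarrow> 'r) set, 'r) wedge) \<Rightarrow> bool" where
  "twistable R p q M Bs N Cs u \<longleftrightarrow> (\<exists>u'. lin R (wtwist R q M Bs) (wtwist R (p * q) N Cs) u' \<and>
     (\<forall>x\<in>carrier (wedges R M Bs). u' (wtw_in R q M Bs x) = wtw_tw R p q N Cs (u x)))"

lemma htwist_twistable:
  assumes q: "frob_pow R q \<in> ring_hom R R" and M: "rmod R M" and ok: "blocks_ok R M Bs"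
    and W: "rmod R (wtwist R (p * q) N Cs)"
    and t: "twistable R p q M Bs N Cs u"
  shows "lin R (wtwist R q M Bs) (wtwist R (p * q) N Cs) (htwist R p q M Bs N Cs u)"
    and "x \<in> carrier (wedges R M Bs) \<Longrightarrow> htwist R p q M Bs N Cs u (wtw_in R q M Bs x) = wtw_tw R p q N Cs (u x)"
proof -
  obtain u' where u': "lin R (wtwist R q M Bs) (wtwist R (p * q) N Cs) u'"
     "\<And>x. x \<in> carrier (wedges R M Bs) \<Longrightarrow> u' (wtw_in R q M Bs x) = wtw_tw R p q N Cs (u x)"
    using t by (auto simp: twistable_def)
  note h = htwist[OF q M ok W u'(1) u'(2)]
  show "lin R (wtwist R q M Bs) (wtwist R (p * q) N Cs) (htwist R p q M Bs N Cs u)"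
    by (rule slin_cong[OF u'(1) _ wtwist_module[OF q M ok]]) (simp add: h)
  show "x \<in> carrier (wedges R M Bs) \<Longrightarrow> htwist R p q M Bs N Cs u (wtw_in R q M Bs x) = wtw_tw R p q N Cs (u x)"
    using h[of "wtw_in R q M Bs x"] u'(2) slin_closed[OF wtw_in(1)[OF q M ok]] by simp
qed

text \<open>On a source of rank one the twisted map is prescribed by the image of the generator, and
  compatibility with \<open>u\<close> has to be tested on the generator alone.\<close>

lemma twistable_rank1:
  assumes q: "frob_pow R p \<in> ring_hom R R" "frob_pow R q \<in> ring_hom R R" "frob_pow R (p * q) \<in> ring_hom R R"
    and M: "rmod R M" and N: "rmod R N" and okN: "blocks_ok R N Cs"
    and r: "rank1 R M Bs gen \<kappa>" "rank1 R (twist R q M) (tw_blocks R q M Bs) (map (map (tw_in R q M)) gen) \<kappa>'"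
    and u: "lin R (wedges R M Bs) (wtwist R p N Cs) u"
  shows "twistable R p q M Bs N Cs u"
proof -
  have ok: "blocks_ok R M Bs" and g: "gen \<in> wgen Bs" using r(1) by (auto simp: rank1_def)
  let ?W = "wtwist R (p * q) N Cs" and ?T = "twist R q M"
  have W: "rmod R ?W" by (rule wtwist_module[OF q(3) N okN])
  interpret W: rmod R ?W by (rule W)
  define s where "s x = wtw_tw R p q N Cs (u x)" for x
  have s: "slin R (frob_pow R q) (wedges R M Bs) ?W s"
    unfolding s_def using slin_comp[OF u wtw_tw(1)[OF q N okN]] by simp
  let ?g = "wsym R M Bs gen"
  have gc: "?g \<in> carrier (wedges R M Bs)" by (rule wsym_closed[OF M ok g])
  have k: "lin R (wtwist R q M Bs) (self_mod R) \<kappa>'" using r(2) by (simp add: rank1_def wtwist_def)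
  define u' where "u' w = \<kappa>' w \<odot>\<^bsub>?W\<^esub> s ?g" for w
  have u': "lin R (wtwist R q M Bs) ?W u'"
    unfolding u'_def by (rule lin_fun_smult[OF W slin_closed[OF s gc] k])
  have "u' (wtw_in R q M Bs x) = s x" if x: "x \<in> carrier (wedges R M Bs)" for x
  proof (rule rank1_eq[OF r(1) M _ s _ x])
    show "slin R (frob_pow R q) (wedges R M Bs) ?W (\<lambda>x. u' (wtw_in R q M Bs x))"
      using slin_comp[OF wtw_in(1)[OF q(2) M ok] u' ring_hom_Pi[OF q(2)]] by simp
    have "\<kappa>' (wtw_in R q M Bs ?g) = \<one>\<^bsub>R\<^esub>"
      using r(2) wtw_in(2)[OF q(2) M ok g] by (simp add: rank1_def)
    then show "u' (wtw_in R q M Bs ?g) = s ?g" using slin_closed[OF s gc] by (simp add: u'_def)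
  qed
  then show ?thesis unfolding twistable_def using u' by (auto simp: s_def)
qed

text \<open>\<open>V\<close> already has values in a twist, so its twist by \<open>q\<close> must
  end in the twist by \<open>p * q\<close>, which is reached through \<open>tw_tw\<close>.\<close>

lemma tw_ext:
  assumes q: "frob_pow R p \<in> ring_hom R R" "frob_pow R q \<in> ring_hom R R" "frob_pow R (p * q) \<in> ring_hom R R"
    and M: "rmod R M" and N: "rmod R N" and V: "lin R M (twist R p N) V"
  obtains V' where "lin R (twist R q M) (twist R (p * q) N) V'"
    "\<And>x. x \<in> carrier M \<Longrightarrow> V' (tw_in R q M x) = tw_tw R p q N (V x)"
proof -
  have s: "slin R (\<lambda>r. frob_pow R q r) M (twist R (p * q) N) (\<lambda>x. tw_tw R p q N (V x))"
    using slin_comp[OF V tw_tw(1)[OF q N]] by simp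
  note l = twist_sext[OF q(2) M twist_module[OF q(3) N] id_ring_hom s]
  show thesis by (rule that[OF l])
qed

lemma wgen_carrier:
  assumes "rmod R M" "blocks_ok R M Bs" "xss \<in> wgen Bs" "xs \<in> set xss"
  shows "set xs \<subseteq> carrier M"
  using assms(2-)
proof (induction Bs arbitrary: xss)
  case (Cons bb Bs)
  obtain a A B where bb: "bb = (a, A, B)" by (cases bb)
  have "A \<subseteq> carrier M" using Cons.prems(1) rmod.submodule_closed(1)[OF assms(1), of A]
    by (auto simp: bb blocks_ok_def)
  moreover have "blocks_ok R M Bs" using Cons.prems(1) by (auto simp: blocks_ok_def)
  ultimately show ?case using Cons.prems(2,3) Cons.IH by (auto simp: bb wgen_Cons subset_iff)
qed simp

text \<open>A map of exterior powers induced by \<open>V\<close> is twisted by twisting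
  \<open>V\<close>.\<close>

lemma twistable_wmap:
  assumes q: "frob_pow R p \<in> ring_hom R R" "frob_pow R q \<in> ring_hom R R" "frob_pow R (p * q) \<in> ring_hom R R"
    and M: "rmod R M" and N: "rmod R N" and V: "lin R M (twist R p N) V"
    and ok: "blocks_ok R M Bs" and okN: "blocks_ok R N Cs" and b: "bmap V Bs (tw_blocks R p N Cs)"
    and BA: "\<And>a A B. (a, A, B) \<in> set Bs \<Longrightarrow> B \<subseteq> A"
  shows "twistable R p q M Bs N Cs (wmap R (twist R p N) (tw_blocks R p N Cs) V)"
proof -
  obtain V' where V': "lin R (twist R q M) (twist R (p * q) N) V'"
    "\<And>x. x \<in> carrier M \<Longrightarrow> V' (tw_in R q M x) = tw_tw R p q N (V x)"
    using tw_ext[OF q M N V] by metis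
  note Mq = twist_module[OF q(2) M] and Npq = twist_module[OF q(3) N] and Np = twist_module[OF q(1) N]
  note okq = tw_blocks_ok[OF q(2) M ok] and okp = tw_blocks_ok[OF q(1) N okN] and okpq = tw_blocks_ok[OF q(3) N okN]
  have id: "(\<lambda>r. r) \<in> carrier R \<rightarrow> carrier R" by auto
  have im: "V' ` tw_sub R q M A \<subseteq> tw_sub R (p * q) N A'"
    if "A \<subseteq> carrier M" "V ` A \<subseteq> tw_sub R p N A'" "A' \<subseteq> carrier N" for A A'
  proof (rule slin_tw_sub[OF q(2) M Npq V'(1) that(1) tw_sub_submodule[OF q(3) N that(3)] _ id])
    fix x assume x: "x \<in> A"
    then have "V x \<in> tw_sub R p N A'" using that by auto
    then have "tw_tw R p q N (V x) \<in> tw_sub R (p * q) N A'"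
      by (rule subsetD[OF tw_tw_sub[OF q N that(3)] imageI])
    then show "V' (tw_in R q M x) \<in> tw_sub R (p * q) N A'" using V'(2)[of x] x that(1) by auto
  qed
  have b': "bmap V' (tw_blocks R q M Bs) (tw_blocks R (p * q) N Cs)"
    using b ok okN BA unfolding bmap_def tw_blocks_def list_all2_map1 list_all2_map2
  proof (elim list.rel_mono_strong, goal_cases)
    case (1 bb cc)
    obtain a A B where bb: "bb = (a, A, B)" by (cases bb)
    obtain a' A' B' where cc: "cc = (a', A', B')" by (cases cc)
    have c: "A \<subseteq> carrier M" "B \<subseteq> A" "A' \<subseteq> carrier N" "B' \<subseteq> carrier N"
      using ok okN 1 BA[of a A B] rmod.submodule_closed(1)[OF M, of A] rmod.submodule_closed(1)[OF N, of A']
      by (auto simp: blocks_ok_def bb cc)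
    have v: "a = a'" "V ` A \<subseteq> tw_sub R p N A'" "V ` B \<subseteq> tw_sub R p N B'"
      using 1 c by (auto simp: bb cc Int_absorb1)
    show ?case using v im[OF c(1) v(2) c(3)] im[OF subset_trans[OF c(2,1)] v(3) c(4)] by (auto simp: bb cc)
  qed
  note w' = wmap[OF Mq Npq V'(1) b' okq okpq, folded wtwist_def]
  note w = wmap[OF M Np V b ok okp, folded wtwist_def]
  let ?u = "wmap R (twist R p N) (tw_blocks R p N Cs) V"
  let ?u' = "wmap R (twist R (p * q) N) (tw_blocks R (p * q) N Cs) V'"
  have "?u' (wtw_in R q M Bs x) = wtw_tw R p q N Cs (?u x)" if x: "x \<in> carrier (wedges R M Bs)" for x
  proof (rule wedges_eq[OF M ok wtwist_module[OF q(3) N okN] _ _ _ x])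
    show "slin R (frob_pow R q) (wedges R M Bs) (wtwist R (p * q) N Cs) (\<lambda>x. ?u' (wtw_in R q M Bs x))"
      using slin_comp[OF wtw_in(1)[OF q(2) M ok] w'(1) ring_hom_Pi[OF q(2)]] by simp
    show "slin R (frob_pow R q) (wedges R M Bs) (wtwist R (p * q) N Cs) (\<lambda>x. wtw_tw R p q N Cs (?u x))"
      using slin_comp[OF w(1) wtw_tw(1)[OF q N okN] id] by simp
    fix xss assume xs: "xss \<in> wgen Bs"
    have c: "set xs \<subseteq> carrier M" if "xs \<in> set xss" for xs
      by (rule wgen_carrier[OF M ok xs that])
    have "map (map V') (map (map (tw_in R q M)) xss) = map (map (tw_tw R p q N)) (map (map V) xss)"
      unfolding map_map using c V'(2) by (intro map_cong refl) (auto simp: subset_iff)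
    then show "?u' (wtw_in R q M Bs (wsym R M Bs xss)) = wtw_tw R p q N Cs (?u (wsym R M Bs xss))"
      using xs w'(2)[OF bmap_wgen[OF bmap_tw_in[OF q(2) M ok] xs]] w(2)[OF xs]
        wtw_tw(2)[OF q N okN bmap_wgen[OF b xs]] wtw_in(2)[OF q(2) M ok xs]
      by (simp del: map_map)
  qed
  then show ?thesis unfolding twistable_def using w'(1) by blast
qed

lemma aform_zero_entry:
  assumes g: "aform R \<phi> M A N n g" and N: "rmod R N" and M: "rmod R M" and A: "submodule A R M"
    and xs: "length xs = n" "set xs \<subseteq> A" "\<zero>\<^bsub>M\<^esub> \<in> set xs"
  shows "g xs = \<zero>\<^bsub>N\<^esub>"
proof -
  interpret M: rmod R M by fact
  interpret N: rmod R N by fact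
  obtain us vs where e: "xs = us @ \<zero>\<^bsub>M\<^esub> # vs" using xs(3) by (meson split_list)
  have "g (us @ (\<zero>\<^bsub>M\<^esub> \<oplus>\<^bsub>M\<^esub> \<zero>\<^bsub>M\<^esub>) # vs) = g (us @ \<zero>\<^bsub>M\<^esub> # vs) \<oplus>\<^bsub>N\<^esub> g (us @ \<zero>\<^bsub>M\<^esub> # vs)"
    by (rule aformD(2)[OF g]) (use xs e M.submodule_closed(2)[OF A] in auto)
  then show ?thesis using aformD(1)[OF g xs(1,2)] unfolding e
    by (metis M.M.r_zero M.M.zero_closed N.M.add.r_cancel_one')
qed

text \<open>The entries are changed one at a time; each change is by an element of \<open>B\<close>,
  and multilinearity splits off a term that is killed.\<close>

lemma aform_replace:
  assumes N: "rmod R N" and M: "rmod R M" and A: "submodule A R M"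
    and k: "\<And>y. y \<in> A \<Longrightarrow> \<alpha> y \<in> A \<and> \<alpha> y \<ominus>\<^bsub>M\<^esub> y \<in> B"
    and g: "aform R \<phi> M A N n g"
    and kill: "\<And>xs. length xs = n \<Longrightarrow> set xs \<subseteq> A \<Longrightarrow> set xs \<inter> B \<noteq> {} \<Longrightarrow> g xs = \<zero>\<^bsub>N\<^esub>"
  shows "length us + length ys = n \<Longrightarrow> set us \<subseteq> A \<Longrightarrow> set ys \<subseteq> A \<Longrightarrow> g (us @ map \<alpha> ys) = g (us @ ys)"
proof (induction ys arbitrary: us)
  case (Cons y ys)
  interpret M: rmod R M by fact
  interpret N: rmod R N by fact
  note c = M.submodule_closed[OF A]
  have y: "y \<in> A" "\<alpha> y \<in> A" "\<alpha> y \<ominus>\<^bsub>M\<^esub> y \<in> B" "\<alpha> y \<ominus>\<^bsub>M\<^esub> y \<in> A" using Cons.prems k c(6) by auto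
  have yc: "y \<in> carrier M" "\<alpha> y \<in> carrier M" using y c(1) by auto
  have e: "\<alpha> y = y \<oplus>\<^bsub>M\<^esub> (\<alpha> y \<ominus>\<^bsub>M\<^esub> y)" using yc
    using M.M.a_lcomm[of y "\<alpha> y" "\<ominus>\<^bsub>M\<^esub> y"] by (simp add: a_minus_def M.M.r_neg)
  have "g (us @ map \<alpha> (y # ys)) = g ((us @ [\<alpha> y]) @ map \<alpha> ys)" by simp
  also have "\<dots> = g ((us @ [\<alpha> y]) @ ys)" by (rule Cons.IH) (use Cons.prems y in auto)
  also have "\<dots> = g (us @ (y \<oplus>\<^bsub>M\<^esub> (\<alpha> y \<ominus>\<^bsub>M\<^esub> y)) # ys)" using e by simp
  also have "\<dots> = g (us @ y # ys) \<oplus>\<^bsub>N\<^esub> g (us @ (\<alpha> y \<ominus>\<^bsub>M\<^esub> y) # ys)"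
    by (rule aformD(2)[OF g]) (use Cons.prems y in auto)
  also have "g (us @ (\<alpha> y \<ominus>\<^bsub>M\<^esub> y) # ys) = \<zero>\<^bsub>N\<^esub>" by (rule kill) (use Cons.prems y in auto)
  finally show ?case using aformD(1)[OF g, of "us @ y # ys"] Cons.prems by simp
qed simp

section \<open>Natural maps given on symbols\<close>

definition smap :: "'r ring \<Rightarrow> ('r, 'm) module \<Rightarrow> 'm block list \<Rightarrow> ('m list list \<Rightarrow> 'm list list) \<Rightarrow>
    ('m, 'r) wedge \<Rightarrow> ('m, 'r) wedge" where
  "smap R M Cs \<tau> = lext R (wedges R M Cs) (\<lambda>xss. wsym R M Cs (\<tau> xss))"

definition smap_ok :: "'r ring \<Rightarrow> ('r, 'm) module \<Rightarrow> 'm block list \<Rightarrow> 'm block list \<Rightarrow>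
    ('m list list \<Rightarrow> 'm list list) \<Rightarrow> bool" where
  "smap_ok R M Bs Cs \<tau> \<longleftrightarrow> multi R (\<lambda>r. r) M Bs (wedges R M Cs) (\<lambda>xss. wsym R M Cs (\<tau> xss)) \<and>
     (\<forall>xss\<in>wgen Bs. \<tau> xss \<in> wgen Cs)"

lemma smap:
  assumes "rmod R M" "blocks_ok R M Bs" "blocks_ok R M Cs" "smap_ok R M Bs Cs \<tau>"
  shows "lin R (wedges R M Bs) (wedges R M Cs) (smap R M Cs \<tau>)"
    and "xss \<in> wgen Bs \<Longrightarrow> smap R M Cs \<tau> (wsym R M Bs xss) = wsym R M Cs (\<tau> xss)"
    and "xss \<in> wgen Bs \<Longrightarrow> \<tau> xss \<in> wgen Cs"
  using multi_lext[OF assms(1,2) wedges_module[OF assms(1,3)], of "\<lambda>xss. wsym R M Cs (\<tau> xss)"] assms(4)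
  unfolding smap_ok_def smap_def by simp_all

text \<open>The symbol map \<open>\<tau>\<close> also makes sense after every twist, where it is called \<open>\<tau>'\<close>.\<close>

definition snat :: "'r ring \<Rightarrow> ('r, 'm) module \<Rightarrow> 'm block list \<Rightarrow> 'm block list \<Rightarrow>
    ('m list list \<Rightarrow> 'm list list) \<Rightarrow> (('m \<Rightarrow> 'r) set list list \<Rightarrow> ('m \<Rightarrow> 'r) set list list) \<Rightarrow> bool" where
  "snat R M Bs Cs \<tau> \<tau>' \<longleftrightarrow> blocks_ok R M Bs \<and> blocks_ok R M Cs \<and> smap_ok R M Bs Cs \<tau> \<and>
     (\<forall>q. frob_pow R q \<in> ring_hom R R \<longrightarrow>
        smap_ok R (twist R q M) (tw_blocks R q M Bs) (tw_blocks R q M Cs) \<tau>') \<and>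
     (\<forall>f xss. \<tau>' (map (map f) xss) = map (map f) (\<tau> xss)) \<and>
     (\<forall>f xss. \<tau>' (map (map f) xss) = map (map f) (\<tau>' xss))"

lemma snat_smap:
  assumes q: "frob_pow R q \<in> ring_hom R R" and M: "rmod R M" and s: "snat R M Bs Cs \<tau> \<tau>'"
  shows "lin R (wtwist R q M Bs) (wtwist R q M Cs) (smap R (twist R q M) (tw_blocks R q M Cs) \<tau>')"
    and "tss \<in> wgen (tw_blocks R q M Bs) \<Longrightarrow> smap R (twist R q M) (tw_blocks R q M Cs) \<tau>'
        (wsym R (twist R q M) (tw_blocks R q M Bs) tss) = wsym R (twist R q M) (tw_blocks R q M Cs) (\<tau>' tss)"
    and "tss \<in> wgen (tw_blocks R q M Bs) \<Longrightarrow> \<tau>' tss \<in> wgen (tw_blocks R q M Cs)"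
proof -
  have ok: "blocks_ok R M Bs" "blocks_ok R M Cs"
    and so: "smap_ok R (twist R q M) (tw_blocks R q M Bs) (tw_blocks R q M Cs) \<tau>'"
    using s q by (auto simp: snat_def)
  note m = smap[OF twist_module[OF q M] tw_blocks_ok[OF q M ok(1)] tw_blocks_ok[OF q M ok(2)] so]
  show "lin R (wtwist R q M Bs) (wtwist R q M Cs) (smap R (twist R q M) (tw_blocks R q M Cs) \<tau>')"
    unfolding wtwist_def by (rule m(1))
qed (use smap[OF twist_module[OF q M] tw_blocks_ok[OF q M] tw_blocks_ok[OF q M]] s q in \<open>auto simp: snat_def\<close>)

text \<open>Rearranging the entries of a symbol commutes with applying one map to all of them. The
  same holds in \<open>snat_tw\<close> for the passage from the twist by \<open>p\<close> to that by
  \<open>p * q\<close>.\<close>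

lemma snat_in:
  assumes q: "frob_pow R q \<in> ring_hom R R" and M: "rmod R M" and s: "snat R M Bs Cs \<tau> \<tau>'"
    and x: "x \<in> carrier (wedges R M Bs)"
  shows "smap R (twist R q M) (tw_blocks R q M Cs) \<tau>' (wtw_in R q M Bs x) = wtw_in R q M Cs (smap R M Cs \<tau> x)"
proof -
  have ok: "blocks_ok R M Bs" "blocks_ok R M Cs" and so: "smap_ok R M Bs Cs \<tau>"
    and nat: "\<And>f xss. \<tau>' (map (map f) xss) = map (map f) (\<tau> xss)" using s by (auto simp: snat_def)
  note m = smap[OF M ok so] and mq = snat_smap[OF q M s]
  have id: "(\<lambda>r. r) \<in> carrier R \<rightarrow> carrier R" by auto
  show ?thesis
  proof (rule wedges_eq[OF M ok(1) wtwist_module[OF q M ok(2)] _ _ _ x])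
    show "slin R (frob_pow R q) (wedges R M Bs) (wtwist R q M Cs)
       (\<lambda>x. smap R (twist R q M) (tw_blocks R q M Cs) \<tau>' (wtw_in R q M Bs x))"
      using slin_comp[OF wtw_in(1)[OF q M ok(1)] mq(1) ring_hom_Pi[OF q]] by simp
    show "slin R (frob_pow R q) (wedges R M Bs) (wtwist R q M Cs) (\<lambda>x. wtw_in R q M Cs (smap R M Cs \<tau> x))"
      using slin_comp[OF m(1) wtw_in(1)[OF q M ok(2)] id] by simp
    fix xss assume xs: "xss \<in> wgen Bs"
    then show "smap R (twist R q M) (tw_blocks R q M Cs) \<tau>' (wtw_in R q M Bs (wsym R M Bs xss)) =
       wtw_in R q M Cs (smap R M Cs \<tau> (wsym R M Bs xss))"
      using wtw_in(2)[OF q M ok(1) xs] mq(2)[OF bmap_wgen[OF bmap_tw_in[OF q M ok(1)] xs]]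
        m(2)[OF xs] wtw_in(2)[OF q M ok(2) m(3)[OF xs]] nat by simp
  qed
qed

lemma snat_tw:
  assumes q: "frob_pow R p \<in> ring_hom R R" "frob_pow R q \<in> ring_hom R R" "frob_pow R (p * q) \<in> ring_hom R R"
    and M: "rmod R M" and s: "snat R M Bs Cs \<tau> \<tau>'"
    and x: "x \<in> carrier (wtwist R p M Bs)"
  shows "smap R (twist R (p * q) M) (tw_blocks R (p * q) M Cs) \<tau>' (wtw_tw R p q M Bs x) =
    wtw_tw R p q M Cs (smap R (twist R p M) (tw_blocks R p M Cs) \<tau>' x)"
proof -
  have ok: "blocks_ok R M Bs" "blocks_ok R M Cs"
    and nat: "\<And>f xss. \<tau>' (map (map f) xss) = map (map f) (\<tau>' xss)" using s by (auto simp: snat_def)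
  note mp = snat_smap[OF q(1) M s] and mpq = snat_smap[OF q(3) M s]
  have id: "(\<lambda>r. r) \<in> carrier R \<rightarrow> carrier R" by auto
  show ?thesis
  proof (rule wedges_eq[OF twist_module[OF q(1) M] tw_blocks_ok[OF q(1) M ok(1)] wtwist_module[OF q(3) M ok(2)]
        _ _ _ x[unfolded wtwist_def], folded wtwist_def])
    show "slin R (frob_pow R q) (wtwist R p M Bs) (wtwist R (p * q) M Cs)
       (\<lambda>x. smap R (twist R (p * q) M) (tw_blocks R (p * q) M Cs) \<tau>' (wtw_tw R p q M Bs x))"
      using slin_comp[OF wtw_tw(1)[OF q M ok(1)] mpq(1) ring_hom_Pi[OF q(2)]] by simp
    show "slin R (frob_pow R q) (wtwist R p M Bs) (wtwist R (p * q) M Cs)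
       (\<lambda>x. wtw_tw R p q M Cs (smap R (twist R p M) (tw_blocks R p M Cs) \<tau>' x))"
      using slin_comp[OF mp(1) wtw_tw(1)[OF q M ok(2)] id] by simp
    fix tss assume t: "tss \<in> wgen (tw_blocks R p M Bs)"
    then show "smap R (twist R (p * q) M) (tw_blocks R (p * q) M Cs) \<tau>'
         (wtw_tw R p q M Bs (wsym R (twist R p M) (tw_blocks R p M Bs) tss)) =
       wtw_tw R p q M Cs (smap R (twist R p M) (tw_blocks R p M Cs) \<tau>' (wsym R (twist R p M) (tw_blocks R p M Bs) tss))"
      using wtw_tw(2)[OF q M ok(1) t] mpq(2)[OF bmap_wgen[OF wtw_tw(3)[OF q M ok(1)] t]]
        mp(2)[OF t] wtw_tw(2)[OF q M ok(2) mp(3)[OF t]] nat by simp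
  qed
qed

text \<open>One step of the comparison: \<open>f\<close> and \<open>hs\<close> have a common lift \<open>f'\<close> along the natural maps
  \<open>\<tau>\<close> and \<open>\<rho>\<close>, and this persists after twisting.\<close>

lemma twist_step:
  assumes q: "frob_pow R p \<in> ring_hom R R" "frob_pow R q \<in> ring_hom R R" "frob_pow R (p * q) \<in> ring_hom R R"
    and M: "rmod R M" and N: "rmod R N"
    and \<tau>: "snat R M Pb Eb \<tau> \<tau>'" "snat R N Pb' Eb' \<tau> \<tau>'"
    and \<rho>: "snat R M Pb Lb \<rho> \<rho>'" "snat R N Pb' Lb' \<rho> \<rho>'"
    and f': "lin R (wedges R M Eb) (wtwist R p N Pb') f'" "twistable R p q M Eb N Pb' f'"
    and f: "\<And>w. w \<in> carrier (wedges R M Eb) \<Longrightarrow> f w = smap R (twist R p N) (tw_blocks R p N Eb') \<tau>' (f' w)"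
    and hs: "twistable R p q M Lb N Lb' hs"
      "\<And>v. v \<in> carrier (wedges R M Pb) \<Longrightarrow> hs (smap R M Lb \<rho> v) =
         smap R (twist R p N) (tw_blocks R p N Lb') \<rho>' (f' (smap R M Eb \<tau> v))"
    and v: "v \<in> carrier (wtwist R q M Pb)"
  defines "v' \<equiv> htwist R p q M Eb N Pb' f' (smap R (twist R q M) (tw_blocks R q M Eb) \<tau>' v)"
  shows "v' \<in> carrier (wtwist R (p * q) N Pb')"
    and "htwist R p q M Eb N Eb' f (smap R (twist R q M) (tw_blocks R q M Eb) \<tau>' v) =
      smap R (twist R (p * q) N) (tw_blocks R (p * q) N Eb') \<tau>' v'"
    and "htwist R p q M Lb N Lb' hs (smap R (twist R q M) (tw_blocks R q M Lb) \<rho>' v) =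
      smap R (twist R (p * q) N) (tw_blocks R (p * q) N Lb') \<rho>' v'"
proof -
  have ok: "blocks_ok R M Pb" "blocks_ok R M Eb" "blocks_ok R M Lb"
      "blocks_ok R N Pb'" "blocks_ok R N Eb'" "blocks_ok R N Lb'"
    using \<tau> \<rho> by (auto simp: snat_def)
  note W = wtwist_module[OF q(3) N]
  note F = htwist_twistable[OF q(2) M ok(2) W[OF ok(4)] f'(2)]
  note H = htwist_twistable[OF q(2) M ok(3) W[OF ok(6)] hs(1)]
  have id: "(\<lambda>r. r) \<in> carrier R \<rightarrow> carrier R" by auto
  note iv = snat_smap(1)[OF q(2) M \<tau>(1)]
  have ivc: "smap R (twist R q M) (tw_blocks R q M Eb) \<tau>' v \<in> carrier (wtwist R q M Eb)"
    by (rule slin_closed[OF iv v])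
  show "v' \<in> carrier (wtwist R (p * q) N Pb')"
    unfolding v'_def by (rule slin_closed[OF F(1) ivc])
  have sm: "smap R M Eb \<tau> x \<in> carrier (wedges R M Eb)" "smap R M Lb \<rho> x \<in> carrier (wedges R M Lb)"
    if "x \<in> carrier (wedges R M Pb)" for x
    using slin_closed[OF smap(1)[OF M ok(1,2), of \<tau>] that] slin_closed[OF smap(1)[OF M ok(1,3), of \<rho>] that]
      \<tau>(1) \<rho>(1) by (auto simp: snat_def)
  show "htwist R p q M Eb N Eb' f (smap R (twist R q M) (tw_blocks R q M Eb) \<tau>' v) =
      smap R (twist R (p * q) N) (tw_blocks R (p * q) N Eb') \<tau>' v'"
    unfolding v'_def
  \<comment> \<open>The twist of \<open>f\<close> is recognised as the twist of \<open>f'\<close>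
    followed by the natural map, since this composite is linear and has the right values on
    \<open>1 \<otimes> x\<close>.\<close>
  proof (rule htwist[OF q(2) M ok(2) W[OF ok(5)] _ _ ivc])
    show "lin R (wtwist R q M Eb) (wtwist R (p * q) N Eb')
       (\<lambda>w. smap R (twist R (p * q) N) (tw_blocks R (p * q) N Eb') \<tau>' (htwist R p q M Eb N Pb' f' w))"
      using slin_comp[OF F(1) snat_smap(1)[OF q(3) N \<tau>(2)] id] by simp
    fix x assume x: "x \<in> carrier (wedges R M Eb)"
    show "smap R (twist R (p * q) N) (tw_blocks R (p * q) N Eb') \<tau>' (htwist R p q M Eb N Pb' f' (wtw_in R q M Eb x)) =
        wtw_tw R p q N Eb' (f x)"
      using F(2)[OF x] snat_tw[OF q N \<tau>(2) slin_closed[OF f'(1) x]] f[OF x] by simp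
  qed
  show "htwist R p q M Lb N Lb' hs (smap R (twist R q M) (tw_blocks R q M Lb) \<rho>' v) =
      smap R (twist R (p * q) N) (tw_blocks R (p * q) N Lb') \<rho>' v'"
    unfolding v'_def
  \<comment> \<open>The maps \<open>hs\<close> and \<open>f'\<close> are related only over
    \<open>Pb\<close>. Both sides are therefore viewed as linear maps on its twist and compared on
    the elements \<open>1 \<otimes> x\<close>.\<close>
  proof (rule wtwist_eq[OF q(2) M ok(1) W[OF ok(6)] id _ _ _ v])
    show "lin R (wtwist R q M Pb) (wtwist R (p * q) N Lb')
      (\<lambda>v. htwist R p q M Lb N Lb' hs (smap R (twist R q M) (tw_blocks R q M Lb) \<rho>' v))"
      using slin_comp[OF snat_smap(1)[OF q(2) M \<rho>(1)] H(1) id] by simp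
    have 1: "lin R (wtwist R q M Pb) (wtwist R (p * q) N Pb')
      (\<lambda>v. htwist R p q M Eb N Pb' f' (smap R (twist R q M) (tw_blocks R q M Eb) \<tau>' v))"
      using slin_comp[OF iv F(1) id] by simp
    show "lin R (wtwist R q M Pb) (wtwist R (p * q) N Lb')
      (\<lambda>v. smap R (twist R (p * q) N) (tw_blocks R (p * q) N Lb') \<rho>'
        (htwist R p q M Eb N Pb' f' (smap R (twist R q M) (tw_blocks R q M Eb) \<tau>' v)))"
      using slin_comp[OF 1 snat_smap(1)[OF q(3) N \<rho>(2)] id] by simp
    fix xss assume "xss \<in> wgen Pb"
    then have x: "wsym R M Pb xss \<in> carrier (wedges R M Pb)" (is "?x \<in> _") by (rule wsym_closed[OF M ok(1)])
    have "htwist R p q M Lb N Lb' hs (smap R (twist R q M) (tw_blocks R q M Lb) \<rho>' (wtw_in R q M Pb ?x)) =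
        wtw_tw R p q N Lb' (hs (smap R M Lb \<rho> ?x))"
      using snat_in[OF q(2) M \<rho>(1) x] H(2)[OF sm(2)[OF x]] by simp
    also have "\<dots> = wtw_tw R p q N Lb' (smap R (twist R p N) (tw_blocks R p N Lb') \<rho>' (f' (smap R M Eb \<tau> ?x)))"
      using hs(2)[OF x] by simp
    also have "\<dots> = smap R (twist R (p * q) N) (tw_blocks R (p * q) N Lb') \<rho>' (wtw_tw R p q N Pb' (f' (smap R M Eb \<tau> ?x)))"
      using snat_tw[OF q N \<rho>(2) slin_closed[OF f'(1) sm(1)[OF x]]] by simp
    also have "wtw_tw R p q N Pb' (f' (smap R M Eb \<tau> ?x)) =
       htwist R p q M Eb N Pb' f' (smap R (twist R q M) (tw_blocks R q M Eb) \<tau>' (wtw_in R q M Pb ?x))"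
      using snat_in[OF q(2) M \<tau>(1) x] F(2)[OF sm(1)[OF x]] by simp
    finally show "htwist R p q M Lb N Lb' hs (smap R (twist R q M) (tw_blocks R q M Lb) \<rho>' (wtw_in R q M Pb ?x)) =
      smap R (twist R (p * q) N) (tw_blocks R (p * q) N Lb') \<rho>'
       (htwist R p q M Eb N Pb' f' (smap R (twist R q M) (tw_blocks R q M Eb) \<tau>' (wtw_in R q M Pb ?x)))" .
  qed
qed

section \<open>Contractions\<close>

text \<open>The functionals in \<open>cs\<close> absorb as many entries, \<open>g\<close> is applied
  to the entries that remain, and the constant list \<open>\<omega>\<close> fills the second block.
  Every ingredient is explicit and can be twisted separately.\<close>

definition cform :: "'r ring \<Rightarrow> ('r, 'n) module \<Rightarrow> 'n block list \<Rightarrow> ('m \<Rightarrow> 'r) list \<Rightarrow> ('m \<Rightarrow> 'n) \<Rightarrow> 'n list \<Rightarrow>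
    'm list \<Rightarrow> ('n, 'r) wedge" where
  "cform R N Cs cs g \<omega> = lifts (wedges R N Cs) cs (\<lambda>zs. wsym R N Cs [map g zs, \<omega>])"

text \<open>The second clause, for vectors that \<open>g\<close> sends into \<open>B\<close>, is the
  condition that \<open>lifts_basis\<close> and \<open>lifts_kill\<close> will ask of the innermost
  form.\<close>

lemma cform_base:
  assumes M: "rmod R M" and N: "rmod R N" and ok: "blocks_ok R N [(m, carrier N, B), (d, A', B')]"
    and g: "lin R M N g" and \<omega>: "length \<omega> = d" "set \<omega> \<subseteq> A'"
  defines "Cs \<equiv> [(m, carrier N, B), (d, A', B')]"
  shows "aform R (\<lambda>r. r) M (carrier M) (wedges R N Cs) m (\<lambda>zs. wsym R N Cs [map g zs, \<omega>])"
    and "length zs = m \<Longrightarrow> set zs \<subseteq> carrier M \<Longrightarrow> x \<in> set zs \<Longrightarrow> g x \<in> B \<Longrightarrow> wsym R N Cs [map g zs, \<omega>] = \<zero>\<^bsub>wedges R N Cs\<^esub>"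
proof -
  have id: "(\<lambda>r. r) \<in> carrier R \<rightarrow> carrier R" by auto
  have sy: "multi R (\<lambda>r. r) N Cs (wedges R N Cs) (wsym R N Cs)"
    using multi_wsym[OF N ok] by (simp add: Cs_def)
  then have s: "aform R (\<lambda>r. r) N (carrier N) (wedges R N Cs) m (\<lambda>zs. wsym R N Cs [zs, \<omega>])"
    "length zs = m \<Longrightarrow> set zs \<subseteq> carrier N \<Longrightarrow> set zs \<inter> B \<noteq> {} \<Longrightarrow> wsym R N Cs [zs, \<omega>] = \<zero>\<^bsub>wedges R N Cs\<^esub>" for zs
    using \<omega> unfolding Cs_def multi_pair by auto
  have gc: "g ` carrier M \<subseteq> carrier N" using slin_closed[OF g] by auto
  show "aform R (\<lambda>r. r) M (carrier M) (wedges R N Cs) m (\<lambda>zs. wsym R N Cs [map g zs, \<omega>])"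
    using aform_map[OF s(1) g _ gc id] by simp
  assume z: "length zs = m" "set zs \<subseteq> carrier M" "x \<in> set zs" "g x \<in> B"
  then have "g x \<in> set (map g zs) \<inter> B" by auto
  then show "wsym R N Cs [map g zs, \<omega>] = \<zero>\<^bsub>wedges R N Cs\<^esub>"
    by (intro s(2)) (use z gc in auto)
qed

lemma cform_multi:
  assumes M: "rmod R M" and N: "rmod R N" and ok: "blocks_ok R N [(m, carrier N, B), (d, A', B')]"
    and g: "lin R M N g" and \<omega>: "length \<omega> = d" "set \<omega> \<subseteq> A'"
    and cs: "\<And>c. c \<in> set cs \<Longrightarrow> lin R M (self_mod R) c"
  defines "Cs \<equiv> [(m, carrier N, B), (d, A', B')]"
  shows "multi R (\<lambda>r. r) M [(m + length cs, carrier M, {\<zero>\<^bsub>M\<^esub>})] (wedges R N Cs) (\<lambda>xss. cform R N Cs cs g \<omega> (hd xss))"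
    and "aform R (\<lambda>r. r) M (carrier M) (wedges R N Cs) (m + length cs) (cform R N Cs cs g \<omega>)"
proof -
  note b = cform_base[OF M N ok g \<omega>, folded Cs_def]
  have W: "rmod R (wedges R N Cs)" using wedges_module[OF N ok] by (simp add: Cs_def)
  show a: "aform R (\<lambda>r. r) M (carrier M) (wedges R N Cs) (m + length cs) (cform R N Cs cs g \<omega>)"
    unfolding cform_def by (rule lifts_aform[OF W M b(1) cs])
  interpret M: rmod R M by fact
  have z: "cform R N Cs cs g \<omega> xs = \<zero>\<^bsub>wedges R N Cs\<^esub>"
    if "length xs = m + length cs" "set xs \<subseteq> carrier M" "\<zero>\<^bsub>M\<^esub> \<in> set xs" for xs
    by (rule aform_zero_entry[OF a W M M.carrier_is_submodule that])
  show "multi R (\<lambda>r. r) M [(m + length cs, carrier M, {\<zero>\<^bsub>M\<^esub>})] (wedges R N Cs) (\<lambda>xss. cform R N Cs cs g \<omega> (hd xss))"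
    unfolding multi_single using a z by auto
qed

text \<open>The functionals, \<open>g\<close> and \<open>\<omega>\<close> are twisted one by one,
  and the contraction made from the results is the twist of the given one.\<close>

lemma cform_twistable:
  assumes q: "frob_pow R p \<in> ring_hom R R" "frob_pow R q \<in> ring_hom R R" "frob_pow R (p * q) \<in> ring_hom R R"
    and M: "rmod R M" and N: "rmod R N" and ok: "blocks_ok R N [(m, carrier N, B), (d, A', B')]"
    and g: "lin R M (twist R p N) g" and \<omega>: "length \<omega> = d" "set \<omega> \<subseteq> tw_sub R p N A'"
    and c: "\<And>k. k \<in> set ks \<Longrightarrow> lin R M (self_mod R) (c k)"
  defines "Cs \<equiv> [(m, carrier N, B), (d, A', B')]"
  defines "W \<equiv> wtwist R p N Cs"
  defines "f \<equiv> lext R W (\<lambda>xss. cform R (twist R p N) (tw_blocks R p N Cs) (map c ks) g \<omega> (hd xss))"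
  defines "Eb \<equiv> [(m + length ks, carrier M, {\<zero>\<^bsub>M\<^esub>})]"
  shows "lin R (wedges R M Eb) W f"
    and "length xs = m + length ks \<Longrightarrow> set xs \<subseteq> carrier M \<Longrightarrow>
       f (wsym R M Eb [xs]) = cform R (twist R p N) (tw_blocks R p N Cs) (map c ks) g \<omega> xs"
    and "twistable R p q M Eb N Cs f"
proof -
  interpret M: rmod R M by fact
  interpret N: rmod R N by fact
  have ok': "blocks_ok R N Cs" using ok by (simp add: Cs_def)
  have okE: "blocks_ok R M Eb" using M.carrier_is_submodule by (simp add: Eb_def blocks_ok_def)
  have tCs: "tw_blocks R r N Cs = [(m, carrier (twist R r N), tw_sub R r N B), (d, tw_sub R r N A', tw_sub R r N B')]"
    if "frob_pow R r \<in> ring_hom R R" for r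
    by (simp add: tw_blocks_def Cs_def tw_sub_carrier[OF that N])
  have tEb: "tw_blocks R q M Eb = [(m + length ks, carrier (twist R q M), {\<zero>\<^bsub>twist R q M\<^esub>})]"
    by (simp add: tw_blocks_def Eb_def tw_sub_carrier[OF q(2) M] tw_sub_zero[OF q(2) M])
  note Mq = twist_module[OF q(2) M] and Np = twist_module[OF q(1) N] and Npq = twist_module[OF q(3) N]
  have okp: "blocks_ok R (twist R p N) [(m, carrier (twist R p N), tw_sub R p N B), (d, tw_sub R p N A', tw_sub R p N B')]"
    using tw_blocks_ok[OF q(1) N ok'] tCs[OF q(1)] by simp
  have okpq: "blocks_ok R (twist R (p * q) N) [(m, carrier (twist R (p * q) N), tw_sub R (p * q) N B),
       (d, tw_sub R (p * q) N A', tw_sub R (p * q) N B')]"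
    using tw_blocks_ok[OF q(3) N ok'] tCs[OF q(3)] by simp
  have mcs: "x \<in> set (map c ks) \<Longrightarrow> lin R M (self_mod R) x" for x using c by auto
  note mm = cform_multi[where cs = "map c ks", OF M Np okp g \<omega> mcs, folded tCs[OF q(1)], folded wtwist_def W_def]
  have Wm: "rmod R W" unfolding W_def by (rule wtwist_module[OF q(1) N ok'])
  note l = multi_lext[OF M okE Wm, of "\<lambda>xss. cform R (twist R p N) (tw_blocks R p N Cs) (map c ks) g \<omega> (hd xss)"]
  have m1: "multi R (\<lambda>r. r) M Eb W (\<lambda>xss. cform R (twist R p N) (tw_blocks R p N Cs) (map c ks) g \<omega> (hd xss))"
    using mm(1) by (simp add: Eb_def)
  show f: "lin R (wedges R M Eb) W f" unfolding f_def by (rule l(1)[OF m1])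
  show fv: "f (wsym R M Eb [xs]) = cform R (twist R p N) (tw_blocks R p N Cs) (map c ks) g \<omega> xs"
    if "length xs = m + length ks" "set xs \<subseteq> carrier M" for xs
    using l(2)[OF m1, of "[xs]"] that by (simp add: f_def Eb_def wgen_Cons)
  obtain g' where g': "lin R (twist R q M) (twist R (p * q) N) g'"
    "\<And>x. x \<in> carrier M \<Longrightarrow> g' (tw_in R q M x) = tw_tw R p q N (g x)"
    using tw_ext[OF q M N g] by metis
  have A': "A' \<subseteq> carrier N" using ok N.submodule_closed(1)[of A'] by (auto simp: blocks_ok_def)
  define \<omega>' where "\<omega>' = map (tw_tw R p q N) \<omega>"
  have \<omega>': "length \<omega>' = d" "set \<omega>' \<subseteq> tw_sub R (p * q) N A'"
    using \<omega> tw_tw_sub[OF q N A'] by (auto simp: \<omega>'_def)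
  define c' where "c' k = tw_fun R q (c k)" for k
  have c': "lin R (twist R q M) (self_mod R) (c' k)" "\<And>x. x \<in> carrier M \<Longrightarrow> c' k (tw_in R q M x) = frob_pow R q (c k x)"
    if "k \<in> set ks" for k using tw_fun[OF q(2) M c[OF that]] by (auto simp: c'_def)
  have mcs': "x \<in> set (map c' ks) \<Longrightarrow> lin R (twist R q M) (self_mod R) x" for x using c' by auto
  let ?Cq = "tw_blocks R (p * q) N Cs" and ?Cp = "tw_blocks R p N Cs"
  let ?G = "\<lambda>xss. cform R (twist R (p * q) N) ?Cq (map c' ks) g' \<omega>' (hd xss)"
  have m2: "multi R (\<lambda>r. r) (twist R q M) (tw_blocks R q M Eb) (wtwist R (p * q) N Cs) ?G"
    using cform_multi(1)[where cs = "map c' ks", OF Mq Npq okpq g'(1) \<omega>' mcs'] by (simp add: tEb wtwist_def tCs[OF q(3)])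
  note l' = multi_lext[OF Mq tw_blocks_ok[OF q(2) M okE] wtwist_module[OF q(3) N ok'] m2, folded wtwist_def]
  let ?f' = "lext R (wtwist R (p * q) N Cs) ?G"
  have id: "(\<lambda>r. r) \<in> carrier R \<rightarrow> carrier R" by auto
  have "?f' (wtw_in R q M Eb x) = wtw_tw R p q N Cs (f x)" if x: "x \<in> carrier (wedges R M Eb)" for x
  proof (rule wedges_eq[OF M okE wtwist_module[OF q(3) N ok'] _ _ _ x])
    show "slin R (frob_pow R q) (wedges R M Eb) (wtwist R (p * q) N Cs) (\<lambda>x. ?f' (wtw_in R q M Eb x))"
      using slin_comp[OF wtw_in(1)[OF q(2) M okE] l'(1) ring_hom_Pi[OF q(2)]] by simp
    show "slin R (frob_pow R q) (wedges R M Eb) (wtwist R (p * q) N Cs) (\<lambda>x. wtw_tw R p q N Cs (f x))"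
      using slin_comp[OF f[unfolded W_def] wtw_tw(1)[OF q N ok'] id] by simp
    fix xss assume xs: "xss \<in> wgen Eb"
    then obtain vs where vs: "xss = [vs]" "length vs = m + length ks" "set vs \<subseteq> carrier M"
      by (auto simp: Eb_def wgen_Cons)
    have "?f' (wtw_in R q M Eb (wsym R M Eb xss)) =
       cform R (twist R (p * q) N) ?Cq (map c' ks) g' \<omega>' (map (tw_in R q M) vs)"
      using wtw_in(2)[OF q(2) M okE xs] l'(2)[OF bmap_wgen[OF bmap_tw_in[OF q(2) M okE] xs]] by (simp add: vs(1))
    also have "\<dots> = wtw_tw R p q N Cs (cform R (twist R p N) ?Cp (map c ks) g \<omega> vs)"
      unfolding cform_def wtwist_def[symmetric]
    proof (rule lifts_slin[OF wtwist_module[OF q(1) N ok'] wtwist_module[OF q(3) N ok'] wtw_tw(1)[OF q N ok'] M _ _ _ vs(2,3)])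
      note bb = cform_base[OF M Np okp g \<omega>, folded tCs[OF q(1)], folded wtwist_def]
      show "aform R (\<lambda>r. r) M (carrier M) (wtwist R p N Cs) m (\<lambda>zs. wsym R (twist R p N) ?Cp [map g zs, \<omega>])"
        by (rule bb(1))
      fix zs assume z: "length zs = m" "set zs \<subseteq> carrier M"
      have gz: "[map g zs, \<omega>] \<in> wgen ?Cp" using z \<omega> slin_closed[OF g] by (auto simp: tCs[OF q(1)] wgen_Cons)
      have "map g' (map (tw_in R q M) zs) = map (tw_tw R p q N) (map g zs)" using z g'(2) by auto
      then show "wsym R (twist R (p * q) N) ?Cq [map g' (map (tw_in R q M) zs), \<omega>'] =
          wtw_tw R p q N Cs (wsym R (twist R p N) ?Cp [map g zs, \<omega>])"
        using wtw_tw(2)[OF q N ok' gz] by (simp add: \<omega>'_def del: map_map)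
    qed (use c c' in auto)
    finally show "?f' (wtw_in R q M Eb (wsym R M Eb xss)) = wtw_tw R p q N Cs (f (wsym R M Eb xss))"
      using fv[OF vs(2,3)] vs(1) by simp
  qed
  then show "twistable R p q M Eb N Cs f" unfolding twistable_def using l'(1) by blast
qed

section \<open>The local structure of Frobenius and Verschiebung\<close>

section \<open>Frobenius and Verschiebung in adapted bases\<close>

lemma strict_sorted_nth_ge: "sorted_wrt (<) (ks :: nat list) \<Longrightarrow> i < length ks \<Longrightarrow> i \<le> ks ! i"
proof (induction i)
  case (Suc i)
  then have "ks ! i < ks ! Suc i" by (simp add: sorted_wrt_iff_nth_less)
  then show ?case using Suc by simp
qed simp

text \<open>One index \<open>k\<close>: \<open>E\<close> is the module at \<open>k\<close>,
  \<open>E'\<close> the module at \<open>k - 1\<close>, and \<open>d\<close> the Hodge rank at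
  \<open>k - 1\<close>. A basis is given on \<open>E'\<close>; the one on \<open>E\<close> will be
  built from it by means of \<open>F\<close> and \<open>V\<close>.\<close>

locale fv_step =
  fixes R :: "'r ring" and p :: nat and E E' :: "('r, 'e) module"
    and F :: "('e \<Rightarrow> 'r) set \<Rightarrow> 'e" and V :: "'e \<Rightarrow> ('e \<Rightarrow> 'r) set"
    and h d :: nat and b' :: "nat \<Rightarrow> 'e" and c' :: "nat \<Rightarrow> 'e \<Rightarrow> 'r"
  assumes frob: "frob_pow R p \<in> ring_hom R R" and E: "rmod R E" and E': "rmod R E'"
    and db': "dual_basis R E' h b' c'" and dh: "d \<le> h"
    and F: "lin R (twist R p E') E F" and V: "lin R E (twist R p E') V"
    and kerV: "{x \<in> carrier E. V x = \<zero>\<^bsub>twist R p E'\<^esub>} = F ` carrier (twist R p E')"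
    and kerF: "{t \<in> carrier (twist R p E'). F t = \<zero>\<^bsub>E\<^esub>} = V ` carrier E"
    and imV: "V ` carrier E = csub R (twist R p E') (\<lambda>k. tw_fun R p (c' k)) {d..<h}"
begin

abbreviation "T \<equiv> twist R p E'"

definition t where "t k = tw_in R p E' (b' k)"
definition tc where "tc k = tw_fun R p (c' k)"

sublocale E: rmod R E by (rule E)
sublocale T: rmod R T by (rule twist_module[OF frob E'])

lemma tdb: "dual_basis R T h t tc"
  using twist_dual_basis[OF frob E' db'] by (simp add: t_def[abs_def] tc_def[abs_def])

lemma self: "rmod R (self_mod R)"
  by (rule self_mod_module[OF module_cring[OF E]])

lemmas Tb = dual_basisD[OF tdb]

lemma imV': "V ` carrier E = csub R T tc {d..<h}"
  using imV by (simp add: tc_def[abs_def])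

lemma Vc: "x \<in> carrier E \<Longrightarrow> V x \<in> carrier T" by (rule slin_closed[OF V])
lemma Fc: "w \<in> carrier T \<Longrightarrow> F w \<in> carrier E" by (rule slin_closed[OF F])

lemma VF: "w \<in> carrier T \<Longrightarrow> V (F w) = \<zero>\<^bsub>T\<^esub>"
  using kerV by auto

lemma FV: "x \<in> carrier E \<Longrightarrow> F (V x) = \<zero>\<^bsub>E\<^esub>"
  using kerF by auto

lemma tcV: "x \<in> carrier E \<Longrightarrow> d \<le> k \<Longrightarrow> k < h \<Longrightarrow> tc k (V x) = \<zero>\<^bsub>R\<^esub>"
proof -
  assume x: "x \<in> carrier E" and k: "d \<le> k" "k < h"
  have "V x \<in> csub R T tc {d..<h}" using x imV' by blast
  then show ?thesis using k by (simp add: csub_def)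
qed

lemma t_im: "k < d \<Longrightarrow> t k \<in> V ` carrier E"
proof -
  assume "k < d"
  then have "tc l (t k) = \<zero>\<^bsub>R\<^esub>" if "l \<in> {d..<h}" for l using that dh by (intro Tb(4)) auto
  then show ?thesis unfolding imV' using Tb(1)[of k] \<open>k < d\<close> dh by (simp add: csub_def)
qed

lemma Ft0: "k < d \<Longrightarrow> F (t k) = \<zero>\<^bsub>E\<^esub>"
  using t_im[of k] FV by (auto simp: image_iff)

text \<open>Preimages under \<open>V\<close> of a basis of its image, completed by the images under
  \<open>F\<close> of the other twisted basis vectors. They will form a basis because Ker
  \<open>V\<close> = Im \<open>F\<close> and because the kernel of \<open>F\<close> is spanned by
  the \<open>t k\<close> with \<open>k < d\<close>.\<close>

definition e where "e k = (if k < d then (SOME x. x \<in> carrier E \<and> V x = t k) else F (t k))"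

lemma e1: "k < d \<Longrightarrow> e k \<in> carrier E \<and> V (e k) = t k"
proof -
  assume "k < d"
  then have "\<exists>x. x \<in> carrier E \<and> V x = t k" using t_im[of k] by (auto simp: image_iff)
  then show ?thesis using someI_ex[of "\<lambda>x. x \<in> carrier E \<and> V x = t k"] \<open>k < d\<close> by (simp add: e_def)
qed

lemma e2: "d \<le> k \<Longrightarrow> e k = F (t k)" by (simp add: e_def)

lemma ec_closed: "k < h \<Longrightarrow> e k \<in> carrier E"
  using e1 e2 Fc Tb(1) by (cases "k < d") auto

text \<open>The linear section of \<open>V\<close> over its image given by the \<open>e\<^sub>k\<close>, \<open>k < d\<close>; \<open>z x\<close> is then a preimage of
  \<open>x - s x\<close> under \<open>F\<close>.\<close>

definition s where "s x = finsum E (\<lambda>k. tc k (V x) \<odot>\<^bsub>E\<^esub> e k) {..<d}"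

lemma tcV_lin: "k < h \<Longrightarrow> lin R E (self_mod R) (\<lambda>x. tc k (V x))"
  using slin_comp[OF V Tb(2)] by simp

lemma s_lin: "lin R E E s"
  unfolding s_def by (rule lin_comb[OF E E]) (use tcV_lin e1 dh in auto)

lemma sc: "x \<in> carrier E \<Longrightarrow> s x \<in> carrier E" by (rule slin_closed[OF s_lin])

lemma tcV_closed: "x \<in> carrier E \<Longrightarrow> k < h \<Longrightarrow> tc k (V x) \<in> carrier R"
  using Tb(6) Vc by simp

text \<open>The coordinates of \<open>V x\<close> with index at least \<open>d\<close> vanish, so
  the sum over \<open>k < d\<close> is its full expansion.\<close>

lemma Vs: "x \<in> carrier E \<Longrightarrow> V (s x) = V x"
proof -
  assume x: "x \<in> carrier E"
  have "V (s x) = finsum T (\<lambda>k. V (tc k (V x) \<odot>\<^bsub>E\<^esub> e k)) {..<d}"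
    unfolding s_def by (rule E.slin_finsum[OF T.rmod_axioms V]) (use e1 x dh tcV_closed in auto)
  also have "\<dots> = finsum T (\<lambda>k. tc k (V x) \<odot>\<^bsub>T\<^esub> t k) {..<d}"
    by (rule T.M.finsum_cong) (use e1 x dh tcV_closed Tb(1) in \<open>auto simp: simp_implies_def slin_smult[OF V]\<close>)
  also have "\<dots> = finsum T (\<lambda>k. tc k (V x) \<odot>\<^bsub>T\<^esub> t k) {..<h}"
    by (rule T.finsum_superset[symmetric]) (use x dh tcV_closed Tb(1) tcV in auto)
  also have "\<dots> = V x" by (rule Tb(5)[OF Vc[OF x]])
  finally show ?thesis .
qed

definition z where "z x = (SOME w. w \<in> carrier T \<and> F w = x \<ominus>\<^bsub>E\<^esub> s x)"

lemma z: "x \<in> carrier E \<Longrightarrow> z x \<in> carrier T \<and> F (z x) = x \<ominus>\<^bsub>E\<^esub> s x"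
proof -
  assume x: "x \<in> carrier E"
  have "V (x \<ominus>\<^bsub>E\<^esub> s x) = \<zero>\<^bsub>T\<^esub>"
    using E.slin_diff[OF T.rmod_axioms V x sc[OF x]] Vs[OF x] Vc[OF x] by (simp add: T.diff_eq_zero)
  then have "x \<ominus>\<^bsub>E\<^esub> s x \<in> F ` carrier T" using kerV x sc[OF x] by blast
  then have "\<exists>w. w \<in> carrier T \<and> F w = x \<ominus>\<^bsub>E\<^esub> s x" by (auto simp: image_iff)
  then show ?thesis unfolding z_def by (rule someI_ex)
qed

text \<open>From \<open>d\<close> on the coordinates are read off a chosen preimage under
  \<open>F\<close>; by \<open>ec_eq\<close> the choice is immaterial.\<close>

definition ec where "ec k x = (if k < d then tc k (V x) else tc k (z x))"

text \<open>Two preimages differ by an element of Ker \<open>F\<close> = Im \<open>V\<close>, where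
  the coordinates \<open>tc k\<close> with \<open>d \<le> k\<close> are zero.\<close>

lemma ec_eq:
  assumes x: "x \<in> carrier E" and w: "w \<in> carrier T" "F w = x \<ominus>\<^bsub>E\<^esub> s x" and k: "d \<le> k" "k < h"
  shows "ec k x = tc k w"
proof -
  have zx: "z x \<in> carrier T" "F (z x) = F w" using z[OF x] w by auto
  have "F (z x \<ominus>\<^bsub>T\<^esub> w) = \<zero>\<^bsub>E\<^esub>"
    using T.slin_diff[OF E F zx(1) w(1)] zx(2) Fc[OF w(1)] by (simp add: E.diff_eq_zero)
  then have "z x \<ominus>\<^bsub>T\<^esub> w \<in> csub R T tc {d..<h}" using kerF imV' zx w by auto
  then have "tc k (z x \<ominus>\<^bsub>T\<^esub> w) = \<zero>\<^bsub>R\<^esub>" using k by (simp add: csub_def)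
  then have "tc k (z x) \<ominus>\<^bsub>self_mod R\<^esub> tc k w = \<zero>\<^bsub>self_mod R\<^esub>"
    using T.slin_diff[OF self Tb(2)[OF k(2)] zx(1) w(1)] by (simp add: self_mod_simps)
  then have "tc k (z x) = tc k w"
    using rmod.diff_eq_zero[OF self, of "tc k (z x)" "tc k w"] Tb(6)[OF k(2)] zx w by (simp add: self_mod_simps)
  then show ?thesis using k by (simp add: ec_def)
qed

lemma sF: "w \<in> carrier T \<Longrightarrow> s (F w) = \<zero>\<^bsub>E\<^esub>"
proof -
  assume w: "w \<in> carrier T"
  have "tc k \<zero>\<^bsub>T\<^esub> = \<zero>\<^bsub>R\<^esub>" if "k < d" for k
    using T.slin_zero[OF self Tb(2)] that dh by (simp add: self_mod_simps)
  then have "s (F w) = finsum E (\<lambda>k. \<zero>\<^bsub>E\<^esub>) {..<d}"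
    unfolding s_def VF[OF w] by (intro E.M.finsum_cong) (use e1 in \<open>auto simp: simp_implies_def\<close>)
  then show ?thesis by simp
qed

lemma ecF: "w \<in> carrier T \<Longrightarrow> d \<le> k \<Longrightarrow> k < h \<Longrightarrow> ec k (F w) = tc k w"
  by (rule ec_eq) (auto simp: Fc sF E.diff_zero)

lemma ecF0: "w \<in> carrier T \<Longrightarrow> k < d \<Longrightarrow> ec k (F w) = \<zero>\<^bsub>R\<^esub>"
  using T.slin_zero[OF self Tb(2)] dh by (simp add: ec_def VF self_mod_simps)

lemma ecV: "k < d \<Longrightarrow> ec k x = tc k (V x)"
  by (simp add: ec_def)

text \<open>For \<open>d \<le> k\<close>, sums and multiples of chosen preimages are again
  admissible preimages, so \<open>ec_eq\<close> yields linearity even if the choice \<open>z\<close>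
  is not linear.\<close>

lemma ec_lin: "k < h \<Longrightarrow> lin R E (self_mod R) (ec k)"
proof (cases "k < d")
  case True
  assume "k < h"
  then show ?thesis using slin_cong[OF tcV_lin _ E, of k "ec k"] True by (simp add: ecV)
next
  case False
  assume k: "k < h"
  show ?thesis
  proof (rule slinI)
    fix x assume x: "x \<in> carrier E"
    note zx = z[OF x]
    show "ec k x \<in> carrier (self_mod R)" using zx Tb(6)[OF k] False by (simp add: ec_def self_mod_simps)
    {
      fix y assume y: "y \<in> carrier E"
      note zy = z[OF y]
      have "F (z x \<oplus>\<^bsub>T\<^esub> z y) = (x \<ominus>\<^bsub>E\<^esub> s x) \<oplus>\<^bsub>E\<^esub> (y \<ominus>\<^bsub>E\<^esub> s y)"
        using zx zy by (simp add: slin_add[OF F])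
      also have "\<dots> = (x \<oplus>\<^bsub>E\<^esub> y) \<ominus>\<^bsub>E\<^esub> s (x \<oplus>\<^bsub>E\<^esub> y)"
        using x y sc by (simp add: slin_add[OF s_lin] a_minus_def E.M.minus_add E.M.a_ac)
      finally have "ec k (x \<oplus>\<^bsub>E\<^esub> y) = tc k (z x \<oplus>\<^bsub>T\<^esub> z y)"
        by (intro ec_eq) (use x y zx zy k False in auto)
      then show "ec k (x \<oplus>\<^bsub>E\<^esub> y) = ec k x \<oplus>\<^bsub>self_mod R\<^esub> ec k y"
        using slin_add[OF Tb(2)[OF k]] zx zy False by (simp add: ec_def)
    }
    fix r assume r: "r \<in> carrier R"
    have "F (r \<odot>\<^bsub>T\<^esub> z x) = r \<odot>\<^bsub>E\<^esub> (x \<ominus>\<^bsub>E\<^esub> s x)" using zx r by (simp add: slin_smult[OF F])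
    also have "\<dots> = (r \<odot>\<^bsub>E\<^esub> x) \<ominus>\<^bsub>E\<^esub> s (r \<odot>\<^bsub>E\<^esub> x)"
      using x r sc by (simp add: slin_smult[OF s_lin] a_minus_def E.smult_r_distr E.smult_r_minus)
    finally have "ec k (r \<odot>\<^bsub>E\<^esub> x) = tc k (r \<odot>\<^bsub>T\<^esub> z x)"
      by (intro ec_eq) (use x r zx k False in auto)
    then show "ec k (r \<odot>\<^bsub>E\<^esub> x) = r \<odot>\<^bsub>self_mod R\<^esub> ec k x"
      using slin_smult[OF Tb(2)[OF k]] zx r False by (simp add: ec_def)
  qed
qed

lemma se: "l < d \<Longrightarrow> s (e l) = e l"
proof -
  assume l: "l < d"
  have "tc k (t l) = (if k = l then \<one>\<^bsub>R\<^esub> else \<zero>\<^bsub>R\<^esub>)" if "k < d" for k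
    using Tb(3)[of k] Tb(4)[of k l] that l dh by auto
  then have "s (e l) = tc l (V (e l)) \<odot>\<^bsub>E\<^esub> e l"
    unfolding s_def by (intro E.finsum_single[of _ l]) (use e1 l in auto)
  then show ?thesis using e1[OF l] Tb(3)[of l] l dh by simp
qed

text \<open>Every \<open>x\<close> is the sum of \<open>s x\<close>, a combination of the
  \<open>e k\<close> with \<open>k < d\<close>, and of \<open>F (z x)\<close>, a combination of the
  others.\<close>

lemma edb: "dual_basis R E h e ec"
  unfolding dual_basis_def
proof (intro conjI allI impI ballI)
  fix k l assume k: "k < h" and l: "l < h"
  show "ec k (e l) = (if k = l then \<one>\<^bsub>R\<^esub> else \<zero>\<^bsub>R\<^esub>)"
  proof (cases "l < d")
    case True
    show ?thesis
    proof (cases "k < d")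
      case k': True
      then show ?thesis using e1[OF True] Tb(3)[OF k] Tb(4)[OF k l] by (auto simp: ecV)
    next
      case False
      have "e l \<ominus>\<^bsub>E\<^esub> s (e l) = \<zero>\<^bsub>E\<^esub>" using se[OF True] e1[OF True] by (simp add: E.diff_eq_zero)
      then have "ec k (e l) = tc k \<zero>\<^bsub>T\<^esub>"
        using e1[OF True] False k T.slin_zero[OF E F] by (intro ec_eq) auto
      then show ?thesis using T.slin_zero[OF self Tb(2)[OF k]] False True by (auto simp: self_mod_simps)
    qed
  next
    case False
    show ?thesis
    proof (cases "k < d")
      case True
      then show ?thesis using ecF0[OF Tb(1)[OF l]] False by (auto simp: e2)
    next
      case k': False
      then show ?thesis using ecF[OF Tb(1)[OF l], of k] k False Tb(3)[OF k] Tb(4)[OF k l] by (auto simp: e2)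
    qed
  qed
next
  fix x assume x: "x \<in> carrier E"
  have zc: "z x \<in> carrier T" "F (z x) = x \<ominus>\<^bsub>E\<^esub> s x" using z[OF x] by auto
  have ex: "ec k x \<in> carrier R" if "k < h" for k by (rule fun_closed[OF ec_lin[OF that] x])
  have "F (z x) = F (finsum T (\<lambda>k. tc k (z x) \<odot>\<^bsub>T\<^esub> t k) {..<h})" using Tb(5)[OF zc(1)] by simp
  also have "\<dots> = finsum E (\<lambda>k. F (tc k (z x) \<odot>\<^bsub>T\<^esub> t k)) {..<h}"
    by (rule T.slin_finsum[OF E F]) (use Tb(1,6) zc in auto)
  \<comment> \<open>The terms below \<open>d\<close> drop out because \<open>F\<close> kills
    \<open>t k\<close> for \<open>k < d\<close>.\<close>
  also have "\<dots> = finsum E (\<lambda>k. F (tc k (z x) \<odot>\<^bsub>T\<^esub> t k)) {d..<h}"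
    by (rule E.finsum_superset) (use Tb(1,6) zc Ft0 Fc in \<open>auto simp: slin_smult[OF F]\<close>)
  also have "\<dots> = finsum E (\<lambda>k. ec k x \<odot>\<^bsub>E\<^esub> e k) {d..<h}"
    by (rule E.M.finsum_cong)
       (use Tb(1,6) zc Fc ex ec_closed in \<open>auto simp: simp_implies_def slin_smult[OF F] ec_def e2\<close>)
  finally have 1: "finsum E (\<lambda>k. ec k x \<odot>\<^bsub>E\<^esub> e k) {d..<h} = x \<ominus>\<^bsub>E\<^esub> s x" using zc by simp
  have 2: "finsum E (\<lambda>k. ec k x \<odot>\<^bsub>E\<^esub> e k) {..<d} = s x"
    unfolding s_def
    by (rule E.M.finsum_cong) (use x tcV_closed e1 dh in \<open>auto simp: simp_implies_def ecV\<close>)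
  have "{..<h} = {..<d} \<union> {d..<h}" using dh by auto
  then have "finsum E (\<lambda>k. ec k x \<odot>\<^bsub>E\<^esub> e k) {..<h} =
      finsum E (\<lambda>k. ec k x \<odot>\<^bsub>E\<^esub> e k) {..<d} \<oplus>\<^bsub>E\<^esub> finsum E (\<lambda>k. ec k x \<odot>\<^bsub>E\<^esub> e k) {d..<h}"
    using ex ec_closed dh by (simp add: E.M.finsum_Un_disjoint ivl_disj_int)
  also have "\<dots> = x" unfolding 1 2 using x sc[OF x]
    using E.M.a_lcomm[of "s x" x "\<ominus>\<^bsub>E\<^esub> s x"] by (simp add: a_minus_def E.M.r_neg)
  finally show "x = finsum E (\<lambda>k. ec k x \<odot>\<^bsub>E\<^esub> e k) {..<h}" by simp
qed (use ec_closed ec_lin in auto)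

lemmas Eb = dual_basisD[OF edb]

text \<open>The coordinates of \<open>V x\<close> from \<open>d\<close> on are zero in any case, so
  only the indices between \<open>m\<close> and \<open>d\<close> impose a condition.\<close>

lemma tilde1:
  assumes "m \<le> d"
  shows "{x \<in> carrier E. V x \<in> csub R T tc {m..<h}} = csub R E ec {m..<d}"
  using assms dh tcV Vc by (auto simp: csub_def ecV)

text \<open>If the coordinates of \<open>x\<close> below \<open>d\<close> vanish, then
  \<open>s x\<close> is zero, so \<open>x\<close> equals \<open>F (z x)\<close> and its other
  coordinates are those of \<open>z x\<close>.\<close>

lemma tilde2:
  assumes m: "d \<le> m" "m \<le> h"
  shows "F ` csub R T tc {m..<h} = csub R E ec ({..<d} \<union> {m..<h})"
proof
  show "F ` csub R T tc {m..<h} \<subseteq> csub R E ec ({..<d} \<union> {m..<h})"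
    using m Fc ecF ecF0 by (auto simp: csub_def)
  show "csub R E ec ({..<d} \<union> {m..<h}) \<subseteq> F ` csub R T tc {m..<h}"
  proof
    fix x assume x: "x \<in> csub R E ec ({..<d} \<union> {m..<h})"
    then have xc: "x \<in> carrier E" by (simp add: csub_def)
    have "tc k (V x) = \<zero>\<^bsub>R\<^esub>" if "k < d" for k using x that ecV[OF that, of x] by (simp add: csub_def)
    then have "s x = finsum E (\<lambda>k. \<zero>\<^bsub>E\<^esub>) {..<d}"
      unfolding s_def by (intro E.M.finsum_cong) (use e1 in \<open>auto simp: simp_implies_def\<close>)
    then have "F (z x) = x" using z[OF xc] xc by (simp add: E.diff_zero)
    moreover have "z x \<in> csub R T tc {m..<h}"
    proof -
      have "tc k (z x) = \<zero>\<^bsub>R\<^esub>" if k: "k \<in> {m..<h}" for k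
      proof -
        have "ec k x = \<zero>\<^bsub>R\<^esub>" using x k by (simp add: csub_def)
        then show ?thesis using k m by (simp add: ec_def)
      qed
      then show ?thesis using z[OF xc] by (simp add: csub_def)
    qed
    ultimately show "x \<in> F ` csub R T tc {m..<h}" by (metis imageI)
  qed
qed

text \<open>A linear partial inverse of \<open>F\<close>: it sends \<open>e k\<close> to
  \<open>t k\<close> for \<open>d \<le> k\<close> and to zero for \<open>k < d\<close>.\<close>

definition g where "g x = finsum T (\<lambda>k. ec k x \<odot>\<^bsub>T\<^esub> t k) {d..<h}"

lemma g_lin: "lin R E T g"
  unfolding g_def by (rule lin_comb[OF E T.rmod_axioms]) (use ec_lin Tb(1) in auto)

lemma g0: "k < d \<Longrightarrow> g (e k) = \<zero>\<^bsub>T\<^esub>"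
proof -
  assume k: "k < d"
  have "ec l (e k) = \<zero>\<^bsub>R\<^esub>" if "l \<in> {d..<h}" for l using that k dh by (intro Eb(4)) auto
  then have "g (e k) = finsum T (\<lambda>l. \<zero>\<^bsub>T\<^esub>) {d..<h}"
    unfolding g_def by (intro T.M.finsum_cong) (use Tb(1) in \<open>auto simp: simp_implies_def\<close>)
  then show ?thesis by simp
qed

text \<open>\<open>g (F w)\<close> has the same coordinates as \<open>w\<close> from
  \<open>d\<close> on, so the error lies in the image of \<open>V\<close>.\<close>

lemma gF:
  assumes w: "w \<in> carrier T"
  shows "g (F w) \<in> carrier T" "g (F w) \<ominus>\<^bsub>T\<^esub> w \<in> csub R T tc {d..<h}"
proof -
  show gc: "g (F w) \<in> carrier T" by (rule slin_closed[OF g_lin Fc[OF w]])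
  interpret S: rmod R "self_mod R" by (rule self)
  have "tc k (g (F w) \<ominus>\<^bsub>T\<^esub> w) = \<zero>\<^bsub>R\<^esub>" if k: "k \<in> {d..<h}" for k
  proof -
    have kh: "k < h" using k by simp
    have ecc: "ec l (F w) \<in> carrier R" if "l < h" for l by (rule fun_closed[OF ec_lin[OF that] Fc[OF w]])
    have "tc k (g (F w)) = finsum (self_mod R) (\<lambda>l. tc k (ec l (F w) \<odot>\<^bsub>T\<^esub> t l)) {d..<h}"
      unfolding g_def by (rule T.slin_finsum[OF self Tb(2)[OF kh]]) (use ecc Tb(1) in auto)
    also have "\<dots> = tc k (ec k (F w) \<odot>\<^bsub>T\<^esub> t k)"
    proof (rule S.finsum_single)
      show "tc k (ec k (F w) \<odot>\<^bsub>T\<^esub> t k) \<in> carrier (self_mod R)"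
        by (rule slin_closed[OF Tb(2)[OF kh]]) (use ecc Tb(1) kh in auto)
      fix l assume "l \<in> {d..<h}" "l \<noteq> k"
      then show "tc k (ec l (F w) \<odot>\<^bsub>T\<^esub> t l) = \<zero>\<^bsub>self_mod R\<^esub>"
        using slin_smult[OF Tb(2)[OF kh] ecc[of l] Tb(1)[of l]] Tb(4)[OF kh, of l] ecc[of l]
        by (simp add: self_mod_simps)
    qed (use k in auto)
    also have "\<dots> = tc k w"
      using slin_smult[OF Tb(2)[OF kh] ecc[OF kh] Tb(1)[OF kh]] Tb(3)[OF kh] ecc[OF kh] ecF[OF w, of k] k
      by (simp add: self_mod_simps)
    finally have "tc k (g (F w)) = tc k w" .
    then show ?thesis
      using T.slin_diff[OF self Tb(2)[OF kh] gc w] S.diff_eq_zero[of "tc k w" "tc k w"] Tb(6)[OF kh w]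
      by (simp add: self_mod_simps)
  qed
  then show "g (F w) \<ominus>\<^bsub>T\<^esub> w \<in> csub R T tc {d..<h}" using gc w by (simp add: csub_def)
qed

text \<open>In a strictly increasing index list every entry from position \<open>d\<close> on is at
  least \<open>d\<close>. So all but the first \<open>d\<close> vectors of a sorted list of basis
  vectors are images under \<open>F\<close>.\<close>

lemma span_split:
  assumes N: "rmod R N" and n: "d \<le> n" and a: "aform R (\<lambda>r. r) E (carrier E) N n f"
    and f0: "\<And>xs ys. set xs \<subseteq> carrier E \<Longrightarrow> length xs = d \<Longrightarrow> set ys \<subseteq> carrier T \<Longrightarrow> length ys = n - d \<Longrightarrow>
      f (xs @ map F ys) = \<zero>\<^bsub>N\<^esub>"
    and vs: "length vs = n" "set vs \<subseteq> carrier E"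
  shows "f vs = \<zero>\<^bsub>N\<^esub>"
proof -
  have c: "carrier E = mspan R E (e ` {..<h})" using csub_span[OF E edb, of "{}"] by (simp add: csub_def)
  show ?thesis
  proof (rule aform_basis0[OF N E _ _ a[unfolded c] _ vs(1) vs(2)[unfolded c]])
    show "e ` {..<h} \<subseteq> carrier E" using ec_closed by auto
    fix ks assume k: "length ks = n" "sorted_wrt (<) ks" "set ks \<subseteq> {..<h}"
    let ?ys = "map t (drop d ks)"
    have ge: "d \<le> k" if "k \<in> set (drop d ks)" for k
    proof -
      obtain i where i: "i < length (drop d ks)" "k = drop d ks ! i" using \<open>k \<in> _\<close> by (metis in_set_conv_nth)
      then have "k = ks ! (d + i)" using n k(1) by simp
      then show ?thesis using strict_sorted_nth_ge[OF k(2), of "d + i"] i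
        by (simp add: less_diff_conv add.commute)
    qed
    have "map e (drop d ks) = map F ?ys" using ge by (auto simp: e2)
    then have "map e ks = map e (take d ks) @ map F ?ys" by (metis append_take_drop_id map_append)
    moreover have "f (map e (take d ks) @ map F ?ys) = \<zero>\<^bsub>N\<^esub>"
    proof (rule f0)
      have "set (take d ks) \<subseteq> {..<h}" "set (drop d ks) \<subseteq> {..<h}"
        using k(3) set_take_subset[of d ks] set_drop_subset[of d ks] by blast+
      then show "set (map e (take d ks)) \<subseteq> carrier E" "set ?ys \<subseteq> carrier T" using ec_closed Tb(1) by auto
    qed (use k n in auto)
    ultimately show "f (map e ks) = \<zero>\<^bsub>N\<^esub>" by simp
  qed auto
qed

text \<open>Evaluates the definite descriptions in \<open>fd\<close> and \<open>theta\<close>: by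
  \<open>span_split\<close> a linear map is determined by its values on the symbols
  \<open>xs @ map F ys\<close>.\<close>

lemma the_split:
  assumes N: "rmod R N" and n: "d \<le> n" and B: "B \<subseteq> carrier E"
    and u0: "lin R (wedges R E [(n, carrier E, B)]) N u0"
    and r: "\<And>xs ys. set xs \<subseteq> carrier E \<Longrightarrow> length xs = d \<Longrightarrow> set ys \<subseteq> carrier T \<Longrightarrow> length ys = n - d \<Longrightarrow>
      u0 (wsym R E [(n, carrier E, B)] [xs @ map F ys]) = rhs xs ys"
    and w: "w \<in> carrier (wedges R E [(n, carrier E, B)])"
  shows "(THE u. u \<in> lin_map R (wedges R E [(n, carrier E, B)]) N \<and>
    (\<forall>xs ys. set xs \<subseteq> carrier E \<and> length xs = d \<and> set ys \<subseteq> carrier T \<and> length ys = n - d \<longrightarrow>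
       u (wsym R E [(n, carrier E, B)] [xs @ map F ys]) = rhs xs ys)) w = u0 w" (is "(THE u. ?P u) w = _")
proof -
  let ?Bs = "[(n, carrier E, B)]" let ?W = "wedges R E ?Bs"
  interpret N: rmod R N by (rule N)
  have ok: "blocks_ok R E ?Bs" using B E.carrier_is_submodule by (simp add: blocks_ok_def)
  note Wm = wedges_module[OF E ok]
  have gen: "[xs @ map F ys] \<in> wgen ?Bs"
    if "set xs \<subseteq> carrier E" "length xs = d" "set ys \<subseteq> carrier T" "length ys = n - d" for xs ys
    using that n Fc by (auto simp: wgen_Cons)
  have id: "(\<lambda>r. r) \<in> carrier R \<rightarrow> carrier R" by auto
  have sy: "aform R (\<lambda>r. r) E (carrier E) ?W n (\<lambda>xs. wsym R E ?Bs [xs])"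
    using multi_wsym[OF E ok] unfolding multi_single by blast
  have uniq: "u x = u0 x" if u: "lin R ?W N u" and ur: "\<And>xs ys. set xs \<subseteq> carrier E \<Longrightarrow> length xs = d \<Longrightarrow> set ys \<subseteq> carrier T \<Longrightarrow> length ys = n - d \<Longrightarrow>
      u (wsym R E ?Bs [xs @ map F ys]) = rhs xs ys" and x: "x \<in> carrier ?W" for u x
  proof (rule wedges_eq[OF E ok N u u0 _ x])
    fix xss assume "xss \<in> wgen ?Bs"
    then obtain vs where vs: "xss = [vs]" "length vs = n" "set vs \<subseteq> carrier E" by (auto simp: wgen_Cons)
    have a: "aform R (\<lambda>r. r) E (carrier E) N n (\<lambda>xs. u (wsym R E ?Bs [xs]) \<ominus>\<^bsub>N\<^esub> u0 (wsym R E ?Bs [xs]))"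
      by (rule aform_diff[OF _ _ N id E.carrier_is_submodule E])
         (use aform_comp[OF sy u Wm N id] aform_comp[OF sy u0 Wm N id] in simp_all)
    have "u (wsym R E ?Bs [vs]) \<ominus>\<^bsub>N\<^esub> u0 (wsym R E ?Bs [vs]) = \<zero>\<^bsub>N\<^esub>"
    proof (rule span_split[OF N n a _ vs(2,3)])
      fix xs ys assume xy: "set xs \<subseteq> carrier E" "length xs = d" "set ys \<subseteq> carrier T" "length ys = n - d"
      have "wsym R E ?Bs [xs @ map F ys] \<in> carrier ?W" by (rule wsym_closed[OF E ok gen[OF xy]])
      then have "u0 (wsym R E ?Bs [xs @ map F ys]) \<in> carrier N" by (rule slin_closed[OF u0])
      then show "u (wsym R E ?Bs [xs @ map F ys]) \<ominus>\<^bsub>N\<^esub> u0 (wsym R E ?Bs [xs @ map F ys]) = \<zero>\<^bsub>N\<^esub>"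
        unfolding ur[OF xy] r[OF xy] by (simp add: N.diff_eq_zero)
    qed
    moreover have "wsym R E ?Bs [vs] \<in> carrier ?W" using aformD(1)[OF sy vs(2,3)] .
    ultimately show "u (wsym R E ?Bs xss) = u0 (wsym R E ?Bs xss)"
      using slin_closed[OF u] slin_closed[OF u0] by (simp add: vs(1) N.diff_eq_zero)
  qed
  have "(THE u. ?P u) = restrict u0 (carrier ?W)"
  proof (rule the_equality)
    show "?P (restrict u0 (carrier ?W))"
      using lin_map_restrict[OF Wm u0] r wsym_closed[OF E ok gen] by simp
  next
    fix u assume u: "?P u"
    then have ul: "lin R ?W N u" and ue: "u \<in> extensional (carrier ?W)" by (auto simp: lin_map_iff)
    show "u = restrict u0 (carrier ?W)"
      by (rule extensionalityI[OF ue]) (use uniq[OF ul] u in auto)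
  qed
  then show ?thesis using w by simp
qed

text \<open>The common lift of \<open>f\<^sub>i\<^sup>n\<close> and of \<open>theta\<close> for \<open>n > d\<close>: contract with the coordinates dual to
  the \<open>e\<^sub>k\<close>, \<open>k < d\<close>, and apply the partial inverse \<open>g\<close> of \<open>F\<close> to what remains.\<close>

lemma cform_split:
  assumes n: "d \<le> n" and A': "A' = csub R E' c' {d..<h}" and B: "A' \<subseteq> B" "B \<subseteq> carrier E'"
  defines "Cs \<equiv> tw_blocks R p E' [(n - d, carrier E', B), (d, A', {\<zero>\<^bsub>E'\<^esub>})]"
  assumes xy: "set xs \<subseteq> carrier E" "length xs = d" "set ys \<subseteq> carrier T" "length ys = n - d"
  shows "cform R T Cs (map ec [0..<d]) g (map t [0..<d]) (xs @ map F ys) = wsym R T Cs [ys, map V xs]"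
proof -
  interpret E': rmod R E' by (rule E')
  let ?tA = "tw_sub R p E' A'" and ?tB = "tw_sub R p E' B"
  have A'c: "A' \<subseteq> carrier E'" using A' by (auto simp: csub_def)
  have A's: "submodule A' R E'" unfolding A' by (rule csub_submodule[OF E']) (use dual_basisD(2)[OF db'] in auto)
  have tA: "?tA = csub R T tc {d..<h}"
    unfolding A' tc_def[abs_def] by (rule tw_sub_csub[OF frob E' db']) auto
  \<comment> \<open>\<open>B\<close> may be anything between \<open>A'\<close> and
    \<open>E'\<close>: it will be \<open>A'\<close> for the common lift and the filtration step for
    the line bundle.\<close>
  have tAB: "?tA \<subseteq> ?tB" by (rule tw_sub_mono[OF frob E' B(1)])
  have tBc: "?tB \<subseteq> carrier T" by (rule tw_sub_subset[OF frob E' B(2)])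
  have Cs: "Cs = [(n - d, carrier T, ?tB), (d, ?tA, {\<zero>\<^bsub>T\<^esub>})]"
    by (simp add: Cs_def tw_blocks_def tw_sub_carrier[OF frob E'] tw_sub_zero[OF frob E'])
  have ok: "blocks_ok R T [(n - d, carrier T, ?tB), (d, ?tA, {\<zero>\<^bsub>T\<^esub>})]"
    using T.carrier_is_submodule tw_sub_submodule[OF frob E' A'c] tBc by (simp add: blocks_ok_def)
  have tAs: "submodule ?tA R T" by (rule tw_sub_submodule[OF frob E' A'c])
  let ?W = "wedges R T Cs" and ?\<omega> = "map t [0..<d]" and ?c = "cform R T Cs (map ec [0..<d]) g (map t [0..<d])"
  have Wm: "rmod R ?W" using wedges_module[OF T.rmod_axioms ok] by (simp add: Cs)
  interpret W: rmod R ?W by (rule Wm)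
  have VA: "V ` carrier E \<subseteq> ?tA" using imV' tA by simp
  have \<omega>: "length ?\<omega> = d" "set ?\<omega> \<subseteq> ?tA" using t_im imV' tA by auto
  note cb = cform_base[OF E T.rmod_axioms ok g_lin \<omega>, folded Cs]
  have ecl: "x \<in> set (map ec [0..<d]) \<Longrightarrow> lin R E (self_mod R) x" for x using ec_lin dh by auto
  have cm: "aform R (\<lambda>r. r) E (carrier E) ?W (n - d + length (map ec [0..<d])) ?c"
    using cform_multi(2)[where cs = "map ec [0..<d]", OF E T.rmod_axioms ok g_lin \<omega> ecl, folded Cs] .
  have cmn: "aform R (\<lambda>r. r) E (carrier E) ?W n ?c" using cm n by simp
  have sy: "multi R (\<lambda>r. r) T Cs ?W (wsym R T Cs)" using multi_wsym[OF T.rmod_axioms ok] by (simp add: Cs)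
  note sy' = sy[unfolded Cs multi_pair, folded Cs]
  have s1: "aform R (\<lambda>r. r) T (carrier T) ?W (n - d) (\<lambda>xs. wsym R T Cs [xs, zs])"
    and s2: "length xs = n - d \<Longrightarrow> set xs \<subseteq> carrier T \<Longrightarrow> set xs \<inter> ?tB \<noteq> {} \<Longrightarrow> wsym R T Cs [xs, zs] = \<zero>\<^bsub>?W\<^esub>"
    if "length zs = d" "set zs \<subseteq> ?tA" for xs zs using sy' that by auto
  have s3: "aform R (\<lambda>r. r) T ?tA ?W d (\<lambda>zs. wsym R T Cs [xs, zs])"
    if "length xs = n - d" "set xs \<subseteq> carrier T" for xs using sy' that by auto
  have id: "(\<lambda>r. r) \<in> carrier R \<rightarrow> carrier R" by auto
  have Fys: "set (map F ys) \<subseteq> carrier E" "length (map F ys) = n - d" using xy Fc by auto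
  have l: "aform R (\<lambda>r. r) E (carrier E) ?W d (\<lambda>xs. ?c (xs @ map F ys))"
    using aform_append2[of R "\<lambda>r. r" E "carrier E" ?W d "map F ys" ?c] cmn Fys n by simp
  have r: "aform R (\<lambda>r. r) E (carrier E) ?W d (\<lambda>xs. wsym R T Cs [ys, map V xs])"
    using aform_map[OF s3[OF xy(4,3)] V _ VA id] by simp
  have dif: "aform R (\<lambda>r. r) E (carrier E) ?W d (\<lambda>xs. ?c (xs @ map F ys) \<ominus>\<^bsub>?W\<^esub> wsym R T Cs [ys, map V xs])"
    by (rule aform_diff[OF l r Wm id E.carrier_is_submodule E])
  have ce: "carrier E = mspan R E (e ` {..<h})" using csub_span[OF E edb, of "{}"] by (simp add: csub_def)
  have "?c (xs @ map F ys) \<ominus>\<^bsub>?W\<^esub> wsym R T Cs [ys, map V xs] = \<zero>\<^bsub>?W\<^esub>"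
  \<comment> \<open>For fixed \<open>ys\<close> both sides are alternating in \<open>xs\<close>, so
    it is enough to insert basis vectors with increasing indices.\<close>
  proof (rule aform_basis0[OF Wm E _ id dif[unfolded ce] _ xy(2) xy(1)[unfolded ce]])
    show "e ` {..<h} \<subseteq> carrier E" using ec_closed by auto
    fix ks assume k: "length ks = d" "sorted_wrt (<) ks" "set ks \<subseteq> {..<h}"
    have ksc: "set (map e ks) \<subseteq> carrier E" using k ec_closed by auto
    show "?c (map e ks @ map F ys) \<ominus>\<^bsub>?W\<^esub> wsym R T Cs [ys, map V (map e ks)] = \<zero>\<^bsub>?W\<^esub>"
    proof (cases "set ks \<subseteq> {..<d}")
      \<comment> \<open>Here \<open>ks\<close> consists of all indices below \<open>d\<close>. The
        functionals absorb exactly these vectors, and \<open>g (F y)\<close> differs from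
        \<open>y\<close> by an element killed in the first block.\<close>
      case True
      have "card (set ks) = d" using k strict_sorted_iff distinct_card by metis
      then have sk: "set ks = {..<d}" using True card_subset_eq[of "{..<d}" "set ks"] by simp
      have ks: "ks = [0..<d]"
      proof (rule sorted_distinct_set_unique)
        show "sorted ks" "distinct ks" using k(2) by (simp_all add: strict_sorted_iff)
      qed (simp_all add: sk atLeast0LessThan)
      have "?c (map e ks @ map F ys) = wsym R T Cs [map g (map F ys), ?\<omega>]"
        unfolding ks cform_def
      proof (rule lifts_basis[OF Wm E cb(1) edb Fys(2,1)])
        fix k xs assume "k \<in> set [0..<d]" "length xs = n - d" "set xs \<subseteq> carrier E" "e k \<in> set xs"
        then show "wsym R T Cs [map g xs, ?\<omega>] = \<zero>\<^bsub>?W\<^esub>"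
          using g0[of k] T.submodule_closed(2)[OF tw_sub_submodule[OF frob E' B(2)]] by (intro cb(2)[of _ "e k"]) auto
      qed (use dh in auto)
      also have "map g (map F ys) = [] @ map (\<lambda>y. g (F y)) ys" by simp
      also have "wsym R T Cs [[] @ map (\<lambda>y. g (F y)) ys, ?\<omega>] = wsym R T Cs [[] @ ys, ?\<omega>]"
        by (rule aform_replace[OF Wm T.rmod_axioms T.carrier_is_submodule _ s1[OF \<omega>] s2[OF \<omega>], of _ "?tB"])
           (use gF tA tAB xy in auto)
      finally have eq1: "?c (map e ks @ map F ys) = wsym R T Cs [[] @ ys, ?\<omega>]" .
      have om: "map V (map e ks) = ?\<omega>" unfolding ks using e1 by auto
      have eq: "?c (map e ks @ map F ys) = wsym R T Cs [ys, map V (map e ks)]"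
        unfolding om using eq1 by simp
      have "wsym R T Cs [ys, map V (map e ks)] \<in> carrier ?W" using aformD(1)[OF r _ ksc] k(1) by simp
      then show ?thesis using eq by (simp add: W.diff_eq_zero)
    next
      \<comment> \<open>Some \<open>e k0\<close> with \<open>d \<le> k0\<close> occurs. It and the
        \<open>n - d\<close> vectors \<open>F y\<close> are annihilated by all functionals, one
        vector more than the innermost form can take. On the right \<open>V (e k0)\<close> is
        zero.\<close>
      case False
      then obtain k0 where "k0 \<in> set ks" "\<not> k0 < d" by auto
      then have k0: "k0 \<in> set ks" "d \<le> k0" "k0 < h" using k(3) by auto
      have Z: "ec l (e k0) = \<zero>\<^bsub>R\<^esub>" if "l < d" for l using that k0 dh by (intro Eb(4)) auto
      let ?Z = "\<lambda>v. \<forall>l<d. ec l v = \<zero>\<^bsub>R\<^esub>"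
      have c0: "?c (map e ks @ map F ys) = \<zero>\<^bsub>?W\<^esub>"
        unfolding cform_def
      proof (rule lifts_count[where Z = ?Z, OF Wm E cb(1)])
        show "c \<in> set (map ec [0..<d]) \<Longrightarrow> lin R E (self_mod R) c \<and> (\<forall>v. ?Z v \<longrightarrow> c v = \<zero>\<^bsub>R\<^esub>)" for c
          using ec_lin dh by auto
        have "filter ?Z (map F ys) = map F ys" using ecF0 xy by (auto simp: filter_id_conv)
        moreover have "e k0 \<in> set (filter ?Z (map e ks))" using k0(1) Z by simp
        then have "0 < length (filter ?Z (map e ks))" by (rule length_pos_if_in_set)
        ultimately show "n - d < length (filter ?Z (map e ks @ map F ys))" using xy by simp
      qed (use k Fys ksc in auto)
      have Ve: "V (e k0) = \<zero>\<^bsub>T\<^esub>" using k0 VF Tb(1) by (simp add: e2)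
      have "V (e k0) \<in> set (map V (map e ks))" using k0(1) by simp
      then have "\<zero>\<^bsub>T\<^esub> \<in> set (map V (map e ks))" unfolding Ve .
      moreover have "set (map V (map e ks)) \<subseteq> ?tA" using VA ksc by (simp add: image_subset_iff)
      moreover have "length (map V (map e ks)) = d" using k(1) by simp
      ultimately have "wsym R T Cs [ys, map V (map e ks)] = \<zero>\<^bsub>?W\<^esub>"
        by (intro aform_zero_entry[OF s3[OF xy(4,3)] Wm T.rmod_axioms tAs])
      then show ?thesis using c0 by (simp add: W.diff_eq_zero)
    qed
  qed
  moreover have "?c (xs @ map F ys) \<in> carrier ?W" using aformD(1)[OF l xy(2,1)] .
  moreover have "wsym R T Cs [ys, map V xs] \<in> carrier ?W" using aformD(1)[OF r xy(2,1)] .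
  ultimately show ?thesis by (simp add: W.diff_eq_zero)
qed

end

section \<open>Products of symbols on quotients, and the map \<open>chi\<close>\<close>

section \<open>Comparison maps\<close>

lemma rmod_zero: "rmod R M \<Longrightarrow> \<zero>\<^bsub>M\<^esub> \<in> carrier M"
proof -
  assume "rmod R M" then interpret M: rmod R M .
  show ?thesis by simp
qed

text \<open>The submodule cut out by \<open>K\<close> is free of rank \<open>n - card K\<close>, so
  more vectors than that make an alternating form vanish, wherever they stand in the list. This
  count is what makes products compatible with quotients below.\<close>

lemma aform_excess:
  assumes N: "rmod R N" and M: "rmod R M" and d: "dual_basis R M n b c" and K: "K \<subseteq> {..<n}"
    and f: "aform R (\<lambda>r. r) M (carrier M) N m f"
    and us: "set us \<subseteq> csub R M c K" "n - card K < length us"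
    and vs: "length vs = m" "set vs \<subseteq> carrier M" and p: "mset vs = mset (us @ ws)"
  shows "f vs = \<zero>\<^bsub>N\<^esub>"
proof -
  interpret M: rmod R M by fact
  have id: "(\<lambda>r. r) \<in> carrier R \<rightarrow> carrier R" by auto
  have e: "csub R M c K = mspan R M (b ` ({..<n} - K))" by (rule csub_span[OF M d K])
  have sv: "set vs = set us \<union> set ws" using arg_cong[OF p, of set_mset] by simp
  have lv: "length us + length ws = m" using arg_cong[OF p, of size] vs by simp
  have a: "aform R (\<lambda>r. r) M (csub R M c K) N (length us) (\<lambda>xs. f (xs @ ws))"
    by (rule aform_subset[OF aform_append2 csub_subset_carrier]) (use f sv vs lv in auto)
  have bI: "b ` ({..<n} - K) \<subseteq> carrier M" using dual_basisD(1)[OF d] by auto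
  have card: "card ({..<n} - K) = n - card K"
    using K finite_subset[OF K] by (simp add: card_Diff_subset)
  have "f (us @ ws) = \<zero>\<^bsub>N\<^esub>"
    by (rule aform_many0[OF N M bI id a[unfolded e] _ _ refl us(1)[unfolded e]]) (use us card in auto)
  then show ?thesis
    by (rule aform_perm0[OF N M M.carrier_is_submodule f, rotated -1]) (use sv vs lv p in auto)
qed

text \<open>\<open>[ys, xs] \<mapsto> xs \<and> ys\<close>.\<close>

definition cat :: "'m list list \<Rightarrow> 'm list list" where
  "cat xss = [concat (rev xss)]"

lemma cat_simps [simp]: "cat [xs] = [xs]" "cat [ys, xs] = [xs @ ys]" "cat (map (map f) xss) = map (map f) (cat xss)"
  by (simp_all add: cat_def map_concat rev_map)

lemma single_form:
  assumes M: "rmod R M" and B: "B \<subseteq> carrier M"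
  shows "aform R (\<lambda>r. r) M (carrier M) (wedges R M [(n, carrier M, B)]) n (\<lambda>xs. wsym R M [(n, carrier M, B)] [xs])"
    and "length xs = n \<Longrightarrow> set xs \<subseteq> carrier M \<Longrightarrow> set xs \<inter> B \<noteq> {} \<Longrightarrow>
      wsym R M [(n, carrier M, B)] [xs] = \<zero>\<^bsub>wedges R M [(n, carrier M, B)]\<^esub>"
    and "blocks_ok R M [(n, carrier M, B)]"
proof -
  interpret M: rmod R M by fact
  show ok: "blocks_ok R M [(n, carrier M, B)]" using B M.carrier_is_submodule by (simp add: blocks_ok_def)
  show "aform R (\<lambda>r. r) M (carrier M) (wedges R M [(n, carrier M, B)]) n (\<lambda>xs. wsym R M [(n, carrier M, B)] [xs])"
    "length xs = n \<Longrightarrow> set xs \<subseteq> carrier M \<Longrightarrow> set xs \<inter> B \<noteq> {} \<Longrightarrow>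
      wsym R M [(n, carrier M, B)] [xs] = \<zero>\<^bsub>wedges R M [(n, carrier M, B)]\<^esub>"
    using multi_wsym[OF M ok] unfolding multi_single by auto
qed

lemma cat_ok_single:
  assumes M: "rmod R M" and A: "A \<subseteq> carrier M" and B: "B \<subseteq> carrier M"
  shows "smap_ok R M [(n, A, B)] [(n, carrier M, B)] cat"
  using aform_subset[OF single_form(1)[OF M B] A] single_form(2)[OF M B] A
  unfolding smap_ok_def multi_single by (auto simp: wgen_Cons)

text \<open>The quotient \<open>B\<close> of the target is left open: it will be zero for the map
  from \<open>P\<close> to the exterior power, and the transported filtration step for
  \<open>chi\<close>. In each case \<open>kill\<close> is the point to be proved.\<close>

lemma cat_ok_pair:
  assumes M: "rmod R M" and B: "B \<subseteq> carrier M" and zB: "\<zero>\<^bsub>M\<^esub> \<in> B" and A: "submodule A R M" and C: "C \<subseteq> carrier M"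
    and kill: "\<And>xs ys. length xs = d \<Longrightarrow> set xs \<subseteq> A \<Longrightarrow> length ys = m \<Longrightarrow> set ys \<subseteq> carrier M \<Longrightarrow> set ys \<inter> C \<noteq> {} \<Longrightarrow>
      wsym R M [(m + d, carrier M, B)] [xs @ ys] = \<zero>\<^bsub>wedges R M [(m + d, carrier M, B)]\<^esub>"
  shows "smap_ok R M [(m, carrier M, C), (d, A, {\<zero>\<^bsub>M\<^esub>})] [(m + d, carrier M, B)] cat"
proof -
  interpret M: rmod R M by fact
  have Ac: "A \<subseteq> carrier M" using M.submodule_closed(1)[OF A] by auto
  note s = single_form[OF M B, where n = "m + d"]
  have W: "rmod R (wedges R M [(m + d, carrier M, B)])" by (rule wedges_module[OF M s(3)])
  have f1: "aform R (\<lambda>r. r) M (carrier M) (wedges R M [(m + d, carrier M, B)]) m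
     (\<lambda>ys. wsym R M [(m + d, carrier M, B)] [xs @ ys])" if "length xs = d" "set xs \<subseteq> A" for xs
    using aform_append[of R "\<lambda>r. r" M "carrier M" "wedges R M [(m + d, carrier M, B)]" xs m
        "\<lambda>xs. wsym R M [(m + d, carrier M, B)] [xs]"] s(1) that Ac by (simp add: add.commute)
  have f2: "aform R (\<lambda>r. r) M A (wedges R M [(m + d, carrier M, B)]) d
     (\<lambda>xs. wsym R M [(m + d, carrier M, B)] [xs @ ys])" if "length ys = m" "set ys \<subseteq> carrier M" for ys
    by (rule aform_subset[OF aform_append2[of R "\<lambda>r. r" M "carrier M" "wedges R M [(m + d, carrier M, B)]" d ys
        "\<lambda>xs. wsym R M [(m + d, carrier M, B)] [xs]"] Ac])
       (use s(1) that in \<open>simp_all add: add.commute\<close>)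
  have z: "wsym R M [(m + d, carrier M, B)] [xs @ ys] = \<zero>\<^bsub>wedges R M [(m + d, carrier M, B)]\<^esub>"
    if "length ys = m" "set ys \<subseteq> carrier M" "length xs = d" "set xs \<subseteq> A" "\<zero>\<^bsub>M\<^esub> \<in> set xs" for xs ys
    by (rule aform_zero_entry[OF f2[OF that(1,2)] W M A that(3-5)])
  show ?thesis unfolding smap_ok_def multi_pair
    using f1 f2 kill z Ac by (auto simp: wgen_Cons)
qed

lemma snat_cat_single:
  assumes M: "rmod R M" and A: "submodule A R M"
  shows "snat R M [(n, A, {\<zero>\<^bsub>M\<^esub>})] [(n, carrier M, {\<zero>\<^bsub>M\<^esub>})] cat cat"
proof -
  interpret M: rmod R M by fact
  have Ac: "A \<subseteq> carrier M" using M.submodule_closed(1)[OF A] by auto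
  have "smap_ok R (twist R q M) (tw_blocks R q M [(n, A, {\<zero>\<^bsub>M\<^esub>})]) (tw_blocks R q M [(n, carrier M, {\<zero>\<^bsub>M\<^esub>})]) cat"
    if q: "frob_pow R q \<in> ring_hom R R" for q
  proof -
    interpret T: rmod R "twist R q M" by (rule twist_module[OF q M])
    show ?thesis
      unfolding tw_blocks_def list.map prod.case tw_sub_carrier[OF q M] tw_sub_zero[OF q M]
      by (rule cat_ok_single[OF T.rmod_axioms tw_sub_subset[OF q M Ac]]) simp
  qed
  then show ?thesis
    unfolding snat_def using A Ac M.carrier_is_submodule cat_ok_single[OF M Ac, of "{\<zero>\<^bsub>M\<^esub>}" n]
    by (simp add: blocks_ok_def)
qed

text \<open>The list \<open>xs\<close> already has \<open>d\<close> entries in \<open>A\<close>,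
  which has rank \<open>d\<close>; an entry of \<open>ys\<close> in \<open>A\<close> is one too
  many.\<close>

lemma cat_ok_adapted:
  assumes M: "rmod R M" and db: "dual_basis R M h b c" and A: "A = csub R M c {d..<h}" and d: "d \<le> h"
  shows "smap_ok R M [(m, carrier M, A), (d, A, {\<zero>\<^bsub>M\<^esub>})] [(m + d, carrier M, {\<zero>\<^bsub>M\<^esub>})] cat"
proof (rule cat_ok_pair[OF M])
  interpret M: rmod R M by fact
  show A': "submodule A R M" unfolding A by (rule csub_submodule[OF M]) (use dual_basisD(2)[OF db] in auto)
  show Ac: "A \<subseteq> carrier M" unfolding A by (rule csub_subset_carrier)
  have z: "{\<zero>\<^bsub>M\<^esub>} \<subseteq> carrier M" by simp
  fix xs ys assume xy: "length xs = d" "set xs \<subseteq> A" "length ys = m" "set ys \<subseteq> carrier M" "set ys \<inter> A \<noteq> {}"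
  then obtain y us vs where y: "y \<in> A" "ys = us @ y # vs" by (metis disjoint_iff split_list)
  let ?Bs = "[(m + d, carrier M, {\<zero>\<^bsub>M\<^esub>})]"
  show "wsym R M ?Bs [xs @ ys] = \<zero>\<^bsub>wedges R M ?Bs\<^esub>"
  proof (rule aform_excess[OF wedges_module[OF M single_form(3)[OF M z]] M db _ single_form(1)[OF M z]])
    show "set (y # xs) \<subseteq> csub R M c {d..<h}" using y xy A by auto
    show "mset (xs @ ys) = mset ((y # xs) @ us @ vs)" using y by simp
  qed (use xy d Ac in auto)
qed (simp_all add: rmod_zero[OF M])

text \<open>The count in \<open>cat_ok_adapted\<close> is phrased in coordinates, so it repeats on
  every twist with the twisted dual basis.\<close>

lemma snat_cat_pair:
  assumes M: "rmod R M" and db: "dual_basis R M h b c" and A: "A = csub R M c {d..<h}" and d: "d \<le> h"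
  shows "snat R M [(m, carrier M, A), (d, A, {\<zero>\<^bsub>M\<^esub>})] [(m + d, carrier M, {\<zero>\<^bsub>M\<^esub>})] cat cat"
proof -
  interpret M: rmod R M by fact
  have As: "submodule A R M" unfolding A by (rule csub_submodule[OF M]) (use dual_basisD(2)[OF db] in auto)
  have Ac: "A \<subseteq> carrier M" unfolding A by (rule csub_subset_carrier)
  have "smap_ok R (twist R q M) (tw_blocks R q M [(m, carrier M, A), (d, A, {\<zero>\<^bsub>M\<^esub>})])
      (tw_blocks R q M [(m + d, carrier M, {\<zero>\<^bsub>M\<^esub>})]) cat"
    if q: "frob_pow R q \<in> ring_hom R R" for q
  proof -
    interpret T: rmod R "twist R q M" by (rule twist_module[OF q M])
    show ?thesis
      unfolding tw_blocks_def list.map prod.case tw_sub_carrier[OF q M] tw_sub_zero[OF q M]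
      by (rule cat_ok_adapted[OF T.rmod_axioms twist_dual_basis[OF q M db] _ d])
         (unfold A, rule tw_sub_csub[OF q M db], auto)
  qed
  then show ?thesis
    unfolding snat_def using As Ac M.carrier_is_submodule cat_ok_adapted[OF M db A d, of m]
    by (simp add: blocks_ok_def)
qed

text \<open>Enlarging \<open>A\<close> and \<open>B\<close> amounts to an inclusion followed by a
  projection.\<close>

lemma id_ok:
  assumes M: "rmod R M" and ok: "blocks_ok R M Bs" "blocks_ok R M Cs"
    and s: "list_all2 (\<lambda>(a, A, B) (a', A', B'). a = a' \<and> A \<subseteq> A' \<and> B \<subseteq> B') Bs Cs"
  shows "smap_ok R M Bs Cs (\<lambda>x. x)"
proof -
  have b: "bmap (\<lambda>x. x) Bs Cs" using s unfolding bmap_def by (rule list.rel_mono_strong) auto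
  have "multi R (\<lambda>r. r) M Bs (wedges R M Cs) (\<lambda>xss. wsym R M Cs (map (map (\<lambda>x. x)) xss))"
    by (rule multi_map[OF multi_wsym[OF M ok(2)] slin_id[OF M] b ok(1) M]) auto
  moreover have "xss \<in> wgen Cs" if "xss \<in> wgen Bs" for xss using bmap_wgen[OF b that] by simp
  ultimately show ?thesis by (simp add: smap_ok_def)
qed

lemma snat_id:
  assumes M: "rmod R M" and ok: "blocks_ok R M Bs" "blocks_ok R M Cs"
    and s: "list_all2 (\<lambda>(a, A, B) (a', A', B'). a = a' \<and> A \<subseteq> A' \<and> B \<subseteq> B') Bs Cs"
  shows "snat R M Bs Cs (\<lambda>x. x) (\<lambda>x. x)"
proof -
  have "smap_ok R (twist R q M) (tw_blocks R q M Bs) (tw_blocks R q M Cs) (\<lambda>x. x)"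
    if q: "frob_pow R q \<in> ring_hom R R" for q
  proof (rule id_ok[OF twist_module[OF q M] tw_blocks_ok[OF q M ok(1)] tw_blocks_ok[OF q M ok(2)]])
    show "list_all2 (\<lambda>(a, A, B) (a', A', B'). a = a' \<and> A \<subseteq> A' \<and> B \<subseteq> B') (tw_blocks R q M Bs) (tw_blocks R q M Cs)"
      unfolding tw_blocks_def list_all2_map1 list_all2_map2
      by (rule list.rel_mono_strong[OF s]) (use tw_sub_mono[OF q M] in \<open>auto split: prod.splits\<close>)
  qed
  then show ?thesis using id_ok[OF M ok s] ok by (simp add: snat_def)
qed

lemma wmap_id: "wmap R M Cs (\<lambda>x. x) = smap R M Cs (\<lambda>x. x)"
  by (simp add: wmap_def smap_def)

section \<open>Tensor products of symbols\<close>

lemma lin_add: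
  assumes N: "rmod R N" and u: "lin R M N u" and v: "lin R M N v"
  shows "lin R M N (\<lambda>x. u x \<oplus>\<^bsub>N\<^esub> v x)"
proof -
  interpret N: rmod R N by fact
  show ?thesis
    by (rule slinI) (use slin_closed[OF u] slin_closed[OF v] in
      \<open>auto simp: slin_add[OF u] slin_add[OF v] slin_smult[OF u] slin_smult[OF v] N.M.a_ac N.smult_r_distr\<close>)
qed

lemma lin_smult:
  assumes N: "rmod R N" and u: "lin R M N u" and r: "r \<in> carrier R"
  shows "lin R M N (\<lambda>x. r \<odot>\<^bsub>N\<^esub> u x)"
proof -
  interpret N: rmod R N by fact
  show ?thesis
    by (rule slinI) (use slin_closed[OF u] r in
      \<open>auto simp: slin_add[OF u] slin_smult[OF u] N.smult_r_distr N.smult_assoc1[symmetric] N.R.m_comm\<close>)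
qed

lemma lin_zero:
  assumes N: "rmod R N"
  shows "lin R M N (\<lambda>x. \<zero>\<^bsub>N\<^esub>)"
proof -
  interpret N: rmod R N by fact
  show ?thesis by (rule slinI) auto
qed

text \<open>Each identity required of a multilinear function of \<open>xss\<close> is an equality of
  linear maps in \<open>D\<close>, hence can be checked when \<open>D\<close> is a symbol.\<close>

lemma multi_family:
  assumes N: "rmod R N" and P: "rmod R P" and M: "rmod R M" and ok: "blocks_ok R M Bs" and okC: "blocks_ok R P Cs"
    and G: "\<And>xss. xss \<in> wgen Bs \<Longrightarrow> lin R (wedges R P Cs) N (G xss)"
    and s: "\<And>yss. yss \<in> wgen Cs \<Longrightarrow> multi R (\<lambda>r. r) M Bs N (\<lambda>xss. G xss (wsym R P Cs yss))"
    and D: "D \<in> carrier (wedges R P Cs)"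
  shows "multi R (\<lambda>r. r) M Bs N (\<lambda>xss. G xss D)"
proof (rule multiI)
  interpret N: rmod R N by fact
  interpret M: rmod R M by fact
  show "xss \<in> wgen Bs \<Longrightarrow> G xss D \<in> carrier N" for xss by (rule slin_closed[OF G D])
  fix B1 a A B B2 pre post
  assume b: "Bs = B1 @ (a, A, B) # B2" "pre \<in> wgen B1" "post \<in> wgen B2"
  have A: "submodule A R M" using ok b by (auto simp: blocks_ok_def)
  note c = M.submodule_closed[OF A]
  have w: "pre @ xs # post \<in> wgen Bs" if "length xs = a" "set xs \<subseteq> A" for xs
    unfolding wgen_split using b that by blast
  note S = multiD(2)[OF s b] and S0 = multiD(3)[OF s b]
  note eq = wedges_eq[OF P okC N _ _ _ D]
  show "aform R (\<lambda>r. r) M A N a (\<lambda>xs. G (pre @ xs # post) D)"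
  proof (rule aformI)
    show "length xs = a \<Longrightarrow> set xs \<subseteq> A \<Longrightarrow> G (pre @ xs # post) D \<in> carrier N" for xs
      by (rule slin_closed[OF G[OF w] D])
    fix us vs x assume u: "set us \<subseteq> A" "set vs \<subseteq> A" "x \<in> A"
    {
      fix y assume a': "length us + Suc (length vs) = a" and y: "y \<in> A"
      show "G (pre @ (us @ (x \<oplus>\<^bsub>M\<^esub> y) # vs) # post) D =
         G (pre @ (us @ x # vs) # post) D \<oplus>\<^bsub>N\<^esub> G (pre @ (us @ y # vs) # post) D"
        by (rule eq[OF G[OF w] lin_add[OF N G[OF w] G[OF w]]])
           (use u y a' c aformD(2)[OF S] in auto)
    }
    {
      fix r assume a': "length us + Suc (length vs) = a" and r: "r \<in> carrier R"
      show "G (pre @ (us @ (r \<odot>\<^bsub>M\<^esub> x) # vs) # post) D = r \<odot>\<^bsub>N\<^esub> G (pre @ (us @ x # vs) # post) D"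
        by (rule eq[OF G[OF w] lin_smult[OF N G[OF w]]])
           (use u r a' c aformD(3)[OF S] in auto)
    }
    assume a': "length us + Suc (Suc (length vs)) = a"
    show "G (pre @ (us @ x # x # vs) # post) D = \<zero>\<^bsub>N\<^esub>"
      by (rule eq[OF G[OF w] lin_zero[OF N]])
         (use u a' c aformD(4)[OF S] in auto)
  qed
  fix xs assume x: "length xs = a" "set xs \<subseteq> A" "set xs \<inter> B \<noteq> {}"
  show "G (pre @ xs # post) D = \<zero>\<^bsub>N\<^esub>"
    by (rule eq[OF G[OF w] lin_zero[OF N]]) (use x S0 in auto)
qed

lemma wgen_append: "xss \<in> wgen Bs \<Longrightarrow> yss \<in> wgen Cs \<Longrightarrow> xss @ yss \<in> wgen (Bs @ Cs)"
  by (simp add: wgen_def list_all2_appendI)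

lemma wtensor:
  assumes M: "rmod R M" and ok: "blocks_ok R M Bs" "blocks_ok R M Cs"
  shows "D \<in> carrier (wedges R M Cs) \<Longrightarrow> lin R (wedges R M Bs) (wedges R M (Bs @ Cs)) (\<lambda>C. wtensor R M (Bs @ Cs) C D)"
    and "C \<in> carrier (wedges R M Bs) \<Longrightarrow> lin R (wedges R M Cs) (wedges R M (Bs @ Cs)) (wtensor R M (Bs @ Cs) C)"
    and "xss \<in> wgen Bs \<Longrightarrow> yss \<in> wgen Cs \<Longrightarrow>
      wtensor R M (Bs @ Cs) (wsym R M Bs xss) (wsym R M Cs yss) = wsym R M (Bs @ Cs) (xss @ yss)"
proof -
  let ?W = "wedges R M (Bs @ Cs)"
  have okBC: "blocks_ok R M (Bs @ Cs)" using ok by (auto simp: blocks_ok_def)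
  have W: "rmod R ?W" by (rule wedges_module[OF M okBC])
  interpret W: rmod R ?W by (rule W)
  interpret C: rmod R "wedges R M Cs" by (rule wedges_module[OF M ok(2)])
  define G where "G xss = lext R ?W (\<lambda>yss. wsym R M (Bs @ Cs) (xss @ yss))" for xss
  note sy = multi_wsym[OF M okBC]
  have m1: "multi R (\<lambda>r. r) M Cs ?W (\<lambda>yss. wsym R M (Bs @ Cs) (xss @ yss))" if x: "xss \<in> wgen Bs" for xss
  proof (rule multiI)
    show "yss \<in> wgen Cs \<Longrightarrow> wsym R M (Bs @ Cs) (xss @ yss) \<in> carrier ?W" for yss
      by (rule wsym_closed[OF M okBC wgen_append[OF x]])
    fix B1 a A B B2 pre post
    assume b: "Cs = B1 @ (a, A, B) # B2" "pre \<in> wgen B1" "post \<in> wgen B2"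
    have e: "Bs @ Cs = (Bs @ B1) @ (a, A, B) # B2" using b by simp
    note p = wgen_append[OF x b(2)]
    show "aform R (\<lambda>r. r) M A ?W a (\<lambda>xs. wsym R M (Bs @ Cs) (xss @ pre @ xs # post))"
      using multiD(2)[OF sy e p b(3)] by simp
    show "length xs = a \<Longrightarrow> set xs \<subseteq> A \<Longrightarrow> set xs \<inter> B \<noteq> {} \<Longrightarrow>
      wsym R M (Bs @ Cs) (xss @ pre @ xs # post) = \<zero>\<^bsub>?W\<^esub>" for xs
      using multiD(3)[OF sy e p b(3), of xs] by simp
  qed
  have m2: "multi R (\<lambda>r. r) M Bs ?W (\<lambda>xss. wsym R M (Bs @ Cs) (xss @ yss))" if y: "yss \<in> wgen Cs" for yss
  proof (rule multiI)
    show "xss \<in> wgen Bs \<Longrightarrow> wsym R M (Bs @ Cs) (xss @ yss) \<in> carrier ?W" for xss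
      by (rule wsym_closed[OF M okBC wgen_append[OF _ y]])
    fix B1 a A B B2 pre post
    assume b: "Bs = B1 @ (a, A, B) # B2" "pre \<in> wgen B1" "post \<in> wgen B2"
    have e: "Bs @ Cs = B1 @ (a, A, B) # (B2 @ Cs)" using b by simp
    note p = wgen_append[OF b(3) y]
    show "aform R (\<lambda>r. r) M A ?W a (\<lambda>xs. wsym R M (Bs @ Cs) ((pre @ xs # post) @ yss))"
      using multiD(2)[OF sy e b(2) p] by simp
    show "length xs = a \<Longrightarrow> set xs \<subseteq> A \<Longrightarrow> set xs \<inter> B \<noteq> {} \<Longrightarrow>
      wsym R M (Bs @ Cs) ((pre @ xs # post) @ yss) = \<zero>\<^bsub>?W\<^esub>" for xs
      using multiD(3)[OF sy e b(2) p, of xs] by simp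
  qed
  note G = multi_lext[OF M ok(2) W m1, folded G_def]
  \<comment> \<open>Multilinearity in the first factor is known when \<open>D\<close> is a symbol;
    \<open>multi_family\<close> extends it to all \<open>D\<close>.\<close>
  have m3: "multi R (\<lambda>r. r) M Bs ?W (\<lambda>xss. G xss D)" if D: "D \<in> carrier (wedges R M Cs)" for D
  proof (rule multi_family[OF W M M ok G(1) _ D])
    fix yss assume y: "yss \<in> wgen Cs"
    note mm = m2[OF y]
    show "multi R (\<lambda>r. r) M Bs ?W (\<lambda>xss. G xss (wsym R M Cs yss))"
    proof (rule multiI)
      fix xss assume "xss \<in> wgen Bs" then show "G xss (wsym R M Cs yss) \<in> carrier ?W"
        using multiD(1)[OF mm] G(2)[OF _ y] by simp
    next
      fix B1 a A B B2 pre post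
      assume b: "Bs = B1 @ (a, A, B) # B2" "pre \<in> wgen B1" "post \<in> wgen B2"
      have A: "submodule A R M" using ok b by (auto simp: blocks_ok_def)
      have w: "pre @ xs # post \<in> wgen Bs" if "length xs = a" "set xs \<subseteq> A" for xs
        unfolding wgen_split using b that by blast
      show "aform R (\<lambda>r. r) M A ?W a (\<lambda>xs. G (pre @ xs # post) (wsym R M Cs yss))"
        by (rule aform_cong[OF multiD(2)[OF mm b] _ A M]) (simp add: G(2)[OF w y])
      show "length xs = a \<Longrightarrow> set xs \<subseteq> A \<Longrightarrow> set xs \<inter> B \<noteq> {} \<Longrightarrow>
        G (pre @ xs # post) (wsym R M Cs yss) = \<zero>\<^bsub>?W\<^esub>" for xs
        using multiD(3)[OF mm b, of xs] by (simp add: G(2)[OF w y])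
    qed
  qed
  have wt: "wtensor R M (Bs @ Cs) C D = lext R ?W (\<lambda>xss. G xss D) C" for C D
    by (simp add: wtensor_def G_def)
  note H = multi_lext[OF M ok(1) W m3]
  show l1: "D \<in> carrier (wedges R M Cs) \<Longrightarrow> lin R (wedges R M Bs) ?W (\<lambda>C. wtensor R M (Bs @ Cs) C D)" for D
    unfolding wt by (rule H(1))
  have val: "wtensor R M (Bs @ Cs) (wsym R M Bs xss) D = G xss D"
    if "xss \<in> wgen Bs" "D \<in> carrier (wedges R M Cs)" for xss D
    unfolding wt by (rule H(2)[OF that(2,1)])
  show "xss \<in> wgen Bs \<Longrightarrow> yss \<in> wgen Cs \<Longrightarrow>
      wtensor R M (Bs @ Cs) (wsym R M Bs xss) (wsym R M Cs yss) = wsym R M (Bs @ Cs) (xss @ yss)"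
    using val wsym_closed[OF M ok(2)] G(2) by simp
  assume Cc: "C \<in> carrier (wedges R M Bs)"
  note eq = wedges_eq[OF M ok(1) W _ _ _ Cc]
  show "lin R (wedges R M Cs) ?W (wtensor R M (Bs @ Cs) C)"
  proof (rule slinI)
    fix D assume D: "D \<in> carrier (wedges R M Cs)"
    show "wtensor R M (Bs @ Cs) C D \<in> carrier ?W" by (rule slin_closed[OF l1[OF D] Cc])
    {
      fix D' assume D': "D' \<in> carrier (wedges R M Cs)"
      show "wtensor R M (Bs @ Cs) C (D \<oplus>\<^bsub>wedges R M Cs\<^esub> D') =
          wtensor R M (Bs @ Cs) C D \<oplus>\<^bsub>?W\<^esub> wtensor R M (Bs @ Cs) C D'"
        by (rule eq[OF l1 lin_add[OF W l1 l1]])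
           (use D D' in \<open>auto simp: val slin_add[OF G(1)]\<close>)
    }
    fix r assume r: "r \<in> carrier R"
    show "wtensor R M (Bs @ Cs) C (r \<odot>\<^bsub>wedges R M Cs\<^esub> D) = r \<odot>\<^bsub>?W\<^esub> wtensor R M (Bs @ Cs) C D"
      by (rule eq[OF l1 lin_smult[OF W l1]])
         (use D r in \<open>auto simp: val slin_smult[OF G(1)]\<close>)
  qed
qed

section \<open>The map \<open>chi\<close>\<close>

text \<open>The case \<open>d \<le> n\<close> of \<open>chi\<close>, with ranks \<open>d\<close> for
  \<open>A\<close>, \<open>h + d - n\<close> for \<open>Fi\<close> and \<open>h - n\<close> for
  \<open>tF\<close>. The basis \<open>b\<close> is adapted to \<open>A\<close> and
  \<open>Fi\<close>, the basis \<open>e\<close> to \<open>tF\<close>; what connects them is the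
  adequacy condition \<open>tF \<subseteq> Fi\<close>.\<close>

locale chi_data =
  fixes R :: "'r ring" and M :: "('r, 'm) module" and h d n :: nat
    and b :: "nat \<Rightarrow> 'm" and c and e :: "nat \<Rightarrow> 'm" and ec and K and A Fi tF :: "'m set"
  assumes M: "rmod R M" and db: "dual_basis R M h b c" and dn: "d \<le> n" "n \<le> h"
    and A: "A = csub R M c {d..<h}" and Fi: "Fi = csub R M c {h + d - n..<h}"
    and de: "dual_basis R M h e ec" and K: "K \<subseteq> {..<h}" "card K = n" and tF: "tF = csub R M ec K"
    and tFi: "tF \<subseteq> Fi"
begin

sublocale M: rmod R M by (rule M)

abbreviation "Q \<equiv> [(n, carrier M, tF)]"
abbreviation "L \<equiv> [(n - d, carrier M, Fi), (d, A, {\<zero>\<^bsub>M\<^esub>})]"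
abbreviation "src \<equiv> [(h - n, tF, {\<zero>\<^bsub>M\<^esub>})]"
abbreviation "tgt \<equiv> [(h - n, Fi, A)]"
abbreviation "tp \<equiv> [(h, carrier M, {\<zero>\<^bsub>M\<^esub>})]"
abbreviation "mul2 \<equiv> lext R (wedges R M tp) (\<lambda>xss. wsym R M tp [xss ! 0 @ xss ! 1])"
abbreviation "mul3 \<equiv> lext R (wedges R M tp) (\<lambda>xss. wsym R M tp [xss ! 0 @ xss ! 2 @ xss ! 1])"

lemma subs: "A \<subseteq> Fi" "A \<subseteq> carrier M" "Fi \<subseteq> carrier M" "tF \<subseteq> carrier M"
  "submodule A R M" "submodule Fi R M" "submodule tF R M"
proof -
  have c: "lin R M (self_mod R) (c k)" if "k < h" for k using dual_basisD(2)[OF db that] .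
  have ec: "lin R M (self_mod R) (ec k)" if "k < h" for k using dual_basisD(2)[OF de that] .
  show "A \<subseteq> Fi" unfolding A Fi by (rule csub_mono) (use dn in auto)
  show "A \<subseteq> carrier M" "Fi \<subseteq> carrier M" "tF \<subseteq> carrier M"
    unfolding A Fi tF by (rule csub_subset_carrier)+
  show "submodule A R M" "submodule Fi R M" unfolding A Fi by (rule csub_submodule[OF M]; use c in simp)+
  show "submodule tF R M" unfolding tF by (rule csub_submodule[OF M]) (use ec K in auto)
qed

lemma ok: "blocks_ok R M Q" "blocks_ok R M L" "blocks_ok R M src" "blocks_ok R M tgt" "blocks_ok R M tp"
  using subs M.carrier_is_submodule by (auto simp: blocks_ok_def)

lemma zc: "{\<zero>\<^bsub>M\<^esub>} \<subseteq> carrier M" by simp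

lemma W: "rmod R (wedges R M tp)" "rmod R (wedges R M Q)"
  by (rule wedges_module[OF M ok(5)], rule wedges_module[OF M ok(1)])

abbreviation "ks \<equiv> sorted_list_of_set K"
abbreviation "js \<equiv> sorted_list_of_set ({..<h} - K)"

lemma fin: "finite K" using K finite_subset by blast

lemma ks: "set ks = K" "length ks = n" "distinct ks" "set ks \<subseteq> {..<h}"
  using fin K by auto

lemma js: "set js = {..<h} - K" "length js = h - n" "distinct js"
  using fin K by (auto simp: card_Diff_subset)

text \<open>A determinant form in the basis \<open>e\<close>, with the vectors spanning
  \<open>tF\<close> in front of those indexed by \<open>K\<close>. In this order it is easily
  evaluated after multiplication by a generator of the determinant of \<open>tF\<close>.\<close>

definition "detE = lifts (self_mod R) (map ec js) (dform R ec ks)"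

lemma self: "rmod R (self_mod R)"
  by (rule self_mod_module[OF module_cring[OF M]])

lemma dQ: "aform R (\<lambda>r. r) M (carrier M) (self_mod R) n (dform R ec ks)"
  using dform(1)[OF M de ks(4)] ks(2) by simp

lemma detE: "aform R (\<lambda>r. r) M (carrier M) (self_mod R) h detE"
proof -
  have "aform R (\<lambda>r. r) M (carrier M) (self_mod R) (n + length (map ec js)) detE"
    unfolding detE_def by (rule lifts_aform[OF self M dQ]) (use js dual_basisD(2)[OF de] in auto)
  then show ?thesis using js(2) dn by simp
qed

lemma e_tF: "k \<in> {..<h} - K \<Longrightarrow> e k \<in> tF"
proof -
  assume k: "k \<in> {..<h} - K"
  have "ec l (e k) = \<zero>\<^bsub>R\<^esub>" if "l \<in> K" for l using that k K by (intro dual_basisD(4)[OF de]) auto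
  then show ?thesis using k dual_basisD(1)[OF de] by (simp add: tF csub_def)
qed

lemma y0: "set (map e js) \<subseteq> tF" "length (map e js) = h - n"
  using js e_tF by auto

lemma detE_eval:
  assumes vs: "length vs = n" "set vs \<subseteq> carrier M"
  shows "detE (map e js @ vs) = dform R ec ks vs"
  unfolding detE_def
proof (rule lifts_basis[OF self M dQ de vs js(3)])
  fix k xs assume k: "k \<in> set js" and xs: "length xs = n" "set xs \<subseteq> carrier M" "e k \<in> set xs"
  have "dform R ec ks xs = \<zero>\<^bsub>R\<^esub>"
    by (rule dform(3)[OF M de ks(4)]) (use xs ks k js e_tF tF in auto)
  then show "dform R ec ks xs = \<zero>\<^bsub>self_mod R\<^esub>" by (simp add: self_mod_simps)
qed (use js in auto)

lemma kap:
  "\<exists>\<kappa>. rank1 R M Q [map e ks] \<kappa> \<and>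
    (\<forall>xs. length xs = n \<and> set xs \<subseteq> carrier M \<longrightarrow> \<kappa> (wsym R M Q [xs]) = dform R ec ks xs)"
proof -
  have b: "blk R M ec h {..<h} K = (n, carrier M, tF)"
    using K by (auto simp: blk_def tF csub_def)
  have c: "csub R M ec ({..<h} - {..<h}) = carrier M" by (simp add: csub_def)
  show ?thesis using rank1_single[OF M de K(1) subset_refl] unfolding b c K(2) .
qed

text \<open>Multiplying by the generator of the determinant of \<open>tF\<close> puts
  \<open>(h - n) + d + 1\<close> vectors into \<open>Fi\<close>, one more than its rank, so
  \<open>detE\<close> vanishes. As \<open>wedges R M Q\<close> is free of rank one and
  \<open>detE\<close> computes its coordinate, the symbol itself is zero.\<close>

lemma Q_zero:
  assumes x: "length xs = d" "set xs \<subseteq> A" "length ys = n - d" "set ys \<subseteq> carrier M" "set ys \<inter> Fi \<noteq> {}"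
  shows "wsym R M Q [xs @ ys] = \<zero>\<^bsub>wedges R M Q\<^esub>"
proof -
  obtain \<kappa> where k: "rank1 R M Q [map e ks] \<kappa>"
    "\<And>xs. length xs = n \<Longrightarrow> set xs \<subseteq> carrier M \<Longrightarrow> \<kappa> (wsym R M Q [xs]) = dform R ec ks xs" using kap by blast
  interpret Q: rmod R "wedges R M Q" by (rule W(2))
  have xy: "length (xs @ ys) = n" "set (xs @ ys) \<subseteq> carrier M" using x dn subs by auto
  obtain y us vs where y: "y \<in> Fi" "ys = us @ y # vs" using x(5) by (metis disjoint_iff split_list)
  have "detE (map e js @ xs @ ys) = \<zero>\<^bsub>self_mod R\<^esub>"
  proof (rule aform_excess[OF self M db _ detE])
    show "set (map e js @ xs @ [y]) \<subseteq> csub R M c {h + d - n..<h}"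
      using y0(1) tFi x(2) subs(1) y(1) unfolding Fi by auto
    show "mset (map e js @ xs @ ys) = mset ((map e js @ xs @ [y]) @ us @ vs)" using y(2) by simp
    show "h - card {h + d - n..<h} < length (map e js @ xs @ [y])" using y0(2) x dn by simp
    show "set (map e js @ xs @ ys) \<subseteq> carrier M" using y0(1) subs xy by auto
    show "length (map e js @ xs @ ys) = h" using y0(2) xy dn by simp
  qed auto
  then have "\<kappa> (wsym R M Q [xs @ ys]) = \<zero>\<^bsub>R\<^esub>"
    using k(2)[OF xy] detE_eval[OF xy] by (simp add: self_mod_simps)
  moreover have "wsym R M Q [xs @ ys] \<in> carrier (wedges R M Q)"
    by (rule wsym_closed[OF M ok(1)]) (use xy in \<open>simp add: wgen_Cons\<close>)
  moreover have "wsym R M Q [map e ks] \<in> carrier (wedges R M Q)"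
    using k(1) wsym_closed[OF M ok(1)] by (simp add: rank1_def)
  ultimately show ?thesis using k(1) unfolding rank1_def by (metis Q.smult_l_null)
qed

lemma cat_ok: "smap_ok R M L Q cat"
  using cat_ok_pair[OF M subs(4) M.submodule_closed(2)[OF subs(7)] subs(5) subs(3), of d "n - d"] Q_zero dn
  by simp

lemma top_form: "aform R (\<lambda>r. r) M (carrier M) (wedges R M tp) h (\<lambda>xs. wsym R M tp [xs])"
  by (rule single_form(1)[OF M zc])

lemma top_part:
  assumes "length us + a + length vs = h" "set us \<subseteq> carrier M" "set vs \<subseteq> carrier M" "B \<subseteq> carrier M"
  shows "aform R (\<lambda>r. r) M B (wedges R M tp) a (\<lambda>xs. wsym R M tp [us @ xs @ vs])"
proof (rule aform_subset[OF _ assms(4)])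
  have 1: "aform R (\<lambda>r. r) M (carrier M) (wedges R M tp) (a + length vs) (\<lambda>xs. wsym R M tp [us @ xs])"
    using aform_append[of R "\<lambda>r. r" M "carrier M" "wedges R M tp" us "a + length vs" "\<lambda>xs. wsym R M tp [xs]"]
      top_form assms by (simp add: add.assoc)
  show "aform R (\<lambda>r. r) M (carrier M) (wedges R M tp) a (\<lambda>xs. wsym R M tp [us @ xs @ vs])"
    using aform_append2[OF 1 assms(3)] .
qed

lemma top_zero: "length xs = h \<Longrightarrow> set xs \<subseteq> carrier M \<Longrightarrow> \<zero>\<^bsub>M\<^esub> \<in> set xs \<Longrightarrow> wsym R M tp [xs] = \<zero>\<^bsub>wedges R M tp\<^esub>"
  by (rule aform_zero_entry[OF top_form W(1) M M.carrier_is_submodule])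

lemma mul2_multi: "multi R (\<lambda>r. r) M (src @ Q) (wedges R M tp) (\<lambda>xss. wsym R M tp [xss ! 0 @ xss ! 1])"
  unfolding append.simps multi_pair
proof (intro conjI allI impI; elim conjE)
  fix ys assume y: "length ys = n" "set ys \<subseteq> carrier M"
  show "aform R (\<lambda>r. r) M tF (wedges R M tp) (h - n) (\<lambda>xs. wsym R M tp [[xs, ys] ! 0 @ [xs, ys] ! 1])"
    using top_part[of "[]" "h - n" ys tF] y dn subs by simp
  fix xs assume "length xs = h - n" "set xs \<subseteq> tF" "set xs \<inter> {\<zero>\<^bsub>M\<^esub>} \<noteq> {}"
  then show "wsym R M tp [[xs, ys] ! 0 @ [xs, ys] ! 1] = \<zero>\<^bsub>wedges R M tp\<^esub>"
    using y dn subs by (intro top_zero) auto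
next
  fix xs assume x: "length xs = h - n" "set xs \<subseteq> tF"
  then show "aform R (\<lambda>r. r) M (carrier M) (wedges R M tp) n (\<lambda>ys. wsym R M tp [[xs, ys] ! 0 @ [xs, ys] ! 1])"
    using top_part[of xs n "[]" "carrier M"] dn subs by simp
  fix ys assume y: "length ys = n" "set ys \<subseteq> carrier M" "set ys \<inter> tF \<noteq> {}"
  then obtain y us vs where y': "y \<in> tF" "ys = us @ y # vs" by (metis disjoint_iff split_list)
  \<comment> \<open>The \<open>h - n\<close> entries of \<open>xs\<close> exhaust the rank of
    \<open>tF\<close>, and \<open>y\<close> is one more vector in it.\<close>
  have "wsym R M tp [xs @ ys] = \<zero>\<^bsub>wedges R M tp\<^esub>"
  proof (rule aform_excess[OF W(1) M de K(1) top_form])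
    show "set (xs @ [y]) \<subseteq> csub R M ec K" using x y' tF by simp
    show "h - card K < length (xs @ [y])" using x K by simp
    show "mset (xs @ ys) = mset ((xs @ [y]) @ us @ vs)" using y' by simp
    show "length (xs @ ys) = h" "set (xs @ ys) \<subseteq> carrier M" using x y subs dn by auto
  qed
  then show "wsym R M tp [[xs, ys] ! 0 @ [xs, ys] ! 1] = \<zero>\<^bsub>wedges R M tp\<^esub>" by simp
qed

lemma mul3_multi: "multi R (\<lambda>r. r) M (tgt @ L) (wedges R M tp) (\<lambda>xss. wsym R M tp [xss ! 0 @ xss ! 2 @ xss ! 1])"
  unfolding append.simps
proof (rule multi_tripleI; (intro conjI allI impI; (elim conjE)?))
  fix zs xs assume z: "length zs = n - d" "set zs \<subseteq> carrier M" and x: "length xs = d" "set xs \<subseteq> A"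
  show "aform R (\<lambda>r. r) M Fi (wedges R M tp) (h - n) (\<lambda>ys. wsym R M tp [[ys, zs, xs] ! 0 @ [ys, zs, xs] ! 2 @ [ys, zs, xs] ! 1])"
    using top_part[of "[]" "h - n" "xs @ zs" Fi] z x dn subs by simp
  fix ys assume y: "length ys = h - n" "set ys \<subseteq> Fi" "set ys \<inter> A \<noteq> {}"
  then obtain y us vs where y': "y \<in> A" "ys = us @ y # vs" by (metis disjoint_iff split_list)
  \<comment> \<open>The entry \<open>y\<close> and the \<open>d\<close> entries of \<open>xs\<close>
    exceed the rank \<open>d\<close> of \<open>A\<close>.\<close>
  have "wsym R M tp [ys @ xs @ zs] = \<zero>\<^bsub>wedges R M tp\<^esub>"
  proof (rule aform_excess[OF W(1) M db _ top_form])
    show "set (y # xs) \<subseteq> csub R M c {d..<h}" using x y' A by simp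
    show "h - card {d..<h} < length (y # xs)" using x dn by simp
    show "mset (ys @ xs @ zs) = mset ((y # xs) @ us @ vs @ zs)" using y' by simp
    show "length (ys @ xs @ zs) = h" "set (ys @ xs @ zs) \<subseteq> carrier M" using x y z subs dn by auto
  qed auto
  then show "wsym R M tp [[ys, zs, xs] ! 0 @ [ys, zs, xs] ! 2 @ [ys, zs, xs] ! 1] = \<zero>\<^bsub>wedges R M tp\<^esub>"
    by simp
next
  fix ys xs assume y: "length ys = h - n" "set ys \<subseteq> Fi" and x: "length xs = d" "set xs \<subseteq> A"
  show "aform R (\<lambda>r. r) M (carrier M) (wedges R M tp) (n - d) (\<lambda>zs. wsym R M tp [[ys, zs, xs] ! 0 @ [ys, zs, xs] ! 2 @ [ys, zs, xs] ! 1])"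
    using top_part[of "ys @ xs" "n - d" "[]" "carrier M"] y x dn subset_trans[OF y(2) subs(3)] subset_trans[OF x(2) subs(2)] by simp
  fix zs assume z: "length zs = n - d" "set zs \<subseteq> carrier M" "set zs \<inter> Fi \<noteq> {}"
  then obtain z us vs where z': "z \<in> Fi" "zs = us @ z # vs" by (metis disjoint_iff split_list)
  \<comment> \<open>The lists \<open>ys\<close> and \<open>xs\<close> and the entry \<open>z\<close>
    give \<open>(h - n) + d + 1\<close> vectors in \<open>Fi\<close>, one more than its
    rank.\<close>
  have "wsym R M tp [ys @ xs @ zs] = \<zero>\<^bsub>wedges R M tp\<^esub>"
  proof (rule aform_excess[OF W(1) M db _ top_form])
    show "set (ys @ xs @ [z]) \<subseteq> csub R M c {h + d - n..<h}" using x y z' subs(1) unfolding Fi by auto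
    show "h - card {h + d - n..<h} < length (ys @ xs @ [z])" using x y dn by simp
    show "mset (ys @ xs @ zs) = mset ((ys @ xs @ [z]) @ us @ vs)" using z' by simp
    show "length (ys @ xs @ zs) = h" "set (ys @ xs @ zs) \<subseteq> carrier M" using x y z subs dn by auto
  qed auto
  then show "wsym R M tp [[ys, zs, xs] ! 0 @ [ys, zs, xs] ! 2 @ [ys, zs, xs] ! 1] = \<zero>\<^bsub>wedges R M tp\<^esub>"
    by simp
next
  fix ys zs assume y: "length ys = h - n" "set ys \<subseteq> Fi" and z: "length zs = n - d" "set zs \<subseteq> carrier M"
  show "aform R (\<lambda>r. r) M A (wedges R M tp) d (\<lambda>xs. wsym R M tp [[ys, zs, xs] ! 0 @ [ys, zs, xs] ! 2 @ [ys, zs, xs] ! 1])"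
    using top_part[of ys d zs A] y z dn subs by simp
  fix xs assume x: "length xs = d" "set xs \<subseteq> A" "set xs \<inter> {\<zero>\<^bsub>M\<^esub>} \<noteq> {}"
  have "wsym R M tp [ys @ xs @ zs] = \<zero>\<^bsub>wedges R M tp\<^esub>"
    by (rule top_zero) (use x y z dn subs in auto)
  then show "wsym R M tp [[ys, zs, xs] ! 0 @ [ys, zs, xs] ! 2 @ [ys, zs, xs] ! 1] = \<zero>\<^bsub>wedges R M tp\<^esub>"
    by simp
qed

lemma ok2: "blocks_ok R M (src @ Q)" "blocks_ok R M (tgt @ L)"
  using ok by (auto simp: blocks_ok_def)

lemmas mul2 = multi_lext[OF M ok2(1) W(1) mul2_multi]
lemmas mul3 = multi_lext[OF M ok2(2) W(1) mul3_multi]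

lemma bt: "bmap (\<lambda>y. y) src tgt"
  using tFi M.submodule_closed(2)[OF subs(5)] by (auto simp: bmap_def)

lemmas dH = wmap[OF M M slin_id[OF M] bt ok(3,4)]

text \<open>On symbols both sides are the class of \<open>ys @ xs @ zs\<close>: the order chosen in
  the definition of \<open>chi\<close> is the one that concatenation produces without a
  sign.\<close>

lemma compat:
  assumes y: "y \<in> carrier (wedges R M src)" and l: "l \<in> carrier (wedges R M L)"
  shows "mul2 (wtensor R M (src @ Q) y (smap R M Q cat l)) =
    mul3 (wtensor R M (tgt @ L) (wmap R M tgt (\<lambda>y. y) y) l)"
proof -
  note sm = smap[OF M ok(2,1) cat_ok]
  have id: "(\<lambda>r. r) \<in> carrier R \<rightarrow> carrier R" by auto
  have 1: "lin R (wedges R M src) (wedges R M tp) (\<lambda>y. mul2 (wtensor R M (src @ Q) y (smap R M Q cat l)))"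
    using slin_comp[OF wtensor(1)[OF M ok(3,1) slin_closed[OF sm(1) l]] mul2(1) id] by simp
  have 2: "lin R (wedges R M src) (wedges R M tp) (\<lambda>y. mul3 (wtensor R M (tgt @ L) (wmap R M tgt (\<lambda>y. y) y) l))"
    using slin_comp[OF slin_comp[OF dH(1) wtensor(1)[OF M ok(4,2) l] id] mul3(1) id] by simp
  show ?thesis
  proof (rule wedges_eq[OF M ok(3) W(1) 1 2 _ y])
    fix yss assume ys: "yss \<in> wgen src"
    then obtain ys where y: "yss = [ys]" "length ys = h - n" "set ys \<subseteq> tF" by (auto simp: wgen_Cons)
    note yc = wsym_closed[OF M ok(3) ys]
    have yt: "yss \<in> wgen tgt" using y tFi by (auto simp: wgen_Cons)
    have dHy: "wmap R M tgt (\<lambda>y. y) (wsym R M src yss) = wsym R M tgt yss" using dH(2)[OF ys] by simp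
    have 3: "lin R (wedges R M L) (wedges R M tp) (\<lambda>l. mul2 (wtensor R M (src @ Q) (wsym R M src yss) (smap R M Q cat l)))"
      using slin_comp[OF slin_comp[OF sm(1) wtensor(2)[OF M ok(3,1) yc] id] mul2(1) id] by simp
    have 4: "lin R (wedges R M L) (wedges R M tp) (\<lambda>l. mul3 (wtensor R M (tgt @ L) (wsym R M tgt yss) l))"
      using slin_comp[OF wtensor(2)[OF M ok(4,2) wsym_closed[OF M ok(4) yt]] mul3(1) id] by simp
    show "mul2 (wtensor R M (src @ Q) (wsym R M src yss) (smap R M Q cat l)) =
       mul3 (wtensor R M (tgt @ L) (wmap R M tgt (\<lambda>y. y) (wsym R M src yss)) l)"
      unfolding dHy
    proof (rule wedges_eq[OF M ok(2) W(1) 3 4 _ l])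
      fix xss assume x: "xss \<in> wgen L"
      then obtain zs xs where zx: "xss = [zs, xs]" by (auto simp: wgen_Cons)
      have c: "cat xss \<in> wgen Q" by (rule sm(3)[OF x])
      have "mul2 (wtensor R M (src @ Q) (wsym R M src yss) (smap R M Q cat (wsym R M L xss))) =
          mul2 (wsym R M (src @ Q) (yss @ cat xss))"
        using sm(2)[OF x] wtensor(3)[OF M ok(3,1) ys c] by simp
      also have "\<dots> = wsym R M tp [ys @ xs @ zs]"
        using mul2(2)[OF wgen_append[OF ys c]] zx y by simp
      also have "\<dots> = mul3 (wsym R M (tgt @ L) (yss @ xss))"
        using mul3(2)[OF wgen_append[OF yt x]] zx y by (simp add: numeral_2_eq_2)
      also have "\<dots> = mul3 (wtensor R M (tgt @ L) (wsym R M tgt yss) (wsym R M L xss))"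
        using wtensor(3)[OF M ok(4,2) yt x] by simp
      finally show "mul2 (wtensor R M (src @ Q) (wsym R M src yss) (smap R M Q cat (wsym R M L xss))) =
        mul3 (wtensor R M (tgt @ L) (wsym R M tgt yss) (wsym R M L xss))" .
    qed
  qed
qed

text \<open>Multiplication by the generator of the determinant of \<open>tF\<close>, followed by
  \<open>detE\<close>, recovers the coordinate \<open>\<kappa>\<close>; so the multiplication is
  injective. This is the uniqueness behind \<open>chi\<close>.\<close>

lemma pairing_inj:
  assumes w: "w \<in> carrier (wedges R M Q)" "w' \<in> carrier (wedges R M Q)"
    and e: "mul2 (wtensor R M (src @ Q) (wsym R M src [map e js]) w) = mul2 (wtensor R M (src @ Q) (wsym R M src [map e js]) w')"
  shows "w = w'"
proof -
  obtain \<kappa> where k: "rank1 R M Q [map e ks] \<kappa>"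
    "\<And>xs. length xs = n \<Longrightarrow> set xs \<subseteq> carrier M \<Longrightarrow> \<kappa> (wsym R M Q [xs]) = dform R ec ks xs" using kap by blast
  have id: "(\<lambda>r. r) \<in> carrier R \<rightarrow> carrier R" by auto
  have y: "[map e js] \<in> wgen src" using y0 by (simp add: wgen_Cons)
  have "multi R (\<lambda>r. r) M tp (self_mod R) (\<lambda>xss. detE (hd xss))"
    unfolding multi_single using detE aform_zero_entry[OF detE self M M.carrier_is_submodule] by auto
  note dt = multi_lext[OF M ok(5) self this]
  let ?\<delta> = "lext R (self_mod R) (\<lambda>xss. detE (hd xss))"
  let ?P = "\<lambda>w. ?\<delta> (mul2 (wtensor R M (src @ Q) (wsym R M src [map e js]) w))"
  have P: "lin R (wedges R M Q) (self_mod R) ?P"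
    using slin_comp[OF slin_comp[OF wtensor(2)[OF M ok(3,1) wsym_closed[OF M ok(3) y]] mul2(1) id] dt(1) id] by simp
  have kl: "lin R (wedges R M Q) (self_mod R) \<kappa>" using k by (simp add: rank1_def)
  have Pk: "?P w = \<kappa> w" if "w \<in> carrier (wedges R M Q)" for w
  proof (rule wedges_eq[OF M ok(1) self P kl _ that])
    fix xss assume x: "xss \<in> wgen Q"
    then obtain vs where vs: "xss = [vs]" "length vs = n" "set vs \<subseteq> carrier M" by (auto simp: wgen_Cons)
    have t: "[map e js @ vs] \<in> wgen tp" using y0 vs subs dn by (auto simp: wgen_Cons)
    show "?P (wsym R M Q xss) = \<kappa> (wsym R M Q xss)"
      using wtensor(3)[OF M ok(3,1) y x] mul2(2)[OF wgen_append[OF y x]] dt(2)[OF t] detE_eval[OF vs(2,3)]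
        k(2)[OF vs(2,3)] by (simp add: vs(1))
  qed
  have "\<kappa> w = \<kappa> w'" unfolding Pk[OF w(1), symmetric] Pk[OF w(2), symmetric] by (rule arg_cong[OF e])
  then show ?thesis using k(1) w unfolding rank1_def by metis
qed

text \<open>Existence comes from \<open>compat\<close>, uniqueness from \<open>pairing_inj\<close>.
  Thus \<open>chi\<close> is nothing but concatenation of the two blocks.\<close>

lemma chi_the:
  assumes l: "l \<in> carrier (wedges R M L)"
  shows "(THE u. u \<in> lin_map R (wedges R M L) (wedges R M Q) \<and>
    (\<forall>y\<in>carrier (wedges R M src). \<forall>l\<in>carrier (wedges R M L).
       mul2 (wtensor R M (src @ Q) y (u l)) =
       mul3 (wtensor R M (tgt @ L) (wmap R M tgt (\<lambda>y. y) y) l))) l = smap R M Q cat l"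
    (is "(THE u. ?P u) l = _")
proof -
  note sm = smap[OF M ok(2,1) cat_ok]
  note Lm = wedges_module[OF M ok(2)]
  have y: "wsym R M src [map e js] \<in> carrier (wedges R M src)"
    by (rule wsym_closed[OF M ok(3)]) (use y0 in \<open>simp add: wgen_Cons\<close>)
  have "(THE u. ?P u) = restrict (smap R M Q cat) (carrier (wedges R M L))"
  proof (rule the_equality)
    show "?P (restrict (smap R M Q cat) (carrier (wedges R M L)))"
      using lin_map_restrict[OF Lm sm(1)] compat by simp
  next
    fix u assume u: "?P u"
    then have ul: "lin R (wedges R M L) (wedges R M Q) u" and ue: "u \<in> extensional (carrier (wedges R M L))"
      by (auto simp: lin_map_iff)
    show "u = restrict (smap R M Q cat) (carrier (wedges R M L))"
    proof (rule extensionalityI[OF ue])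
      fix x assume x: "x \<in> carrier (wedges R M L)"
      have "u x = smap R M Q cat x"
        by (rule pairing_inj[OF slin_closed[OF ul x] slin_closed[OF sm(1) x]])
           (use u compat[OF y x] y x in simp)
      then show "u x = restrict (smap R M Q cat) (carrier (wedges R M L)) x" using x by simp
    qed auto
  qed
  then show ?thesis using l by simp
qed

end

section \<open>One step of the comparison\<close>

definition full_blks :: "('r, 'm) module \<Rightarrow> nat \<Rightarrow> 'm block list" where
  "full_blks M n = [(n, carrier M, {\<zero>\<^bsub>M\<^esub>})]"

text \<open>The filtration step is named by \<open>n\<close>, the value \<open>\<delta>\<close> at
  its index, instead of by the index. For \<open>n = d\<close> the rank \<open>d - n\<close> is
  zero, in accordance with the convention for the index \<open>s(i)\<close>.\<close>

definition fil_sub :: "'r ring \<Rightarrow> ('r, 'm) module \<Rightarrow> nat \<Rightarrow> (nat \<Rightarrow> 'm \<Rightarrow> 'r) \<Rightarrow> nat \<Rightarrow> nat \<Rightarrow> 'm set" where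
  "fil_sub R M h c d n = csub R M c {(if n \<le> d then d - n else h + d - n)..<h}"

definition line_blks :: "'r ring \<Rightarrow> ('r, 'm) module \<Rightarrow> nat \<Rightarrow> (nat \<Rightarrow> 'm \<Rightarrow> 'r) \<Rightarrow> nat \<Rightarrow> nat \<Rightarrow> 'm block list" where
  "line_blks R M h c d n = (if n \<le> d then [(n, csub R M c {d..<h}, fil_sub R M h c d n)]
     else [(n - d, carrier M, fil_sub R M h c d n), (d, csub R M c {d..<h}, {\<zero>\<^bsub>M\<^esub>})])"

text \<open>The module \<open>P\<^sub>k\<close> through which both sides factor: it maps to \<open>\<Lambda>\<^sup>n\<E>\<close> by \<open>cat\<close> and onto the line
  bundle by the projection.\<close>

definition lift_blks :: "'r ring \<Rightarrow> ('r, 'm) module \<Rightarrow> nat \<Rightarrow> (nat \<Rightarrow> 'm \<Rightarrow> 'r) \<Rightarrow> nat \<Rightarrow> nat \<Rightarrow> 'm block list" where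
  "lift_blks R M h c d n = (if n \<le> d then [(n, csub R M c {d..<h}, {\<zero>\<^bsub>M\<^esub>})]
     else [(n - d, carrier M, csub R M c {d..<h}), (d, csub R M c {d..<h}, {\<zero>\<^bsub>M\<^esub>})])"

lemma csub_dual_submodule:
  assumes "rmod R M" "dual_basis R M h b c" "K \<subseteq> {..<h}"
  shows "submodule (csub R M c K) R M"
  by (rule csub_submodule[OF assms(1)]) (use dual_basisD(2)[OF assms(2)] assms(3) in auto)

context
  fixes R :: "'r ring" and M :: "('r, 'm) module" and h d n :: nat and b :: "nat \<Rightarrow> 'm" and c
  assumes M: "rmod R M" and db: "dual_basis R M h b c" and d: "d \<le> h" and n: "n \<le> h"
begin

interpretation M: rmod R M by (rule M)

lemma blks_sub:
  "submodule (csub R M c {d..<h}) R M" "csub R M c {d..<h} \<subseteq> carrier M"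
  "submodule (fil_sub R M h c d n) R M" "fil_sub R M h c d n \<subseteq> carrier M" "\<zero>\<^bsub>M\<^esub> \<in> fil_sub R M h c d n"
  "n \<le> d \<Longrightarrow> fil_sub R M h c d n \<subseteq> csub R M c {d..<h}"
  "d < n \<Longrightarrow> csub R M c {d..<h} \<subseteq> fil_sub R M h c d n"
proof -
  show "submodule (csub R M c {d..<h}) R M" by (rule csub_dual_submodule[OF M db]) auto
  show s: "submodule (fil_sub R M h c d n) R M" unfolding fil_sub_def by (rule csub_dual_submodule[OF M db]) auto
  show "\<zero>\<^bsub>M\<^esub> \<in> fil_sub R M h c d n" by (rule M.submodule_closed(2)[OF s])
  show "csub R M c {d..<h} \<subseteq> carrier M" "fil_sub R M h c d n \<subseteq> carrier M"
    unfolding fil_sub_def by (rule csub_subset_carrier)+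
  show "n \<le> d \<Longrightarrow> fil_sub R M h c d n \<subseteq> csub R M c {d..<h}"
    unfolding fil_sub_def by (rule csub_mono) auto
  show "d < n \<Longrightarrow> csub R M c {d..<h} \<subseteq> fil_sub R M h c d n"
    unfolding fil_sub_def by (rule csub_mono) (use n in auto)
qed

lemma blks_ok: "blocks_ok R M (full_blks M n)" "blocks_ok R M (lift_blks R M h c d n)"
  "blocks_ok R M (line_blks R M h c d n)"
  using blks_sub M.carrier_is_submodule
  by (auto simp: blocks_ok_def full_blks_def lift_blks_def line_blks_def)

lemma lift_cat: "snat R M (lift_blks R M h c d n) (full_blks M n) cat cat"
proof (cases "n \<le> d")
  case True
  then show ?thesis using snat_cat_single[OF M blks_sub(1)] by (simp add: lift_blks_def full_blks_def)
next
  case False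
  then show ?thesis using snat_cat_pair[OF M db refl d, of "n - d"] by (simp add: lift_blks_def full_blks_def)
qed

lemma lift_line: "snat R M (lift_blks R M h c d n) (line_blks R M h c d n) (\<lambda>x. x) (\<lambda>x. x)"
  by (rule snat_id[OF M blks_ok(2,3)]) (use blks_sub in \<open>auto simp: lift_blks_def line_blks_def\<close>)

text \<open>The quotient by the filtration step keeps the last \<open>n\<close> of the first
  \<open>d\<close> basis vectors in one case, and the last \<open>n - d\<close> of all
  \<open>h\<close> in the other.\<close>

lemma line_blk: "n \<le> d \<Longrightarrow> line_blks R M h c d n = [blk R M c h {..<d} {d - n..<d}]"
  "d < n \<Longrightarrow> line_blks R M h c d n = [blk R M c h {..<h} {h + d - n..<h}, blk R M c h {..<d} {..<d}]"
proof -
  have 1: "{..<h} - {..<d} = {d..<h}" "{d..<h} \<union> {..<d} = {..<h}" using d by auto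
  show "n \<le> d \<Longrightarrow> line_blks R M h c d n = [blk R M c h {..<d} {d - n..<d}]"
  proof -
    assume "n \<le> d"
    moreover from this have "{d..<h} \<union> {d - n..<d} = {d - n..<h}" using d by auto
    ultimately show ?thesis by (simp add: line_blks_def fil_sub_def blk_def 1)
  qed
  assume dn: "d < n"
  have "csub R M c {} = carrier M" by (simp add: csub_def)
  then show "line_blks R M h c d n = [blk R M c h {..<h} {h + d - n..<h}, blk R M c h {..<d} {..<d}]"
    using dn n by (simp add: line_blks_def fil_sub_def blk_def 1 csub_all[OF M db])
qed

end

lemma line_rank1_ex:
  assumes M: "rmod R M" and db: "dual_basis R M h b c" and d: "d \<le> h" and n: "n \<le> h"
  defines "ls K \<equiv> map b (sorted_list_of_set K)"
  shows "\<exists>\<kappa>. rank1 R M (line_blks R M h c d n)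
    (if n \<le> d then [ls {d - n..<d}] else [ls {h + d - n..<h}, ls {..<d}]) \<kappa>"
proof (cases "n \<le> d")
  case True
  have "{..<d} \<subseteq> {..<h}" "{d - n..<d} \<subseteq> {..<d}" using d by auto
  from rank1_single[OF M db this(2,1)] show ?thesis
    using True by (auto simp: line_blk(1)[OF M db d n] ls_def)
next
  case False
  have "{h + d - n..<h} \<subseteq> {..<h}" "{..<d} \<subseteq> {..<h}" using d by auto
  from rank1_pair[OF M db this(1) subset_refl subset_refl this(2)] show ?thesis
    using False by (simp add: line_blk(2)[OF M db d n] ls_def)
qed

lemma tw_line_blks:
  assumes q: "frob_pow R q \<in> ring_hom R R" and M: "rmod R M" and db: "dual_basis R M h b c"
    and d: "d \<le> h" and n: "n \<le> h"
  shows "tw_blocks R q M (line_blks R M h c d n) =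
    line_blks R (twist R q M) h (\<lambda>k. tw_fun R q (c k)) d n"
proof -
  note T = twist_module[OF q M] and tdb = twist_dual_basis[OF q M db]
  note t = tw_blk[OF q M db]
  show ?thesis
  proof (cases "n \<le> d")
    case True
    show ?thesis unfolding line_blk(1)[OF M db d n True] line_blk(1)[OF T tdb d n True] tw_blocks_def
      using t[of "{d - n..<d}" "{..<d}"] d by (simp add: subset_eq)
  next
    case False
    then have dn: "d < n" by simp
    show ?thesis unfolding line_blk(2)[OF M db d n dn] line_blk(2)[OF T tdb d n dn] tw_blocks_def
      using t[of "{h + d - n..<h}" "{..<h}"] t[of "{..<d}" "{..<d}"] d by (simp add: subset_eq)
  qed
qed

text \<open>The line bundle and its twist are free of rank one on corresponding generators, so
  \<open>twistable_rank1\<close> applies to every linear map out of it.\<close>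

lemma line_twistable:
  assumes q: "frob_pow R p \<in> ring_hom R R" "frob_pow R q \<in> ring_hom R R" "frob_pow R (p * q) \<in> ring_hom R R"
    and M: "rmod R M" and N: "rmod R N" and okN: "blocks_ok R N Cs"
    and db: "dual_basis R M h b c" and d: "d \<le> h" and n: "n \<le> h"
    and u: "lin R (wedges R M (line_blks R M h c d n)) (wtwist R p N Cs) u"
  shows "twistable R p q M (line_blks R M h c d n) N Cs u"
proof -
  note T = twist_module[OF q(2) M] and tdb = twist_dual_basis[OF q(2) M db]
  note r = line_rank1_ex[OF M db d n] and r' = line_rank1_ex[OF T tdb d n]
  obtain \<kappa> where k: "rank1 R M (line_blks R M h c d n)
    (if n \<le> d then [map b (sorted_list_of_set {d - n..<d})]
     else [map b (sorted_list_of_set {h + d - n..<h}), map b (sorted_list_of_set {..<d})]) \<kappa>" (is "rank1 R M _ ?g \<kappa>")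
    using r by blast
  obtain \<kappa>' where k': "rank1 R (twist R q M) (line_blks R (twist R q M) h (\<lambda>k. tw_fun R q (c k)) d n)
    (if n \<le> d then [map (\<lambda>k. tw_in R q M (b k)) (sorted_list_of_set {d - n..<d})]
     else [map (\<lambda>k. tw_in R q M (b k)) (sorted_list_of_set {h + d - n..<h}),
       map (\<lambda>k. tw_in R q M (b k)) (sorted_list_of_set {..<d})]) \<kappa>'" (is "rank1 R _ _ ?g' \<kappa>'")
    using r' by blast
  have g: "?g' = map (map (tw_in R q M)) ?g" by simp
  show ?thesis
    by (rule twistable_rank1[OF q M N okN k k'[unfolded g, folded tw_line_blks[OF q(2) M db d n]] u])
qed

text \<open>Besides the basis \<open>e\<close> from \<open>fv_step\<close>, suited to the
  transported filtration, \<open>E\<close> gets a basis \<open>b\<close> adapted to its own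
  filtration, with Hodge rank \<open>d1\<close>. \<open>fil_incl\<close> is adequacy, expressed with
  \<open>n\<close> in place of the index \<open>j\<close>.\<close>

locale hasse_step = fv_step R p E E' F V h d b' c'
  for R :: "'r ring" and p :: nat and E E' :: "('r, 'e) module" and F V and h d :: nat and b' c' +
  fixes b :: "nat \<Rightarrow> 'e" and c :: "nat \<Rightarrow> 'e \<Rightarrow> 'r" and d1 n :: nat
  assumes db: "dual_basis R E h b c" and d1h: "d1 \<le> h" and nh: "n \<le> h"
    and fil_incl: "n \<le> d1 \<Longrightarrow> fil_sub R E h c d1 n \<subseteq>
        (if n \<le> d then {x \<in> carrier E. V x \<in> tw_sub R p E' (fil_sub R E' h c' d n)}
         else F ` tw_sub R p E' (fil_sub R E' h c' d n))"
      "d1 < n \<Longrightarrow> (if n \<le> d then {x \<in> carrier E. V x \<in> tw_sub R p E' (fil_sub R E' h c' d n)}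
         else F ` tw_sub R p E' (fil_sub R E' h c' d n)) \<subseteq> fil_sub R E h c d1 n"
begin

text \<open>The indices of the vectors \<open>e k\<close> missing from the transported filtration
  step. There are \<open>n\<close> of them, the rank of the quotient.\<close>

definition "tK = (if n \<le> d then {d - n..<d} else {..<d} \<union> {h + d - n..<h})"
definition "tF = csub R E ec tK"

abbreviation "Eb \<equiv> full_blks E n"
abbreviation "Eb' \<equiv> full_blks E' n"
abbreviation "Pb \<equiv> lift_blks R E h c d1 n"
abbreviation "Pb' \<equiv> lift_blks R E' h c' d n"
abbreviation "Lb \<equiv> line_blks R E h c d1 n"
abbreviation "Lb' \<equiv> line_blks R E' h c' d n"
abbreviation "Qb \<equiv> [(n, carrier E, tF)]"
abbreviation "A' \<equiv> csub R E' c' {d..<h}"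

lemmas okE = blks_ok[OF E db d1h nh]
lemmas okE' = blks_ok[OF E' db' dh nh]

lemma tK: "tK \<subseteq> {..<h}" "card tK = n"
proof -
  show "tK \<subseteq> {..<h}" using dh by (auto simp: tK_def)
  have "card ({..<d} \<union> {h + d - n..<h}) = d + (n - d)" if "d < n"
    using that nh by (subst card_Un_disjoint) auto
  then show "card tK = n" using nh by (simp add: tK_def)
qed

lemma tF: "submodule tF R E" "tF \<subseteq> carrier E" "\<zero>\<^bsub>E\<^esub> \<in> tF"
proof -
  show s: "submodule tF R E" unfolding tF_def by (rule csub_dual_submodule[OF E edb tK(1)])
  show "tF \<subseteq> carrier E" "\<zero>\<^bsub>E\<^esub> \<in> tF" using E.submodule_closed(1,2)[OF s] by auto
qed

lemma tw_csub: "K \<subseteq> {..<h} \<Longrightarrow> tw_sub R p E' (csub R E' c' K) = csub R T tc K"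
  unfolding tc_def[abs_def] by (rule tw_sub_csub[OF frob E' db'])

lemma tw_A': "tw_sub R p E' A' = csub R T tc {d..<h}" by (rule tw_csub) auto

lemma tw_fil: "tw_sub R p E' (fil_sub R E' h c' d n) = csub R T tc {(if n \<le> d then d - n else h + d - n)..<h}"
  unfolding fil_sub_def by (rule tw_csub) auto

lemma tF_eq: "(if n \<le> d then {x \<in> carrier E. V x \<in> tw_sub R p E' (fil_sub R E' h c' d n)}
    else F ` tw_sub R p E' (fil_sub R E' h c' d n)) = tF"
  unfolding tw_fil tF_def tK_def using tilde1[of "d - n"] tilde2[of "h + d - n"] nh by simp

lemma okQ: "blocks_ok R E Qb"
  using tF E.carrier_is_submodule by (simp add: blocks_ok_def)

text \<open>For \<open>n \<le> d\<close> the map induced by \<open>V\<close> already lands in the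
  twisted Hodge submodule. Otherwise the contraction sends \<open>xs @ map F ys\<close> to
  \<open>[ys, map V xs]\<close>; as \<open>ys\<close> matters only modulo the image of
  \<open>V\<close>, the first block of \<open>Pb'\<close> has to be a quotient.\<close>

definition flift :: "('e, 'r) wedge \<Rightarrow> (('e \<Rightarrow> 'r) set, 'r) wedge" where
  "flift = (if n \<le> d then wmap R T (tw_blocks R p E' Pb') V
     else lext R (wtwist R p E' Pb')
       (\<lambda>xss. cform R T (tw_blocks R p E' Pb') (map ec [0..<d]) g (map t [0..<d]) (hd xss)))"

lemma V_A': "V ` carrier E \<subseteq> tw_sub R p E' A'" unfolding tw_A' imV' by simp

lemma V0: "V \<zero>\<^bsub>E\<^esub> = \<zero>\<^bsub>T\<^esub>" by (rule E.slin_zero[OF T.rmod_axioms V])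

lemma tw0: "tw_sub R p E' {\<zero>\<^bsub>E'\<^esub>} = {\<zero>\<^bsub>T\<^esub>}" by (rule tw_sub_zero[OF frob E'])

lemma bmap_V_lift: "n \<le> d \<Longrightarrow> bmap V Eb (tw_blocks R p E' Pb')"
  using V_A' V0 by (auto simp: bmap_def full_blks_def lift_blks_def tw_blocks_def tw0)

lemma bmap_V_full: "bmap V Eb (tw_blocks R p E' Eb')"
  using Vc V0 by (auto simp: bmap_def full_blks_def tw_blocks_def tw0 tw_sub_carrier[OF frob E'])

lemma bmap_V_line: "n \<le> d \<Longrightarrow> bmap V Qb (tw_blocks R p E' Lb')"
  using V_A' tF_eq by (auto simp: bmap_def line_blks_def tw_blocks_def)

lemma t_tw: "set (map t [0..<d]) \<subseteq> tw_sub R p E' A'" using t_im V_A' imV' tw_A' by auto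

lemma ec_lin': "k \<in> set [0..<d] \<Longrightarrow> lin R E (self_mod R) (ec k)" using ec_lin dh by simp

lemma lift_gt: "d < n \<Longrightarrow> Pb' = [(n - d, carrier E', A'), (d, A', {\<zero>\<^bsub>E'\<^esub>})]"
  by (simp add: lift_blks_def)

lemma line_gt: "d < n \<Longrightarrow> Lb' = [(n - d, carrier E', fil_sub R E' h c' d n), (d, A', {\<zero>\<^bsub>E'\<^esub>})]"
  by (simp add: line_blks_def)

text \<open>Twistability depends on an exponent \<open>q\<close>; the other clauses are extracted at
  \<open>q = 1\<close> under the name \<open>flift\<close>.\<close>

lemma flift_all:
  assumes q: "frob_pow R q \<in> ring_hom R R" "frob_pow R (p * q) \<in> ring_hom R R"
  shows "lin R (wedges R E Eb) (wtwist R p E' Pb') flift"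
    and "twistable R p q E Eb E' Pb' flift"
    and "n \<le> d \<Longrightarrow> xss \<in> wgen Eb \<Longrightarrow> flift (wsym R E Eb xss) = wsym R T (tw_blocks R p E' Pb') (map (map V) xss)"
    and "d < n \<Longrightarrow> length xs = n \<Longrightarrow> set xs \<subseteq> carrier E \<Longrightarrow> flift (wsym R E Eb [xs]) =
       cform R T (tw_blocks R p E' Pb') (map ec [0..<d]) g (map t [0..<d]) xs"
proof -
  have "lin R (wedges R E Eb) (wtwist R p E' Pb') flift \<and> twistable R p q E Eb E' Pb' flift \<and>
    (n \<le> d \<longrightarrow> (\<forall>xss\<in>wgen Eb. flift (wsym R E Eb xss) = wsym R T (tw_blocks R p E' Pb') (map (map V) xss))) \<and>
    (d < n \<longrightarrow> (\<forall>xs. length xs = n \<and> set xs \<subseteq> carrier E \<longrightarrow> flift (wsym R E Eb [xs]) =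
       cform R T (tw_blocks R p E' Pb') (map ec [0..<d]) g (map t [0..<d]) xs))"
  proof (cases "n \<le> d")
    case True
    then have f: "flift = wmap R T (tw_blocks R p E' Pb') V" by (simp add: flift_def)
    note w = wmap[OF E T.rmod_axioms V bmap_V_lift[OF True] okE(1) tw_blocks_ok[OF frob E' okE'(2)]]
    have "twistable R p q E Eb E' Pb' flift" unfolding f
      by (rule twistable_wmap[OF frob q E E' V okE(1) okE'(2) bmap_V_lift[OF True]]) (auto simp: full_blks_def)
    then show ?thesis using w True by (simp add: f wtwist_def)
  next
    case False
    then have dn: "d < n" by simp
    have f: "flift = lext R (wtwist R p E' Pb')
       (\<lambda>xss. cform R T (tw_blocks R p E' Pb') (map ec [0..<d]) g (map t [0..<d]) (hd xss))"
      using False by (simp add: flift_def)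
    have e: "[(n - d + length [0..<d], carrier E, {\<zero>\<^bsub>E\<^esub>})] = Eb" "n - d + length [0..<d] = n"
      using dn by (simp_all add: full_blks_def)
    have len: "length (map t [0..<d]) = d" by simp
    note c = cform_twistable[where ks = "[0..<d]" and c = ec,
        OF frob q E E' okE'(2)[unfolded lift_gt[OF dn]] g_lin len t_tw,
        folded lift_gt[OF dn], folded f, unfolded e(1), unfolded e(2)]
    have "flift (wsym R E Eb [xs]) = cform R T (tw_blocks R p E' Pb') (map ec [0..<d]) g (map t [0..<d]) xs"
      if "length xs = n" "set xs \<subseteq> carrier E" for xs
      by (rule c(2)[OF _ that]) (rule ec_lin')
    moreover have "lin R (wedges R E Eb) (wtwist R p E' Pb') flift" by (rule c(1)) (rule ec_lin')
    moreover have "twistable R p q E Eb E' Pb' flift" by (rule c(3)) (rule ec_lin')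
    ultimately show ?thesis using dn by simp
  qed
  note all = this
  show "lin R (wedges R E Eb) (wtwist R p E' Pb') flift" "twistable R p q E Eb E' Pb' flift"
    "n \<le> d \<Longrightarrow> xss \<in> wgen Eb \<Longrightarrow> flift (wsym R E Eb xss) = wsym R T (tw_blocks R p E' Pb') (map (map V) xss)"
    "d < n \<Longrightarrow> length xs = n \<Longrightarrow> set xs \<subseteq> carrier E \<Longrightarrow> flift (wsym R E Eb [xs]) =
       cform R T (tw_blocks R p E' Pb') (map ec [0..<d]) g (map t [0..<d]) xs"
    using all by blast+
qed

lemma frob1: "frob_pow R 1 \<in> ring_hom R R"
proof -
  have cr: "cring R" by (rule module_cring[OF E])
  then interpret cring R .
  show ?thesis by (auto simp: ring_hom_def frob_one[OF cr] simp del: One_nat_def)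
qed

lemmas flift = flift_all[OF frob1, simplified, OF frob]

lemma idPi: "(\<lambda>r. r) \<in> carrier R \<rightarrow> carrier R" by auto

abbreviation "cat_tw \<equiv> smap R T (tw_blocks R p E' Eb') cat"
abbreviation "pr_tw \<equiv> smap R T (tw_blocks R p E' Lb') (\<lambda>x. x)"

lemmas cat_tw = snat_smap[OF frob E' lift_cat[OF E' db' dh nh]]
lemmas pr_tw = snat_smap[OF frob E' lift_line[OF E' db' dh nh]]

lemma flift_split:
  assumes dn: "d < n"
    and xy: "set xs \<subseteq> carrier E" "length xs = d" "set ys \<subseteq> carrier T" "length ys = n - d"
  shows "flift (wsym R E Eb [xs @ map F ys]) = wsym R T (tw_blocks R p E' Pb') [ys, map V xs]"
    "[ys, map V xs] \<in> wgen (tw_blocks R p E' Pb')"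
proof -
  have "set (xs @ map F ys) \<subseteq> carrier E" "length (xs @ map F ys) = n" using xy dn Fc by auto
  then show "flift (wsym R E Eb [xs @ map F ys]) = wsym R T (tw_blocks R p E' Pb') [ys, map V xs]"
    using flift(4)[OF dn] cform_split[OF _ refl subset_refl csub_subset_carrier xy] dn by (simp add: lift_gt[OF dn])
  have "V ` set xs \<subseteq> tw_sub R p E' A'" using V_A' xy by auto
  then show "[ys, map V xs] \<in> wgen (tw_blocks R p E' Pb')"
    using xy by (auto simp: lift_gt[OF dn] tw_blocks_def wgen_Cons tw_sub_carrier[OF frob E'])
qed

text \<open>The map \<open>fd\<close> for one step, with blocks written in coordinates. In the same
  way \<open>thetaM\<close>, \<open>chiM\<close> and \<open>hasseM\<close> stand for
  \<open>theta\<close>, \<open>chi\<close> and \<open>hasse\<close>; they are identified once a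
  whole family of steps is given.\<close>

definition "fdM = (if n \<le> d then wmap R T (tw_blocks R p E' Eb') V
     else (THE u. u \<in> lin_map R (wedges R E Eb) (wedges R T (tw_blocks R p E' Eb')) \<and>
       (\<forall>xs ys. set xs \<subseteq> carrier E \<and> length xs = d \<and> set ys \<subseteq> carrier T \<and> length ys = n - d \<longrightarrow>
          u (wsym R E Eb [xs @ map F ys]) = wsym R T (tw_blocks R p E' Eb') [map V xs @ ys])))"

text \<open>Concatenation turns \<open>[ys, map V xs]\<close> into \<open>map V xs @ ys\<close>,
  which is the value demanded of \<open>fdM\<close>.\<close>

lemma fdM:
  assumes w: "w \<in> carrier (wedges R E Eb)"
  shows "fdM w = cat_tw (flift w)"
proof -
  have l: "lin R (wedges R E Eb) (wedges R T (tw_blocks R p E' Eb')) (\<lambda>w. cat_tw (flift w))"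
    using slin_comp[OF flift(1) cat_tw(1) idPi] by (simp add: wtwist_def)
  note N = wedges_module[OF T.rmod_axioms tw_blocks_ok[OF frob E' okE'(1)]]
  show ?thesis
  proof (cases "n \<le> d")
    case True
    note wm = wmap[OF E T.rmod_axioms V bmap_V_full okE(1) tw_blocks_ok[OF frob E' okE'(1)]]
    show ?thesis unfolding fdM_def using True
    proof (simp, intro wedges_eq[OF E okE(1) N wm(1) l _ w])
      fix xss assume x: "xss \<in> wgen Eb"
      then obtain xs where "xss = [xs]" by (auto simp: full_blks_def wgen_Cons)
      then show "wmap R T (tw_blocks R p E' Eb') V (wsym R E Eb xss) = cat_tw (flift (wsym R E Eb xss))"
        using wm(2)[OF x] flift(3)[OF True x] cat_tw(2)[OF bmap_wgen[OF bmap_V_lift[OF True] x]] by simp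
    qed
  next
    case False
    then have dn: "d < n" by simp
    show ?thesis unfolding fdM_def using False
    proof (simp, unfold full_blks_def[of E], intro the_split[OF N _ _ l[unfolded full_blks_def[of E]] _ w[unfolded full_blks_def]])
      fix xs ys assume xy: "set xs \<subseteq> carrier E" "length xs = d" "set ys \<subseteq> carrier T" "length ys = n - d"
      show "cat_tw (flift (wsym R E [(n, carrier E, {\<zero>\<^bsub>E\<^esub>})] [xs @ map F ys])) =
        wsym R T (tw_blocks R p E' Eb') [map V xs @ ys]"
        using flift_split(1)[OF dn xy] cat_tw(2)[OF flift_split(2)[OF dn xy]] by (simp add: full_blks_def[of E])
    qed (use dn in auto)
  qed
qed

definition "thetaM = (if n \<le> d then wmap R T (tw_blocks R p E' Lb') V
     else (THE u. u \<in> lin_map R (wedges R E Qb) (wedges R T (tw_blocks R p E' Lb')) \<and>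
       (\<forall>xs ys. set xs \<subseteq> carrier E \<and> length xs = d \<and> set ys \<subseteq> carrier T \<and> length ys = n - d \<longrightarrow>
          u (wsym R E Qb [xs @ map F ys]) = wsym R T (tw_blocks R p E' Lb') [ys, map V xs])))"

abbreviation "pr_Q \<equiv> smap R E Qb (\<lambda>x. x)"

lemma pr_Q_ok: "smap_ok R E Eb Qb (\<lambda>x. x)"
  by (rule id_ok[OF E okE(1) okQ]) (use tF in \<open>simp add: full_blks_def\<close>)

lemmas pr_Q = smap[OF E okE(1) okQ pr_Q_ok]

text \<open>The contraction into the line bundle must kill \<open>tF\<close>. An element
  \<open>F w\<close> with \<open>w\<close> in the twisted filtration step is annihilated by the
  functionals, and \<open>g (F w)\<close> differs from \<open>w\<close> by an element of the image
  of \<open>V\<close>, which lies in that step since \<open>d < n\<close>.\<close>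

lemma line_form:
  assumes dn: "d < n"
  defines "G \<equiv> \<lambda>xss. cform R T (tw_blocks R p E' Lb') (map ec [0..<d]) g (map t [0..<d]) (hd xss)"
  shows "lin R (wedges R E Qb) (wedges R T (tw_blocks R p E' Lb')) (lext R (wedges R T (tw_blocks R p E' Lb')) G)"
    "xss \<in> wgen Qb \<Longrightarrow> lext R (wedges R T (tw_blocks R p E' Lb')) G (wsym R E Qb xss) = G xss"
proof -
  let ?tL = "tw_blocks R p E' Lb'" and ?tB = "tw_sub R p E' (fil_sub R E' h c' d n)"
  note okL = tw_blocks_ok[OF frob E' okE'(3)]
  note N = wedges_module[OF T.rmod_axioms okL]
  have e: "?tL = [(n - d, carrier T, ?tB), (d, tw_sub R p E' A', {\<zero>\<^bsub>T\<^esub>})]"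
    by (simp add: line_gt[OF dn] tw_blocks_def tw_sub_carrier[OF frob E'] tw0)
  have len: "length (map t [0..<d]) = d" by simp
  have ecl: "x \<in> set (map ec [0..<d]) \<Longrightarrow> lin R E (self_mod R) x" for x using ec_lin' by auto
  note okL' = okL[unfolded e]
  note cb = cform_base[OF E T.rmod_axioms okL' g_lin len t_tw, folded e]
  note cm = cform_multi[where cs = "map ec [0..<d]", OF E T.rmod_axioms okL' g_lin len t_tw ecl, folded e]
  have nd: "n - d + length (map ec [0..<d]) = n" using dn by simp
  have kill: "G [xs] = \<zero>\<^bsub>wedges R T ?tL\<^esub>"
    if xs: "length xs = n" "set xs \<subseteq> carrier E" "set xs \<inter> tF \<noteq> {}" for xs
  proof -
    obtain x where x: "x \<in> set xs" "x \<in> tF" using xs(3) by auto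
    then obtain w where w: "w \<in> ?tB" "x = F w" using tF_eq dn by auto
    have wc: "w \<in> carrier T" using w(1) tw_sub_subset[OF frob E' blks_sub(4)[OF E' db' dh nh]] by auto
    note sB = T.submodule_closed[OF tw_sub_submodule[OF frob E' blks_sub(4)[OF E' db' dh nh]]]
    have "{h + d - n..<h} \<subseteq> {d..<h}" using nh by auto
    then have "g (F w) \<ominus>\<^bsub>T\<^esub> w \<in> ?tB" using subsetD[OF csub_mono[of "{h + d - n..<h}" "{d..<h}" R T tc] gF(2)[OF wc]] dn
      unfolding tw_fil by simp
    then have "(g (F w) \<ominus>\<^bsub>T\<^esub> w) \<oplus>\<^bsub>T\<^esub> w \<in> ?tB" by (rule sB(3)[OF _ w(1)])
    moreover have "(g (F w) \<ominus>\<^bsub>T\<^esub> w) \<oplus>\<^bsub>T\<^esub> w = g (F w)"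
      using gF(1)[OF wc] wc by (simp add: a_minus_def T.M.a_assoc T.M.l_neg)
    ultimately have gx: "g x \<in> ?tB" using w(2) by simp
    show ?thesis unfolding G_def cform_def list.sel
    proof (rule lifts_kill[OF N E cb(1), of x])
      show "x \<in> carrier E" using x xs by auto
      show "wsym R T ?tL [map g zs, map t [0..<d]] = \<zero>\<^bsub>wedges R T ?tL\<^esub>"
        if "length zs = n - d" "set zs \<subseteq> carrier E" "x \<in> set zs" for zs by (rule cb(2)[OF that gx])
      show "lin R E (self_mod R) a \<and> a x = \<zero>\<^bsub>R\<^esub>" if "a \<in> set (map ec [0..<d])" for a
        using that ecl ecF0[OF wc] w(2) by auto
    qed (use xs x nd in auto)
  qed
  have "multi R (\<lambda>r. r) E Qb (wedges R T ?tL) G"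
    unfolding multi_single using cm(2) nd kill by (simp add: G_def)
  note l = multi_lext[OF E okQ N this]
  show "lin R (wedges R E Qb) (wedges R T ?tL) (lext R (wedges R T ?tL) G)" by (rule l(1))
  show "xss \<in> wgen Qb \<Longrightarrow> lext R (wedges R T ?tL) G (wsym R E Qb xss) = G xss" by (rule l(2))
qed

text \<open>With the values of \<open>v\<close> as right-hand side, both maps satisfy the
  description in \<open>the_split\<close>, so both equal the described map.\<close>

lemma split_unique:
  assumes N: "rmod R N" and dn: "d \<le> n"
    and u: "lin R (wedges R E Eb) N u" and v: "lin R (wedges R E Eb) N v"
    and e: "\<And>xs ys. set xs \<subseteq> carrier E \<Longrightarrow> length xs = d \<Longrightarrow> set ys \<subseteq> carrier T \<Longrightarrow> length ys = n - d \<Longrightarrow>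
      u (wsym R E Eb [xs @ map F ys]) = v (wsym R E Eb [xs @ map F ys])"
    and w: "w \<in> carrier (wedges R E Eb)"
  shows "u w = v w"
proof -
  let ?rhs = "\<lambda>xs ys. v (wsym R E Eb [xs @ map F ys])"
  have z: "{\<zero>\<^bsub>E\<^esub>} \<subseteq> carrier E" by simp
  note fe = full_blks_def[of E n]
  note ts = the_split[where rhs = ?rhs, OF N dn z _ _ w[unfolded fe]]
  show ?thesis
    using ts[OF u[unfolded fe]] ts[OF v[unfolded fe]] e by (simp add: fe)
qed

text \<open>For \<open>d < n\<close> the map \<open>thetaM\<close> is a definite description, so
  both cases are stated as agreement with some linear \<open>u\<close>. The last clause holds
  because \<open>u\<close> and the common lift are given by the same contraction, up to the quotient
  taken in the first block.\<close>

lemma thetaM: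
  "\<exists>u. lin R (wedges R E Qb) (wtwist R p E' Lb') u \<and> (\<forall>w\<in>carrier (wedges R E Qb). thetaM w = u w) \<and>
     (\<forall>w\<in>carrier (wedges R E Eb). u (pr_Q w) = pr_tw (flift w))"
proof -
  have l: "lin R (wedges R E Eb) (wedges R T (tw_blocks R p E' Lb')) (\<lambda>w. pr_tw (flift w))"
    using slin_comp[OF flift(1) pr_tw(1) idPi] by (simp add: wtwist_def)
  note N = wedges_module[OF T.rmod_axioms tw_blocks_ok[OF frob E' okE'(3)]]
  show ?thesis
  proof (cases "n \<le> d")
    case True
    then have th: "thetaM = wmap R T (tw_blocks R p E' Lb') V" by (simp add: thetaM_def)
    note wm = wmap[OF E T.rmod_axioms V bmap_V_line[OF True] okQ tw_blocks_ok[OF frob E' okE'(3)]]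
    have l2: "lin R (wedges R E Eb) (wedges R T (tw_blocks R p E' Lb')) (\<lambda>w. thetaM (pr_Q w))"
      unfolding th using slin_comp[OF pr_Q(1) wm(1) idPi] by simp
    have "thetaM (pr_Q w) = pr_tw (flift w)" if w: "w \<in> carrier (wedges R E Eb)" for w
    proof (rule wedges_eq[OF E okE(1) N l2 l _ w])
      fix xss assume x: "xss \<in> wgen Eb"
      then show "thetaM (pr_Q (wsym R E Eb xss)) = pr_tw (flift (wsym R E Eb xss))"
        using pr_Q(2)[OF x] wm(2)[OF pr_Q(3)[OF x]] flift(3)[OF True x]
          pr_tw(2)[OF bmap_wgen[OF bmap_V_lift[OF True] x]] by (simp add: th)
    qed
    then show ?thesis using wm(1) by (intro exI[of _ thetaM]) (simp add: th wtwist_def)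
  next
    case False
    then have dn: "d < n" by simp
    define u where "u = lext R (wedges R T (tw_blocks R p E' Lb'))
      (\<lambda>xss. cform R T (tw_blocks R p E' Lb') (map ec [0..<d]) g (map t [0..<d]) (hd xss))"
    note lf = line_form[OF dn, folded u_def]
    have us: "u (wsym R E Qb [xs @ map F ys]) = wsym R T (tw_blocks R p E' Lb') [ys, map V xs]"
      if xy: "set xs \<subseteq> carrier E" "length xs = d" "set ys \<subseteq> carrier T" "length ys = n - d" for xs ys
    proof -
      have "[xs @ map F ys] \<in> wgen Qb" using xy dn Fc by (auto simp: wgen_Cons)
      then show ?thesis
        using lf(2) cform_split[OF _ refl blks_sub(7)[OF E' db' dh nh dn] blks_sub(4)[OF E' db' dh nh] xy] dn
        by (simp add: line_gt[OF dn])
    qed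
    have th: "thetaM w = u w" if "w \<in> carrier (wedges R E Qb)" for w
      unfolding thetaM_def using False by (simp, intro the_split[OF N _ tF(2) lf(1) us that]) (use dn in auto)
    have l2: "lin R (wedges R E Eb) (wedges R T (tw_blocks R p E' Lb')) (\<lambda>w. u (pr_Q w))"
      using slin_comp[OF pr_Q(1) lf(1) idPi] by simp
    have z: "{\<zero>\<^bsub>E\<^esub>} \<subseteq> carrier E" by simp
    have "u (pr_Q w) = pr_tw (flift w)" if w: "w \<in> carrier (wedges R E Eb)" for w
    proof -
      have 1: "u (pr_Q (wsym R E Eb [xs @ map F ys])) = wsym R T (tw_blocks R p E' Lb') [ys, map V xs]"
        "pr_tw (flift (wsym R E Eb [xs @ map F ys])) = wsym R T (tw_blocks R p E' Lb') [ys, map V xs]"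
        if xy: "set xs \<subseteq> carrier E" "length xs = d" "set ys \<subseteq> carrier T" "length ys = n - d" for xs ys
      proof -
        have "[xs @ map F ys] \<in> wgen Eb" using xy dn Fc by (auto simp: wgen_Cons full_blks_def)
        then show "u (pr_Q (wsym R E Eb [xs @ map F ys])) = wsym R T (tw_blocks R p E' Lb') [ys, map V xs]"
          using pr_Q(2) us[OF xy] by simp
        show "pr_tw (flift (wsym R E Eb [xs @ map F ys])) = wsym R T (tw_blocks R p E' Lb') [ys, map V xs]"
          using flift_split(1)[OF dn xy] pr_tw(2)[OF flift_split(2)[OF dn xy]] by simp
      qed
      show ?thesis by (rule split_unique[OF N less_imp_le[OF dn] l2 l _ w]) (simp add: 1)
    qed
    then show ?thesis using lf(1) th by (intro exI[of _ u]) (simp add: wtwist_def)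
  qed
qed

abbreviation "src \<equiv> [(h - n, tF, {\<zero>\<^bsub>E\<^esub>})]"
abbreviation "tgt \<equiv> [(h - n, fil_sub R E h c d1 n, csub R E c {d1..<h})]"
abbreviation "tp \<equiv> [(h, carrier E, {\<zero>\<^bsub>E\<^esub>})]"

definition "chiM = (if n \<le> d1 then wmap R E Qb (\<lambda>x. x)
     else (THE u. u \<in> lin_map R (wedges R E Lb) (wedges R E Qb) \<and>
       (\<forall>y\<in>carrier (wedges R E src). \<forall>l\<in>carrier (wedges R E Lb).
          lext R (wedges R E tp) (\<lambda>xss. wsym R E tp [xss ! 0 @ xss ! 1]) (wtensor R E (src @ Qb) y (u l)) =
          lext R (wedges R E tp) (\<lambda>xss. wsym R E tp [xss ! 0 @ xss ! 2 @ xss ! 1])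
            (wtensor R E (tgt @ Lb) (wmap R E tgt (\<lambda>y. y) y) l))))"

abbreviation "catE \<equiv> smap R E Eb cat"
abbreviation "prE \<equiv> smap R E Lb (\<lambda>x. x)"

lemma lift_maps:
  "lin R (wedges R E Pb) (wedges R E Eb) catE" "lin R (wedges R E Pb) (wedges R E Lb) prE"
  "xss \<in> wgen Pb \<Longrightarrow> catE (wsym R E Pb xss) = wsym R E Eb (cat xss)"
  "xss \<in> wgen Pb \<Longrightarrow> prE (wsym R E Pb xss) = wsym R E Lb xss"
  "xss \<in> wgen Pb \<Longrightarrow> cat xss \<in> wgen Eb" "xss \<in> wgen Pb \<Longrightarrow> xss \<in> wgen Lb"
  using smap[OF E okE(2,1), of cat] smap[OF E okE(2,3), of "\<lambda>x. x"] lift_cat[OF E db d1h nh] lift_line[OF E db d1h nh]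
  by (simp_all add: snat_def)

text \<open>In both cases the map acts on symbols by concatenation, trivially so when there is a
  single block; \<open>key\<close> draws the conclusion from this alone.\<close>

lemma chiM:
  "\<exists>u. lin R (wedges R E Lb) (wedges R E Qb) u \<and> (\<forall>w\<in>carrier (wedges R E Lb). chiM w = u w) \<and>
     (\<forall>v\<in>carrier (wedges R E Pb). u (prE v) = pr_Q (catE v))"
proof -
  note N = wedges_module[OF E okQ]
  have key: "\<forall>v\<in>carrier (wedges R E Pb). u (prE v) = pr_Q (catE v)"
    if u: "lin R (wedges R E Lb) (wedges R E Qb) u"
      and ug: "\<And>xss. xss \<in> wgen Lb \<Longrightarrow> u (wsym R E Lb xss) = wsym R E Qb (cat xss)" for u
  proof
    fix v assume v: "v \<in> carrier (wedges R E Pb)"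
    have 1: "lin R (wedges R E Pb) (wedges R E Qb) (\<lambda>v. u (prE v))"
      using slin_comp[OF lift_maps(2) u idPi] by simp
    have 2: "lin R (wedges R E Pb) (wedges R E Qb) (\<lambda>v. pr_Q (catE v))"
      using slin_comp[OF lift_maps(1) pr_Q(1) idPi] by simp
    show "u (prE v) = pr_Q (catE v)"
      by (rule wedges_eq[OF E okE(2) N 1 2 _ v])
         (simp add: lift_maps(3,4) ug[OF lift_maps(6)] pr_Q(2)[OF lift_maps(5)])
  qed
  show ?thesis
  proof (cases "n \<le> d1")
    case True
    have Lb: "Lb = [(n, csub R E c {d1..<h}, fil_sub R E h c d1 n)]" using True by (simp add: line_blks_def)
    \<comment> \<open>Adequacy makes the identity on entries respect the two quotients.\<close>
    have fi: "fil_sub R E h c d1 n \<subseteq> tF" using fil_incl(1)[OF True] tF_eq by simp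
    have so: "smap_ok R E Lb Qb (\<lambda>x. x)"
      by (rule id_ok[OF E okE(3) okQ]) (use fi in \<open>auto simp: Lb csub_def\<close>)
    note s = smap[OF E okE(3) okQ so]
    have "pr_Q (wsym R E Lb xss) = wsym R E Qb (cat xss)" if x: "xss \<in> wgen Lb" for xss
    proof -
      obtain xs where "xss = [xs]" using x by (auto simp: Lb wgen_Cons)
      then show ?thesis using s(2)[OF x] by simp
    qed
    then show ?thesis using s(1) key True by (intro exI[of _ pr_Q]) (simp add: chiM_def wmap_id)
  next
    case False
    then have dn: "d1 < n" by simp
    have Lb: "Lb = [(n - d1, carrier E, fil_sub R E h c d1 n), (d1, csub R E c {d1..<h}, {\<zero>\<^bsub>E\<^esub>})]"
      using False by (simp add: line_blks_def)
    \<comment> \<open>Here adequacy enters in the opposite direction, as the inclusion of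
      \<open>tF\<close> in the filtration step.\<close>
    interpret C: chi_data R E h d1 n b c e ec tK "csub R E c {d1..<h}" "fil_sub R E h c d1 n" tF
      by unfold_locales
        (use E db dn nh edb tK fil_incl(2)[OF dn, unfolded tF_eq] in \<open>simp_all add: fil_sub_def tF_def\<close>)
    note s = smap[OF E C.ok(2,1) C.cat_ok, folded Lb]
    have "chiM w = smap R E Qb cat w" if w: "w \<in> carrier (wedges R E Lb)" for w
      unfolding chiM_def using C.chi_the[folded Lb, OF w] False by simp
    then show ?thesis using s(1,2) key by (intro exI[of _ "smap R E Qb cat"]) simp
  qed
qed

definition "hasseM = (\<lambda>x\<in>carrier (wedges R E Lb). thetaM (chiM x))"

text \<open>The compatibilities of \<open>chi\<close> and \<open>theta\<close> with the projections
  are pasted together.\<close>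

lemma hasseM:
  "lin R (wedges R E Lb) (wtwist R p E' Lb') hasseM"
  "v \<in> carrier (wedges R E Pb) \<Longrightarrow> hasseM (prE v) = pr_tw (flift (catE v))"
proof -
  obtain u where u: "lin R (wedges R E Lb) (wedges R E Qb) u" "\<And>w. w \<in> carrier (wedges R E Lb) \<Longrightarrow> chiM w = u w"
     "\<And>v. v \<in> carrier (wedges R E Pb) \<Longrightarrow> u (prE v) = pr_Q (catE v)" using chiM by blast
  obtain t where t: "lin R (wedges R E Qb) (wtwist R p E' Lb') t"
     "\<And>w. w \<in> carrier (wedges R E Qb) \<Longrightarrow> thetaM w = t w"
     "\<And>w. w \<in> carrier (wedges R E Eb) \<Longrightarrow> t (pr_Q w) = pr_tw (flift w)" using thetaM by blast
  have h: "hasseM w = t (u w)" if "w \<in> carrier (wedges R E Lb)" for w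
    using that u(2) t(2)[OF slin_closed[OF u(1) that]] by (simp add: hasseM_def)
  have tu: "lin R (wedges R E Lb) (wtwist R p E' Lb') (\<lambda>w. t (u w))" using slin_comp[OF u(1) t(1) idPi] by simp
  show "lin R (wedges R E Lb) (wtwist R p E' Lb') hasseM"
    by (rule slin_cong[OF tu _ wedges_module[OF E okE(3)]]) (simp add: h)
  assume v: "v \<in> carrier (wedges R E Pb)"
  show "hasseM (prE v) = pr_tw (flift (catE v))"
    using h[OF slin_closed[OF lift_maps(2) v]] u(3)[OF v] t(3)[OF slin_closed[OF lift_maps(1) v]] by simp
qed

end

section \<open>From one index to the whole chain, and from rings to schemes\<close>

section \<open>The comparison over a ring\<close>

context
  fixes h :: nat and d :: "int \<Rightarrow> nat"
  assumes dh: "\<And>k. d k \<le> h" and h: "0 < h"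
begin

lemma steps_strict: "sorted_wrt (<) (0 # step_list h d @ [h])"
  using h by (auto simp: step_list_def sorted_wrt_append)

lemma delta_less: "j < j' \<Longrightarrow> j' \<le> nsteps h d + 1 \<Longrightarrow> delta h d j < delta h d j'"
  using sorted_wrt_nth_less[OF steps_strict] by (simp add: delta_def nsteps_def)

lemma delta_le_iff: "j \<le> nsteps h d + 1 \<Longrightarrow> j' \<le> nsteps h d + 1 \<Longrightarrow> delta h d j \<le> delta h d j' \<longleftrightarrow> j \<le> j'"
  using delta_less[of j j'] delta_less[of j' j] by (cases j j' rule: linorder_cases) auto

text \<open>Each \<open>d k\<close> is an inner step or one of the ends \<open>0\<close> and
  \<open>h\<close>, and strict growth of \<open>delta\<close> makes its index unique.\<close>

lemma sidx: "sidx h d k \<le> nsteps h d + 1" "delta h d (sidx h d k) = d k"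
proof -
  have "d k \<in> set (0 # step_list h d @ [h])" using dh[of k] by (auto simp: step_list_def)
  then obtain j where j: "j < length (0 # step_list h d @ [h])" "delta h d j = d k"
    unfolding delta_def by (metis in_set_conv_nth)
  then have j': "j \<le> nsteps h d + 1" by (simp add: nsteps_def)
  have "sidx h d k = j" unfolding sidx_def
  proof (rule the_equality)
    fix j' assume "j' \<le> nsteps h d + 1 \<and> delta h d j' = d k"
    then show "j' = j" using delta_le_iff[of j j'] delta_le_iff[of j' j] j j' by simp
  qed (use j j' in simp)
  then show "sidx h d k \<le> nsteps h d + 1" "delta h d (sidx h d k) = d k" using j j' by auto
qed

lemma sidx_le_iff: "j \<le> nsteps h d + 1 \<Longrightarrow> j \<le> sidx h d k \<longleftrightarrow> delta h d j \<le> d k"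
  using delta_le_iff[OF _ sidx(1)] sidx(2) by metis

lemma sidx_eq_iff: "j \<le> nsteps h d + 1 \<Longrightarrow> j = sidx h d k \<longleftrightarrow> delta h d j = d k"
  using delta_le_iff[OF _ sidx(1), of j k] delta_le_iff[OF sidx(1), of j k] sidx(2) by (metis order_antisym order_refl)

lemma sidx_range: "d k \<notin> {0, h} \<Longrightarrow> sidx h d k \<in> {1..nsteps h d}"
proof -
  assume k: "d k \<notin> {0, h}"
  have "delta h d 0 = 0" "delta h d (nsteps h d + 1) = h" by (simp_all add: delta_def nsteps_def nth_append)
  then have "sidx h d k \<noteq> 0" "sidx h d k \<noteq> nsteps h d + 1" using k sidx(2)[of k] by (metis insertCI)+
  then show ?thesis using sidx(1)[of k] by simp
qed

end

text \<open>What the geometric hypotheses provide on one trivializing open; everything from here to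
  the comparison is algebra over the ring \<open>base D\<close>.\<close>

locale fdm_data =
  fixes D :: "('r, 'e) fdm" and bs :: "int \<Rightarrow> 'e list" and i :: int
  assumes R: "cring (base D)" and prime: "prime (chr D)"
    and char: "add_pow (base D) (chr D) \<one>\<^bsub>base D\<^esub> = \<zero>\<^bsub>base D\<^esub>" and dg: "1 \<le> dg D"
    and E: "\<And>k. rmod (base D) (Em D k)" and dmh: "\<And>k. dm D k \<le> hgt D"
    and per: "\<And>k. dm D (k + int (dg D)) = dm D k"
    and bs: "\<And>k. basis (base D) (Em D k) (bs k)" and len: "\<And>k. length (bs k) = hgt D"
    and hdg: "\<And>k. hdg D k = mspan (base D) (Em D k) (set (take (dm D k) (bs k)))"
    and flt: "\<And>k j. j \<in> {1..nsteps (hgt D) (dm D)} - {sx D k} \<Longrightarrow>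
      flt D k j = mspan (base D) (Em D k) (set (take (fil_rank (hgt D) (dm D) k j) (bs k)))"
    and Fm: "\<And>k. lin (base D) (twist (base D) (chr D) (Em D (k - 1))) (Em D k) (Fm D k)"
    and Vm: "\<And>k. lin (base D) (Em D k) (twist (base D) (chr D) (Em D (k - 1))) (Vm D k)"
    and kerV: "\<And>k. {x \<in> carrier (Em D k). Vm D k x = \<zero>\<^bsub>twist (base D) (chr D) (Em D (k - 1))\<^esub>} =
      Fm D k ` carrier (twist (base D) (chr D) (Em D (k - 1)))"
    and kerF: "\<And>k. {t \<in> carrier (twist (base D) (chr D) (Em D (k - 1))). Fm D k t = \<zero>\<^bsub>Em D k\<^esub>} =
      Vm D k ` carrier (Em D k)"
    and imV: "\<And>k. Vm D k ` carrier (Em D k) = tw_sub (base D) (chr D) (Em D (k - 1)) (hdg D (k - 1))"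
    and adequate: "\<And>k j. 1 \<le> j \<Longrightarrow> j < sx D k \<Longrightarrow> j \<le> nsteps (hgt D) (dm D) \<Longrightarrow> flt D k j \<subseteq> tFil D k j"
      "\<And>k j. sx D k < j \<Longrightarrow> j \<le> nsteps (hgt D) (dm D) \<Longrightarrow> tFil D k j \<subseteq> flt D k j"
    and nontriv: "dm D i \<notin> {0, hgt D}"
begin

abbreviation "R \<equiv> base D"
abbreviation "p \<equiv> chr D"
abbreviation "h \<equiv> hgt D"
definition "n = dm D i"
definition "j = sx D i"
definition "b k = (!) (bs k)"
definition "c k = (SOME c. dual_basis R (Em D k) h (b k) c)"

lemma frob: "frob_pow R (p ^ l) \<in> ring_hom R R" by (rule frob_pow_hom[OF R prime char])

lemma frob1: "frob_pow R p \<in> ring_hom R R" using frob[of 1] by simp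

lemma db: "dual_basis R (Em D k) h (b k) (c k)"
proof -
  have "\<exists>c. dual_basis R (Em D k) h (b k) c" using basis_dual[OF E bs] unfolding b_def len by metis
  then show ?thesis unfolding c_def by (rule someI_ex)
qed

lemma span_take: "mspan R (Em D k) (set (take m (bs k))) = csub R (Em D k) (c k) {m..<h}"
  using mspan_take[OF E, of k "bs k" "c k" m] db[of k] by (simp add: b_def len)

lemma hpos: "0 < h" using nontriv dmh[of i] by auto

lemmas sidx' = sidx[where h = "hgt D" and d = "dm D", OF dmh hpos]

lemma j: "1 \<le> j" "j \<le> nsteps h (dm D)" "dlt D j = n" "n \<le> h"
  using sidx_range[where h = "hgt D" and d = "dm D", OF dmh hpos nontriv] sidx'(2) dmh by (auto simp: j_def n_def)

text \<open>\<open>delta\<close> is strictly increasing, so comparing \<open>j\<close> with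
  \<open>s(k)\<close> amounts to comparing \<open>n\<close> with the Hodge rank at \<open>k\<close>,
  as in the definitions of the blocks.\<close>

lemma j_iff: "j \<le> sx D k \<longleftrightarrow> n \<le> dm D k" "j = sx D k \<longleftrightarrow> n = dm D k" "j < sx D k \<longleftrightarrow> n < dm D k"
  using sidx_le_iff[where h = "hgt D" and d = "dm D" and j = j and k = k, OF dmh hpos]
    sidx_eq_iff[where h = "hgt D" and d = "dm D" and j = j and k = k, OF dmh hpos] j by auto

lemma hodge: "hdg D k = csub R (Em D k) (c k) {dm D k..<h}"
  by (simp add: hdg span_take)

lemma Fil: "Fil D k j = fil_sub R (Em D k) h (c k) (dm D k) n"
proof (cases "j = sx D k")
  case True
  then have "n = dm D k" using j_iff by simp
  then show ?thesis using True csub_all[OF E db[of k]] by (simp add: Fil_def fil_sub_def atLeast0LessThan)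
next
  case False
  then have "fil_rank h (dm D) k j = (if n \<le> dm D k then dm D k - n else h + dm D k - n)"
    using j_iff[of k] j by (auto simp: fil_rank_def)
  then show ?thesis using False flt[of j k] j by (simp add: Fil_def fil_sub_def span_take)
qed

lemma Lblk: "Lblk D k j = line_blks R (Em D k) h (c k) (dm D k) n"
  by (simp add: Lblk_def line_blks_def j_iff j Fil hodge)

lemma tFil: "tFil D k j = (let T = tw_sub R p (Em D (k - 1)) (fil_sub R (Em D (k - 1)) h (c (k - 1)) (dm D (k - 1)) n) in
  if n \<le> dm D (k - 1) then {x \<in> carrier (Em D k). Vm D k x \<in> T} else Fm D k ` T)"
  by (simp add: tFil_def Fil j_iff)

text \<open>Serves the case \<open>j = s(k)\<close>, where the filtration step is zero by convention
  and the adequacy conditions are silent.\<close>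

lemma zero_tFil: "\<zero>\<^bsub>Em D k\<^esub> \<in> tFil D k j"
proof -
  interpret E: rmod R "Em D k" by (rule E)
  interpret T: rmod R "twist R p (Em D (k - 1))" by (rule twist_module[OF frob1 E])
  have "\<zero>\<^bsub>twist R p (Em D (k - 1))\<^esub> \<in> tw_sub R p (Em D (k - 1)) (fil_sub R (Em D (k - 1)) h (c (k - 1)) (dm D (k - 1)) n)"
    by (rule T.submodule_closed(2)[OF tw_sub_submodule[OF frob1 E blks_sub(4)[OF E db dmh j(4)]]])
  then show ?thesis
    using E.slin_zero[OF T.rmod_axioms Vm] T.slin_zero[OF E.rmod_axioms Fm] unfolding tFil Let_def
    by (auto intro!: image_eqI[of _ _ "\<zero>\<^bsub>twist R p (Em D (k - 1))\<^esub>"])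
qed

lemma fil_incl: "n \<le> dm D k \<Longrightarrow> Fil D k j \<subseteq> tFil D k j" "dm D k < n \<Longrightarrow> tFil D k j \<subseteq> Fil D k j"
proof -
  show "Fil D k j \<subseteq> tFil D k j" if "n \<le> dm D k"
  proof (cases "j = sx D k")
    case True then show ?thesis using zero_tFil by (simp add: Fil_def)
  next
    case False
    then have "j < sx D k" using that j_iff by simp
    then show ?thesis using False adequate(1)[of j k] j by (simp add: Fil_def)
  qed
  assume "dm D k < n"
  then have "sx D k < j" using j_iff(1)[of k] by simp
  then show "tFil D k j \<subseteq> Fil D k j" using adequate(2)[of k j] j by (simp add: Fil_def)
qed

lemma step: "hasse_step R p (Em D k) (Em D (k - 1)) (Fm D k) (Vm D k) h (dm D (k - 1)) (b (k - 1)) (c (k - 1))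
    (b k) (c k) (dm D k) n"
proof (intro hasse_step.intro fv_step.intro hasse_step_axioms.intro)
  show "Vm D k ` carrier (Em D k) =
    csub R (twist R p (Em D (k - 1))) (\<lambda>l. tw_fun R p (c (k - 1) l)) {dm D (k - 1)..<h}"
    unfolding imV hodge by (rule tw_sub_csub[OF frob1 E db]) auto
  show "n \<le> dm D k \<Longrightarrow> fil_sub R (Em D k) h (c k) (dm D k) n \<subseteq>
    (if n \<le> dm D (k - 1) then {x \<in> carrier (Em D k). Vm D k x \<in> tw_sub R p (Em D (k - 1)) (fil_sub R (Em D (k - 1)) h (c (k - 1)) (dm D (k - 1)) n)}
     else Fm D k ` tw_sub R p (Em D (k - 1)) (fil_sub R (Em D (k - 1)) h (c (k - 1)) (dm D (k - 1)) n))"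
    using fil_incl(1)[of k] unfolding Fil tFil Let_def .
  show "dm D k < n \<Longrightarrow>
    (if n \<le> dm D (k - 1) then {x \<in> carrier (Em D k). Vm D k x \<in> tw_sub R p (Em D (k - 1)) (fil_sub R (Em D (k - 1)) h (c (k - 1)) (dm D (k - 1)) n)}
     else Fm D k ` tw_sub R p (Em D (k - 1)) (fil_sub R (Em D (k - 1)) h (c (k - 1)) (dm D (k - 1)) n)) \<subseteq>
    fil_sub R (Em D k) h (c k) (dm D k) n"
    using fil_incl(2)[of k] unfolding Fil tFil Let_def .
qed (rule frob1 E db dmh Fm Vm kerV kerF j)+

abbreviation "Pblk k \<equiv> lift_blks R (Em D k) h (c k) (dm D k) n"

lemma Eblk: "Eblk D k n = full_blks (Em D k) n"
  by (simp add: Eblk_def full_blks_def)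

lemmas fdM = hasse_step.fdM[OF step]
lemmas hasseM = hasse_step.hasseM[OF step]

lemma fd: "fd D k n = hasse_step.fdM R p (Em D k) (Em D (k - 1)) (Fm D k) (Vm D k) (dm D (k - 1)) n"
  unfolding fd_def Let_def hasse_step.fdM_def[OF step] Eblk ..

lemma Qblk: "Qblk D k j = [(n, carrier (Em D k), hasse_step.tF R p (Em D k) (Em D (k - 1)) (Fm D k) (Vm D k) h (dm D (k - 1)) (b (k - 1)) (c (k - 1)) n)]"
  unfolding Qblk_def j(3) hasse_step.tF_eq[OF step, symmetric] tFil Let_def ..

lemma theta: "theta D k j = hasse_step.thetaM R p (Em D k) (Em D (k - 1)) (Fm D k) (Vm D k) h (dm D (k - 1)) (b (k - 1)) (c (k - 1)) n"
  unfolding theta_def Let_def hasse_step.thetaM_def[OF step] Qblk Lblk j_iff j(3) ..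

lemma chi: "chi D k j = hasse_step.chiM R p (Em D k) (Em D (k - 1)) (Fm D k) (Vm D k) h (dm D (k - 1)) (b (k - 1)) (c (k - 1)) (c k) (dm D k) n"
proof -
  have "tFil D k j = hasse_step.tF R p (Em D k) (Em D (k - 1)) (Fm D k) (Vm D k) h (dm D (k - 1)) (b (k - 1)) (c (k - 1)) n"
    unfolding hasse_step.tF_eq[OF step, symmetric] tFil Let_def ..
  then show ?thesis
    unfolding chi_def Let_def hasse_step.chiM_def[OF step] Qblk Lblk j_iff j(3) Fil hodge by simp
qed

lemma hasse: "hasse D k j = hasse_step.hasseM R p (Em D k) (Em D (k - 1)) (Fm D k) (Vm D k) h (dm D (k - 1)) (b (k - 1)) (c (k - 1)) (c k) (dm D k) n"
  unfolding hasse_def hasse_step.hasseM_def[OF step] theta chi Lblk ..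

lemma smap_id:
  assumes M: "rmod R M" and ok: "blocks_ok R M Bs" and w: "w \<in> carrier (wedges R M Bs)"
  shows "smap R M Bs (\<lambda>x. x) w = w"
proof -
  have so: "smap_ok R M Bs Bs (\<lambda>x. x)" using multi_wsym[OF M ok] by (simp add: smap_ok_def)
  note s = smap[OF M ok ok so]
  show ?thesis
    by (rule wedges_eq[OF M ok wedges_module[OF M ok] s(1) slin_id[OF wedges_module[OF M ok]] _ w]) (rule s(2))
qed

text \<open>Where the Hodge rank is \<open>n\<close> the filtration step is zero, and
  \<open>P\<close>, the line bundle and the Hodge determinant have the same block. This happens at
  both ends of the chain, at \<open>i\<close> and at \<open>i - f\<close>.\<close>

lemma start_blks:
  assumes "dm D k = n"
  shows "Pblk k = [(n, hdg D k, {\<zero>\<^bsub>Em D k\<^esub>})]" "Lblk D k j = Pblk k" "Hblk D k n = Pblk k"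
proof -
  show P: "Pblk k = [(n, hdg D k, {\<zero>\<^bsub>Em D k\<^esub>})]" using assms by (simp add: lift_blks_def hodge)
  have "j = sx D k" using assms j_iff(2) by simp
  then show "Lblk D k j = Pblk k" unfolding P Lblk_def using j(3) by (simp add: Fil_def)
  show "Hblk D k n = Pblk k" unfolding P Hblk_def ..
qed

lemma wmap_cat:
  assumes k: "dm D k = n" and x: "x \<in> carrier (wedges R (Em D k) (Pblk k))"
  shows "wmap R (Em D k) (full_blks (Em D k) n) (\<lambda>x. x) x = smap R (Em D k) (full_blks (Em D k) n) cat x"
proof -
  note ok = blks_ok[OF E db dmh j(4), of k]
  have c: "smap_ok R (Em D k) (Pblk k) (full_blks (Em D k) n) cat"
    using lift_cat[OF E db dmh j(4), of k] by (simp add: snat_def)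
  note sc = smap[OF E ok(2,1) c]
  have "smap_ok R (Em D k) (Pblk k) (full_blks (Em D k) n) (\<lambda>x. x)"
    by (rule id_ok[OF E ok(2,1)])
       (use csub_subset_carrier in \<open>simp add: start_blks(1)[OF k] full_blks_def hodge\<close>)
  note si = smap[OF E ok(2,1) this]
  show ?thesis unfolding wmap_id
  proof (rule wedges_eq[OF E ok(2) wedges_module[OF E ok(1)] si(1) sc(1) _ x])
    fix xss assume x: "xss \<in> wgen (Pblk k)"
    then obtain xs where "xss = [xs]" by (auto simp: start_blks(1)[OF k] wgen_Cons)
    then show "smap R (Em D k) (full_blks (Em D k) n) (\<lambda>x. x) (wsym R (Em D k) (Pblk k) xss) =
      smap R (Em D k) (full_blks (Em D k) n) cat (wsym R (Em D k) (Pblk k) xss)"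
      using si(2)[OF x] sc(2)[OF x] by simp
  qed
qed

lemma frob_Suc: "frob_pow R (p * p ^ l) \<in> ring_hom R R"
  using frob[of "Suc l"] by simp

lemmas cat_nat = lift_cat[OF E db dmh j(4)]
lemmas line_nat = lift_line[OF E db dmh j(4)]

abbreviation "fl k \<equiv> hasse_step.flift R p (Em D k) (Em D (k - 1)) (Fm D k) (Vm D k) h (dm D (k - 1)) (b (k - 1)) (c (k - 1)) n"

text \<open>\<open>twist_step\<close> with \<open>q = p ^ l\<close>. The lift is twistable as a
  contraction or as a map induced by \<open>V\<close>, the Hasse invariant because its source has
  rank one.\<close>

lemma step_lift:
  fixes l :: nat and k :: int
  assumes v: "v \<in> carrier (wtwist R (p ^ l) (Em D k) (Pblk k))"
  defines "w \<equiv> smap R (twist R (p ^ l) (Em D k)) (tw_blocks R (p ^ l) (Em D k) (Eblk D k n)) cat v"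
    and "v' \<equiv> htwist R p (p ^ l) (Em D k) (Eblk D k n) (Em D (k - 1)) (Pblk (k - 1)) (fl k)
      (smap R (twist R (p ^ l) (Em D k)) (tw_blocks R (p ^ l) (Em D k) (Eblk D k n)) cat v)"
  shows "v' \<in> carrier (wtwist R (p ^ Suc l) (Em D (k - 1)) (Pblk (k - 1)))"
    and "htwist R p (p ^ l) (Em D k) (Eblk D k n) (Em D (k - 1)) (Eblk D (k - 1) n) (fd D k n) w =
      smap R (twist R (p ^ Suc l) (Em D (k - 1))) (tw_blocks R (p ^ Suc l) (Em D (k - 1)) (Eblk D (k - 1) n)) cat v'"
    and "hasse_pow D k j l (smap R (twist R (p ^ l) (Em D k)) (tw_blocks R (p ^ l) (Em D k) (Lblk D k j)) (\<lambda>x. x) v) =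
      smap R (twist R (p ^ Suc l) (Em D (k - 1))) (tw_blocks R (p ^ Suc l) (Em D (k - 1)) (Lblk D (k - 1) j)) (\<lambda>x. x) v'"
proof -
  note fl = hasse_step.flift_all[OF step frob frob_Suc]
  have tw: "twistable R p (p ^ l) (Em D k) (line_blks R (Em D k) h (c k) (dm D k) n) (Em D (k - 1))
      (line_blks R (Em D (k - 1)) h (c (k - 1)) (dm D (k - 1)) n) (hasse D k j)"
    unfolding hasse
    by (rule line_twistable[OF frob1 frob frob_Suc E E blks_ok(3)[OF E db dmh j(4)] db dmh j(4) hasseM(1)])
  note ts = twist_step[OF frob1 frob frob_Suc E E cat_nat cat_nat line_nat line_nat fl(1) fl(2) _ tw _ v,
      OF fdM[folded fd] hasseM(2)[folded hasse]]
  show "v' \<in> carrier (wtwist R (p ^ Suc l) (Em D (k - 1)) (Pblk (k - 1)))"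
    unfolding v'_def Eblk power_Suc by (rule ts(1))
  show "htwist R p (p ^ l) (Em D k) (Eblk D k n) (Em D (k - 1)) (Eblk D (k - 1) n) (fd D k n) w =
      smap R (twist R (p ^ Suc l) (Em D (k - 1))) (tw_blocks R (p ^ Suc l) (Em D (k - 1)) (Eblk D (k - 1) n)) cat v'"
    unfolding v'_def w_def Eblk power_Suc by (rule ts(2))
  show "hasse_pow D k j l (smap R (twist R (p ^ l) (Em D k)) (tw_blocks R (p ^ l) (Em D k) (Lblk D k j)) (\<lambda>x. x) v) =
      smap R (twist R (p ^ Suc l) (Em D (k - 1))) (tw_blocks R (p ^ Suc l) (Em D (k - 1)) (Lblk D (k - 1) j)) (\<lambda>x. x) v'"
    unfolding v'_def hasse_pow_def Eblk Lblk power_Suc by (rule ts(3))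
qed

text \<open>The element \<open>v\<close> carries both chains; \<open>step_lift\<close> moves it from
  index \<open>i - l\<close> to \<open>i - l - 1\<close> and from the exponent \<open>p ^ l\<close>
  to \<open>p ^ Suc l\<close>.\<close>

lemma common_lift:
  assumes x: "x \<in> carrier (wedges R (Em D i) (Pblk i))"
  shows "\<exists>v. v \<in> carrier (wtwist R (p ^ l) (Em D (i - int l)) (Pblk (i - int l))) \<and>
    ha_upto D i n l (wmap R (Em D i) (Eblk D i n) (\<lambda>x. x) x) =
      smap R (twist R (p ^ l) (Em D (i - int l))) (tw_blocks R (p ^ l) (Em D (i - int l)) (Eblk D (i - int l) n)) cat v \<and>
    hasse_prod_upto D i j l x =
      smap R (twist R (p ^ l) (Em D (i - int l))) (tw_blocks R (p ^ l) (Em D (i - int l)) (Lblk D (i - int l) j)) (\<lambda>x. x) v"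
proof (induction l)
  case 0
  have i: "dm D i = n" by (simp add: n_def)
  \<comment> \<open>Both chains begin with the twist by \<open>p ^ 0\<close>, so the initial element
    is \<open>1 \<otimes> x\<close>.\<close>
  note f = frob[of 0, unfolded power_0]
  have ok: "blocks_ok R (Em D i) (Pblk i)" by (rule blks_ok(2)[OF E db dmh j(4)])
  have "wmap R (Em D i) (Eblk D i n) (\<lambda>x. x) x = smap R (Em D i) (Eblk D i n) cat x"
    unfolding Eblk by (rule wmap_cat[OF i x])
  moreover have "smap R (Em D i) (Lblk D i j) (\<lambda>x. x) x = x"
    unfolding start_blks(2)[OF i] by (rule smap_id[OF E ok x])
  ultimately show ?case
    using snat_in[OF f E cat_nat x] snat_in[OF f E line_nat x] slin_closed[OF wtw_in(1)[OF f E ok] x]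
    by (intro exI[of _ "wtw_in R 1 (Em D i) (Pblk i) x"]) (simp add: Eblk Lblk)
next
  case (Suc l)
  have e: "i - int (Suc l) = i - int l - 1" by simp
  from Suc obtain v where v: "v \<in> carrier (wtwist R (p ^ l) (Em D (i - int l)) (Pblk (i - int l)))"
    "ha_upto D i n l (wmap R (Em D i) (Eblk D i n) (\<lambda>x. x) x) =
      smap R (twist R (p ^ l) (Em D (i - int l))) (tw_blocks R (p ^ l) (Em D (i - int l)) (Eblk D (i - int l) n)) cat v"
    "hasse_prod_upto D i j l x =
      smap R (twist R (p ^ l) (Em D (i - int l))) (tw_blocks R (p ^ l) (Em D (i - int l)) (Lblk D (i - int l) j)) (\<lambda>x. x) v"
    by blast
  note s = step_lift[OF v(1)]
  show ?case unfolding e ha_upto.simps hasse_prod_upto.simps v(2,3)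
    by (intro exI conjI) (rule s)+
qed

theorem ha_eq_hasse_prod: "ha D i = hasse_prod D i j"
proof -
  define l where "l = dg D - 1"
  let ?k = "i - int l"
  have i: "dm D i = n" by (simp add: n_def)
  have e: "?k - 1 + int (dg D) = i" using dg by (simp add: l_def)
  \<comment> \<open>The chain ends at index \<open>i - f\<close>, where by periodicity the Hodge
    rank is again \<open>n\<close>.\<close>
  have k: "dm D (?k - 1) = n" using per[of "?k - 1"] i unfolding e by simp
  note step' = step[of ?k]
  have eq: "htwist R p (p ^ l) (Em D ?k) (Eblk D ?k n) (Em D (?k - 1)) (Hblk D (?k - 1) n)
       (wmap R (twist R p (Em D (?k - 1))) (tw_blocks R p (Em D (?k - 1)) (Hblk D (?k - 1) n)) (Vm D ?k))
       (ha_upto D i n l (wmap R (Em D i) (Eblk D i n) (\<lambda>x. x) x)) = hasse_prod_upto D i j (dg D) x"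
    if x: "x \<in> carrier (wedges R (Em D i) (Pblk i))" for x
  proof -
    obtain v where v: "v \<in> carrier (wtwist R (p ^ l) (Em D ?k) (Pblk ?k))"
      "ha_upto D i n l (wmap R (Em D i) (Eblk D i n) (\<lambda>x. x) x) =
        smap R (twist R (p ^ l) (Em D ?k)) (tw_blocks R (p ^ l) (Em D ?k) (Eblk D ?k n)) cat v"
      "hasse_prod_upto D i j l x =
        smap R (twist R (p ^ l) (Em D ?k)) (tw_blocks R (p ^ l) (Em D ?k) (Lblk D ?k j)) (\<lambda>x. x) v"
      using common_lift[OF x] by blast
    \<comment> \<open>The last map of \<open>ha\<close> is the exterior power of \<open>V\<close>
      into the Hodge determinant instead of \<open>fd\<close>. Since the Hodge rank at the target is
      \<open>n\<close>, it is the common lift itself.\<close>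
    have fl: "wmap R (twist R p (Em D (?k - 1))) (tw_blocks R p (Em D (?k - 1)) (Pblk (?k - 1))) (Vm D ?k) = fl ?k"
      unfolding hasse_step.flift_def[OF step'] using k by simp
    have dgS: "dg D = Suc l" using dg by (simp add: l_def)
    note s = step_lift[OF v(1)]
    show ?thesis unfolding v(2) dgS hasse_prod_upto.simps v(3) s(3) start_blks(2,3)[OF k] fl
      by (rule smap_id[OF twist_module[OF frob E] tw_blocks_ok[OF frob E blks_ok(2)[OF E db dmh j(4)]]
            s(1)[unfolded wtwist_def], symmetric])
  qed
  show ?thesis unfolding ha_def hasse_prod_def Let_def start_blks(2,3)[OF i] n_def[symmetric] l_def[symmetric]
    using eq by (auto simp: i intro!: restrict_ext)
qed

end

section \<open>Restriction to trivializing opens\<close>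

lemma ring_hom_add_pow:
  assumes f: "f \<in> ring_hom A B" and A: "ring A" and B: "ring B"
  shows "f (add_pow A (n :: nat) \<one>\<^bsub>A\<^esub>) = add_pow B n \<one>\<^bsub>B\<^esub>"
proof (induction n)
  interpret A: ring A by fact
  interpret B: ring B by fact
  case 0
  then show ?case using ring_hom_zero[OF f A B] by simp
next
  interpret A: ring A by fact
  case (Suc n)
  have "add_pow A n \<one>\<^bsub>A\<^esub> \<in> carrier A" by simp
  then show ?case using Suc ring_hom_add[OF f, of "add_pow A n \<one>\<^bsub>A\<^esub>" "\<one>\<^bsub>A\<^esub>"] ring_hom_one[OF f]
    by (simp add: add_pow_def)
qed

text \<open>\<open>p\<close> times one is a \<open>p\<close>-multiple, hence in the kernel of
  reduction.\<close>

lemma residue_char: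
  assumes "unramified_integers Q"
  shows "add_pow (kk Q) (cp Q) \<one>\<^bsub>kk Q\<^esub> = \<zero>\<^bsub>kk Q\<^esub>"
proof -
  have O: "ring (OF Q)" and k: "ring (kk Q)" and red: "red Q \<in> ring_hom (OF Q) (kk Q)"
    and ker: "{x \<in> carrier (OF Q). red Q x = \<zero>\<^bsub>kk Q\<^esub>} = p_multiples (OF Q) (cp Q) 1"
    using assms by (auto simp: unramified_integers_def domain_def cring_def field_def)
  interpret O: ring "OF Q" by (rule O)
  have "add_pow (OF Q) (cp Q) \<one>\<^bsub>OF Q\<^esub> \<in> p_multiples (OF Q) (cp Q) 1" by (auto simp: p_multiples_def)
  then have "red Q (add_pow (OF Q) (cp Q) \<one>\<^bsub>OF Q\<^esub>) = \<zero>\<^bsub>kk Q\<^esub>" using ker by blast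
  then show ?thesis using ring_hom_add_pow[OF red O k] by simp
qed

text \<open>The sections over \<open>U\<close> receive a ring homomorphism from the residue field,
  in which \<open>p\<close> is zero.\<close>

lemma sections_ring:
  assumes S: "k_scheme (kk Q) S" and Q: "unramified_integers Q" and U: "affine_open S U"
  shows "cring (sec S U)" "add_pow (sec S U) (cp Q) \<one>\<^bsub>sec S U\<^esub> = \<zero>\<^bsub>sec S U\<^esub>"
proof -
  let ?X = "topspace (topo S)"
  have rs: "ringed_space S" and st: "kstr S \<in> ring_hom (kk Q) (sec S ?X)"
    using S by (auto simp: k_scheme_def scheme_def)
  have o: "openin (topo S) U" using U by (simp add: affine_open_def)
  have UX: "U \<subseteq> ?X" by (rule openin_subset[OF o])
  have cr: "cring (sec S V)" if "openin (topo S) V" for V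
    using rs that unfolding ringed_space_def by simp
  show c: "cring (sec S U)" by (rule cr[OF o])
  have X: "ring (sec S ?X)" using cr[of ?X] by (simp add: cring_def)
  have k: "ring (kk Q)" using Q by (auto simp: unramified_integers_def domain_def cring_def field_def)
  have re: "rest S ?X U \<in> ring_hom (sec S ?X) (sec S U)"
    using rs o UX unfolding ringed_space_def by simp
  have R: "ring (sec S U)" using c by (simp add: cring_def)
  have "add_pow (sec S U) (cp Q) \<one>\<^bsub>sec S U\<^esub> = rest S ?X U (kstr S (add_pow (kk Q) (cp Q) \<one>\<^bsub>kk Q\<^esub>))"
    using ring_hom_add_pow[OF st k X] ring_hom_add_pow[OF re X R] by simp
  then show "add_pow (sec S U) (cp Q) \<one>\<^bsub>sec S U\<^esub> = \<zero>\<^bsub>sec S U\<^esub>"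
    using residue_char[OF Q] ring_hom_zero[OF st k X] ring_hom_zero[OF re X R] by simp
qed

text \<open>\<open>dieudonne_theory\<close> states that the carrier of \<open>crysi\<close> is a
  submodule of \<open>crysi\<close>. The operations are those of the whole crystal, so this closure
  also makes it a submodule there, and hence a module.\<close>

lemma crysi_module:
  assumes T: "dieudonne_theory Q h S G" and U: "affine_open S U"
  shows "rmod (sec S U) (crysi Q S G U k)"
proof -
  let ?R = "sec S U" and ?M = "crysU S G U" and ?E = "crysi Q S G U k"
  have M: "rmod ?R ?M" using T U by (simp add: dieudonne_theory_def rmod_def)
  then interpret M: rmod ?R ?M .
  have s: "submodule (carrier ?E) ?R ?E"
    using T U by (simp add: dieudonne_theory_def locally_direct_factor_def qc_sub_def)
  have ops: "x \<oplus>\<^bsub>?E\<^esub> y = x \<oplus>\<^bsub>?M\<^esub> y" "r \<odot>\<^bsub>?E\<^esub> x = r \<odot>\<^bsub>?M\<^esub> x" "\<zero>\<^bsub>?E\<^esub> = \<zero>\<^bsub>?M\<^esub>" for x y r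
    by (simp_all add: crysi_def)
  have sg: "subgroup (carrier ?E) (add_monoid ?E)" using s by (simp add: submodule_def)
  have "submodule (carrier ?E) ?R ?M"
  proof (rule M.submoduleI')
    show "carrier ?E \<subseteq> carrier ?M" by (auto simp: crysi_def)
    show "\<zero>\<^bsub>?M\<^esub> \<in> carrier ?E" using subgroup.one_closed[OF sg] by (simp add: ops)
    show "x \<in> carrier ?E \<Longrightarrow> y \<in> carrier ?E \<Longrightarrow> x \<oplus>\<^bsub>?M\<^esub> y \<in> carrier ?E" for x y
      using subgroup.m_closed[OF sg] by (simp add: ops)
    show "r \<in> carrier ?R \<Longrightarrow> x \<in> carrier ?E \<Longrightarrow> r \<odot>\<^bsub>?M\<^esub> x \<in> carrier ?E" for r x
      using submodule.smult_closed[OF s] by (simp add: ops)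
  qed
  then have "Module.module ?R (?M\<lparr>carrier := carrier ?E\<rparr>)"
    using M by (auto simp: rmod_def intro: submodule.submodule_is_module)
  moreover have "?M\<lparr>carrier := carrier ?E\<rparr> = ?E" by (simp add: crysi_def)
  ultimately show ?thesis by (simp add: rmod_def)
qed

theorem theorem1p2p3:
  fixes Q :: "('o, 'k) coefs"
    and S :: "('s, 'r, 'k) kscheme"
    and G :: "('s, 'r, 'a, 'o) bt_group"
    and h :: nat
    and d :: "int \<Rightarrow> nat"
    and Phi :: "int \<Rightarrow> nat \<Rightarrow> 's set \<Rightarrow> ('a, 'r) crys set"
    and i :: int
  assumes "unramified_integers Q"
    and "k_scheme (kk Q) S"
    and "p_divisible_group (cp Q) (cf Q * h) S G"
    and "ring_action (OF Q) S G"
    and "dieudonne_theory Q h S G"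
    and "hodge_ranks Q h S G d"
    and "adequate_filtrations Q h S G d Phi"
    and "i \<in> {1..int (cf Q)}"
    and "d i \<notin> {0, h}"
  shows "Ha Q h S G d Phi i = refined_hasse_product Q h S G d Phi i (sidx h d i)"
  unfolding Ha_def refined_hasse_product_def
\<comment> \<open>Both sides are families over the trivializing opens, so one such open is
  fixed.\<close>
proof (rule restrict_ext)
  note Q = assms(1) and S = assms(2) and T = assms(5) and H = assms(6) and A = assms(7)
  fix U assume U: "U \<in> trivializing Q h S G d Phi"
  let ?D = "fdm_on Q h S G d Phi U" and ?R = "sec S U" and ?E = "crysi Q S G U"
  have aff: "affine_open S U" using U by (simp add: trivializing_def)
  have D: "base ?D = ?R" "chr ?D = cp Q" "dg ?D = cf Q" "hgt ?D = h" "dm ?D = d" "Em ?D = ?E"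
    "Fm ?D = frobi Q S G U" "Vm ?D = veri Q S G U" "hdg ?D = hodgei Q S G U" "flt ?D = (\<lambda>i j. Phi i j U)"
    by (simp_all add: fdm_on_def)
  have "\<exists>bs. length bs = h \<and> basis ?R (?E k) bs \<and>
        hodgei Q S G U k = mspan ?R (?E k) (set (take (d k) bs)) \<and>
        (\<forall>j\<in>{1..nsteps h d} - {sidx h d k}.
           Phi k j U = mspan ?R (?E k) (set (take (fil_rank h d k j) bs)))" for k
    using U unfolding trivializing_def by blast
  \<comment> \<open>A basis is chosen for every integer index; the choices at indices congruent
    modulo \<open>f\<close> may differ.\<close>
  then obtain bs where bs: "\<And>k. length (bs k) = h \<and> basis ?R (?E k) (bs k) \<and>
        hodgei Q S G U k = mspan ?R (?E k) (set (take (d k) (bs k))) \<and>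
        (\<forall>j\<in>{1..nsteps h d} - {sidx h d k}.
           Phi k j U = mspan ?R (?E k) (set (take (fil_rank h d k j) (bs k))))" by metis
  have FV: "frobi Q S G U k \<in> lin_map ?R (twist ?R (cp Q) (?E (k - 1))) (?E k) \<and>
     veri Q S G U k \<in> lin_map ?R (?E k) (twist ?R (cp Q) (?E (k - 1))) \<and>
     {x \<in> carrier (?E k). veri Q S G U k x = \<zero>\<^bsub>twist ?R (cp Q) (?E (k - 1))\<^esub>} =
       frobi Q S G U k ` carrier (twist ?R (cp Q) (?E (k - 1))) \<and>
     {t \<in> carrier (twist ?R (cp Q) (?E (k - 1))). frobi Q S G U k t = \<zero>\<^bsub>?E k\<^esub>} =
       veri Q S G U k ` carrier (?E k) \<and>
     veri Q S G U k ` carrier (?E k) = tw_sub ?R (cp Q) (?E (k - 1)) (hodgei Q S G U (k - 1))" for k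
  proof -
    have "\<forall>i U. affine_open S U \<longrightarrow>
        (let R = sec S U; E = crysi Q S G U i; E' = crysi Q S G U (i - 1); T = twist R (cp Q) E';
             F = frobi Q S G U i; V = veri Q S G U i in
          F \<in> lin_map R T E \<and> V \<in> lin_map R E T \<and>
          {x \<in> carrier E. V x = \<zero>\<^bsub>T\<^esub>} = F ` carrier T \<and>
          {t \<in> carrier T. F t = \<zero>\<^bsub>E\<^esub>} = V ` carrier E \<and>
          V ` carrier E = tw_sub R (cp Q) E' (hodgei Q S G U (i - 1)))"
      using T unfolding dieudonne_theory_def by (elim conjE)
    from this[rule_format, OF aff, of k] show ?thesis unfolding Let_def .
  qed
  interpret fdm_data ?D bs i
  proof (unfold fdm_data_def D, intro conjI allI impI)
    fix k j
    show "1 \<le> j \<Longrightarrow> j < sidx h d k \<Longrightarrow> j \<le> nsteps h d \<Longrightarrow> Phi k j U \<subseteq> tFil ?D k j"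
      using A aff unfolding adequate_filtrations_def by blast
    show "sidx h d k < j \<Longrightarrow> j \<le> nsteps h d \<Longrightarrow> tFil ?D k j \<subseteq> Phi k j U"
      using A aff unfolding adequate_filtrations_def by blast
    show "prime (cp Q)" "1 \<le> cf Q" using Q by (auto simp: unramified_integers_def)
    show "d k \<le> h" "d (k + int (cf Q)) = d k" using H by (auto simp: hodge_ranks_def)
  qed (use sections_ring[OF S Q aff] crysi_module[OF T aff] bs FV assms(9) in \<open>simp_all add: lin_map_iff\<close>)
  show "ha ?D i = hasse_prod ?D i (sidx h d i)" using ha_eq_hasse_prod unfolding j_def D .
qed

end
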